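(* Under the standing setup (Assumption A and Assumption Z), the process $\left\{\sqrt{n/p}\,\big(\operatorname{trace}Y^k-\mathbf E\operatorname{trace}Y^k\big)\right\}_{k=1}^\infty$ converges in distribution (i.e. in finite-dimensional distributions) as $p\to\infty$ to a zero-mean Gaussian process $\{G_k\}_{k=1}^\infty$ with covariance $$\frac1{k\ell}\mathbf E\,G_kG_\ell=2R^{(k+\ell)}_0+\sum_{i,j\in\mathbb Z}R^{(k-1)}_iQ_{ij}R^{(\ell-1)}_j .$$
   Context: Joint cumulant: for real random variables $X_1,\dots,X_k$ with moments of all orders, $\mathbf C(X_1,\dots,X_k)=i^{-k}\frac{\partial^k}{\partial t_1\cdots\partial t_k}\log \mathbf E\exp(\sum_{j=1}^k i t_jX_j)\big|_{t=0}$. Assumption A: $p$ is a positive integer, $b=b(p)>0$ and $n=n(p)$ a positive integer depending on $p$; as $p\to\infty$, $b\to\infty$, $n\to\infty$, $b/n\to0$, and $b\le p$. Assumption Z: $\{Z_j\}_{j\in\mathbb Z}$ is a stationary sequence of real random variables with (1) $\mathbf E|Z_0|^k<\infty$ for all $k\ge1$, (2) $\mathbf EZ_0=0$, (3) $\sum_{j_1,\dots,j_r\in\mathbb Z}|\mathbf C(Z_0,Z_{j_1},\dots,Z_{j_r})|<\infty$ for all $r\ge1$. Matrices: let $\{\{Z^{(i)}_j\}_{j\in\mathbb Z}\}_{i\ge1}$ be i.i.d. copies of $\{Z_j\}$; $X$ is the $n\times p$ matrix with $X_{ij}=Z^{(i)}_j/\sqrt n$; $B$ is the $p\times p$ matrix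 with $B_{ij}=1$ if $|i-j|\le b$ and $0$ otherwise; $Y$ is the $p\times p$ matrix $Y_{ij}=B_{ij}(X^TX)_{ij}$. Let $R(j)=\mathrm{Cov}(Z_0,Z_j)$; for integers $m\ge1$, $R^{(m)}_i=(R\star\cdots\star R)(i)$ ($m$-fold convolution, $(F\star G)(j)=\sum_{k\in\mathbb Z}F(j-k)G(k)$), and $R^{(0)}_i=\delta_{i0}$. Let $Q_{ij}=\sum_{\ell\in\mathbb Z}\mathbf C(Z_i,Z_0,Z_{j+\ell},Z_\ell)$ for $i,j\in\mathbb Z$. *)

theory Defs
  imports "HOL-Probability.Probability"
begin

fun iter_pd :: "((nat \<Rightarrow> real) \<Rightarrow> complex) \<Rightarrow> nat list \<Rightarrow> (nat \<Rightarrow> real) \<Rightarrow> complex" where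
  "iter_pd f [] = f"
| "iter_pd f (j # js) =
     (\<lambda>t. vector_derivative (\<lambda>s. iter_pd f js (t(j := s))) (at (t j)))"

definition joint_charfun :: "'a measure \<Rightarrow> ('a \<Rightarrow> real) list \<Rightarrow> (nat \<Rightarrow> real) \<Rightarrow> complex" where
  "joint_charfun M Xs t = (LINT \<omega>|M. cis (\<Sum>j<length Xs. t j * (Xs ! j) \<omega>))"

text \<open>Joint cumulant C(X_1,...,X_k) = i^(-k) d^k/(dt_1...dt_k) log E exp(i sum t_j X_j) at t = 0.
  (The value is real under the moment assumptions; we take the real part.)\<close>
definition joint_cumulant :: "'a measure \<Rightarrow> ('a \<Rightarrow> real) list \<Rightarrow> real" where
  "joint_cumulant M Xs =
     Re (inverse (\<i> ^ length Xs) *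
         iter_pd (\<lambda>t. Ln (joint_charfun M Xs t)) [0..<length Xs] (\<lambda>_. 0))"

definition conv_int :: "(int \<Rightarrow> real) \<Rightarrow> (int \<Rightarrow> real) \<Rightarrow> int \<Rightarrow> real" where
  "conv_int F G j = (\<Sum>\<^sub>\<infinity>k\<in>(UNIV::int set). F (j - k) * G k)"

fun conv_pow :: "(int \<Rightarrow> real) \<Rightarrow> nat \<Rightarrow> int \<Rightarrow> real" where
  "conv_pow R 0 = (\<lambda>i. if i = 0 then 1 else 0)"
| "conv_pow R (Suc m) = conv_int R (conv_pow R m)"

definition mat_mult :: "nat \<Rightarrow> (nat \<Rightarrow> nat \<Rightarrow> real) \<Rightarrow> (nat \<Rightarrow> nat \<Rightarrow> real) \<Rightarrow> nat \<Rightarrow> nat \<Rightarrow> real" where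
  "mat_mult p A C = (\<lambda>i j. \<Sum>l\<in>{1..p}. A i l * C l j)"

fun mat_pow :: "nat \<Rightarrow> (nat \<Rightarrow> nat \<Rightarrow> real) \<Rightarrow> nat \<Rightarrow> nat \<Rightarrow> nat \<Rightarrow> real" where
  "mat_pow p A 0 = (\<lambda>i j. if i = j then 1 else 0)"
| "mat_pow p A (Suc k) = mat_mult p (mat_pow p A k) A"

definition mat_trace :: "nat \<Rightarrow> (nat \<Rightarrow> nat \<Rightarrow> real) \<Rightarrow> real" where
  "mat_trace p A = (\<Sum>i\<in>{1..p}. A i i)"

text \<open>The banded sample covariance matrix Y (p x p, indices 1..p):
  Y_ij = B_ij (X^T X)_ij with X_ri = Z^(r)_i / sqrt n, r = 1..n, B_ij = [|i-j| <= b].\<close>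
definition banded_Y :: "real \<Rightarrow> nat \<Rightarrow> nat \<Rightarrow> (nat \<Rightarrow> int \<Rightarrow> 'a \<Rightarrow> real) \<Rightarrow> 'a \<Rightarrow> nat \<Rightarrow> nat \<Rightarrow> real" where
  "banded_Y b n p Zc \<omega> i j =
     (if \<bar>real i - real j\<bar> \<le> b then 1 else 0) *
     (\<Sum>r\<in>{1..n}. (Zc r (int i) \<omega> / sqrt (real n)) * (Zc r (int j) \<omega> / sqrt (real n)))"

definition centred_gaussian_rv :: "'a measure \<Rightarrow> ('a \<Rightarrow> real) \<Rightarrow> bool" where
  "centred_gaussian_rv N X \<longleftrightarrow> X \<in> borel_measurable N \<and>
     (\<exists>\<sigma>::real. \<sigma> \<ge> 0 \<and>
        (if \<sigma> = 0 then distr N borel X = return borel 0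
         else distributed N lborel X (\<lambda>x. ennreal (normal_density 0 \<sigma> x))))"

text \<open>A probability measure N on R^N (product sigma-algebra) is the law of a zero-mean
  Gaussian process {G_k}_{k>=1}, G_k(x) = x k: every finite linear combination of the
  coordinates with indices >= 1 is centred Gaussian.\<close>
definition centred_gaussian_process_law :: "(nat \<Rightarrow> real) measure \<Rightarrow> bool" where
  "centred_gaussian_process_law N \<longleftrightarrow> prob_space N \<and>
     sets N = sets (PiM UNIV (\<lambda>_::nat. borel)) \<and>
     (\<forall>K c. finite K \<and> K \<subseteq> {1..} \<longrightarrow>
        centred_gaussian_rv N (\<lambda>x. \<Sum>k\<in>K. c k * x k))"

text \<open>Convergence of finite-dimensional distributions: for every finite index set K \<subseteq> {1..},
  the random vector (T p k)_{k\<in>K} (embedded in R^N by zero outside K) converges in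
  distribution to (x k)_{k\<in>K} under N, tested against all bounded continuous functions.\<close>
definition fdd_converges :: "'a measure \<Rightarrow> (nat \<Rightarrow> nat \<Rightarrow> 'a \<Rightarrow> real) \<Rightarrow> (nat \<Rightarrow> real) measure \<Rightarrow> bool" where
  "fdd_converges M T N \<longleftrightarrow>
     (\<forall>K. finite K \<and> K \<subseteq> {1..} \<longrightarrow>
       (\<forall>f :: (nat \<Rightarrow> real) \<Rightarrow> real. continuous_on UNIV f \<and> bounded (range f) \<longrightarrow>
          ((\<lambda>p. LINT \<omega>|M. f (\<lambda>k. if k \<in> K then T p k \<omega> else 0))
             \<longlonglongrightarrow> (LINT x|N. f (\<lambda>k. if k \<in> K then x k else 0)))))"

end

theory Submission
  imports Defs
begin

text \<open>Write \<open>Y = A + D\<close>, where \<open>A = E Y\<close> is the banded covariance matrix. In the expansion of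
  \<open>trace (Y ^ k)\<close> the part linear in \<open>D\<close> is \<open>k * trace (A ^ (k - 1) * D)\<close>, a sum over the independent rows
  of quadratic forms in the entries of one row; a word with at least two factors \<open>D\<close> has variance at most a
  constant times \<open>p * b / n^2\<close>, which is negligible against \<open>p / n\<close>. That bound comes from expanding the
  covariance into cumulants: only partitions of the two index cycles that connect them and have no
  edge as a block contribute, and the sum over the indices of a block is bounded along the links of the cycles.

  The quadratic forms have fourth moments of order \<open>p^2\<close>, so Lyapunov's argument gives a normal limit for
  every linear combination, and by dominated convergence their covariances divided by \<open>p\<close> converge to the
  Toeplitz limit. Joint convergence follows because on a large cube every bounded continuous function is a
  continuous function of the sines of the scaled coordinates, hence nearly a trigonometric polynomial.\<close>

section \<open>Set partitions and combinatorial cumulants\<close>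

text \<open>The variance bound is a count of powers of \<open>n\<close>. Two copies of a word
  contain together \<open>Q\<close> noise factors, which carry \<open>n^(-Q)\<close>, and
  \<open>2 Q\<close> ends, each with a state (column, row). Blocks have at least two points, so a
  partition \<open>P\<close> has at most \<open>Q\<close> of them. Exploring the blocks along links
  costs \<open>p n\<close> for the first and \<open>n\<close> for each further block, since a power
  of \<open>A\<close> ties columns but leaves the row free: in all \<open>p n^|P|\<close>. The
  target \<open>p b n^(Q-2)\<close> is therefore missed when \<open>|P|\<close> is
  \<open>Q - 1\<close> or \<open>Q\<close>. A factor \<open>D\<close> fixes the row and costs only
  \<open>b\<close>; as no edge is a block, for so many blocks some such link joins two different
  blocks, which settles \<open>Q - 1\<close>. For \<open>|P| = Q\<close> all blocks are pairs, and
  another factor \<open>n\<close> has to be gained: a pair joining the two cycles is summed out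
  first, its rows being fixed by other ends.

  The statement defines cumulants as derivatives of a logarithm, whereas this counting needs them as
  solutions of the moment-cumulant formula. The two are identified by differentiating moments under
  a complex weight, before any summation starts.\<close>

abbreviation partitions :: "'a set \<Rightarrow> 'a set set set" where
  "partitions S \<equiv> {P. partition_on S P}"

text \<open>The right-hand side of the moment-cumulant formula: if \<kappa> gives the cumulants,
  this is the moment of \<open>S\<close>.\<close>

definition psum :: "('a set \<Rightarrow> 'b::comm_ring_1) \<Rightarrow> 'a set \<Rightarrow> 'b" where
  "psum \<kappa> S = (\<Sum>P\<in>partitions S. \<Prod>B\<in>P. \<kappa> B)"

lemma partitions_empty [simp]: "partitions {} = {{}}"
  by (auto simp: partition_on_empty)

lemma psum_empty [simp]: "psum \<kappa> {} = 1"
  by (simp add: psum_def)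

lemma partition_on_memD:
  assumes "partition_on S P" "B \<in> P"
  shows "B \<subseteq> S" "B \<noteq> {}"
  using assms by (auto simp: partition_on_def)

lemma psum_cong:
  assumes "\<And>B. B \<subseteq> S \<Longrightarrow> B \<noteq> {} \<Longrightarrow> \<kappa> B = \<kappa>' B"
  shows "psum \<kappa> S = psum \<kappa>' S"
  unfolding psum_def
proof (intro sum.cong refl prod.cong)
  fix P B assume "P \<in> partitions S" "B \<in> P"
  then show "\<kappa> B = \<kappa>' B" using assms[of B] partition_on_memD[of S P B] by simp
qed

text \<open>Partitions are sorted by the block \<open>insert x B\<close> that contains
  \<open>x\<close>; what remains is an arbitrary partition of \<open>S - B\<close>. This recursion
  is the tool for most later identities between partition sums.\<close>

lemma psum_insert:
  assumes "finite S" "x \<notin> S"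
  shows "psum \<kappa> (insert x S) = (\<Sum>B\<in>Pow S. \<kappa> (insert x B) * psum \<kappa> (S - B))"
proof -
  let ?f = "\<lambda>(B,P). insert (insert x B) P"
  let ?D = "Sigma (Pow S) (\<lambda>B. partitions (S - B))"
  have notin: "x \<notin> \<Union>P" if "partition_on (S - B) P" for B P
    using that assms(2) by (auto simp: partition_on_def)
  have inj: "inj_on ?f ?D"
  proof (rule inj_onI, clarsimp)
    fix B P B' P'
    assume a: "B \<subseteq> S" "B' \<subseteq> S" "partition_on (S - B) P" "partition_on (S - B') P'"
      "insert (insert x B) P = insert (insert x B') P'"
    have x: "x \<notin> \<Union>P" "x \<notin> \<Union>P'" using notin a by blast+
    have "insert x B = insert x B'" using x a(5) by blast
    moreover have "x \<notin> B" "x \<notin> B'" using a assms(2) by auto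
    ultimately have "B = B'" by (metis insert_ident)
    moreover have "insert x B \<notin> P" "insert x B \<notin> P'" using x by auto
    then have "P = P'" using a(5) \<open>B = B'\<close> by (metis insert_ident)
    with \<open>B = B'\<close> show "B = B' \<and> P = P'" by blast
  qed
  have img: "?f ` ?D = partitions (insert x S)"
  proof (intro equalityI subsetI)
    fix P assume "P \<in> ?f ` ?D"
    then obtain B P' where B: "B \<subseteq> S" "partition_on (S - B) P'" "P = insert (insert x B) P'" by auto
    have "insert x S - insert x B = S - B" using assms(2) by auto
    moreover have "disjnt (insert x B) (\<Union>P')"
      using B notin[OF B(2)] by (auto simp: partition_on_def disjnt_def)
    ultimately have "partition_on (insert x S) P"
      using B unfolding B(3) by (subst partition_on_insert) auto
    then show "P \<in> partitions (insert x S)" by simp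
  next
    fix P assume "P \<in> partitions (insert x S)"
    then have P: "partition_on (insert x S) P" by simp
    then obtain C where C: "C \<in> P" "x \<in> C" by (auto simp: partition_on_def)
    let ?B = "C - {x}" let ?P = "P - {C}"
    have PC: "P = insert (insert x ?B) ?P" and iC: "insert x ?B = C" using C by (auto simp: insert_absorb)
    have "disjnt C (\<Union>?P)" using P C by (auto simp: partition_on_def disjnt_def pairwise_def)
    then have "partition_on (insert x S - C) ?P"
      using P C by (metis insert_Diff partition_on_insert)
    moreover have "insert x S - C = S - ?B" using C assms(2) by auto
    moreover have "?B \<subseteq> S" using partition_on_memD[OF P C(1)] by auto
    ultimately have "(?B, ?P) \<in> ?D" by simp
    then show "P \<in> ?f ` ?D" using PC by (metis (no_types, lifting) case_prod_conv image_eqI)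
  qed
  have "psum \<kappa> (insert x S) = (\<Sum>z\<in>?D. \<Prod>B\<in>?f z. \<kappa> B)"
    unfolding psum_def img[symmetric] by (rule sum.reindex[OF inj, unfolded comp_def])
  also have "\<dots> = (\<Sum>(B,P)\<in>?D. \<kappa> (insert x B) * (\<Prod>B\<in>P. \<kappa> B))"
  proof (rule sum.cong[OF refl], clarsimp)
    fix B P assume a: "B \<subseteq> S" "partition_on (S - B) P"
    have "finite P" using a assms(1) finite_elements by blast
    moreover have "insert x B \<notin> P" using notin[OF a(2)] by blast
    ultimately show "prod \<kappa> (insert (insert x B) P) = \<kappa> (insert x B) * prod \<kappa> P" by simp
  qed
  also have "\<dots> = (\<Sum>B\<in>Pow S. \<Sum>P\<in>partitions (S - B). \<kappa> (insert x B) * (\<Prod>B\<in>P. \<kappa> B))"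
    using assms(1) by (subst sum.Sigma) (auto intro: finitely_many_partition_on)
  finally show ?thesis by (simp add: psum_def sum_distrib_left)
qed

lemma psum_split_top:
  assumes "finite S" "S \<noteq> {}"
  shows "psum \<kappa> S = \<kappa> S + (\<Sum>P\<in>partitions S - {{S}}. \<Prod>B\<in>P. \<kappa> B)"
  unfolding psum_def using assms
  by (subst sum.remove[of _ "{S}"]) (auto intro: finitely_many_partition_on simp: partition_on_space)

lemma partition_block_card_less:
  assumes "finite S" "partition_on S P" "P \<noteq> {S}" "B \<in> P"
  shows "card B < card S"
proof -
  have B: "B \<subseteq> S" "B \<noteq> {}" using partition_on_memD[OF assms(2,4)] by auto
  have "B \<noteq> S"
  proof
    assume "B = S"
    have "C = S" if "C \<in> P" for C
    proof (rule ccontr)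
      assume "C \<noteq> S"
      then have "C \<inter> S = {}" using assms(2,4) that \<open>B = S\<close>
        by (auto simp: partition_on_def pairwise_def disjnt_def)
      then show False using partition_on_memD[OF assms(2) that] by blast
    qed
    then show False using assms(3,4) by blast
  qed
  then show ?thesis using B assms(1) by (simp add: psubset_card_mono psubsetI)
qed

text \<open>The moment-cumulant formula solved for the term of the one-block partition; the
  recursion descends to smaller blocks. Infinite sets get the value 0, because \<open>card\<close>,
  which drives the termination, cannot decrease there.\<close>

function cum :: "('a set \<Rightarrow> 'b::comm_ring_1) \<Rightarrow> 'a set \<Rightarrow> 'b" where
  "cum m S = (if finite S then m S - (\<Sum>P\<in>partitions S - {{S}}. \<Prod>B\<in>P. cum m B) else 0)"
  by auto
termination
  by (relation "Wellfounded.measure (\<lambda>(m,S). card S)") (auto intro: partition_block_card_less)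

declare cum.simps [simp del]

lemma psum_cum:
  assumes "finite S" "S \<noteq> {}"
  shows "psum (cum m) S = m S"
  using assms by (subst psum_split_top) (auto simp: cum.simps[of m S])

text \<open>Partition sums determine the function, since each of them fixes the value on the top
  block in terms of smaller sets. Transport along injections, scaling and the vanishing under
  independence are all proved by naming a candidate and computing its partition sums.\<close>

lemma cum_unique:
  assumes "finite H" "\<And>S. S \<subseteq> H \<Longrightarrow> S \<noteq> {} \<Longrightarrow> psum \<kappa> S = m S"
  shows "B \<subseteq> H \<Longrightarrow> B \<noteq> {} \<Longrightarrow> \<kappa> B = cum m B"
proof (induction "card B" arbitrary: B rule: less_induct)
  case less
  have fin: "finite B" using less assms finite_subset by blast
  have "(\<Sum>P\<in>partitions B - {{B}}. \<Prod>C\<in>P. \<kappa> C) = (\<Sum>P\<in>partitions B - {{B}}. \<Prod>C\<in>P. cum m C)"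
  proof (intro sum.cong refl prod.cong)
    fix P C assume P: "P \<in> partitions B - {{B}}" "C \<in> P"
    then have "card C < card B" "C \<subseteq> B" "C \<noteq> {}"
      using partition_block_card_less[OF fin, of P C] partition_on_memD[of B P C] by blast+
    then show "\<kappa> C = cum m C" using less.hyps less.prems by blast
  qed
  moreover have "psum \<kappa> B = psum (cum m) B"
    using assms(2)[OF less.prems] psum_cum[OF fin less.prems(2), of m] by simp
  ultimately show ?case using psum_split_top[OF fin less.prems(2)] by (metis add_right_cancel)
qed

lemma cum_singleton: "cum m {x} = m {x}"
  using psum_cum[of "{x}" m] psum_insert[of "{}" x "cum m"] by simp

lemma cum_cong:
  assumes "finite S" "S \<noteq> {}" "\<And>B. B \<subseteq> S \<Longrightarrow> B \<noteq> {} \<Longrightarrow> m B = m' B"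
  shows "cum m S = cum m' S"
proof (rule cum_unique[OF assms(1)])
  fix T assume "T \<subseteq> S" "T \<noteq> {}"
  then show "psum (cum m) T = m' T" using assms psum_cum[of T m] by (metis finite_subset)
qed (use assms in auto)

lemma psum_image:
  assumes "finite S" "inj_on f S"
  shows "psum \<kappa> (f ` S) = psum (\<lambda>B. \<kappa> (f ` B)) S"
  using assms
proof (induction "card S" arbitrary: S rule: less_induct)
  case less
  show ?case
  proof (cases "S = {}")
    case False
    then obtain x S' where S: "S = insert x S'" "x \<notin> S'" by (meson Set.set_insert ex_in_conv)
    have fin: "finite S'" using less S by simp
    have fx: "f x \<notin> f ` S'" and inj': "inj_on f S'" using less S by auto
    have inj2: "inj_on ((`) f) (Pow S')" using inj' by (metis inj_on_image_Pow)
    have "psum \<kappa> (f ` S) = (\<Sum>B\<in>Pow (f ` S'). \<kappa> (insert (f x) B) * psum \<kappa> (f ` S' - B))"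
      unfolding S image_insert using fin fx by (subst psum_insert) auto
    also have "\<dots> = (\<Sum>B\<in>Pow S'. \<kappa> (insert (f x) (f ` B)) * psum \<kappa> (f ` S' - f ` B))"
      unfolding image_Pow_surj[OF refl, symmetric] by (rule sum.reindex[OF inj2, unfolded comp_def])
    also have "\<dots> = (\<Sum>B\<in>Pow S'. \<kappa> (f ` insert x B) * psum (\<lambda>B. \<kappa> (f ` B)) (S' - B))"
    proof (intro sum.cong refl)
      fix B assume B: "B \<in> Pow S'"
      have "f ` S' - f ` B = f ` (S' - B)" using B inj' by (metis Diff_subset PowD inj_on_image_set_diff subset_refl)
      moreover have "card (S' - B) < card S" using S fin
        by (metis card_insert_disjoint card_mono Diff_subset less_Suc_eq_le)
      ultimately have "psum \<kappa> (f ` S' - f ` B) = psum (\<lambda>B. \<kappa> (f ` B)) (S' - B)"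
        using less.hyps[of "S' - B"] fin inj' by (metis Diff_subset finite_Diff inj_on_subset)
      then show "\<kappa> (insert (f x) (f ` B)) * psum \<kappa> (f ` S' - f ` B)
          = \<kappa> (f ` insert x B) * psum (\<lambda>B. \<kappa> (f ` B)) (S' - B)" by simp
    qed
    also have "\<dots> = psum (\<lambda>B. \<kappa> (f ` B)) S" unfolding S using fin S by (subst psum_insert) auto
    finally show ?thesis .
  qed simp
qed

lemma cum_image:
  assumes "finite S" "S \<noteq> {}" "inj_on f S"
  shows "cum m (f ` S) = cum (\<lambda>B. m (f ` B)) S"
proof (rule cum_unique[OF assms(1)])
  fix T assume T: "T \<subseteq> S" "T \<noteq> {}"
  then have "finite T" "inj_on f T" using assms by (auto intro: finite_subset inj_on_subset)
  then show "psum (\<lambda>B. cum m (f ` B)) T = m (f ` T)"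
    using psum_image[of T f "cum m"] psum_cum[of "f ` T" m] T by simp
qed (use assms in auto)

text \<open>The block sizes of a partition add up to the size of the set, so the powers of
  \<open>c\<close> collect into one factor. It serves for the powers of \<i> in characteristic
  functions.\<close>

lemma cum_scale:
  assumes "finite S" "S \<noteq> {}"
  shows "cum (\<lambda>B. c ^ card B * m B) S = c ^ card S * cum m S"
proof (rule cum_unique[OF assms(1), symmetric])
  fix T assume T: "T \<subseteq> S" "T \<noteq> {}"
  then have fin: "finite T" using assms finite_subset by blast
  have "psum (\<lambda>B. c ^ card B * cum m B) T = c ^ card T * psum (cum m) T"
    unfolding psum_def sum_distrib_left
  proof (intro sum.cong refl)
    fix P assume P: "P \<in> partitions T"
    have "card T = (\<Sum>B\<in>P. card B)"
      using product_partition[of T P] P fin partition_on_memD(1)[of T P] by (auto intro: finite_subset)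
    then show "(\<Prod>B\<in>P. c ^ card B * cum m B) = c ^ card T * prod (cum m) P"
      by (simp add: prod.distrib power_sum)
  qed
  then show "psum (\<lambda>B. c ^ card B * cum m B) T = c ^ card T * m T" using psum_cum[OF fin T(2)] by metis
qed (use assms in auto)

lemma cum_of_real:
  assumes "finite S" "S \<noteq> {}"
  shows "cum (\<lambda>B. of_real (m B) :: complex) S = of_real (cum m S)"
proof (rule cum_unique[OF assms(1), symmetric])
  fix T assume T: "T \<subseteq> S" "T \<noteq> {}"
  then have "finite T" using assms finite_subset by blast
  then have "m T = (\<Sum>P\<in>partitions T. \<Prod>B\<in>P. cum m B)"
    using psum_cum[of T m] T by (simp add: psum_def)
  then show "psum (\<lambda>B. complex_of_real (cum m B)) T = of_real (m T)" by (simp add: psum_def)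
qed (use assms in auto)

text \<open>A partition whose blocks all lie on one side is a pair of partitions of the two sides.
  The induction removes points of the first side only; once that is exhausted, the cut-off is
  invisible on \<open>H2\<close>.\<close>

lemma psum_no_mixing:
  assumes "finite H1" "finite H2" "H1 \<inter> H2 = {}"
  shows "psum (\<lambda>B. if B \<subseteq> H1 \<or> B \<subseteq> H2 then \<kappa> B else 0) (H1 \<union> H2) = psum \<kappa> H1 * psum \<kappa> H2"
proof -
  let ?k = "\<lambda>B. if B \<subseteq> H1 \<or> B \<subseteq> H2 then \<kappa> B else 0"
  have H2: "psum ?k S = psum \<kappa> S" if "S \<subseteq> H2" for S
    by (rule psum_cong) (use that in auto)
  have "psum ?k (S1 \<union> H2) = psum \<kappa> S1 * psum \<kappa> H2" if "S1 \<subseteq> H1" for S1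
    using that
  proof (induction "card S1" arbitrary: S1 rule: less_induct)
    case less
    have fS: "finite S1" using less.prems assms finite_subset by blast
    show ?case
    proof (cases "S1 = {}")
      case True
      then show ?thesis using H2[of H2] by simp
    next
      case False
      then obtain x S' where S: "S1 = insert x S'" "x \<notin> S'" by (meson Set.set_insert ex_in_conv)
      have fin: "finite S'" "x \<in> H1" "x \<notin> H2" "S' \<subseteq> H1" using less S fS assms by auto
      have "psum ?k (S1 \<union> H2) = (\<Sum>B\<in>Pow (S' \<union> H2). ?k (insert x B) * psum ?k (S' \<union> H2 - B))"
        unfolding S Un_insert_left using fin S assms by (subst psum_insert) auto
      \<comment> \<open>A block that contains \<open>x\<close> and also meets \<open>H2\<close> is
        cut off to 0.\<close>
      also have "\<dots> = (\<Sum>B\<in>Pow S'. ?k (insert x B) * psum ?k (S' \<union> H2 - B))"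
      proof (rule sum.mono_neutral_right)
        show "\<forall>B\<in>Pow (S' \<union> H2) - Pow S'. ?k (insert x B) * psum ?k (S' \<union> H2 - B) = 0"
          using fin assms by auto
      qed (use fin assms in auto)
      also have "\<dots> = (\<Sum>B\<in>Pow S'. \<kappa> (insert x B) * (psum \<kappa> (S' - B) * psum \<kappa> H2))"
      proof (intro sum.cong refl)
        fix B assume B: "B \<in> Pow S'"
        have "S' \<union> H2 - B = (S' - B) \<union> H2" using B fin assms by auto
        moreover have "card (S' - B) < card S1" using S fin
          by (metis card_insert_disjoint card_mono Diff_subset less_Suc_eq_le)
        moreover have "insert x B \<subseteq> H1" using B fin by auto
        ultimately show "?k (insert x B) * psum ?k (S' \<union> H2 - B)
            = \<kappa> (insert x B) * (psum \<kappa> (S' - B) * psum \<kappa> H2)"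
          using less.hyps[of "S' - B"] fin by (auto simp: subset_iff)
      qed
      also have "\<dots> = psum \<kappa> S1 * psum \<kappa> H2"
        unfolding S using fin S by (subst psum_insert) (auto simp: sum_distrib_right mult.assoc)
      finally show ?thesis .
    qed
  qed
  then show ?thesis by simp
qed

text \<open>Cumulants across independent families vanish: cutting \<open>cum m\<close> off to 0 on
  mixed sets leaves the partition sums equal to \<open>m\<close>, because \<open>m\<close>
  factorises, and by uniqueness the cut-off changed nothing.\<close>

lemma cum_mixing_eq_0:
  assumes fin: "finite H1" "finite H2" and disj: "H1 \<inter> H2 = {}"
    and m: "\<And>S. S \<subseteq> H1 \<union> H2 \<Longrightarrow> m S = m (S \<inter> H1) * m (S \<inter> H2)" and m0: "m {} = 1"
    and B: "B \<subseteq> H1 \<union> H2" "\<not> B \<subseteq> H1" "\<not> B \<subseteq> H2"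
  shows "cum m B = 0"
proof -
  let ?k = "\<lambda>B. if B \<subseteq> H1 \<or> B \<subseteq> H2 then cum m B else 0"
  have pc: "psum (cum m) S = m S" if "finite S" for S
    using that psum_cum[of S m] m0 by (cases "S = {}") auto
  have "?k B = cum m B"
  proof (rule cum_unique[of "H1 \<union> H2"])
    fix S assume S: "S \<subseteq> H1 \<union> H2"
    have "psum ?k S = psum (\<lambda>B. if B \<subseteq> S \<inter> H1 \<or> B \<subseteq> S \<inter> H2 then cum m B else 0) S"
      by (rule psum_cong) auto
    also have "\<dots> = psum (\<lambda>B. if B \<subseteq> S \<inter> H1 \<or> B \<subseteq> S \<inter> H2 then cum m B else 0) ((S \<inter> H1) \<union> (S \<inter> H2))"
      using S by (simp add: Int_Un_distrib[symmetric] Int_absorb2)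
    also have "\<dots> = psum (cum m) (S \<inter> H1) * psum (cum m) (S \<inter> H2)"
      using fin disj by (intro psum_no_mixing) auto
    also have "\<dots> = m S" using fin S m by (simp add: pc)
    finally show "psum ?k S = m S" .
  qed (use fin B in auto)
  then show ?thesis using B by simp
qed

text \<open>The terms lost when \<kappa> is set to 0 at \<open>E\<close> belong to the partitions
  with block \<open>E\<close>, and these arise by adding \<open>E\<close> to a partition of
  \<open>S - E\<close>. Centring a product over \<open>E\<close> has exactly this effect on its
  expectation.\<close>

lemma psum_fun_upd_0:
  assumes "finite S" "E \<subseteq> S" "E \<noteq> {}"
  shows "psum (\<kappa>(E := 0)) S = psum \<kappa> S - \<kappa> E * psum \<kappa> (S - E)"
proof -
  have fin: "finite (partitions S)" using assms(1) by (rule finitely_many_partition_on)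
  let ?A = "{P. partition_on S P \<and> E \<in> P}" and ?N = "{P. partition_on S P \<and> E \<notin> P}"
  have un: "partitions S = ?A \<union> ?N" by auto
  have finAN: "finite ?A" "finite ?N" using fin unfolding un by auto
  have A: "?A = insert E ` partitions (S - E)"
  proof (intro equalityI subsetI)
    fix P assume P: "P \<in> ?A"
    then have PE: "P = insert E (P - {E})" by auto
    have "disjnt E (\<Union>(P - {E}))" using P by (auto simp: partition_on_def disjnt_def pairwise_def)
    then have "partition_on (S - E) (P - {E})" using P PE by (metis (no_types, lifting) mem_Collect_eq partition_on_insert)
    then show "P \<in> insert E ` partitions (S - E)" using PE by blast
  next
    fix P assume "P \<in> insert E ` partitions (S - E)"
    then obtain P' where P': "partition_on (S - E) P'" "P = insert E P'" by auto
    then have "disjnt E (\<Union>P')" by (auto simp: partition_on_def disjnt_def)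
    then show "P \<in> ?A" using P' assms by (simp add: partition_on_insert)
  qed
  have notin: "E \<notin> P" if "partition_on (S - E) P" for P
    using that assms by (auto simp: partition_on_def)
  then have inj: "inj_on (insert E) (partitions (S - E))"
    by (intro inj_onI) (metis insert_ident mem_Collect_eq)
  have sA: "(\<Sum>P\<in>?A. \<Prod>B\<in>P. \<kappa>' B) = \<kappa>' E * psum \<kappa>' (S - E)" for \<kappa>' :: "'a set \<Rightarrow> 'b"
    unfolding A sum.reindex[OF inj] psum_def sum_distrib_left comp_def
  proof (intro sum.cong refl)
    fix P assume P: "P \<in> partitions (S - E)"
    then have "finite P" using assms(1) finite_elements by blast
    then show "prod \<kappa>' (insert E P) = \<kappa>' E * prod \<kappa>' P" using notin P by simp
  qed
  have "psum (\<kappa>(E := 0)) S = (\<Sum>P\<in>?A. \<Prod>B\<in>P. (\<kappa>(E := 0)) B) + (\<Sum>P\<in>?N. \<Prod>B\<in>P. (\<kappa>(E := 0)) B)"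
    unfolding psum_def un using finAN by (intro sum.union_disjoint) auto
  also have "(\<Sum>P\<in>?N. \<Prod>B\<in>P. (\<kappa>(E := 0)) B) = (\<Sum>P\<in>?N. \<Prod>B\<in>P. \<kappa> B)"
    by (intro sum.cong refl prod.cong) auto
  also have "\<dots> = psum \<kappa> S - (\<Sum>P\<in>?A. \<Prod>B\<in>P. \<kappa> B)"
    unfolding psum_def un using finAN by (subst sum.union_disjoint) auto
  finally show ?thesis by (simp only: sA) simp
qed

section \<open>Joint cumulants of random variables\<close>

text \<open>Finiteness of all moments passes to sums and products, so the integrability of every
  polynomial in the matrix entries follows by structural rules.\<close>

definition all_moments :: "'a measure \<Rightarrow> ('a \<Rightarrow> real) \<Rightarrow> bool" where
  "all_moments M X \<longleftrightarrow> X \<in> borel_measurable M \<and> (\<forall>k::nat. integrable M (\<lambda>\<omega>. \<bar>X \<omega>\<bar> ^ k))"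

lemma all_moments_measurable [measurable_dest]: "all_moments M X \<Longrightarrow> X \<in> borel_measurable M"
  by (simp add: all_moments_def)

lemma all_moments_integrable_power: "all_moments M X \<Longrightarrow> integrable M (\<lambda>\<omega>. X \<omega> ^ k)"
proof -
  assume a: "all_moments M X"
  then have "integrable M (\<lambda>\<omega>. \<bar>X \<omega>\<bar> ^ k)" by (simp add: all_moments_def)
  then show ?thesis
    by (rule Bochner_Integration.integrable_bound)
      (use a in \<open>auto simp: all_moments_def power_abs\<close>)
qed

lemma all_moments_integrable: "all_moments M X \<Longrightarrow> integrable M X"
  using all_moments_integrable_power[of M X 1] by simp

lemma all_moments_mult:
  assumes "all_moments M X" "all_moments M Y"
  shows "all_moments M (\<lambda>\<omega>. X \<omega> * Y \<omega>)"
  unfolding all_moments_def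
proof (intro conjI allI)
  fix k
  have "integrable M (\<lambda>\<omega>. \<bar>X \<omega>\<bar> ^ (2*k) + \<bar>Y \<omega>\<bar> ^ (2*k))"
    using assms by (auto simp: all_moments_def)
  then show "integrable M (\<lambda>\<omega>. \<bar>X \<omega> * Y \<omega>\<bar> ^ k)"
  proof (rule Bochner_Integration.integrable_bound)
    show "AE \<omega> in M. norm (\<bar>X \<omega> * Y \<omega>\<bar> ^ k) \<le> norm (\<bar>X \<omega>\<bar> ^ (2*k) + \<bar>Y \<omega>\<bar> ^ (2*k))"
    proof (rule AE_I2)
      fix \<omega>
      have "2 * (\<bar>X \<omega>\<bar>^k * \<bar>Y \<omega>\<bar>^k) \<le> (\<bar>X \<omega>\<bar>^k)^2 + (\<bar>Y \<omega>\<bar>^k)^2"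
        using sum_squares_bound[of "\<bar>X \<omega>\<bar>^k" "\<bar>Y \<omega>\<bar>^k"] by (simp add: mult.assoc)
      moreover have "0 \<le> \<bar>X \<omega>\<bar>^k * \<bar>Y \<omega>\<bar>^k" by simp
      ultimately have "\<bar>X \<omega>\<bar>^k * \<bar>Y \<omega>\<bar>^k \<le> (\<bar>X \<omega>\<bar>^k)^2 + (\<bar>Y \<omega>\<bar>^k)^2" by linarith
      then show "norm (\<bar>X \<omega> * Y \<omega>\<bar> ^ k) \<le> norm (\<bar>X \<omega>\<bar> ^ (2*k) + \<bar>Y \<omega>\<bar> ^ (2*k))"
        by (simp add: abs_mult power_mult_distrib power_mult[symmetric] mult.commute[of _ 2])
    qed
  qed (use assms in \<open>auto simp: all_moments_def\<close>)
qed (use assms in \<open>auto simp: all_moments_def\<close>)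

lemma all_moments_add:
  assumes "all_moments M X" "all_moments M Y"
  shows "all_moments M (\<lambda>\<omega>. X \<omega> + Y \<omega>)"
  unfolding all_moments_def
proof (intro conjI allI)
  fix k
  have "integrable M (\<lambda>\<omega>. 2^k * (\<bar>X \<omega>\<bar> ^ k + \<bar>Y \<omega>\<bar> ^ k))"
    using assms by (auto simp: all_moments_def)
  then show "integrable M (\<lambda>\<omega>. \<bar>X \<omega> + Y \<omega>\<bar> ^ k)"
  proof (rule Bochner_Integration.integrable_bound)
    show "AE \<omega> in M. norm (\<bar>X \<omega> + Y \<omega>\<bar> ^ k) \<le> norm (2^k * (\<bar>X \<omega>\<bar> ^ k + \<bar>Y \<omega>\<bar> ^ k))"
    proof (rule AE_I2)
      fix \<omega>
      let ?m = "max \<bar>X \<omega>\<bar> \<bar>Y \<omega>\<bar>"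
      have "\<bar>X \<omega> + Y \<omega>\<bar> ^ k \<le> (2 * ?m) ^ k" by (intro power_mono) auto
      also have "\<dots> = 2^k * ?m^k" by (simp add: power_mult_distrib)
      also have "?m ^ k \<le> \<bar>X \<omega>\<bar>^k + \<bar>Y \<omega>\<bar>^k" by (simp add: max_def)
      finally show "norm (\<bar>X \<omega> + Y \<omega>\<bar> ^ k) \<le> norm (2^k * (\<bar>X \<omega>\<bar> ^ k + \<bar>Y \<omega>\<bar> ^ k))" by simp
    qed
  qed (use assms in \<open>auto simp: all_moments_def\<close>)
qed (use assms in \<open>auto simp: all_moments_def\<close>)

lemma (in finite_measure) all_moments_const: "all_moments M (\<lambda>_. c)"
  by (simp add: all_moments_def)

lemma (in finite_measure) all_moments_sum:
  assumes "\<And>i. i \<in> I \<Longrightarrow> all_moments M (X i)"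
  shows "all_moments M (\<lambda>\<omega>. \<Sum>i\<in>I. X i \<omega>)"
  using assms
  by (induction I rule: infinite_finite_induct) (auto intro: all_moments_const all_moments_add)

lemma (in finite_measure) all_moments_prod:
  assumes "\<And>i. i \<in> I \<Longrightarrow> all_moments M (X i)"
  shows "all_moments M (\<lambda>\<omega>. \<Prod>i\<in>I. X i \<omega>)"
  using assms
  by (induction I rule: infinite_finite_induct) (auto intro: all_moments_const all_moments_mult)

lemma (in finite_measure) all_moments_cmult:
  "all_moments M X \<Longrightarrow> all_moments M (\<lambda>\<omega>. c * X \<omega>)"
  by (intro all_moments_mult all_moments_const)

lemma (in finite_measure) all_moments_diff:
  "all_moments M X \<Longrightarrow> all_moments M Y \<Longrightarrow> all_moments M (\<lambda>\<omega>. X \<omega> - Y \<omega>)"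
  using all_moments_add[of M X "\<lambda>\<omega>. (-1) * Y \<omega>"] all_moments_cmult[of Y "-1"] by simp

lemma cis_taylor1: "cmod (cis u - 1 - \<i> * u) \<le> u\<^sup>2 / 2"
  using iexp_approx1[of u 1] by (simp add: cis_conv_exp algebra_simps power2_eq_square)

text \<open>Taylor's bound for \<open>cis\<close>, integrated, makes the error of the linear
  approximation at most \<open>C * (s - s0)^2\<close> for all \<open>s\<close> at once, where
  \<open>C\<close> is the integral of \<open>cmod Y * x^2\<close>.\<close>

lemma integral_cis_has_vector_derivative:
  fixes Y :: "'a \<Rightarrow> complex" and x \<theta> :: "'a \<Rightarrow> real"
  assumes [measurable]: "Y \<in> borel_measurable M" "x \<in> borel_measurable M" "\<theta> \<in> borel_measurable M"
    and i0: "integrable M Y" and i1: "integrable M (\<lambda>\<omega>. Y \<omega> * x \<omega>)"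
    and i2: "integrable M (\<lambda>\<omega>. cmod (Y \<omega>) * (x \<omega>)\<^sup>2)"
  shows "((\<lambda>s. LINT \<omega>|M. Y \<omega> * cis (\<theta> \<omega> + s * x \<omega>)) has_vector_derivative
     (LINT \<omega>|M. (\<i> * x \<omega> * Y \<omega>) * cis (\<theta> \<omega> + s0 * x \<omega>))) (at s0)"
proof -
  let ?F = "\<lambda>s. LINT \<omega>|M. Y \<omega> * cis (\<theta> \<omega> + s * x \<omega>)"
  let ?D = "LINT \<omega>|M. (\<i> * x \<omega> * Y \<omega>) * cis (\<theta> \<omega> + s0 * x \<omega>)"
  define C where "C = (LINT \<omega>|M. cmod (Y \<omega>) * (x \<omega>)\<^sup>2)"
  have C0: "C \<ge> 0" unfolding C_def by (intro integral_nonneg_AE) auto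
  have [measurable]: "(\<lambda>\<omega>. cis (\<theta> \<omega> + s * x \<omega>)) \<in> borel_measurable M" for s
    unfolding cis_conv_exp by measurable
  have I: "integrable M (\<lambda>\<omega>. Y \<omega> * cis (\<theta> \<omega> + s * x \<omega>))" for s
    by (rule Bochner_Integration.integrable_bound[OF i0]) (auto simp: norm_mult)
  have I': "integrable M (\<lambda>\<omega>. (\<i> * x \<omega> * Y \<omega>) * cis (\<theta> \<omega> + s0 * x \<omega>))"
    by (rule Bochner_Integration.integrable_bound[OF i1]) (auto simp: norm_mult)
  have est: "cmod (?F s - ?F s0 - (s - s0) *\<^sub>R ?D) \<le> C * (s - s0)\<^sup>2" for s
  proof -
    let ?h = "s - s0"
    have "?F s - ?F s0 - ?h *\<^sub>R ?D = (LINT \<omega>|M. Y \<omega> * cis (\<theta> \<omega> + s * x \<omega>)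
       - Y \<omega> * cis (\<theta> \<omega> + s0 * x \<omega>) - ?h *\<^sub>R ((\<i> * x \<omega> * Y \<omega>) * cis (\<theta> \<omega> + s0 * x \<omega>)))"
      using I I' by (subst Bochner_Integration.integral_diff Bochner_Integration.integral_scaleR_right | simp)+
    also have "cmod (LINT \<omega>|M. Y \<omega> * cis (\<theta> \<omega> + s * x \<omega>)
       - Y \<omega> * cis (\<theta> \<omega> + s0 * x \<omega>) - ?h *\<^sub>R ((\<i> * x \<omega> * Y \<omega>) * cis (\<theta> \<omega> + s0 * x \<omega>))) \<le> (LINT \<omega>|M. ?h\<^sup>2 * (cmod (Y \<omega>) * (x \<omega>)\<^sup>2))"
    proof (rule order_trans[OF integral_norm_bound], rule integral_mono)
      fix \<omega>
      have "cis (\<theta> \<omega> + s * x \<omega>) = cis (\<theta> \<omega> + s0 * x \<omega>) * cis (?h * x \<omega>)"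
        by (simp add: cis_mult algebra_simps)
      then have "Y \<omega> * cis (\<theta> \<omega> + s * x \<omega>) - Y \<omega> * cis (\<theta> \<omega> + s0 * x \<omega>)
          - ?h *\<^sub>R ((\<i> * x \<omega> * Y \<omega>) * cis (\<theta> \<omega> + s0 * x \<omega>))
         = Y \<omega> * cis (\<theta> \<omega> + s0 * x \<omega>) * (cis (?h * x \<omega>) - 1 - \<i> * of_real (?h * x \<omega>))"
        by (simp add: algebra_simps scaleR_conv_of_real)
      then have "cmod (Y \<omega> * cis (\<theta> \<omega> + s * x \<omega>) - Y \<omega> * cis (\<theta> \<omega> + s0 * x \<omega>)
          - ?h *\<^sub>R ((\<i> * x \<omega> * Y \<omega>) * cis (\<theta> \<omega> + s0 * x \<omega>)))
         \<le> cmod (Y \<omega>) * ((?h * x \<omega>)\<^sup>2 / 2)"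
        using cis_taylor1[of "?h * x \<omega>"] by (simp only: norm_mult norm_cis mult_1_right) (rule mult_left_mono, auto)
      also have "\<dots> \<le> ?h\<^sup>2 * (cmod (Y \<omega>) * (x \<omega>)\<^sup>2)"
        by (simp add: power_mult_distrib)
      finally show "cmod (Y \<omega> * cis (\<theta> \<omega> + s * x \<omega>) - Y \<omega> * cis (\<theta> \<omega> + s0 * x \<omega>)
          - ?h *\<^sub>R ((\<i> * x \<omega> * Y \<omega>) * cis (\<theta> \<omega> + s0 * x \<omega>))) \<le> ?h\<^sup>2 * (cmod (Y \<omega>) * (x \<omega>)\<^sup>2)" .
    qed (use I I' i2 in \<open>auto intro!: integrable_norm Bochner_Integration.integrable_diff\<close>)
    also have "\<dots> = C * ?h\<^sup>2" by (simp add: C_def)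
    finally show ?thesis .
  qed
  show ?thesis
    unfolding has_vector_derivative_def has_derivative_at_alt
  proof (intro conjI allI impI)
    fix e :: real assume e: "e > 0"
    show "\<exists>d>0. \<forall>y. norm (y - s0) < d \<longrightarrow>
        norm (?F y - ?F s0 - (y - s0) *\<^sub>R ?D) \<le> e * norm (y - s0)"
    \<comment> \<open>The summand 1 covers the case \<open>C = 0\<close>.\<close>
    proof (intro exI[of _ "e / (C + 1)"] conjI allI impI)
      fix y assume y: "norm (y - s0) < e / (C + 1)"
      have "C * \<bar>y - s0\<bar> \<le> (C + 1) * \<bar>y - s0\<bar>" by (simp add: mult_right_mono)
      also have "\<dots> \<le> e" using y C0 by (simp add: field_simps)
      finally have "C * \<bar>y - s0\<bar> * \<bar>y - s0\<bar> \<le> e * \<bar>y - s0\<bar>" by (intro mult_right_mono) auto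
      then show "norm (?F y - ?F s0 - (y - s0) *\<^sub>R ?D) \<le> e * norm (y - s0)"
        using est[of y] by (simp add: power2_eq_square mult.assoc abs_mult_self_eq)
    qed (use e C0 in auto)
  qed (rule bounded_linear_scaleR_left)
qed

text \<open>A family of moment functions that evolves like the moments of an exponentially tilted law:
  differentiating a cumulant adds the variable of differentiation to it.\<close>
lemma cum_has_vector_derivative:
  fixes m :: "real \<Rightarrow> 'a set \<Rightarrow> complex"
  assumes "finite S" "S \<noteq> {}" "j \<notin> S" and m0: "\<And>s. m s {} = 1"
    and der: "\<And>B. B \<subseteq> S \<Longrightarrow> ((\<lambda>s. m s B) has_vector_derivative m s0 (insert j B) - m s0 B * m s0 {j}) (at s0)"
  shows "((\<lambda>s. cum (m s) S) has_vector_derivative cum (m s0) (insert j S)) (at s0)"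
  using assms(1-3) der
proof (induction "card S" arbitrary: S rule: less_induct)
  case less
  then obtain x S' where S: "S = insert x S'" "x \<notin> S'" by (meson Set.set_insert ex_in_conv)
  have fin: "finite S'" "x \<noteq> j" "j \<notin> S'" using less S by auto
  have pc: "psum (cum (m s)) T = m s T" if "finite T" for T s
    using that psum_cum[of T "m s"] m0 by (cases "T = {}") auto
  let ?c = "\<lambda>s. cum (m s)"
  have rec: "m s (insert x T) = (\<Sum>B\<in>Pow T. ?c s (insert x B) * m s (T - B))"
    if "finite T" "x \<notin> T" for T s
    using that psum_insert[of T x "?c s"] pc finite_subset[of _ T] by (auto simp: pc)
  \<comment> \<open>The term \<open>B = S'\<close> of the recursion is the cumulant of
    \<open>S\<close> itself, because \<open>m s {} = 1\<close>; the remaining terms contain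
    cumulants of smaller sets only.\<close>
  have recS: "?c s S = m s S - (\<Sum>B\<in>Pow S' - {S'}. ?c s (insert x B) * m s (S' - B))" for s
    using rec[of S' s] fin S by (subst (asm) sum.remove[of _ S']) (auto simp: m0)
  let ?m = "m s0" and ?k = "cum (m s0)"
  \<comment> \<open>Product rule for the term of \<open>B\<close>: the induction hypothesis inserts
    \<open>j\<close> into the cumulant, and the moment follows its own rule with the normalising
    product subtracted.\<close>
  let ?f = "\<lambda>B. ?k (insert x B) * ?m (insert j (S' - B)) + ?k (insert x (insert j B)) * ?m (S' - B)
      - ?k (insert x B) * ?m (S' - B) * ?m {j}"
  have "((\<lambda>s. ?c s S) has_vector_derivative
      (?m (insert j S) - ?m S * ?m {j}) - (\<Sum>B\<in>Pow S' - {S'}. ?f B)) (at s0)"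
    unfolding recS
  proof (intro derivative_intros)
    show "((\<lambda>s. m s S) has_vector_derivative ?m (insert j S) - ?m S * ?m {j}) (at s0)"
      using less.prems by blast
    fix B assume B: "B \<in> Pow S' - {S'}"
    have c: "card (insert x B) < card S"
      using B S fin by (intro psubset_card_mono) auto
    have "((\<lambda>s. ?c s (insert x B)) has_vector_derivative ?k (insert j (insert x B))) (at s0)"
    proof (rule less.hyps[OF c])
      show "finite (insert x B)" using B fin finite_subset by auto
      show "j \<notin> insert x B" using B fin by auto
    next
      fix C assume "C \<subseteq> insert x B"
      then have "C \<subseteq> S" using B S by auto
      then show "((\<lambda>s. m s C) has_vector_derivative ?m (insert j C) - ?m C * ?m {j}) (at s0)"
        using less.prems by blast
    qed auto
    moreover have "((\<lambda>s. m s (S' - B)) has_vector_derivative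
       ?m (insert j (S' - B)) - ?m (S' - B) * ?m {j}) (at s0)"
      using less.prems(4)[of "S' - B"] S by blast
    ultimately show "((\<lambda>s. ?c s (insert x B) * m s (S' - B)) has_vector_derivative ?f B) (at s0)"
      by (rule has_vector_derivative_eq_rhs[OF has_vector_derivative_mult])
        (simp add: algebra_simps insert_commute)
  qed
  moreover have "(?m (insert j S) - ?m S * ?m {j}) - (\<Sum>B\<in>Pow S' - {S'}. ?f B) = ?k (insert j S)"
  proof -
    \<comment> \<open>The subsets of \<open>insert j S'\<close> are sorted by whether they contain
      \<open>j\<close>; the two resulting sums are the two derivative terms in
      \<open>?f\<close>.\<close>
    have "?m (insert j S) = (\<Sum>B\<in>Pow (insert j S'). ?k (insert x B) * ?m (insert j S' - B))"
      using rec[of "insert j S'"] fin S by (simp add: insert_commute)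
    also have "\<dots> = (\<Sum>B\<in>Pow S'. ?k (insert x B) * ?m (insert j S' - B))
         + (\<Sum>B\<in>insert j ` Pow S'. ?k (insert x B) * ?m (insert j S' - B))"
      unfolding Pow_insert using fin by (intro sum.union_disjoint) auto
    also have "(\<Sum>B\<in>insert j ` Pow S'. ?k (insert x B) * ?m (insert j S' - B))
        = (\<Sum>B\<in>Pow S'. ?k (insert x (insert j B)) * ?m (S' - B))"
    proof (subst sum.reindex)
      show "inj_on (insert j) (Pow S')" using fin by (auto intro!: inj_onI)
      show "sum ((\<lambda>B. ?k (insert x B) * ?m (insert j S' - B)) \<circ> insert j) (Pow S')
        = (\<Sum>B\<in>Pow S'. ?k (insert x (insert j B)) * ?m (S' - B))"
      proof (intro sum.cong refl)
        fix B assume "B \<in> Pow S'"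
        have "insert j S' - insert j B = S' - B" using fin by auto
        then show "((\<lambda>B. ?k (insert x B) * ?m (insert j S' - B)) \<circ> insert j) B
            = ?k (insert x (insert j B)) * ?m (S' - B)" by simp
      qed
    qed
    also have "(\<Sum>B\<in>Pow S'. ?k (insert x B) * ?m (insert j S' - B))
        = (\<Sum>B\<in>Pow S'. ?k (insert x B) * ?m (insert j (S' - B)))"
    proof (intro sum.cong refl)
      fix B assume "B \<in> Pow S'"
      then have "insert j S' - B = insert j (S' - B)" using fin by auto
      then show "?k (insert x B) * ?m (insert j S' - B) = ?k (insert x B) * ?m (insert j (S' - B))" by simp
    qed
    finally have 1: "?m (insert j S) = (\<Sum>B\<in>Pow S'. ?k (insert x B) * ?m (insert j (S' - B)))
        + (\<Sum>B\<in>Pow S'. ?k (insert x (insert j B)) * ?m (S' - B))" .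
    have 2: "?m S * ?m {j} = (\<Sum>B\<in>Pow S'. ?k (insert x B) * ?m (S' - B) * ?m {j})"
      unfolding S using rec[OF fin(1) S(2)] by (simp add: sum_distrib_right)
    have "?m (insert j S) - ?m S * ?m {j} = (\<Sum>B\<in>Pow S'. ?f B)"
      unfolding 1 2 by (simp add: sum.distrib sum_subtractf)
    also have "\<dots> = ?f S' + (\<Sum>B\<in>Pow S' - {S'}. ?f B)"
      using fin by (intro sum.remove) auto
    also have "?f S' = ?k (insert j S)" unfolding S by (simp add: m0 insert_commute)
    finally show ?thesis by simp
  qed
  ultimately show ?case by simp
qed

text \<open>The first derivative of the logarithm of the characteristic function is a mean under the
  complex weight \<open>cis (\<theta> t)\<close>. By \<open>cum_has_vector_derivative\<close> each
  further derivative adds one variable to the cumulant of these tilted moments. At 0 they are the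
  ordinary moments times powers of \<i>, which the prefactor in \<open>joint_cumulant\<close>
  removes.\<close>

theorem joint_cumulant_eq_cum:
  assumes "prob_space M" and mom: "\<And>X. X \<in> set Xs \<Longrightarrow> all_moments M X" and ne: "Xs \<noteq> []"
  shows "joint_cumulant M Xs = cum (\<lambda>B. LINT \<omega>|M. (\<Prod>j\<in>B. (Xs ! j) \<omega>)) {..<length Xs}"
proof -
  interpret prob_space M by fact
  define k where "k = length Xs"
  define \<theta> where "\<theta> = (\<lambda>t \<omega>. \<Sum>j<k. t j * (Xs ! j) \<omega>)"
  define Y where "Y = (\<lambda>B \<omega>. \<Prod>j\<in>B. \<i> * complex_of_real ((Xs ! j) \<omega>))"
  define \<Phi> where "\<Phi> = (\<lambda>B t. LINT \<omega>|M. Y B \<omega> * cis (\<theta> t \<omega>))"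
  \<comment> \<open>Moments under the weight \<open>cis (\<theta> t)\<close>, normalised. The empty
    set gets 1 by decree, so that this value is right even where \<open>\<Phi> {} t\<close>
    vanishes; the derivative lemma asks for it at every point.\<close>
  define m where "m = (\<lambda>t B. if B = {} then 1 else \<Phi> B t / \<Phi> {} t)"
  have momj: "all_moments M (Xs ! j)" if "j < k" for j using that mom by (simp add: k_def)
  then have meas: "Xs ! j \<in> borel_measurable M" if "j < k" for j
    using that by (simp add: all_moments_def)
  have \<theta>m: "\<theta> t \<in> borel_measurable M" for t
    unfolding \<theta>_def using meas by (intro borel_measurable_sum borel_measurable_times) auto
  have YB: "Y B \<omega> = \<i> ^ card B * complex_of_real (\<Prod>j\<in>B. (Xs ! j) \<omega>)" for B \<omega>
    by (simp add: Y_def prod.distrib)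
  have momB: "all_moments M (\<lambda>\<omega>. \<Prod>j\<in>B. (Xs ! j) \<omega>)" if "B \<subseteq> {..<k}" for B
    using that momj by (intro all_moments_prod) auto
  have Ym: "Y B \<in> borel_measurable M" if "B \<subseteq> {..<k}" for B
    unfolding YB[abs_def] using all_moments_measurable[OF momB[OF that]] by (auto simp del: of_real_prod)
  have \<Phi>_der: "((\<lambda>s. \<Phi> B (t(j := s))) has_vector_derivative \<Phi> (insert j B) (t(j := s0))) (at s0)"
    if B: "B \<subseteq> {..<k}" "j < k" "j \<notin> B" for B t j s0
  proof -
    have fB: "finite B" using B finite_subset by blast
    let ?x = "Xs ! j"
    define \<theta>0 where "\<theta>0 = \<theta> (t(j := 0))"
    have th: "\<theta> (t(j := s)) = (\<lambda>\<omega>. \<theta>0 \<omega> + s * ?x \<omega>)" for s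
    proof
      fix \<omega>
      have "(\<Sum>i\<in>{..<k} - {j}. (t(j := s)) i * (Xs ! i) \<omega>) = (\<Sum>i\<in>{..<k} - {j}. (t(j := 0)) i * (Xs ! i) \<omega>)"
        by (intro sum.cong) auto
      then show "\<theta> (t(j := s)) \<omega> = \<theta>0 \<omega> + s * ?x \<omega>"
        unfolding \<theta>0_def \<theta>_def using B by (simp add: sum.remove[of "{..<k}" j])
    qed
    have "((\<lambda>s. LINT \<omega>|M. Y B \<omega> * cis (\<theta>0 \<omega> + s * ?x \<omega>)) has_vector_derivative
       (LINT \<omega>|M. (\<i> * ?x \<omega> * Y B \<omega>) * cis (\<theta>0 \<omega> + s0 * ?x \<omega>))) (at s0)"
    proof (rule integral_cis_has_vector_derivative)
      show "integrable M (Y B)" unfolding YB[abs_def]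
        using all_moments_integrable[OF momB[OF B(1)]] by (auto simp del: of_real_prod)
      show "integrable M (\<lambda>\<omega>. Y B \<omega> * complex_of_real (?x \<omega>))" unfolding YB[abs_def]
        using all_moments_integrable[OF all_moments_mult[OF momB[OF B(1)] momj[OF B(2)]]]
        by (simp add: mult.assoc del: of_real_prod flip: of_real_mult)
      have "integrable M (\<lambda>\<omega>. \<bar>(\<Prod>j\<in>B. (Xs ! j) \<omega>) * ((?x \<omega>) * (?x \<omega>))\<bar> ^ 1)"
        using all_moments_mult[OF momB[OF B(1)] all_moments_mult[OF momj[OF B(2)] momj[OF B(2)]]]
        unfolding all_moments_def by blast
      then show "integrable M (\<lambda>\<omega>. cmod (Y B \<omega>) * (?x \<omega>)\<^sup>2)" unfolding YB[abs_def]
        by (simp add: norm_mult norm_power power2_eq_square abs_mult del: of_real_prod)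
    qed (use B Ym \<theta>m meas \<theta>0_def in auto)
    moreover have "\<i> * complex_of_real (?x \<omega>) * Y B \<omega> = Y (insert j B) \<omega>" for \<omega>
      unfolding Y_def using B fB by simp
    ultimately show ?thesis unfolding \<Phi>_def th by simp
  qed
  \<comment> \<open>Here \<open>Ln\<close> is differentiable and the normalisation is nonzero.
    Openness is established along coordinate lines (\<open>U_ev\<close>), the directions in which
    \<open>iter_pd\<close> differentiates.\<close>
  define U where "U = {t. 0 < Re (\<Phi> {} t)}"
  have U_ev: "\<forall>\<^sub>F s in nhds (t j). t(j := s) \<in> U" if "t \<in> U" "j < k" for t j
  proof -
    have "isCont (\<lambda>s. \<Phi> {} (t(j := s))) (t j)"
      using \<Phi>_der[of "{}" j t "t j"] that by (auto intro: has_vector_derivative_continuous)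
    then have "isCont (\<lambda>s. Re (\<Phi> {} (t(j := s)))) (t j)" unfolding isCont_def by (rule tendsto_Re)
    then have "((\<lambda>s. Re (\<Phi> {} (t(j := s)))) \<longlongrightarrow> Re (\<Phi> {} (t(j := t j)))) (nhds (t j))"
      unfolding continuous_at tendsto_nhds_iff by simp
    then show ?thesis using that by (auto simp: U_def dest: order_tendstoD(1)[where a = 0])
  qed
  have U_nz: "\<Phi> {} t \<noteq> 0" "\<Phi> {} t \<notin> \<real>\<^sub>\<le>\<^sub>0" if "t \<in> U" for t
    using that by (auto simp: U_def complex_nonpos_Reals_iff)
  have m_der: "((\<lambda>s. m (t(j := s)) B) has_vector_derivative m t (insert j B) - m t B * m t {j}) (at (t j))"
    if t: "t \<in> U" and B: "B \<subseteq> {..<k}" "j < k" "j \<notin> B" for t j B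
  proof (cases "B = {}")
    case True then show ?thesis by (simp add: m_def)
  next
    case False
    have "((\<lambda>s. \<Phi> B (t(j := s)) / \<Phi> {} (t(j := s))) has_vector_derivative
       (\<Phi> (insert j B) t * \<Phi> {} t - \<Phi> B t * \<Phi> {j} t) / (\<Phi> {} t * \<Phi> {} t)) (at (t j))"
      using \<Phi>_der[OF B, of t "t j"] \<Phi>_der[of "{}" j t "t j"] B U_nz[OF t]
      unfolding has_vector_derivative_def
      by (auto intro!: derivative_eq_intros simp: field_simps scaleR_conv_of_real fun_eq_iff)
    then show ?thesis using False U_nz[OF t] by (simp add: m_def field_simps)
  qed
  have main: "iter_pd (\<lambda>t. Ln (joint_charfun M Xs t)) js t = cum (m t) (set js)"
    if "js \<noteq> []" "distinct js" "set js \<subseteq> {..<k}" "t \<in> U" for js t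
    using that
  proof (induction js arbitrary: t)
    case (Cons j js)
    have jcf: "joint_charfun M Xs t = \<Phi> {} t" for t
      by (simp add: joint_charfun_def \<Phi>_def Y_def \<theta>_def k_def)
    have j: "j < k" "j \<notin> set js" using Cons.prems by auto
    show ?case
    proof (cases "js = []")
      case True
      have "((\<lambda>s. Ln (\<Phi> {} (t(j := s)))) has_vector_derivative \<Phi> {j} t * inverse (\<Phi> {} t)) (at (t j))"
        using field_vector_diff_chain_at[OF \<Phi>_der[of "{}" j t "t j"], of Ln "inverse (\<Phi> {} t)"] j U_nz Cons.prems
        by (simp add: comp_def has_field_derivative_Ln)
      then have "vector_derivative (\<lambda>s. Ln (\<Phi> {} (t(j := s)))) (at (t j)) = m t {j}"
        by (simp add: vector_derivative_at m_def divide_inverse)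
      moreover have "cum (m t) {j} = m t {j}" by (rule cum_singleton)
      ultimately show ?thesis using True by (simp add: jcf)
    next
      case False
      \<comment> \<open>The induction hypothesis is available on \<open>U\<close> only, but a
        derivative at \<open>t j\<close> depends only on nearby values.\<close>
      have ev: "\<forall>\<^sub>F s in nhds (t j). iter_pd (\<lambda>t. Ln (joint_charfun M Xs t)) js (t(j := s))
          = cum (m (t(j := s))) (set js)"
        using U_ev[OF Cons.prems(4) j(1)] by eventually_elim (use Cons False in auto)
      have "((\<lambda>s. cum (m (t(j := s))) (set js)) has_vector_derivative cum (m (t(j := t j))) (insert j (set js))) (at (t j))"
      proof (rule cum_has_vector_derivative)
        fix B assume "B \<subseteq> set js"
        then show "((\<lambda>s. m (t(j := s)) B) has_vector_derivative
           m (t(j := t j)) (insert j B) - m (t(j := t j)) B * m (t(j := t j)) {j}) (at (t j))"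
          using m_der[of t B j] Cons.prems j by (auto simp: subset_iff)
      qed (use j False in \<open>auto simp: m_def\<close>)
      then have "((\<lambda>s. iter_pd (\<lambda>t. Ln (joint_charfun M Xs t)) js (t(j := s))) has_vector_derivative
          cum (m t) (insert j (set js))) (at (t j))"
        using ev eventually_nhds_x_imp_x[OF ev]
        by (subst has_vector_derivative_cong_ev[where g = "\<lambda>s. cum (m (t(j := s))) (set js)"])
          (auto elim: eventually_mono)
      then show ?thesis by (simp add: vector_derivative_at)
    qed
  qed simp
  have zero: "\<Phi> {} (\<lambda>_. 0) = 1" by (simp add: \<Phi>_def Y_def \<theta>_def prob_space)
  let ?m = "\<lambda>B. LINT \<omega>|M. (\<Prod>j\<in>B. (Xs ! j) \<omega>)"
  have m_zero: "m (\<lambda>_. 0) B = \<i> ^ card B * complex_of_real (?m B)" if "B \<subseteq> {..<k}" for B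
  proof -
    have "\<Phi> B (\<lambda>_. 0) = \<i> ^ card B * complex_of_real (?m B)"
      by (simp add: \<Phi>_def \<theta>_def YB del: of_real_prod)
    then show ?thesis using zero by (auto simp: m_def prob_space)
  qed
  have "iter_pd (\<lambda>t. Ln (joint_charfun M Xs t)) [0..<k] (\<lambda>_. 0) = cum (m (\<lambda>_. 0)) {..<k}"
    using main[of "[0..<k]" "\<lambda>_. 0"] ne zero by (auto simp: k_def U_def atLeast0LessThan)
  also have "\<dots> = cum (\<lambda>B. \<i> ^ card B * complex_of_real (?m B)) {..<k}"
    using ne m_zero by (intro cum_cong) (auto simp: k_def)
  also have "\<dots> = \<i> ^ k * of_real (cum ?m {..<k})"
    using ne cum_of_real[of "{..<k}" ?m] cum_scale[of "{..<k}" \<i> "\<lambda>B. complex_of_real (?m B)"]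
    by (simp add: k_def lessThan_empty_iff)
  finally have "inverse (\<i> ^ k) * iter_pd (\<lambda>t. Ln (joint_charfun M Xs t)) [0..<k] (\<lambda>_. 0)
      = complex_of_real (cum ?m {..<k})"
    by (simp flip: mult.assoc)
  then show ?thesis by (simp add: joint_cumulant_def k_def)
qed

section \<open>Summation along networks of blocks\<close>

lemma prod_le_prod_subset:
  fixes f :: "'a \<Rightarrow> real"
  assumes "finite A'" "A \<subseteq> A'" "\<And>x. x \<in> A' \<Longrightarrow> 0 \<le> f x \<and> f x \<le> 1"
  shows "prod f A' \<le> prod f A"
proof -
  have "prod f A' = prod f (A' - A) * prod f A" using assms by (intro prod.subset_diff) auto
  also have "\<dots> \<le> 1 * prod f A"
    using assms by (intro mult_right_mono prod_le_1 prod_nonneg) auto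
  finally show ?thesis by simp
qed

lemma sum_PiE_Un:
  assumes "finite A" "finite B" "A \<inter> B = {}" "finite S"
  shows "(\<Sum>\<sigma>\<in>PiE (A \<union> B) (\<lambda>_. S). f \<sigma>)
    = (\<Sum>\<sigma>\<in>PiE A (\<lambda>_. S). \<Sum>\<tau>\<in>PiE B (\<lambda>_. S). f (\<lambda>x. if x \<in> B then \<tau> x else \<sigma> x))"
proof -
  have "(\<Sum>\<sigma>\<in>PiE (A \<union> B) (\<lambda>_. S). f \<sigma>)
     = (\<Sum>(\<sigma>,\<tau>)\<in>PiE A (\<lambda>_. S) \<times> PiE B (\<lambda>_. S). f (\<lambda>x. if x \<in> B then \<tau> x else \<sigma> x))"
  proof (rule sum.reindex_bij_witness[of _ "\<lambda>(\<sigma>,\<tau>) x. if x \<in> B then \<tau> x else \<sigma> x"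
        "\<lambda>\<sigma>. (restrict \<sigma> A, restrict \<sigma> B)"])
    fix \<sigma> assume "\<sigma> \<in> PiE (A \<union> B) (\<lambda>_. S)"
    then have \<sigma>: "\<And>x. x \<notin> A \<union> B \<Longrightarrow> \<sigma> x = undefined" "\<And>x. x \<in> A \<union> B \<Longrightarrow> \<sigma> x \<in> S"
      by (auto simp: PiE_def extensional_def)
    have eq: "(\<lambda>x. if x \<in> B then restrict \<sigma> B x else restrict \<sigma> A x) = \<sigma>"
      using \<sigma> by (auto simp: fun_eq_iff restrict_def)
    show "(case (restrict \<sigma> A, restrict \<sigma> B) of (\<sigma>, \<tau>) \<Rightarrow> \<lambda>x. if x \<in> B then \<tau> x else \<sigma> x) = \<sigma>"
      using eq by simp
    show "(case (restrict \<sigma> A, restrict \<sigma> B) of (\<sigma>, \<tau>) \<Rightarrow> f (\<lambda>x. if x \<in> B then \<tau> x else \<sigma> x)) = f \<sigma>"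
      using eq by simp
    show "(restrict \<sigma> A, restrict \<sigma> B) \<in> PiE A (\<lambda>_. S) \<times> PiE B (\<lambda>_. S)"
      using \<sigma> by auto
  next
    fix z assume "z \<in> PiE A (\<lambda>_. S) \<times> PiE B (\<lambda>_. S)"
    then obtain \<sigma> \<tau> where z: "z = (\<sigma>,\<tau>)" "\<sigma> \<in> PiE A (\<lambda>_. S)" "\<tau> \<in> PiE B (\<lambda>_. S)" by auto
    have e: "x \<notin> A \<Longrightarrow> \<sigma> x = undefined" "x \<notin> B \<Longrightarrow> \<tau> x = undefined" for x
      using z by (auto simp: PiE_def extensional_def)
    have "restrict (\<lambda>x. if x \<in> B then \<tau> x else \<sigma> x) A = \<sigma>"
      using assms(3) e by (auto simp: fun_eq_iff restrict_def)
    moreover have "restrict (\<lambda>x. if x \<in> B then \<tau> x else \<sigma> x) B = \<tau>"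
      using e by (auto simp: fun_eq_iff restrict_def)
    ultimately show "(restrict ((case z of (\<sigma>, \<tau>) \<Rightarrow> \<lambda>x. if x \<in> B then \<tau> x else \<sigma> x)) A,
        restrict (case z of (\<sigma>, \<tau>) \<Rightarrow> \<lambda>x. if x \<in> B then \<tau> x else \<sigma> x) B) = z"
      using z by simp
    show "(case z of (\<sigma>, \<tau>) \<Rightarrow> \<lambda>x. if x \<in> B then \<tau> x else \<sigma> x) \<in> PiE (A \<union> B) (\<lambda>_. S)"
      using z by (auto simp: PiE_def extensional_def Pi_def)
  qed
  also have "\<dots> = (\<Sum>\<sigma>\<in>PiE A (\<lambda>_. S). \<Sum>\<tau>\<in>PiE B (\<lambda>_. S). f (\<lambda>x. if x \<in> B then \<tau> x else \<sigma> x))"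
    by (rule sum.cartesian_product[symmetric])
  finally show ?thesis .
qed

text \<open>The points of \<open>H\<close> carry states from \<open>S\<close>; \<open>\<kappa>\<close> ties the states of each block of the
  partition \<open>P\<close> together, and a link allows at most \<open>N\<close> states at one end given the state at the other.
  Hence summing over the states of one more block costs a factor \<open>K * N\<close> if a link leads to it.\<close>
locale network =
  fixes H :: "'h set" and P :: "'h set set" and S :: "'s set"
    and \<kappa> :: "'h set \<Rightarrow> ('h \<Rightarrow> 's) \<Rightarrow> real" and w :: "'h \<Rightarrow> 'h \<Rightarrow> 's \<Rightarrow> 's \<Rightarrow> real"
    and L :: "('h \<times> 'h) set" and K N :: real
  assumes finite_H: "finite H" and partition: "partition_on H P" and finite_S: "finite S"
    and kappa_nonneg: "B \<in> P \<Longrightarrow> \<kappa> B \<sigma> \<ge> 0"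
    and kappa_local: "B \<in> P \<Longrightarrow> (\<And>h. h \<in> B \<Longrightarrow> \<sigma> h = \<sigma>' h) \<Longrightarrow> \<kappa> B \<sigma> = \<kappa> B \<sigma>'"
    and kappa_sum: "B \<in> P \<Longrightarrow> h \<in> B \<Longrightarrow> s \<in> S \<Longrightarrow>
        (\<Sum>\<sigma>\<in>{\<sigma>\<in>PiE B (\<lambda>_. S). \<sigma> h = s}. \<kappa> B \<sigma>) \<le> K"
    and L_H: "L \<subseteq> H \<times> H" and L_sym: "(g,h) \<in> L \<Longrightarrow> (h,g) \<in> L"
    and w_range: "(g,h) \<in> L \<Longrightarrow> s \<in> S \<Longrightarrow> t \<in> S \<Longrightarrow> 0 \<le> w g h s t \<and> w g h s t \<le> 1"
    and w_row: "(g,h) \<in> L \<Longrightarrow> g \<noteq> h \<Longrightarrow> s \<in> S \<Longrightarrow> (\<Sum>t\<in>S. w g h s t * w h g t s) \<le> N"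
    and K_nonneg: "K \<ge> 0" and N_nonneg: "N \<ge> 0"
begin

lemma prod_links_cong:
  assumes "A \<inter> B = {}"
  shows "(\<Prod>(g,h)\<in>L \<inter> (A \<times> A). w g h (if g \<in> B then \<tau> g else \<sigma> g) (if h \<in> B then \<tau> h else \<sigma> h))
    = (\<Prod>(g,h)\<in>L \<inter> (A \<times> A). w g h (\<sigma> g) (\<sigma> h))"
proof (intro prod.cong refl)
  fix z assume "z \<in> L \<inter> (A \<times> A)"
  then have "fst z \<notin> B" "snd z \<notin> B" using assms by auto
  then show "(case z of (g,h) \<Rightarrow> w g h (if g \<in> B then \<tau> g else \<sigma> g) (if h \<in> B then \<tau> h else \<sigma> h))
    = (case z of (g,h) \<Rightarrow> w g h (\<sigma> g) (\<sigma> h))" by (simp add: case_prod_beta)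
qed

definition weight :: "'h set set \<Rightarrow> ('h \<Rightarrow> 's) \<Rightarrow> real" where
  "weight U \<sigma> = (\<Prod>B\<in>U. \<kappa> B \<sigma>) * (\<Prod>(g,h)\<in>L \<inter> (\<Union>U \<times> \<Union>U). w g h (\<sigma> g) (\<sigma> h))"

definition total :: "'h set set \<Rightarrow> real" where
  "total U = (\<Sum>\<sigma>\<in>PiE (\<Union>U) (\<lambda>_. S). weight U \<sigma>)"

text \<open>In the graph whose vertices are the blocks and whose edges come from links, these are
  the unions of connected components.\<close>

definition closed :: "'h set set \<Rightarrow> bool" where
  "closed U \<longleftrightarrow> (\<forall>(g,h)\<in>L. g \<in> \<Union>U \<longrightarrow> h \<in> \<Union>U)"

lemma finite_L: "finite L"
  using L_H finite_H by (meson finite_SigmaI finite_subset)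

lemma finite_P: "finite P"
  using finite_elements[OF finite_H partition] .

lemma Union_subset: "U \<subseteq> P \<Longrightarrow> \<Union>U \<subseteq> H"
  using partition by (auto simp: partition_on_def)

lemma finite_Union: "U \<subseteq> P \<Longrightarrow> finite (\<Union>U)"
  by (rule finite_subset[OF Union_subset finite_H])

lemma block_disjoint: "U \<subseteq> P \<Longrightarrow> B \<in> P \<Longrightarrow> B \<notin> U \<Longrightarrow> \<Union>U \<inter> B = {}"
proof -
  assume a: "U \<subseteq> P" "B \<in> P" "B \<notin> U"
  have "C \<inter> B = {}" if "C \<in> U" for C
    using partition a that unfolding partition_on_def disjnt_def[symmetric] by (metis pairwiseD subsetD)
  then show ?thesis by auto
qed

lemma combined_range:
  assumes "\<sigma> \<in> PiE A (\<lambda>_. S)" "\<tau> \<in> PiE B (\<lambda>_. S)" "(g,h) \<in> L" "g \<in> A \<union> B" "h \<in> A \<union> B"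
  shows "0 \<le> w g h (if g \<in> B then \<tau> g else \<sigma> g) (if h \<in> B then \<tau> h else \<sigma> h) \<and>
         w g h (if g \<in> B then \<tau> g else \<sigma> g) (if h \<in> B then \<tau> h else \<sigma> h) \<le> 1"
proof -
  have "(if x \<in> B then \<tau> x else \<sigma> x) \<in> S" if "x \<in> A \<union> B" for x
    using that assms by (auto simp: PiE_def Pi_def)
  then show ?thesis using w_range[OF assms(3)] assms(4,5) by blast
qed

lemma links_nonneg:
  assumes "\<And>x. x \<in> V \<Longrightarrow> \<sigma> x \<in> S"
  shows "0 \<le> (\<Prod>(g,h)\<in>L \<inter> (V \<times> V). w g h (\<sigma> g) (\<sigma> h))"
  using assms w_range by (intro prod_nonneg) auto

lemma weight_nonneg:
  assumes "U \<subseteq> P" "\<sigma> \<in> PiE (\<Union>U) (\<lambda>_. S)"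
  shows "0 \<le> weight U \<sigma>"
  unfolding weight_def using assms kappa_nonneg
  by (intro mult_nonneg_nonneg links_nonneg prod_nonneg) auto

lemma total_empty: "total {} = 1"
  by (simp add: total_def weight_def)

text \<open>The assignments on the new block are grouped by the state at its point \<open>h\<close>.
  Given that state the block costs \<open>K\<close> by \<open>kappa_sum\<close>; then
  \<open>v\<close>, a bound for the new link factors, is summed over the state and costs \<rho>.
  Taking \<open>v\<close> as 1 or as the product along one link gives the next two lemmas.\<close>

lemma total_insert_le:
  assumes U: "U \<subseteq> P" "B \<in> P" "B \<notin> U" and h: "h \<in> B"
    and v0: "\<And>\<sigma> t. \<sigma> \<in> PiE (\<Union>U) (\<lambda>_. S) \<Longrightarrow> t \<in> S \<Longrightarrow> 0 \<le> v \<sigma> t"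
    and row: "\<And>\<sigma>. \<sigma> \<in> PiE (\<Union>U) (\<lambda>_. S) \<Longrightarrow> (\<Sum>t\<in>S. v \<sigma> t) \<le> \<rho>"
    and links: "\<And>\<sigma> \<tau>. \<sigma> \<in> PiE (\<Union>U) (\<lambda>_. S) \<Longrightarrow> \<tau> \<in> PiE B (\<lambda>_. S) \<Longrightarrow>
       (\<Prod>(g,h)\<in>L \<inter> ((\<Union>U \<union> B) \<times> (\<Union>U \<union> B)). w g h (if g \<in> B then \<tau> g else \<sigma> g) (if h \<in> B then \<tau> h else \<sigma> h))
        \<le> (\<Prod>(g,h)\<in>L \<inter> (\<Union>U \<times> \<Union>U). w g h (\<sigma> g) (\<sigma> h)) * v \<sigma> (\<tau> h)"
  shows "total (insert B U) \<le> total U * (K * \<rho>)"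
proof -
  have disj: "\<Union>U \<inter> B = {}" using block_disjoint U by blast
  have fin: "finite (\<Union>U)" "finite B" "finite U"
    using finite_Union[OF U(1)] U finite_Union[of "{B}"] finite_P finite_subset by auto
  have step: "(\<Sum>\<tau>\<in>PiE B (\<lambda>_. S). weight (insert B U) (\<lambda>x. if x \<in> B then \<tau> x else \<sigma> x))
      \<le> weight U \<sigma> * (K * \<rho>)" if \<sigma>: "\<sigma> \<in> PiE (\<Union>U) (\<lambda>_. S)" for \<sigma>
  proof -
    have "(\<Sum>\<tau>\<in>PiE B (\<lambda>_. S). weight (insert B U) (\<lambda>x. if x \<in> B then \<tau> x else \<sigma> x))
       \<le> (\<Sum>\<tau>\<in>PiE B (\<lambda>_. S). weight U \<sigma> * (\<kappa> B \<tau> * v \<sigma> (\<tau> h)))"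
    proof (rule sum_mono)
      fix \<tau> assume \<tau>: "\<tau> \<in> PiE B (\<lambda>_. S)"
      let ?c = "\<lambda>x. if x \<in> B then \<tau> x else \<sigma> x"
      have 1: "(\<Prod>C\<in>insert B U. \<kappa> C ?c) = \<kappa> B \<tau> * (\<Prod>C\<in>U. \<kappa> C \<sigma>)"
      proof -
        have "\<kappa> B ?c = \<kappa> B \<tau>" using U by (intro kappa_local) auto
        moreover have "(\<Prod>C\<in>U. \<kappa> C ?c) = (\<Prod>C\<in>U. \<kappa> C \<sigma>)"
          using U disj by (intro prod.cong refl kappa_local) auto
        ultimately show ?thesis using fin U by simp
      qed
      have UB: "\<Union>(insert B U) = \<Union>U \<union> B" by auto
      have "weight (insert B U) ?c \<le> (\<kappa> B \<tau> * (\<Prod>C\<in>U. \<kappa> C \<sigma>)) *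
          ((\<Prod>(g,h)\<in>L \<inter> (\<Union>U \<times> \<Union>U). w g h (\<sigma> g) (\<sigma> h)) * v \<sigma> (\<tau> h))"
        unfolding weight_def 1 UB using links[OF \<sigma> \<tau>] kappa_nonneg U
        by (intro mult_left_mono mult_nonneg_nonneg prod_nonneg) auto
      then show "weight (insert B U) ?c \<le> weight U \<sigma> * (\<kappa> B \<tau> * v \<sigma> (\<tau> h))"
        by (simp add: weight_def mult_ac)
    qed
    also have "\<dots> = weight U \<sigma> * (\<Sum>\<tau>\<in>PiE B (\<lambda>_. S). \<kappa> B \<tau> * v \<sigma> (\<tau> h))"
      by (simp add: sum_distrib_left)
    also have "(\<Sum>\<tau>\<in>PiE B (\<lambda>_. S). \<kappa> B \<tau> * v \<sigma> (\<tau> h))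
        = (\<Sum>t\<in>S. \<Sum>\<tau>\<in>{\<tau>\<in>PiE B (\<lambda>_. S). \<tau> h = t}. \<kappa> B \<tau> * v \<sigma> (\<tau> h))"
      using fin h finite_S by (intro sum.group[symmetric] finite_PiE) auto
    also have "\<dots> = (\<Sum>t\<in>S. v \<sigma> t * (\<Sum>\<tau>\<in>{\<tau>\<in>PiE B (\<lambda>_. S). \<tau> h = t}. \<kappa> B \<tau>))"
      by (auto simp: sum_distrib_left intro!: sum.cong)
    also have "\<dots> \<le> (\<Sum>t\<in>S. v \<sigma> t * K)"
      using U h v0[OF \<sigma>] by (intro sum_mono mult_left_mono kappa_sum) auto
    also have "\<dots> \<le> K * \<rho>"
      using mult_left_mono[OF row[OF \<sigma>] K_nonneg] by (simp add: sum_distrib_left mult.commute)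
    finally show ?thesis using weight_nonneg[OF U(1) \<sigma>] by (simp add: mult_left_mono)
  qed
  have UB: "\<Union>(insert B U) = \<Union>U \<union> B" by auto
  have "total (insert B U) = (\<Sum>\<sigma>\<in>PiE (\<Union>U) (\<lambda>_. S). \<Sum>\<tau>\<in>PiE B (\<lambda>_. S).
      weight (insert B U) (\<lambda>x. if x \<in> B then \<tau> x else \<sigma> x))"
    unfolding total_def UB using fin disj finite_S by (intro sum_PiE_Un) auto
  also have "\<dots> \<le> (\<Sum>\<sigma>\<in>PiE (\<Union>U) (\<lambda>_. S). weight U \<sigma> * (K * \<rho>))"
    by (intro sum_mono step)
  also have "\<dots> = total U * (K * \<rho>)" by (simp add: total_def sum_distrib_right)
  finally show ?thesis .
qed

lemma total_insert_start:
  assumes U: "U \<subseteq> P" "B \<in> P" "B \<notin> U"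
  shows "total (insert B U) \<le> total U * (K * card S)"
proof -
  obtain h where h: "h \<in> B" using U partition_on_memD[OF partition] by blast
  show ?thesis
  proof (rule total_insert_le[OF U h, where v = "\<lambda>_ _. 1"])
    fix \<sigma> \<tau> assume \<sigma>: "\<sigma> \<in> PiE (\<Union>U) (\<lambda>_. S)" and \<tau>: "\<tau> \<in> PiE B (\<lambda>_. S)"
    let ?c = "\<lambda>x. if x \<in> B then \<tau> x else \<sigma> x"
    have "(\<Prod>(g,h)\<in>L \<inter> ((\<Union>U \<union> B) \<times> (\<Union>U \<union> B)). w g h (?c g) (?c h))
        \<le> (\<Prod>(g,h)\<in>L \<inter> (\<Union>U \<times> \<Union>U). w g h (?c g) (?c h))"
    proof (rule prod_le_prod_subset)
      fix z assume "z \<in> L \<inter> ((\<Union>U \<union> B) \<times> (\<Union>U \<union> B))"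
      then show "0 \<le> (case z of (g,h) \<Rightarrow> w g h (?c g) (?c h)) \<and> (case z of (g,h) \<Rightarrow> w g h (?c g) (?c h)) \<le> 1"
        using combined_range[OF \<sigma> \<tau>, of "fst z" "snd z"] unfolding case_prod_beta
        by (metis IntD1 IntD2 mem_Sigma_iff prod.collapse)
    qed (use finite_L in auto)
    also have "\<dots> = (\<Prod>(g,h)\<in>L \<inter> (\<Union>U \<times> \<Union>U). w g h (\<sigma> g) (\<sigma> h))"
      by (rule prod_links_cong[OF block_disjoint[OF U]])
    finally show "(\<Prod>(g,h)\<in>L \<inter> ((\<Union>U \<union> B) \<times> (\<Union>U \<union> B)). w g h (?c g) (?c h))
        \<le> (\<Prod>(g,h)\<in>L \<inter> (\<Union>U \<times> \<Union>U). w g h (\<sigma> g) (\<sigma> h)) * 1" by simp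
  qed auto
qed

text \<open>Of the links created by the new block only \<open>(g,h)\<close> and its reverse are
  kept; the others are bounded by 1.\<close>

lemma total_insert_link:
  assumes U: "U \<subseteq> P" "B \<in> P" "B \<notin> U" and gh: "(g,h) \<in> L" "g \<in> \<Union>U" "h \<in> B"
    and row: "\<And>s. s \<in> S \<Longrightarrow> (\<Sum>t\<in>S. w g h s t * w h g t s) \<le> \<rho>"
  shows "total (insert B U) \<le> total U * (K * \<rho>)"
proof (rule total_insert_le[OF U gh(3), where v = "\<lambda>\<sigma> t. w g h (\<sigma> g) t * w h g t (\<sigma> g)"])
  note disj = block_disjoint[OF U]
  fix \<sigma> assume \<sigma>: "\<sigma> \<in> PiE (\<Union>U) (\<lambda>_. S)"
  then have g: "\<sigma> g \<in> S" using gh by (auto simp: PiE_def)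
  show "(\<Sum>t\<in>S. w g h (\<sigma> g) t * w h g t (\<sigma> g)) \<le> \<rho>" by (rule row[OF g])
  show "0 \<le> w g h (\<sigma> g) t * w h g t (\<sigma> g)" if "t \<in> S" for t
    using w_range L_sym gh g that by (intro mult_nonneg_nonneg) auto
  fix \<tau> assume \<tau>: "\<tau> \<in> PiE B (\<lambda>_. S)"
  let ?c = "\<lambda>x. if x \<in> B then \<tau> x else \<sigma> x"
  let ?f = "\<lambda>(g,h). w g h (?c g) (?c h)"
  have gB: "g \<notin> B" and hU: "h \<notin> \<Union>U" "h \<in> B" "g \<noteq> h" using disj gh by auto
  have "prod ?f (L \<inter> ((\<Union>U \<union> B) \<times> (\<Union>U \<union> B)))
      \<le> prod ?f (insert (g,h) (insert (h,g) (L \<inter> (\<Union>U \<times> \<Union>U))))"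
  proof (rule prod_le_prod_subset)
    fix z assume "z \<in> L \<inter> ((\<Union>U \<union> B) \<times> (\<Union>U \<union> B))"
    then show "0 \<le> ?f z \<and> ?f z \<le> 1"
      using combined_range[OF \<sigma> \<tau>, of "fst z" "snd z"] unfolding case_prod_beta
      by (metis IntD1 IntD2 mem_Sigma_iff prod.collapse)
  qed (use finite_L gh L_sym[OF gh(1)] in auto)
  also have "\<dots> = ?f (g,h) * (?f (h,g) * prod ?f (L \<inter> (\<Union>U \<times> \<Union>U)))"
    using finite_L hU by (subst prod.insert, simp, force, subst prod.insert, simp, force) auto
  also have "prod ?f (L \<inter> (\<Union>U \<times> \<Union>U)) = (\<Prod>(g,h)\<in>L \<inter> (\<Union>U \<times> \<Union>U). w g h (\<sigma> g) (\<sigma> h))"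
    by (rule prod_links_cong[OF disj])
  finally show "prod ?f (L \<inter> ((\<Union>U \<union> B) \<times> (\<Union>U \<union> B)))
      \<le> (\<Prod>(g,h)\<in>L \<inter> (\<Union>U \<times> \<Union>U). w g h (\<sigma> g) (\<sigma> h)) * (w g h (\<sigma> g) (\<tau> h) * w h g (\<tau> h) (\<sigma> g))"
    using gB hU by (simp add: mult_ac)
qed

text \<open>Exploration: while the family is not closed, some link leads to a new block, and adding
  that block costs \<open>K * N\<close>.\<close>

lemma grow_closed:
  assumes "U \<subseteq> P"
  shows "\<exists>U'. U \<subseteq> U' \<and> U' \<subseteq> P \<and> closed U' \<and> total U' \<le> total U * (K * N) ^ (card U' - card U)"
  using assms
proof (induction "card (P - U)" arbitrary: U rule: less_induct)
  case less
  show ?case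
  proof (cases "closed U")
    case True
    then show ?thesis using less by (intro exI[of _ U]) auto
  next
    case False
    then obtain g h where gh: "(g,h) \<in> L" "g \<in> \<Union>U" "h \<notin> \<Union>U" by (auto simp: closed_def)
    then have "h \<in> H" using L_H by auto
    then obtain B where B: "B \<in> P" "h \<in> B" using partition by (auto simp: partition_on_def)
    have BU: "B \<notin> U" using B gh by auto
    have neq: "g \<noteq> h" using gh by auto
    have 1: "total (insert B U) \<le> total U * (K * N)"
      by (rule total_insert_link[OF less.prems B(1) BU gh(1,2) B(2)]) (rule w_row[OF gh(1) neq])
    have "card (P - insert B U) < card (P - U)"
      using finite_P B BU by (intro psubset_card_mono) auto
    then obtain U' where U': "insert B U \<subseteq> U'" "U' \<subseteq> P" "closed U'"
      "total U' \<le> total (insert B U) * (K * N) ^ (card U' - card (insert B U))"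
      using less.hyps[of "insert B U"] less.prems B by auto
    have fU: "finite U" "finite U'" using finite_P less.prems U' finite_subset by auto
    have "card (insert B U) \<le> card U'" using U' fU by (intro card_mono) auto
    then have c: "card U' - card U = Suc (card U' - card (insert B U))" using fU BU by simp
    have "total U' \<le> (total U * (K * N)) * (K * N) ^ (card U' - card (insert B U))"
      using U'(4) 1 K_nonneg N_nonneg by (meson mult_nonneg_nonneg mult_right_mono order_trans zero_le_power)
    then show ?thesis using U' c by (intro exI[of _ U']) (auto simp: mult.assoc)
  qed
qed

lemma total_le_connected:
  assumes conn: "\<And>U. U \<subseteq> P \<Longrightarrow> U \<noteq> {} \<Longrightarrow> closed U \<Longrightarrow> U = P"
    and U: "U \<subseteq> P" "U \<noteq> {}"
  shows "total P \<le> total U * (K * N) ^ (card P - card U)"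
  using grow_closed[OF U(1)] conn U by (metis subset_empty)

lemma total_le:
  assumes conn: "\<And>U. U \<subseteq> P \<Longrightarrow> U \<noteq> {} \<Longrightarrow> closed U \<Longrightarrow> U = P" and "P \<noteq> {}"
  shows "total P \<le> (K * card S) * (K * N) ^ (card P - 1)"
proof -
  obtain B where B: "B \<in> P" using assms by auto
  have "total P \<le> total {B} * (K * N) ^ (card P - card {B})"
    using B by (intro total_le_connected conn) auto
  also have "\<dots> \<le> (K * card S) * (K * N) ^ (card P - 1)"
    using total_insert_start[of "{}" B] B K_nonneg N_nonneg by (simp add: total_empty mult_right_mono)
  finally show ?thesis .
qed

text \<open>The exploration starts at the block of \<open>g\<close> and crosses the link to
  \<open>h\<close> first, so that the row sum \<rho> of this link replaces one factor
  \<open>N\<close>.\<close>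

lemma total_le_cheap_link:
  assumes conn: "\<And>U. U \<subseteq> P \<Longrightarrow> U \<noteq> {} \<Longrightarrow> closed U \<Longrightarrow> U = P"
    and gh: "(g,h) \<in> L" "\<And>B. B \<in> P \<Longrightarrow> g \<in> B \<Longrightarrow> h \<notin> B"
    and row: "\<And>s. s \<in> S \<Longrightarrow> (\<Sum>t\<in>S. w g h s t * w h g t s) \<le> \<rho>" and \<rho>: "\<rho> \<ge> 0"
  shows "total P \<le> (K * card S) * (K * \<rho>) * (K * N) ^ (card P - 2)"
proof -
  have "g \<in> H" "h \<in> H" using gh L_H by auto
  then obtain A B where AB: "A \<in> P" "g \<in> A" "B \<in> P" "h \<in> B" using partition by (auto simp: partition_on_def)
  then have "A \<noteq> B" using gh by auto
  have "total {B, A} \<le> total {A} * (K * \<rho>)"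
    using AB \<open>A \<noteq> B\<close> gh row by (intro total_insert_link[of "{A}" B g h]) auto
  also have "\<dots> \<le> (K * card S) * (K * \<rho>)"
    using total_insert_start[of "{}" A] AB K_nonneg \<rho> by (simp add: total_empty mult_right_mono)
  finally have "total {B, A} \<le> (K * card S) * (K * \<rho>)" .
  moreover have "total P \<le> total {B, A} * (K * N) ^ (card P - card {B, A})"
    using AB by (intro total_le_connected conn) auto
  moreover have "card {B, A} = 2" using \<open>A \<noteq> B\<close> by auto
  ultimately show ?thesis
    using K_nonneg N_nonneg by (smt (verit) mult_nonneg_nonneg mult_right_mono zero_le_power)
qed

end

section \<open>Parity, and the weights of band links and path links\<close>

lemma even_card_involution:
  assumes "finite A" "\<And>a. a \<in> A \<Longrightarrow> f a \<in> A \<and> f (f a) = a \<and> f a \<noteq> a"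
  shows "even (card A)"
  using assms
proof (induction "card A" arbitrary: A rule: less_induct)
  case less
  show ?case
  proof (cases "A = {}")
    case False
    then obtain a where a: "a \<in> A" by auto
    let ?B = "A - {a, f a}"
    have fa: "f a \<in> A" "f a \<noteq> a" using less.prems a by auto
    have c: "card A = Suc (Suc (card ?B))"
    proof -
      have "card {a, f a} = 2" using fa by auto
      moreover have "card {a, f a} \<le> card A" using a fa less.prems(1) by (intro card_mono) auto
      ultimately show ?thesis using a fa by (simp add: card_Diff_subset)
    qed
    have "even (card ?B)"
    proof (rule less.hyps)
      fix b assume b: "b \<in> ?B"
      have "f b \<noteq> a" "f b \<noteq> f a" using b less.prems(2) a by (metis DiffE insertCI)+
      then show "f b \<in> ?B \<and> f (f b) = b \<and> f b \<noteq> b" using b less.prems(2) by auto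
    qed (use c less.prems in auto)
    then show ?thesis using c by simp
  qed simp
qed

lemma sum_PiE_insert:
  assumes "finite A" "x \<notin> A" "finite S"
  shows "(\<Sum>\<sigma>\<in>PiE (insert x A) (\<lambda>_. S). f \<sigma>) = (\<Sum>\<sigma>\<in>PiE A (\<lambda>_. S). \<Sum>s\<in>S. f (\<sigma>(x := s)))"
proof -
  have "(\<Sum>\<sigma>\<in>PiE (insert x A) (\<lambda>_. S). f \<sigma>) = (\<Sum>(s,\<sigma>)\<in>S \<times> PiE A (\<lambda>_. S). f (\<sigma>(x := s)))"
    unfolding PiE_insert_eq using inj_combinator[OF assms(2), of "\<lambda>_. S"]
    by (subst sum.reindex) (auto simp: case_prod_beta comp_def)
  also have "\<dots> = (\<Sum>s\<in>S. \<Sum>\<sigma>\<in>PiE A (\<lambda>_. S). f (\<sigma>(x := s)))"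
    by (rule sum.cartesian_product[symmetric])
  finally show ?thesis by (subst sum.swap)
qed

text \<open>A state is a pair (column, row) of the data matrix. The weight combines the band
  condition on columns with the equality of rows that the product of \<open>X\<close> with its
  transpose imposes on the two ends of a noise factor.\<close>

definition band_weight :: "real \<Rightarrow> nat \<times> nat \<Rightarrow> nat \<times> nat \<Rightarrow> real" where
  "band_weight b s t = (if \<bar>real (fst s) - real (fst t)\<bar> \<le> b \<and> snd s = snd t then 1 else 0)"

text \<open>A link occurs in both orientations, hence the square root: the two orientations together
  give \<open>q\<close> of the column difference. Rows are left free.\<close>

definition half_weight :: "(int \<Rightarrow> real) \<Rightarrow> nat \<times> nat \<Rightarrow> nat \<times> nat \<Rightarrow> real" where
  "half_weight q s t = sqrt (q (int (fst s) - int (fst t)))"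

lemma sum_shift_le:
  fixes q :: "int \<Rightarrow> real" and A :: "nat set"
  assumes "\<And>F. finite F \<Longrightarrow> sum q F \<le> c" "finite A"
  shows "(\<Sum>v\<in>A. q (int u - int v)) \<le> c" "(\<Sum>v\<in>A. q (int v - int u)) \<le> c"
proof -
  have "(\<Sum>v\<in>A. q (int u - int v)) = sum q ((\<lambda>v. int u - int v) ` A)"
    by (subst sum.reindex) (auto simp: inj_on_def)
  then show "(\<Sum>v\<in>A. q (int u - int v)) \<le> c" using assms by simp
  have "(\<Sum>v\<in>A. q (int v - int u)) = sum q ((\<lambda>v. int v - int u) ` A)"
    by (subst sum.reindex) (auto simp: inj_on_def)
  then show "(\<Sum>v\<in>A. q (int v - int u)) \<le> c" using assms by simp
qed

lemma card_band_le:
  assumes "b \<ge> 0"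
  shows "real (card {j\<in>{1..p}. \<bar>real i - real j\<bar> \<le> b}) \<le> 2 * b + 1"
proof -
  have "int ` {j\<in>{1..p}. \<bar>real i - real j\<bar> \<le> b} \<subseteq> {int i - \<lfloor>b\<rfloor>..int i + \<lfloor>b\<rfloor>}"
  proof
    fix z assume "z \<in> int ` {j\<in>{1..p}. \<bar>real i - real j\<bar> \<le> b}"
    then obtain j where j: "z = int j" "\<bar>real i - real j\<bar> \<le> b" by auto
    then have "\<bar>int i - int j\<bar> \<le> \<lfloor>b\<rfloor>" by (simp add: le_floor_iff)
    then show "z \<in> {int i - \<lfloor>b\<rfloor>..int i + \<lfloor>b\<rfloor>}" using j by auto
  qed
  then have "card (int ` {j\<in>{1..p}. \<bar>real i - real j\<bar> \<le> b}) \<le> card {int i - \<lfloor>b\<rfloor>..int i + \<lfloor>b\<rfloor>}"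
    by (intro card_mono) auto
  also have "\<dots> = nat (2 * \<lfloor>b\<rfloor> + 1)" by simp
  finally have "card {j\<in>{1..p}. \<bar>real i - real j\<bar> \<le> b} \<le> nat (2 * \<lfloor>b\<rfloor> + 1)"
    by (simp add: card_image)
  moreover have "\<lfloor>b\<rfloor> \<ge> 0" using assms by simp
  ultimately have "real (card {j\<in>{1..p}. \<bar>real i - real j\<bar> \<le> b}) \<le> 2 * real_of_int \<lfloor>b\<rfloor> + 1"
    by linarith
  also have "\<dots> \<le> 2 * b + 1" by simp
  finally show ?thesis .
qed

lemma band_weight_row:
  assumes "b \<ge> 0"
  shows "(\<Sum>t\<in>{1..p} \<times> {1..n}. band_weight b s t * band_weight b t s) \<le> 2 * b + 1"
proof -
  have "(\<Sum>t\<in>{1..p} \<times> {1..n}. band_weight b s t * band_weight b t s)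
      = (\<Sum>t\<in>{1..p} \<times> {1..n}. if t \<in> {j\<in>{1..p}. \<bar>real (fst s) - real j\<bar> \<le> b} \<times> {snd s} then 1 else 0)"
    by (intro sum.cong) (auto simp: band_weight_def)
  also have "\<dots> = (\<Sum>t\<in>({1..p} \<times> {1..n}) \<inter> ({j\<in>{1..p}. \<bar>real (fst s) - real j\<bar> \<le> b} \<times> {snd s}). 1)"
    by (subst sum.inter_restrict) auto
  also have "\<dots> \<le> real (card ({j\<in>{1..p}. \<bar>real (fst s) - real j\<bar> \<le> b} \<times> {snd s}))"
    using card_mono[of "{j\<in>{1..p}. \<bar>real (fst s) - real j\<bar> \<le> b} \<times> {snd s}"
      "({1..p} \<times> {1..n}) \<inter> ({j\<in>{1..p}. \<bar>real (fst s) - real j\<bar> \<le> b} \<times> {snd s})"]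
    by (simp only: sum_constant) simp
  also have "\<dots> = real (card {j\<in>{1..p}. \<bar>real (fst s) - real j\<bar> \<le> b})"
    by (simp add: card_cartesian_product)
  also have "\<dots> \<le> 2 * b + 1" by (rule card_band_le[OF assms])
  finally show ?thesis .
qed

lemma half_weight_mult:
  assumes "\<And>d. q d \<ge> 0" "\<And>d. q (-d) = q d"
  shows "half_weight q s t * half_weight q t s = q (int (fst s) - int (fst t))"
  using assms(1)[of "int (fst s) - int (fst t)"] assms(2)[of "int (fst s) - int (fst t)"]
  by (simp add: half_weight_def)

text \<open>The columns contribute at most 1 and the free row contributes \<open>n\<close>. This
  makes path links the expensive ones, compared with \<open>2 * b + 1\<close> for a band
  link.\<close>

lemma half_weight_row:
  assumes "\<And>d. q d \<ge> 0" "\<And>d. q (-d) = q d" "\<And>F. finite F \<Longrightarrow> sum q F \<le> 1"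
  shows "(\<Sum>t\<in>{1..p} \<times> {1..n}. half_weight q s t * half_weight q t s) \<le> real n"
proof -
  have "(\<Sum>t\<in>{1..p} \<times> {1..n}. half_weight q s t * half_weight q t s)
      = (\<Sum>(i,r)\<in>{1..p} \<times> {1..n}. q (int (fst s) - int i))"
    using half_weight_mult[of q, OF assms(1,2)] by (intro sum.cong) auto
  also have "\<dots> = real n * (\<Sum>i\<in>{1..p}. q (int (fst s) - int i))"
    by (subst sum.cartesian_product[symmetric]) (simp add: sum_distrib_left)
  also have "\<dots> \<le> real n * 1" using sum_shift_le(1)[of q 1 "{1..p}"] assms(3) by (intro mult_left_mono) auto
  finally show ?thesis by simp
qed

text \<open>The points are the ends of the noise factors in two closed words. \<open>mt\<close>
  exchanges the two ends of one noise factor, \<open>pl\<close> crosses the intermediate power of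
  the mean matrix to the neighbouring factor. By \<open>conn1\<close> and \<open>conn2\<close> each
  word forms a single alternating cycle.\<close>

locale two_cycles =
  fixes H1 H2 :: "'h set" and mt pl :: "'h \<Rightarrow> 'h"
  assumes fin: "finite H1" "finite H2" and disj: "H1 \<inter> H2 = {}"
    and closed1: "h \<in> H1 \<Longrightarrow> mt h \<in> H1" "h \<in> H1 \<Longrightarrow> pl h \<in> H1"
    and closed2: "h \<in> H2 \<Longrightarrow> mt h \<in> H2" "h \<in> H2 \<Longrightarrow> pl h \<in> H2"
    and mt: "h \<in> H1 \<union> H2 \<Longrightarrow> mt (mt h) = h" "h \<in> H1 \<union> H2 \<Longrightarrow> mt h \<noteq> h"
    and pl: "h \<in> H1 \<union> H2 \<Longrightarrow> pl (pl h) = h" "h \<in> H1 \<union> H2 \<Longrightarrow> pl h \<noteq> h"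
    and mt_pl: "h \<in> H1 \<union> H2 \<Longrightarrow> mt h \<noteq> pl h"
    and conn1: "V \<subseteq> H1 \<Longrightarrow> V \<noteq> {} \<Longrightarrow> (\<And>h. h \<in> V \<Longrightarrow> mt h \<in> V \<and> pl h \<in> V) \<Longrightarrow> V = H1"
    and conn2: "V \<subseteq> H2 \<Longrightarrow> V \<noteq> {} \<Longrightarrow> (\<And>h. h \<in> V \<Longrightarrow> mt h \<in> V \<and> pl h \<in> V) \<Longrightarrow> V = H2"
begin

definition "H = H1 \<union> H2"

lemma fin_H: "finite H" using fin by (simp add: H_def)

lemma H_closed: "h \<in> H \<Longrightarrow> mt h \<in> H" "h \<in> H \<Longrightarrow> pl h \<in> H"
  using closed1 closed2 by (auto simp: H_def)

text \<open>Removing one point from a cycle leaves it connected: if exactly one neighbour of the removed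
  point were in \<open>V\<close>, then \<open>V\<close> would be matched up by one of the involutions but for a single point
  by the other.\<close>
lemma punctured_connected:
  assumes x: "x \<in> A" and A: "A = H1 \<or> A = H2" and V: "V \<subseteq> A - {x}" "V \<noteq> {}"
    and m: "\<And>h. h \<in> V \<Longrightarrow> mt h \<noteq> x \<Longrightarrow> mt h \<in> V" and p: "\<And>h. h \<in> V \<Longrightarrow> pl h \<noteq> x \<Longrightarrow> pl h \<in> V"
  shows "V = A - {x}"
proof -
  have AH: "A \<subseteq> H1 \<union> H2" and finV: "finite V" using A V fin finite_subset[of V A] by auto
  have conn: "W = A" if "W \<subseteq> A" "W \<noteq> {}" "\<And>h. h \<in> W \<Longrightarrow> mt h \<in> W \<and> pl h \<in> W" for W
    using conn1 conn2 A that by metis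
  have xH: "x \<in> H1 \<union> H2" using x AH by auto
  have nx: "mt h \<noteq> x" if "h \<in> V" "h \<noteq> mt x" for h
  proof
    assume "mt h = x"
    moreover have "mt (mt h) = h" using that V AH by (intro mt(1)) auto
    ultimately show False using that by simp
  qed
  have nx': "pl h \<noteq> x" if "h \<in> V" "h \<noteq> pl x" for h
  proof
    assume "pl h = x"
    moreover have "pl (pl h) = h" using that V AH by (intro pl(1)) auto
    ultimately show False using that by simp
  qed
  have VH: "V \<subseteq> H1 \<union> H2" using V AH by auto
  show ?thesis
  proof (cases "mt x \<in> V")
    case mtx: True
    show ?thesis
    proof (cases "pl x \<in> V")
      case plx: True
      have "insert x V = A"
      proof (rule conn)
        fix h assume "h \<in> insert x V"
        then show "mt h \<in> insert x V \<and> pl h \<in> insert x V" using mtx plx m p by blast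
      qed (use x V in auto)
      then show ?thesis using V by auto
    next
      case False
      have "even (card V)"
        using p nx' False pl VH by (intro even_card_involution[OF finV, of pl]) (metis subsetD)
      moreover have "even (card (V - {mt x}))"
      proof (rule even_card_involution[of _ mt])
        fix h assume h: "h \<in> V - {mt x}"
        then have "mt h \<in> V" using m nx by auto
        moreover have "mt h \<noteq> mt x" using mt h VH V xH by (metis DiffD1 Diff_insert_absorb insert_absorb insert_subset subsetD Diff_iff singletonI)
        ultimately show "mt h \<in> V - {mt x} \<and> mt (mt h) = h \<and> mt h \<noteq> h" using mt h VH by auto
      qed (use finV in auto)
      moreover have "card V = Suc (card (V - {mt x}))" by (rule card_Suc_Diff1[OF finV mtx, symmetric])
      ultimately show ?thesis by simp
    qed
  next
    case mtx: False
    show ?thesis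
    proof (cases "pl x \<in> V")
      case plx: True
      have "even (card V)"
        using m nx mtx mt VH by (intro even_card_involution[OF finV, of mt]) (metis subsetD)
      moreover have "even (card (V - {pl x}))"
      proof (rule even_card_involution[of _ pl])
        fix h assume h: "h \<in> V - {pl x}"
        then have "pl h \<in> V" using p nx' by auto
        moreover have "pl h \<noteq> pl x" using pl h VH V xH by (metis DiffD1 Diff_insert_absorb insert_absorb insert_subset subsetD Diff_iff singletonI)
        ultimately show "pl h \<in> V - {pl x} \<and> pl (pl h) = h \<and> pl h \<noteq> h" using pl h VH by auto
      qed (use finV in auto)
      moreover have "card V = Suc (card (V - {pl x}))" by (rule card_Suc_Diff1[OF finV plx, symmetric])
      ultimately show ?thesis by simp
    next
      case False
      have "V = A"
      proof (rule conn)
        fix h assume "h \<in> V"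
        then show "mt h \<in> V \<and> pl h \<in> V" using m p nx nx' mtx False by metis
      qed (use V in auto)
      then show ?thesis using V x by auto
    qed
  qed
qed

lemma block_subset_union:
  assumes "partition_on A P" "U \<subseteq> P" "B \<in> P" "B \<inter> \<Union>U \<noteq> {}"
  shows "B \<in> U"
proof -
  obtain C z where C: "C \<in> U" "z \<in> B" "z \<in> C" using assms(4) by auto
  then have "C = B" using assms(1-3) unfolding partition_on_def pairwise_def disjnt_def by blast
  then show ?thesis using C by simp
qed

end

text \<open>\<open>Q\<close> is the number of noise factors in both words together, half the number
  of ends; two words with at least two factors each give \<open>4 \<le> Q\<close>. The kernel
  \<open>q\<close> stands for the normalised bound on powers of the mean matrix, \<open>a\<close>
  for the covariances within a pair, \<open>K\<close> for all block sums; \<open>B0\<close> is a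
  block meeting both cycles. By \<open>2 * b + 1 \<le> real n\<close> no link costs more than
  \<open>n\<close>.\<close>

locale crossing = two_cycles H1 H2 mt pl
  for H1 H2 :: "'h set" and mt pl :: "'h \<Rightarrow> 'h" +
  fixes P :: "'h set set" and \<kappa> :: "'h set \<Rightarrow> ('h \<Rightarrow> nat \<times> nat) \<Rightarrow> real"
    and p n :: nat and b K :: real and q a :: "int \<Rightarrow> real" and Q :: nat and B0 :: "'h set"
  assumes P: "partition_on H P" and two: "B \<in> P \<Longrightarrow> 2 \<le> card B"
    and noedge: "h \<in> H \<Longrightarrow> {h, mt h} \<notin> P"
    and cross: "B0 \<in> P" "B0 \<inter> H1 \<noteq> {}" "B0 \<inter> H2 \<noteq> {}"
    and card_H: "card H = 2 * Q" and Q4: "4 \<le> Q"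
    and b: "0 \<le> b" "2 * b + 1 \<le> real n"
    and q: "q d \<ge> 0" "q (- d) = q d" "finite F \<Longrightarrow> sum q F \<le> 1"
    and a: "a d \<ge> 0" "finite F \<Longrightarrow> sum a F \<le> K"
    and kappa: "B \<in> P \<Longrightarrow> \<kappa> B \<sigma> \<ge> 0"
      "B \<in> P \<Longrightarrow> (\<And>h. h \<in> B \<Longrightarrow> \<sigma> h = \<sigma>' h) \<Longrightarrow> \<kappa> B \<sigma> = \<kappa> B \<sigma>'"
      "B \<in> P \<Longrightarrow> h \<in> B \<Longrightarrow> s \<in> {1..p} \<times> {1..n} \<Longrightarrow>
        (\<Sum>\<sigma>\<in>{\<sigma>\<in>PiE B (\<lambda>_. {1..p} \<times> {1..n}). \<sigma> h = s}. \<kappa> B \<sigma>) \<le> K"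
      "{x, y} \<in> P \<Longrightarrow> x \<noteq> y \<Longrightarrow> \<kappa> {x, y} \<sigma> \<le> a (int (fst (\<sigma> x)) - int (fst (\<sigma> y)))"
    and K1: "1 \<le> K"
begin

definition "S = {1..p} \<times> {1..n}"
definition "w g h = (if h = mt g then band_weight b else half_weight q)"
definition "L = (\<lambda>h. (h, mt h)) ` H \<union> (\<lambda>h. (h, pl h)) ` H"

lemma half_weight_range: "0 \<le> half_weight q s t" "half_weight q s t \<le> 1"
  using q(1) q(3)[of "{int (fst s) - int (fst t)}"] by (auto simp: half_weight_def)

lemma band_weight_range: "0 \<le> band_weight b s t" "band_weight b s t \<le> 1"
  by (auto simp: band_weight_def)

lemma mt_eq_iff: "g \<in> H \<Longrightarrow> h \<in> H \<Longrightarrow> mt g = h \<longleftrightarrow> mt h = g"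
  using mt by (auto simp: H_def)

lemma w_mt: "h \<in> H \<Longrightarrow> w h (mt h) = band_weight b" "h \<in> H \<Longrightarrow> w (mt h) h = band_weight b"
  using mt by (auto simp: w_def H_def)

lemma w_pl: "h \<in> H \<Longrightarrow> w h (pl h) = half_weight q" "h \<in> H \<Longrightarrow> w (pl h) h = half_weight q"
proof -
  assume h: "h \<in> H"
  then have "mt h \<noteq> pl h" using mt_pl by (auto simp: H_def)
  moreover have "mt (pl h) \<noteq> h" using h H_closed mt_eq_iff calculation by metis
  ultimately show "w h (pl h) = half_weight q" "w (pl h) h = half_weight q" by (auto simp: w_def)
qed

lemma w_bounds: "0 \<le> w g h s t \<and> w g h s t \<le> 1"
  using half_weight_range band_weight_range by (simp add: w_def)

lemma w_row_le: "(g,h) \<in> L \<Longrightarrow> (\<Sum>t\<in>S. w g h s t * w h g t s) \<le> real n"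
proof -
  assume "(g,h) \<in> L"
  then consider "g \<in> H" "h = mt g" | "g \<in> H" "h = pl g" by (auto simp: L_def)
  then show ?thesis
  proof cases
    case 1
    then show ?thesis using band_weight_row[OF b(1), of s p n] b(2) by (simp add: w_mt S_def)
  next
    case 2
    then show ?thesis using half_weight_row[of q s p n] q by (simp add: w_pl S_def)
  qed
qed

sublocale net: network H P S \<kappa> w L K "real n"
proof
  show "L \<subseteq> H \<times> H" using H_closed by (auto simp: L_def)
  show "(h,g) \<in> L" if "(g,h) \<in> L" for g h
  proof -
    from that consider "g \<in> H" "h = mt g" | "g \<in> H" "h = pl g" by (auto simp: L_def)
    then show ?thesis
    proof cases
      case 1
      then have "(h, g) = (\<lambda>h. (h, mt h)) h" "h \<in> H" using mt(1)[of g] H_closed by (auto simp: H_def)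
      then show ?thesis unfolding L_def by blast
    next
      case 2
      then have "(h, g) = (\<lambda>h. (h, pl h)) h" "h \<in> H" using pl(1)[of g] H_closed by (auto simp: H_def)
      then show ?thesis unfolding L_def by blast
    qed
  qed
  show "(\<Sum>t\<in>S. w g h s t * w h g t s) \<le> real n" if "(g,h) \<in> L" for g h s
    using w_row_le[OF that] .
  show "\<kappa> B \<sigma> = \<kappa> B \<sigma>'" if "B \<in> P" "\<And>h. h \<in> B \<Longrightarrow> \<sigma> h = \<sigma>' h" for B \<sigma> \<sigma>'
    using kappa(2)[OF that] .
  show "(\<Sum>\<sigma>\<in>{\<sigma>\<in>PiE B (\<lambda>_. S). \<sigma> h = s}. \<kappa> B \<sigma>) \<le> K" if "B \<in> P" "h \<in> B" "s \<in> S" for B h s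
    using kappa(3)[OF that(1,2)] that(3) unfolding S_def .
  show "0 \<le> w g h s t \<and> w g h s t \<le> 1" for g h s t by (rule w_bounds)
  show "\<kappa> B \<sigma> \<ge> 0" if "B \<in> P" for B \<sigma> using kappa(1)[OF that] .
  show "finite H" by (rule fin_H)
  show "partition_on H P" by (rule P)
  show "finite S" by (simp add: S_def)
qed (use K1 in auto)

lemma P_Union: "\<Union>P = H"
  using P by (auto simp: partition_on_def)

lemma total_eq: "net.total P = (\<Sum>\<sigma>\<in>PiE H (\<lambda>_. S). (\<Prod>B\<in>P. \<kappa> B \<sigma>) *
    ((\<Prod>h\<in>H. band_weight b (\<sigma> h) (\<sigma> (mt h))) * (\<Prod>h\<in>H. half_weight q (\<sigma> h) (\<sigma> (pl h)))))"
  unfolding net.total_def net.weight_def P_Union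
proof (intro sum.cong refl arg_cong2[where f = "(*)"])
  fix \<sigma>
  have "L \<inter> (H \<times> H) = L" using H_closed by (auto simp: L_def)
  moreover have "(\<Prod>(g,h)\<in>L. w g h (\<sigma> g) (\<sigma> h)) =
      (\<Prod>(g,h)\<in>(\<lambda>h. (h, mt h)) ` H. w g h (\<sigma> g) (\<sigma> h)) * (\<Prod>(g,h)\<in>(\<lambda>h. (h, pl h)) ` H. w g h (\<sigma> g) (\<sigma> h))"
    unfolding L_def using fin_H mt_pl by (intro prod.union_disjoint) (auto simp: H_def)
  ultimately show "(\<Prod>(g,h)\<in>L \<inter> (H \<times> H). w g h (\<sigma> g) (\<sigma> h)) =
     (\<Prod>h\<in>H. band_weight b (\<sigma> h) (\<sigma> (mt h))) * (\<Prod>h\<in>H. half_weight q (\<sigma> h) (\<sigma> (pl h)))"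
    by (simp add: prod.reindex inj_on_def w_mt w_pl)
qed

text \<open>A closed family covers each cycle entirely or not at all. Whichever cycle it covers, it
  thereby meets \<open>B0\<close>, hence contains it, and so reaches the other cycle.\<close>

lemma connected:
  assumes "U \<subseteq> P" "U \<noteq> {}" "net.closed U"
  shows "U = P"
proof -
  define V where "V = \<Union>U"
  have VH: "V \<subseteq> H" unfolding V_def using net.Union_subset assms by blast
  have cl: "mt h \<in> V \<and> pl h \<in> V" if "h \<in> V" for h
  proof -
    have "h \<in> H" using that VH by blast
    then have "(h, mt h) \<in> L" "(h, pl h) \<in> L" by (auto simp: L_def)
    then show ?thesis using assms(3) that unfolding net.closed_def V_def by blast
  qed
  have "V \<noteq> {}" unfolding V_def using assms P partition_on_memD(2)[OF P] by blast
  have 1: "V \<inter> H1 = {} \<or> V \<inter> H1 = H1" using conn1[of "V \<inter> H1"] cl closed1 by blast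
  have 2: "V \<inter> H2 = {} \<or> V \<inter> H2 = H2" using conn2[of "V \<inter> H2"] cl closed2 by blast
  have "B0 \<inter> V \<noteq> {}" using 1 2 cross \<open>V \<noteq> {}\<close> VH unfolding H_def by blast
  then have "B0 \<in> U" using block_subset_union[OF P assms(1) cross(1)] V_def by blast
  then have "V \<inter> H1 \<noteq> {}" "V \<inter> H2 \<noteq> {}" using cross unfolding V_def by auto
  then have VH': "V = H" using 1 2 VH unfolding H_def by blast
  have "B \<in> U" if "B \<in> P" for B
    using block_subset_union[OF P assms(1) that] partition_on_memD[OF P that] VH' unfolding V_def by blast
  then show ?thesis using assms by blast
qed

lemma card_P_sum: "(\<Sum>B\<in>P. card B) = 2 * Q"
  using product_partition[OF P] card_H fin_H partition_on_memD(1)[OF P] by (metis finite_subset)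

lemma card_P_le: "card P \<le> Q"
proof -
  have "card P * 2 \<le> (\<Sum>B\<in>P. card B)" using sum_mono[of P "\<lambda>_. 2" card] two by simp
  then show ?thesis using card_P_sum by simp
qed

lemma P_nonempty: "P \<noteq> {}"
  using cross by auto

text \<open>If no matching link joined two blocks, every block would contain at least two whole edges.\<close>
lemma exists_mt_crossing:
  assumes "Q \<le> card P + 1"
  shows "\<exists>h\<in>H. \<forall>B\<in>P. h \<in> B \<longrightarrow> mt h \<notin> B"
proof (rule ccontr)
  assume "\<not> ?thesis"
  then have *: "\<exists>B\<in>P. h \<in> B \<and> mt h \<in> B" if "h \<in> H" for h using that by blast
  have B4: "4 \<le> card B" if B: "B \<in> P" for B
  proof -
    have BH: "B \<subseteq> H" and finB: "finite B"
      using partition_on_memD(1)[OF P B] fin_H finite_subset by auto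
    have mB: "mt h \<in> B" if hB: "h \<in> B" for h
    proof -
      obtain C where C: "C \<in> P" "h \<in> C" "mt h \<in> C" using *[of h] hB BH by auto
      then have "C = B" using P B hB unfolding partition_on_def pairwise_def disjnt_def by blast
      then show ?thesis using C by simp
    qed
    have "even (card B)"
      using mB BH mt by (intro even_card_involution[OF finB, of mt]) (auto simp: H_def)
    moreover have "card B \<noteq> 2"
    proof
      assume c: "card B = 2"
      obtain h where h: "h \<in> B" using partition_on_memD(2)[OF P B] by auto
      then have "{h, mt h} \<subseteq> B" "card {h, mt h} = 2" using mB mt(2)[of h] BH by (auto simp: H_def)
      then have "{h, mt h} = B" using c finB by (metis card_subset_eq)
      then show False using noedge[of h] h BH B by auto
    qed
    ultimately show ?thesis using two[OF B] by (auto elim!: evenE)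
  qed
  have "card P * 4 \<le> (\<Sum>B\<in>P. card B)" using sum_mono[of P "\<lambda>_. 4" card] B4 by simp
  then show False using card_P_sum assms Q4 by simp
qed

lemma card_S: "real (card S) = real p * real n"
  by (simp add: S_def)

text \<open>Plain exploration gives \<open>p n\<close> for the first block and \<open>n\<close> for
  each further one, altogether \<open>p n^|P|\<close>; with two blocks fewer than \<open>Q\<close>
  this is already within the target.\<close>

lemma total_le_few_blocks:
  assumes "card P + 2 \<le> Q"
  shows "net.total P \<le> K ^ Q * real p * (2 * b + 1) * real n ^ (Q - 2)"
proof -
  have n1: "1 \<le> real n" using b by linarith
  have c: "card P \<noteq> 0" using P_nonempty net.finite_P by simp
  have "net.total P \<le> (K * card S) * (K * real n) ^ (card P - 1)"
    by (rule net.total_le[OF connected P_nonempty])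
  also have "\<dots> = K ^ Suc (card P - 1) * real p * 1 * real n ^ Suc (card P - 1)"
    unfolding card_S by (simp add: power_mult_distrib)
  also have "\<dots> \<le> K ^ Q * real p * (2 * b + 1) * real n ^ (Q - 2)"
    using K1 n1 assms c b by (intro mult_mono power_increasing mult_nonneg_nonneg) auto
  finally show ?thesis .
qed

text \<open>One block short of \<open>Q\<close>, plain exploration misses the target by a factor of
  order \<open>n / b\<close>; a band link between two different blocks makes up for it.\<close>

lemma total_le_many_blocks:
  assumes "card P + 1 = Q"
  shows "net.total P \<le> K ^ Q * real p * (2 * b + 1) * real n ^ (Q - 2)"
proof -
  obtain h where h: "h \<in> H" "\<forall>B\<in>P. h \<in> B \<longrightarrow> mt h \<notin> B" using exists_mt_crossing assms by auto
  have n1: "1 \<le> real n" using b by linarith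
  have "net.total P \<le> (K * card S) * (K * (2 * b + 1)) * (K * real n) ^ (card P - 2)"
  proof (rule net.total_le_cheap_link[OF connected, of h "mt h"])
    show "(h, mt h) \<in> L" using h by (auto simp: L_def)
    show "(\<Sum>t\<in>S. w h (mt h) s t * w (mt h) h t s) \<le> 2 * b + 1" for s
      using band_weight_row[OF b(1), of s p n] h by (simp add: w_mt S_def)
  qed (use h b in auto)
  also have "\<dots> = K ^ Suc (Suc (card P - 2)) * real p * (2 * b + 1) * real n ^ Suc (card P - 2)"
    unfolding card_S by (simp add: power_mult_distrib)
  also have "\<dots> \<le> K ^ Q * real p * (2 * b + 1) * real n ^ (Q - 2)"
    using K1 n1 assms Q4 b by (intro mult_mono power_increasing mult_nonneg_nonneg) auto
  finally show ?thesis .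
qed

lemma sum_S_row_le:
  assumes "\<And>i. 0 \<le> g i"
  shows "(\<Sum>s\<in>S. g (fst s) * (if snd s = r then 1 else 0)) \<le> (\<Sum>i\<in>{1..p}. g i :: real)"
proof -
  have "(\<Sum>s\<in>S. g (fst s) * (if snd s = r then 1 else 0))
      = (\<Sum>i\<in>{1..p}. \<Sum>r'\<in>{1..n}. g i * (if r' = r then 1 else 0))"
    unfolding S_def by (subst sum.cartesian_product) (auto intro!: sum.cong)
  also have "\<dots> = (\<Sum>i\<in>{1..p}. g i * (if r \<in> {1..n} then 1 else 0))"
    by (simp add: sum_distrib_left[symmetric])
  also have "\<dots> \<le> (\<Sum>i\<in>{1..p}. g i)" using assms by (intro sum_mono) auto
  finally show ?thesis .
qed

text \<open>The convolution of \<open>q\<close>, \<open>a\<close> and \<open>q\<close> cut off to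
  \<open>{1..p}\<close>: it is what remains of the pair \<open>{x, y}\<close> once its states are
  summed out, leading from the column \<open>u\<close> of the neighbour of \<open>x\<close> to the
  column \<open>v\<close> of the neighbour of \<open>y\<close>.\<close>

definition bridge :: "nat \<Rightarrow> nat \<Rightarrow> real" where
  "bridge u v = (\<Sum>i\<in>{1..p}. \<Sum>j\<in>{1..p}. q (int i - int u) * a (int i - int j) * q (int j - int v))"

lemma bridge_nonneg: "0 \<le> bridge u v"
  unfolding bridge_def using q a by (intro sum_nonneg mult_nonneg_nonneg) auto

lemma bridge_row:
  "(\<Sum>v\<in>{1..p}. bridge u v) \<le> K" "(\<Sum>u\<in>{1..p}. bridge u v) \<le> K"
proof -
  have q1: "(\<Sum>i\<in>{1..p}. q (int i - int u)) \<le> 1" "(\<Sum>i\<in>{1..p}. q (int u - int i)) \<le> 1" for u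
    using sum_shift_le[of q 1 "{1..p}" u] q by auto
  have a1: "(\<Sum>i\<in>{1..p}. a (int i - int u)) \<le> K" "(\<Sum>i\<in>{1..p}. a (int u - int i)) \<le> K" for u
    using sum_shift_le[of a K "{1..p}" u] a by auto
  have "(\<Sum>v\<in>{1..p}. bridge u v)
      = (\<Sum>i\<in>{1..p}. \<Sum>v\<in>{1..p}. \<Sum>j\<in>{1..p}. q (int i - int u) * a (int i - int j) * q (int j - int v))"
    unfolding bridge_def by (rule sum.swap)
  also have "\<dots> = (\<Sum>i\<in>{1..p}. \<Sum>j\<in>{1..p}. \<Sum>v\<in>{1..p}. q (int i - int u) * a (int i - int j) * q (int j - int v))"
    by (intro sum.cong refl sum.swap)
  also have "\<dots> = (\<Sum>i\<in>{1..p}. q (int i - int u) * (\<Sum>j\<in>{1..p}. a (int i - int j) * (\<Sum>v\<in>{1..p}. q (int j - int v))))"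
    by (simp add: sum_distrib_left mult.assoc)
  also have "\<dots> \<le> (\<Sum>i\<in>{1..p}. q (int i - int u) * (\<Sum>j\<in>{1..p}. a (int i - int j) * 1))"
    using q a q1 by (intro sum_mono mult_left_mono) auto
  also have "\<dots> \<le> (\<Sum>i\<in>{1..p}. q (int i - int u) * K)"
    using q a1 by (intro sum_mono mult_left_mono) auto
  also have "\<dots> \<le> K" using mult_right_mono[OF q1(1)[of u], of K] K1 by (simp add: sum_distrib_right)
  finally show "(\<Sum>v\<in>{1..p}. bridge u v) \<le> K" .
  have "(\<Sum>u\<in>{1..p}. bridge u v)
      = (\<Sum>i\<in>{1..p}. \<Sum>u\<in>{1..p}. \<Sum>j\<in>{1..p}. q (int i - int u) * a (int i - int j) * q (int j - int v))"
    unfolding bridge_def by (rule sum.swap)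
  also have "\<dots> = (\<Sum>i\<in>{1..p}. (\<Sum>u\<in>{1..p}. q (int i - int u)) * (\<Sum>j\<in>{1..p}. a (int i - int j) * q (int j - int v)))"
    by (simp add: sum_product mult.assoc)
  also have "\<dots> \<le> (\<Sum>i\<in>{1..p}. 1 * (\<Sum>j\<in>{1..p}. a (int i - int j) * q (int j - int v)))"
    using q a q1 by (intro sum_mono mult_right_mono sum_nonneg mult_nonneg_nonneg) auto
  also have "\<dots> = (\<Sum>j\<in>{1..p}. (\<Sum>i\<in>{1..p}. a (int i - int j)) * q (int j - int v))"
    unfolding sum_distrib_right mult_1 by (rule sum.swap)
  also have "\<dots> \<le> (\<Sum>j\<in>{1..p}. K * q (int j - int v))"
    using q a1 by (intro sum_mono mult_right_mono) auto
  also have "\<dots> \<le> K" using mult_left_mono[OF q1(1)[of v], of K] K1 by (simp add: sum_distrib_left)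
  finally show "(\<Sum>u\<in>{1..p}. bridge u v) \<le> K" .
qed

lemma bridge_le: "v \<in> {1..p} \<Longrightarrow> bridge u v \<le> K"
  using member_le_sum[of v "{1..p}" "bridge u"] bridge_nonneg bridge_row(1)[of u] by fastforce

text \<open>If all blocks are pairs, a pair \<open>{x, y}\<close> joining the two cycles is summed out first. It leaves a
  new link between the neighbours \<open>pl x\<close> and \<open>pl y\<close>, at the cost of a constant instead of
  a factor \<open>n\<close>, because the second components of \<open>x\<close> and \<open>y\<close> are fixed by \<open>mt x\<close> and \<open>mt y\<close>.\<close>
lemma total_le_pairs:
  assumes cQ: "card P = Q"
  shows "net.total P \<le> K ^ Q * real p * (2 * b + 1) * real n ^ (Q - 2)"
proof -
  \<comment> \<open>\<open>Q\<close> blocks of size at least two fill \<open>2 * Q\<close> points,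
    so none can be larger.\<close>
  have pair: "card B = 2" if "B \<in> P" for B
  proof (rule ccontr)
    assume "card B \<noteq> 2"
    then have "2 < card B" using two[OF that] by simp
    then have "(\<Sum>B\<in>P. 2) < (\<Sum>B\<in>P. card B)"
      using two that net.finite_P by (intro sum_strict_mono_ex1) auto
    then show False using card_P_sum cQ by simp
  qed
  obtain x y where xy: "x \<in> B0" "x \<in> H1" "y \<in> B0" "y \<in> H2" using cross by auto
  then have "x \<noteq> y" using disj by auto
  have finB0: "finite B0" using pair[OF cross(1)] card.infinite by fastforce
  have B0: "B0 = {x, y}"
    using pair[OF cross(1)] xy \<open>x \<noteq> y\<close> finB0 by (metis card_2_iff card_subset_eq empty_subsetI insert_subset)
  define xs ys xh yh where "xs = pl x" and "ys = pl y" and "xh = mt x" and "yh = mt y"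
  define H' where "H' = H - {x, y}"
  define P' where "P' = P - {B0}"
  have xyH: "x \<in> H" "y \<in> H" using xy by (auto simp: H_def)
  have in1: "xs \<in> H1" "xh \<in> H1" "ys \<in> H2" "yh \<in> H2"
    using xy closed1 closed2 by (auto simp: xs_def xh_def ys_def yh_def)
  have ne: "xs \<noteq> x" "xh \<noteq> x" "xs \<noteq> xh" "ys \<noteq> y" "yh \<noteq> y" "ys \<noteq> yh"
    using pl(2)[of x] pl(2)[of y] mt(2)[of x] mt(2)[of y] mt_pl[of x] mt_pl[of y] xy
    by (auto simp: xs_def xh_def ys_def yh_def)
  have ne2: "u \<noteq> v" if "u \<in> H1" "v \<in> H2" for u v using that disj by auto
  have inH': "xs \<in> H'" "xh \<in> H'" "ys \<in> H'" "yh \<in> H'"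
    using in1 ne ne2 xy by (auto simp: H'_def H_def)
  have H: "H = insert x (insert y H')" "x \<notin> insert y H'" "y \<notin> H'" "finite H'"
    using xyH \<open>x \<noteq> y\<close> fin_H by (auto simp: H'_def)
  have UP': "\<Union>P' = H'"
  proof -
    have "disjnt B0 (\<Union>P')" using P cross(1) unfolding P'_def partition_on_def disjnt_def pairwise_def by auto
    moreover have "H = B0 \<union> \<Union>P'" using P_Union cross(1) unfolding P'_def by auto
    ultimately show ?thesis unfolding H'_def B0 disjnt_def by auto
  qed
  have partP': "partition_on H' P'"
    unfolding partition_on_def UP' using P by (auto simp: P'_def partition_on_def pairwise_def)
  have finP': "finite P'" using net.finite_P by (simp add: P'_def)
  define L' where "L' = L \<inter> (H' \<times> H')"
  define L2 where "L2 = insert (xs, ys) (insert (ys, xs) L')"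
  \<comment> \<open>The new link carries the bridge in one orientation and 1 in the other, so that
    both together count it once. Division by \<open>K\<close> keeps the weight within 1 and
    reappears as the factor \<open>K\<close> in \<open>step\<close>.\<close>
  define w2 where "w2 = (\<lambda>g h s t. if (g,h) = (xs,ys) then bridge (fst s) (fst t) / K
      else if (g,h) = (ys,xs) then 1 else w g h s t)"
  have L_sep: "(g,h) \<in> L \<Longrightarrow> g \<in> H1 \<longleftrightarrow> h \<in> H1" for g h
    using closed1 closed2 disj by (auto simp: L_def H_def)
  have notL: "(xs,ys) \<notin> L'" "(ys,xs) \<notin> L'" using L_sep in1 disj by (auto simp: L'_def)
  have w2_eq: "w2 g h = w g h" "w2 h g = w h g" if "(g,h) \<in> L'" for g h
  proof -
    have "(h,g) \<in> L'" using that net.L_sym by (auto simp: L'_def)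
    then have "(g,h) \<noteq> (xs,ys)" "(g,h) \<noteq> (ys,xs)" "(h,g) \<noteq> (xs,ys)" "(h,g) \<noteq> (ys,xs)"
      using that notL by auto
    then show "w2 g h = w g h" "w2 h g = w h g" unfolding w2_def by (simp_all only: if_False)
  qed
  have xsys: "xs \<noteq> ys" using ne2 in1 by auto
  have w2_xy: "w2 xs ys s t = bridge (fst s) (fst t) / K" "w2 ys xs s t = 1" for s t
    using xsys by (auto simp: w2_def)
  interpret n2: network H' P' S \<kappa> w2 L2 K "real n"
  proof
    show "L2 \<subseteq> H' \<times> H'" using inH' by (auto simp: L2_def L'_def)
    show "(h,g) \<in> L2" if "(g,h) \<in> L2" for g h
      using that net.L_sym by (auto simp: L2_def L'_def)
    show "0 \<le> w2 g h s t \<and> w2 g h s t \<le> 1" if "(g,h) \<in> L2" "s \<in> S" "t \<in> S" for g h s t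
    proof -
      have "fst t \<in> {1..p}" using that by (auto simp: S_def)
      then show ?thesis using bridge_nonneg bridge_le K1 w_bounds by (simp add: w2_def)
    qed
    show "(\<Sum>t\<in>S. w2 g h s t * w2 h g t s) \<le> real n" if gh: "(g,h) \<in> L2" "g \<noteq> h" "s \<in> S" for g h s
    proof -
      have S_sum: "(\<Sum>t\<in>S. f (fst t) / K) \<le> real n" if "(\<Sum>i\<in>{1..p}. f i) \<le> K" for f :: "nat \<Rightarrow> real"
      proof -
        have "(\<Sum>t\<in>S. f (fst t) / K) = (\<Sum>(i,r)\<in>{1..p}\<times>{1..n}. f i / K)"
          by (auto simp: S_def intro!: sum.cong)
        also have "\<dots> = real n * ((\<Sum>i\<in>{1..p}. f i) / K)"
          by (subst sum.cartesian_product[symmetric]) (simp add: sum_distrib_left sum_divide_distrib)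
        also have "\<dots> \<le> real n * 1" using that K1 by (intro mult_left_mono) auto
        finally show ?thesis by simp
      qed
      consider "g = xs" "h = ys" | "g = ys" "h = xs" | "(g,h) \<in> L'" using gh by (auto simp: L2_def)
      then show ?thesis
      proof cases
        case 1
        then show ?thesis using S_sum[OF bridge_row(1)[of "fst s"]] by (simp add: w2_xy)
      next
        case 2
        then show ?thesis using S_sum[OF bridge_row(2)[of "fst s"]] by (simp add: w2_xy)
      next
        case 3
        then show ?thesis using w_row_le[of g h s] w2_eq[OF 3] by (simp add: L'_def)
      qed
    qed
    show "\<kappa> B \<sigma> = \<kappa> B \<sigma>'" if "B \<in> P'" "\<And>h. h \<in> B \<Longrightarrow> \<sigma> h = \<sigma>' h" for B \<sigma> \<sigma>'
      using kappa(2)[of B, OF _ that(2)] that(1) by (auto simp: P'_def)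
    show "(\<Sum>\<sigma>\<in>{\<sigma>\<in>PiE B (\<lambda>_. S). \<sigma> h = s}. \<kappa> B \<sigma>) \<le> K" if "B \<in> P'" "h \<in> B" "s \<in> S" for B h s
      using net.kappa_sum[of B h s] that by (auto simp: P'_def)
    show "\<kappa> B \<sigma> \<ge> 0" if "B \<in> P'" for B \<sigma> using kappa(1) that by (auto simp: P'_def)
  qed (use H partP' net.finite_S K1 in auto)
  have prod_L2: "(\<Prod>(g,h)\<in>L2 \<inter> (H' \<times> H'). w2 g h (\<sigma> g) (\<sigma> h))
      = bridge (fst (\<sigma> xs)) (fst (\<sigma> ys)) / K * (\<Prod>(g,h)\<in>L'. w g h (\<sigma> g) (\<sigma> h))" for \<sigma>
  proof -
    have "L2 \<inter> (H' \<times> H') = L2" using n2.L_H by auto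
    moreover have "(\<Prod>(g,h)\<in>L2. w2 g h (\<sigma> g) (\<sigma> h)) =
       w2 xs ys (\<sigma> xs) (\<sigma> ys) * (w2 ys xs (\<sigma> ys) (\<sigma> xs) * (\<Prod>(g,h)\<in>L'. w2 g h (\<sigma> g) (\<sigma> h)))"
      unfolding L2_def using notL xsys net.finite_L by (subst prod.insert, simp add: L'_def, simp, subst prod.insert) (auto simp: L'_def)
    moreover have "(\<Prod>(g,h)\<in>L'. w2 g h (\<sigma> g) (\<sigma> h)) = (\<Prod>(g,h)\<in>L'. w g h (\<sigma> g) (\<sigma> h))"
      by (intro prod.cong refl) (auto simp: w2_eq)
    ultimately show ?thesis by (simp add: w2_xy)
  qed
  have step: "net.total P \<le> K * n2.total P'"
  proof -
    \<comment> \<open>The links retained at \<open>x\<close> and \<open>y\<close>: path links in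
      both orientations, which make up a full \<open>q\<close>, and band links in one orientation,
      enough for a weight that is 0 or 1.\<close>
    define E where "E = {(x,xs),(xs,x),(x,xh),(y,ys),(ys,y),(y,yh)}"
    have EL: "E \<subseteq> L"
    proof -
      have "(x,xs) \<in> L" "(x,xh) \<in> L" "(y,ys) \<in> L" "(y,yh) \<in> L"
        using xyH by (auto simp: L_def xs_def xh_def ys_def yh_def)
      then show ?thesis using net.L_sym by (auto simp: E_def)
    qed
    have LE: "L' \<inter> E = {}" by (auto simp: E_def L'_def H'_def)
    let ?u = "\<lambda>\<sigma> s t. a (int (fst s) - int (fst t)) *
       ((q (int (fst s) - int (fst (\<sigma> xs))) * (if snd s = snd (\<sigma> xh) then 1 else 0)) *
        (q (int (fst t) - int (fst (\<sigma> ys))) * (if snd t = snd (\<sigma> yh) then 1 else 0)))"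
    have le: "net.weight P (\<sigma>(y := t, x := s)) \<le>
        ((\<Prod>B\<in>P'. \<kappa> B \<sigma>) * (\<Prod>(g,h)\<in>L'. w g h (\<sigma> g) (\<sigma> h))) * ?u \<sigma> s t" for \<sigma> s t
    proof -
      let ?\<tau> = "\<sigma>(y := t, x := s)"
      have \<tau>: "?\<tau> x = s" "?\<tau> y = t" "h \<in> H' \<Longrightarrow> ?\<tau> h = \<sigma> h" for h using \<open>x \<noteq> y\<close> by (auto simp: H'_def)
      have k: "(\<Prod>B\<in>P. \<kappa> B ?\<tau>) = \<kappa> B0 ?\<tau> * (\<Prod>B\<in>P'. \<kappa> B \<sigma>)"
      proof -
        have "(\<Prod>B\<in>P. \<kappa> B ?\<tau>) = \<kappa> B0 ?\<tau> * (\<Prod>B\<in>P'. \<kappa> B ?\<tau>)"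
          unfolding P'_def using net.finite_P cross(1) by (rule prod.remove)
        moreover have "(\<Prod>B\<in>P'. \<kappa> B ?\<tau>) = (\<Prod>B\<in>P'. \<kappa> B \<sigma>)"
        proof (intro prod.cong refl)
          fix B assume B: "B \<in> P'"
          then have "B \<subseteq> H'" using UP' by auto
          then show "\<kappa> B ?\<tau> = \<kappa> B \<sigma>" using B by (intro n2.kappa_local \<tau>(3)) auto
        qed
        ultimately show ?thesis by simp
      qed
      have kB0: "\<kappa> B0 ?\<tau> \<le> a (int (fst s) - int (fst t))"
        using kappa(4)[of x y ?\<tau>] cross(1) \<open>x \<noteq> y\<close> unfolding B0 by simp
      have "(\<Prod>(g,h)\<in>L \<inter> (H \<times> H). w g h (?\<tau> g) (?\<tau> h)) \<le> (\<Prod>(g,h)\<in>L' \<union> E. w g h (?\<tau> g) (?\<tau> h))"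
      proof (rule prod_le_prod_subset)
        show "finite (L \<inter> (H \<times> H))" using net.finite_L by simp
        show "L' \<union> E \<subseteq> L \<inter> (H \<times> H)" using EL net.L_H by (auto simp: L'_def)
        show "0 \<le> (case z of (g,h) \<Rightarrow> w g h (?\<tau> g) (?\<tau> h)) \<and> (case z of (g,h) \<Rightarrow> w g h (?\<tau> g) (?\<tau> h)) \<le> 1" for z
          unfolding case_prod_beta by (rule w_bounds)
      qed
      also have "\<dots> = (\<Prod>(g,h)\<in>L'. w g h (?\<tau> g) (?\<tau> h)) * (\<Prod>(g,h)\<in>E. w g h (?\<tau> g) (?\<tau> h))"
        using LE net.finite_L by (intro prod.union_disjoint) (auto simp: L'_def E_def)
      also have "(\<Prod>(g,h)\<in>L'. w g h (?\<tau> g) (?\<tau> h)) = (\<Prod>(g,h)\<in>L'. w g h (\<sigma> g) (\<sigma> h))"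
      proof (intro prod.cong refl)
        fix z assume "z \<in> L'"
        then have "fst z \<in> H'" "snd z \<in> H'" by (auto simp: L'_def)
        then show "(case z of (g,h) \<Rightarrow> w g h (?\<tau> g) (?\<tau> h)) = (case z of (g,h) \<Rightarrow> w g h (\<sigma> g) (\<sigma> h))"
          unfolding case_prod_beta by (simp only: \<tau>(3))
      qed
      finally have l1: "(\<Prod>(g,h)\<in>L \<inter> (H \<times> H). w g h (?\<tau> g) (?\<tau> h)) \<le>
          (\<Prod>(g,h)\<in>L'. w g h (\<sigma> g) (\<sigma> h)) * (\<Prod>(g,h)\<in>E. w g h (?\<tau> g) (?\<tau> h))" .
      have l2: "(\<Prod>(g,h)\<in>E. w g h (?\<tau> g) (?\<tau> h)) \<le>
         (q (int (fst s) - int (fst (\<sigma> xs))) * (if snd s = snd (\<sigma> xh) then 1 else 0)) *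
         (q (int (fst t) - int (fst (\<sigma> ys))) * (if snd t = snd (\<sigma> yh) then 1 else 0))"
      proof -
        have dist: "distinct [(x,xs),(xs,x),(x,xh),(y,ys),(ys,y),(y,yh)]"
          using ne ne2[OF xy(2) xy(4)] ne2[OF in1(1) xy(4)] ne2[OF in1(2) xy(4)] ne2[OF xy(2) in1(3)] ne2[OF xy(2) in1(4)] ne2[OF in1(1) in1(3)]
          by auto
        have "(\<Prod>(g,h)\<in>E. w g h (?\<tau> g) (?\<tau> h)) = prod_list (map (\<lambda>(g,h). w g h (?\<tau> g) (?\<tau> h)) [(x,xs),(xs,x),(x,xh),(y,ys),(ys,y),(y,yh)])"
          using prod.distinct_set_conv_list[OF dist, of "\<lambda>(g,h). w g h (?\<tau> g) (?\<tau> h)"] by (simp add: E_def)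
        also have "\<dots> = (w x xs s (\<sigma> xs) * w xs x (\<sigma> xs) s) * w x xh s (\<sigma> xh) *
            ((w y ys t (\<sigma> ys) * w ys y (\<sigma> ys) t) * w y yh t (\<sigma> yh))"
          using \<tau> inH' by simp
        also have "\<dots> = (q (int (fst s) - int (fst (\<sigma> xs))) * band_weight b s (\<sigma> xh)) *
            (q (int (fst t) - int (fst (\<sigma> ys))) * band_weight b t (\<sigma> yh))"
          using xyH half_weight_mult[of q, OF q(1) q(2)]
          by (simp add: xs_def xh_def ys_def yh_def w_mt w_pl)
        \<comment> \<open>From the band links only the equality of rows is kept. It fixes the rows
          of \<open>x\<close> and \<open>y\<close>, which is why their sums produce no factor
          \<open>n\<close>.\<close>
        also have "\<dots> \<le> (q (int (fst s) - int (fst (\<sigma> xs))) * (if snd s = snd (\<sigma> xh) then 1 else 0)) *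
         (q (int (fst t) - int (fst (\<sigma> ys))) * (if snd t = snd (\<sigma> yh) then 1 else 0))"
          using q by (intro mult_mono mult_nonneg_nonneg) (auto simp: band_weight_def)
        finally show ?thesis .
      qed
      have nnL: "0 \<le> (\<Prod>(g,h)\<in>L'. w g h (\<sigma> g) (\<sigma> h))"
        using w_bounds by (intro prod_nonneg) (simp add: case_prod_beta)
      have l: "(\<Prod>(g,h)\<in>L \<inter> (H \<times> H). w g h (?\<tau> g) (?\<tau> h)) \<le> (\<Prod>(g,h)\<in>L'. w g h (\<sigma> g) (\<sigma> h)) *
         ((q (int (fst s) - int (fst (\<sigma> xs))) * (if snd s = snd (\<sigma> xh) then 1 else 0)) *
         (q (int (fst t) - int (fst (\<sigma> ys))) * (if snd t = snd (\<sigma> yh) then 1 else 0)))"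
        by (rule order_trans[OF l1 mult_left_mono[OF l2 nnL]])
      have nn: "0 \<le> (\<Prod>B\<in>P'. \<kappa> B \<sigma>)" using n2.kappa_nonneg by (intro prod_nonneg) auto
      have "net.weight P ?\<tau> \<le> (a (int (fst s) - int (fst t)) * (\<Prod>B\<in>P'. \<kappa> B \<sigma>)) * ((\<Prod>(g,h)\<in>L'. w g h (\<sigma> g) (\<sigma> h)) *
         ((q (int (fst s) - int (fst (\<sigma> xs))) * (if snd s = snd (\<sigma> xh) then 1 else 0)) *
         (q (int (fst t) - int (fst (\<sigma> ys))) * (if snd t = snd (\<sigma> yh) then 1 else 0))))"
        unfolding net.weight_def P_Union k
      proof (rule mult_mono[OF _ l])
        show "\<kappa> B0 ?\<tau> * (\<Prod>B\<in>P'. \<kappa> B \<sigma>) \<le> a (int (fst s) - int (fst t)) * (\<Prod>B\<in>P'. \<kappa> B \<sigma>)"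
          by (rule mult_right_mono[OF kB0 nn])
        show "0 \<le> a (int (fst s) - int (fst t)) * (\<Prod>B\<in>P'. \<kappa> B \<sigma>)" using a nn by simp
        show "0 \<le> (\<Prod>(g,h)\<in>L \<inter> (H \<times> H). w g h (?\<tau> g) (?\<tau> h))"
          unfolding case_prod_beta using w_bounds by (intro prod_nonneg) blast
      qed
      then show ?thesis by (simp only: mult_ac)
    qed
    have sumu: "(\<Sum>t\<in>S. \<Sum>s\<in>S. ?u \<sigma> s t) \<le> bridge (fst (\<sigma> xs)) (fst (\<sigma> ys))" for \<sigma>
    proof -
      let ?A = "\<lambda>i j. a (int i - int j)" and ?q1 = "\<lambda>i. q (int i - int (fst (\<sigma> xs)))" and ?q2 = "\<lambda>j. q (int j - int (fst (\<sigma> ys)))"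
      have "(\<Sum>t\<in>S. \<Sum>s\<in>S. ?u \<sigma> s t) = (\<Sum>t\<in>S. (?q2 (fst t) * (\<Sum>s\<in>S. (?A (fst s) (fst t) * ?q1 (fst s)) * (if snd s = snd (\<sigma> xh) then 1 else 0)))
          * (if snd t = snd (\<sigma> yh) then 1 else 0))"
        unfolding sum_distrib_left sum_distrib_right by (simp only: mult_ac)
      also have "\<dots> \<le> (\<Sum>t\<in>S. (?q2 (fst t) * (\<Sum>i\<in>{1..p}. ?A i (fst t) * ?q1 i)) * (if snd t = snd (\<sigma> yh) then 1 else 0))"
      proof (rule sum_mono)
        fix t assume "t \<in> S"
        have "(\<Sum>s\<in>S. (?A (fst s) (fst t) * ?q1 (fst s)) * (if snd s = snd (\<sigma> xh) then 1 else 0)) \<le> (\<Sum>i\<in>{1..p}. ?A i (fst t) * ?q1 i)"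
          using q a by (intro sum_S_row_le[of "\<lambda>i. ?A i (fst t) * ?q1 i"] mult_nonneg_nonneg) auto
        then show "(?q2 (fst t) * (\<Sum>s\<in>S. (?A (fst s) (fst t) * ?q1 (fst s)) * (if snd s = snd (\<sigma> xh) then 1 else 0)))
          * (if snd t = snd (\<sigma> yh) then 1 else 0) \<le> (?q2 (fst t) * (\<Sum>i\<in>{1..p}. ?A i (fst t) * ?q1 i)) * (if snd t = snd (\<sigma> yh) then 1 else 0)"
          using q by (intro mult_right_mono mult_left_mono) auto
      qed
      also have "\<dots> \<le> (\<Sum>j\<in>{1..p}. ?q2 j * (\<Sum>i\<in>{1..p}. ?A i j * ?q1 i))"
        using q a by (intro sum_S_row_le[of "\<lambda>j. ?q2 j * (\<Sum>i\<in>{1..p}. ?A i j * ?q1 i)"] mult_nonneg_nonneg sum_nonneg) auto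
      also have "\<dots> = bridge (fst (\<sigma> xs)) (fst (\<sigma> ys))"
        unfolding bridge_def by (subst sum.swap) (simp add: sum_distrib_left mult_ac)
      finally show ?thesis .
    qed
    have "net.total P = (\<Sum>\<sigma>\<in>PiE H' (\<lambda>_. S). \<Sum>t\<in>S. \<Sum>s\<in>S. net.weight P (\<sigma>(y := t, x := s)))"
      unfolding net.total_def P_Union H(1) using H net.finite_S
      by (subst sum_PiE_insert, simp, simp, simp, subst sum_PiE_insert) auto
    also have "\<dots> \<le> (\<Sum>\<sigma>\<in>PiE H' (\<lambda>_. S). \<Sum>t\<in>S. \<Sum>s\<in>S. ((\<Prod>B\<in>P'. \<kappa> B \<sigma>) * (\<Prod>(g,h)\<in>L'. w g h (\<sigma> g) (\<sigma> h))) * ?u \<sigma> s t)"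
      by (intro sum_mono le)
    also have "\<dots> = (\<Sum>\<sigma>\<in>PiE H' (\<lambda>_. S). ((\<Prod>B\<in>P'. \<kappa> B \<sigma>) * (\<Prod>(g,h)\<in>L'. w g h (\<sigma> g) (\<sigma> h))) * (\<Sum>t\<in>S. \<Sum>s\<in>S. ?u \<sigma> s t))"
      by (simp only: sum_distrib_left)
    also have "\<dots> \<le> (\<Sum>\<sigma>\<in>PiE H' (\<lambda>_. S). ((\<Prod>B\<in>P'. \<kappa> B \<sigma>) * (\<Prod>(g,h)\<in>L'. w g h (\<sigma> g) (\<sigma> h))) * bridge (fst (\<sigma> xs)) (fst (\<sigma> ys)))"
      using n2.kappa_nonneg w_bounds by (intro sum_mono mult_left_mono sumu mult_nonneg_nonneg prod_nonneg) (auto simp: case_prod_beta)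
    also have "\<dots> = K * n2.total P'"
      unfolding n2.total_def n2.weight_def UP' prod_L2 sum_distrib_left using K1 by (intro sum.cong refl) (simp add: field_simps)
    finally show ?thesis .
  qed
  \<comment> \<open>Without \<open>x\<close> and \<open>y\<close> each cycle is still connected by
    \<open>punctured_connected\<close>, and the bridge joins the two remainders.\<close>
  have conn: "U = P'" if U: "U \<subseteq> P'" "U \<noteq> {}" "n2.closed U" for U
  proof -
    define V where "V = \<Union>U"
    have VH: "V \<subseteq> H'" unfolding V_def using n2.Union_subset U by blast
    have cl: "h \<in> V" if "(g,h) \<in> L2" "g \<in> V" for g h
      using that U(3) unfolding n2.closed_def V_def by blast
    have clm: "mt h \<in> V" if "h \<in> V" "mt h \<in> H'" for h
    proof (rule cl)
      have "h \<in> H'" using that VH by blast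
      then show "(h, mt h) \<in> L2" using that by (auto simp: L2_def L'_def L_def H'_def)
    qed (rule that)
    have clp: "pl h \<in> V" if "h \<in> V" "pl h \<in> H'" for h
    proof (rule cl)
      have "h \<in> H'" using that VH by blast
      then show "(h, pl h) \<in> L2" using that by (auto simp: L2_def L'_def L_def H'_def)
    qed (rule that)
    have H1': "H' \<inter> H1 = H1 - {x}" and H2': "H' \<inter> H2 = H2 - {y}"
      using xy disj by (auto simp: H'_def H_def)
    have 1: "V \<inter> H1 = {} \<or> V \<inter> H1 = H1 - {x}"
    proof (cases "V \<inter> H1 = {}")
      case False
      have "V \<inter> H1 = H1 - {x}"
      proof (rule punctured_connected[OF xy(2) _ _ False])
        fix h assume h: "h \<in> V \<inter> H1"
        show "mt h \<in> V \<inter> H1" if "mt h \<noteq> x" using clm[of h] closed1(1)[of h] h that H1' by blast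
        show "pl h \<in> V \<inter> H1" if "pl h \<noteq> x" using clp[of h] closed1(2)[of h] h that H1' by blast
      qed (use VH H1' in auto)
      then show ?thesis by simp
    qed simp
    have 2: "V \<inter> H2 = {} \<or> V \<inter> H2 = H2 - {y}"
    proof (cases "V \<inter> H2 = {}")
      case False
      have "V \<inter> H2 = H2 - {y}"
      proof (rule punctured_connected[OF xy(4) _ _ False])
        fix h assume h: "h \<in> V \<inter> H2"
        show "mt h \<in> V \<inter> H2" if "mt h \<noteq> y" using clm[of h] closed2(1)[of h] h that H2' by blast
        show "pl h \<in> V \<inter> H2" if "pl h \<noteq> y" using clp[of h] closed2(2)[of h] h that H2' by blast
      qed (use VH H2' in auto)
      then show ?thesis by simp
    qed simp
    have bridge_link: "xs \<in> V \<longleftrightarrow> ys \<in> V"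
      using cl[of xs ys] cl[of ys xs] unfolding L2_def by blast
    have Vne: "V \<noteq> {}"
    proof -
      obtain B where "B \<in> U" using U(2) by auto
      moreover from this have "B \<in> P'" using U(1) by auto
      ultimately show ?thesis using partition_on_memD(2)[OF partP'] unfolding V_def by auto
    qed
    have V12: "V = (V \<inter> H1) \<union> (V \<inter> H2)" using VH unfolding H'_def H_def by blast
    have xs1: "xs \<in> V \<longleftrightarrow> V \<inter> H1 = H1 - {x}" using 1 in1 ne by blast
    have ys1: "ys \<in> V \<longleftrightarrow> V \<inter> H2 = H2 - {y}" using 2 in1 ne by blast
    have "xs \<in> V"
    proof (rule ccontr)
      assume n: "xs \<notin> V"
      then have "ys \<notin> V" using bridge_link by simp
      then have "V \<inter> H1 = {}" "V \<inter> H2 = {}" using n xs1 ys1 1 2 by simp_all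
      then show False using Vne V12 by simp
    qed
    then have "V \<inter> H1 = H1 - {x}" "V \<inter> H2 = H2 - {y}" using xs1 ys1 bridge_link by simp_all
    moreover have "H' = (H' \<inter> H1) \<union> (H' \<inter> H2)" unfolding H'_def H_def by blast
    ultimately have VH': "V = H'" using V12 H1' H2' by simp
    have "B \<in> U" if "B \<in> P'" for B
      using block_subset_union[OF partP' U(1) that] partition_on_memD[OF partP' that] VH'
      unfolding V_def by blast
    then show ?thesis using U by blast
  qed
  \<comment> \<open>All blocks are pairs and no edge is a block, so the band link at
    \<open>xs\<close> leads to a different block.\<close>
  have "n2.total P' \<le> (K * card S) * (K * (2 * b + 1)) * (K * real n) ^ (card P' - 2)"
  proof (rule n2.total_le_cheap_link[OF conn, of xs "mt xs"])
    have "mt xs \<in> H1" using in1 closed1 by blast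
    moreover have "mt xs \<noteq> x" using mt_eq_iff[of xs x] xyH inH' ne by (auto simp: H'_def xh_def)
    ultimately have mxs: "mt xs \<in> H'" using ne2 xy by (auto simp: H'_def H_def)
    then have inL': "(xs, mt xs) \<in> L'" using inH' by (auto simp: L'_def L_def H'_def)
    then show "(xs, mt xs) \<in> L2" by (simp add: L2_def)
    show "mt xs \<notin> B" if B: "B \<in> P'" "xs \<in> B" for B
    proof
      assume m: "mt xs \<in> B"
      have "B \<in> P" using B by (simp add: P'_def)
      have xsH: "xs \<in> H" using inH' by (simp add: H'_def)
      then have "card {xs, mt xs} = 2" using mt(2)[of xs] by (auto simp: H_def)
      moreover have "finite B" using pair[OF \<open>B \<in> P\<close>] card.infinite by fastforce
      ultimately have "{xs, mt xs} = B" using m B pair[OF \<open>B \<in> P\<close>] by (intro card_subset_eq) auto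
      then show False using noedge[OF xsH] \<open>B \<in> P\<close> by simp
    qed
    show "(\<Sum>t\<in>S. w2 xs (mt xs) s t * w2 (mt xs) xs t s) \<le> 2 * b + 1" for s
      using band_weight_row[OF b(1), of s p n] inH' w2_eq[OF inL'] by (simp add: w_mt S_def H'_def)
  qed (use b in auto)
  also have "\<dots> = K ^ Suc (Suc (card P' - 2)) * real p * (2 * b + 1) * real n ^ Suc (card P' - 2)"
    unfolding card_S by (simp add: power_mult_distrib)
  finally have n2: "n2.total P' \<le> K ^ Suc (Suc (card P' - 2)) * real p * (2 * b + 1) * real n ^ Suc (card P' - 2)" .
  \<comment> \<open>Of the \<open>Q - 1\<close> blocks in \<open>P'\<close> the first gives
    \<open>p n\<close>, the cheap link gives \<open>2 * b + 1\<close>, and the other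
    \<open>Q - 3\<close> give \<open>n\<close> each.\<close>
  have cP': "card P' = Q - 1" using cross(1) net.finite_P cQ by (simp add: P'_def)
  then have e: "Suc (Suc (Suc (card P' - 2))) = Q" "Suc (card P' - 2) = Q - 2" using Q4 by auto
  have "net.total P \<le> K * (K ^ Suc (Suc (card P' - 2)) * real p * (2 * b + 1) * real n ^ Suc (card P' - 2))"
    using step mult_left_mono[OF n2, of K] K1 by linarith
  also have "\<dots> = K ^ Suc (Suc (Suc (card P' - 2))) * real p * (2 * b + 1) * real n ^ Suc (card P' - 2)"
    by simp
  finally show ?thesis unfolding e(1) unfolding e(2) .
qed

theorem total_bound:
  "(\<Sum>\<sigma>\<in>PiE H (\<lambda>_. {1..p} \<times> {1..n}). (\<Prod>B\<in>P. \<kappa> B \<sigma>) *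
    ((\<Prod>h\<in>H. band_weight b (\<sigma> h) (\<sigma> (mt h))) * (\<Prod>h\<in>H. half_weight q (\<sigma> h) (\<sigma> (pl h)))))
   \<le> K ^ Q * real p * (2 * b + 1) * real n ^ (Q - 2)"
proof -
  consider "card P + 2 \<le> Q" | "card P + 1 = Q" | "card P = Q" using card_P_le by linarith
  then have "net.total P \<le> K ^ Q * real p * (2 * b + 1) * real n ^ (Q - 2)"
    using total_le_few_blocks total_le_many_blocks total_le_pairs by cases
  then show ?thesis unfolding total_eq unfolding S_def .
qed

end

section \<open>Stationary sequences and independent copies\<close>

lemma cum_pair:
  assumes "x \<noteq> y"
  shows "cum m {x, y} = m {x, y} - m {x} * m {y}"
proof -
  have "m {x, y} = psum (cum m) (insert x {y})" by (rule psum_cum[symmetric]) auto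
  also have "\<dots> = cum m {x} * psum (cum m) {y} + cum m {x, y} * psum (cum m) {}"
    using assms by (subst psum_insert) (auto simp: Pow_insert)
  also have "psum (cum m) {y} = m {y}" by (rule psum_cum) auto
  finally show ?thesis by (simp add: cum_singleton)
qed

text \<open>Subtracting the cumulant of an edge from its product removes precisely the partitions
  with that edge as a block. The uncentred set \<open>S\<close> is there for the induction:
  expanding one centred factor either moves its edge into \<open>S\<close> or splits off its
  cumulant, and \<open>psum_fun_upd_0\<close> compares the two partition sums.\<close>

lemma (in prob_space) expectation_prod_centred:
  fixes X :: "'h \<Rightarrow> 'a \<Rightarrow> real" and F :: "'h set set"
  defines "m \<equiv> \<lambda>S. expectation (\<lambda>\<omega>. \<Prod>h\<in>S. X h \<omega>)"
  assumes "finite F" "finite (\<Union>F)" "pairwise disjnt F" "{} \<notin> F" "finite S" "\<Union>F \<inter> S = {}"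
    and mom: "\<And>h. h \<in> \<Union>F \<union> S \<Longrightarrow> all_moments M (X h)"
  shows "expectation (\<lambda>\<omega>. (\<Prod>e\<in>F. (\<Prod>h\<in>e. X h \<omega>) - cum m e) * (\<Prod>h\<in>S. X h \<omega>))
    = psum (\<lambda>B. if B \<in> F then 0 else cum m B) (\<Union>F \<union> S)"
  using assms(2-)
proof (induction F arbitrary: S rule: finite_induct)
  case empty
  then show ?case using psum_cum[of S m] by (cases "S = {}") (auto simp: m_def prob_space)
next
  case (insert e F)
  have e: "finite e" "e \<noteq> {}" "e \<inter> \<Union>F = {}" "finite (\<Union>F)" "e \<inter> S = {}"
  proof -
    have "disjnt e C" if "C \<in> F" for C
      using insert.prems(2) insert.hyps(2) that by (auto simp: pairwise_insert)
    then show "e \<inter> \<Union>F = {}" by (auto simp: disjnt_def)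
  qed (use insert.prems in auto)
  have disjF: "pairwise disjnt F" using insert.prems(2) by (auto simp: pairwise_insert)
  let ?P = "\<lambda>\<omega>. \<Prod>e\<in>F. (\<Prod>h\<in>e. X h \<omega>) - cum m e"
  let ?k = "\<lambda>B. if B \<in> F then 0 else cum m B"
  have mF: "all_moments M (\<lambda>\<omega>. (\<Prod>h\<in>e'. X h \<omega>) - cum m e')" if "e' \<in> F" for e'
    using insert.prems(6) that by (intro all_moments_diff all_moments_prod all_moments_const) auto
  have int: "integrable M (\<lambda>\<omega>. ?P \<omega> * (\<Prod>h\<in>T. X h \<omega>))" if "T \<subseteq> e \<union> S" for T
    using insert.prems(6) that mF
    by (intro all_moments_integrable[OF all_moments_mult] all_moments_prod) auto
  have "expectation (\<lambda>\<omega>. (\<Prod>e\<in>insert e F. (\<Prod>h\<in>e. X h \<omega>) - cum m e) * (\<Prod>h\<in>S. X h \<omega>))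
     = expectation (\<lambda>\<omega>. ?P \<omega> * (\<Prod>h\<in>e \<union> S. X h \<omega>) - cum m e * (?P \<omega> * (\<Prod>h\<in>S. X h \<omega>)))"
    using insert.hyps insert.prems(4) e
    by (intro Bochner_Integration.integral_cong refl) (simp add: prod.union_disjoint algebra_simps)
  also have "\<dots> = expectation (\<lambda>\<omega>. ?P \<omega> * (\<Prod>h\<in>e \<union> S. X h \<omega>)) - cum m e * expectation (\<lambda>\<omega>. ?P \<omega> * (\<Prod>h\<in>S. X h \<omega>))"
    using int by (subst Bochner_Integration.integral_diff) auto
  also have "expectation (\<lambda>\<omega>. ?P \<omega> * (\<Prod>h\<in>e \<union> S. X h \<omega>)) = psum ?k (\<Union>F \<union> (e \<union> S))"
    using insert.prems e disjF by (intro insert.IH) auto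
  also have "expectation (\<lambda>\<omega>. ?P \<omega> * (\<Prod>h\<in>S. X h \<omega>)) = psum ?k (\<Union>F \<union> S)"
    using insert.prems e disjF by (intro insert.IH) auto
  also have "psum ?k (\<Union>F \<union> (e \<union> S)) - cum m e * psum ?k (\<Union>F \<union> S) = psum (?k(e := 0)) (\<Union>F \<union> (e \<union> S))"
  proof -
    have "\<Union>F \<union> (e \<union> S) - e = \<Union>F \<union> S" using e by auto
    moreover have "psum (?k(e := 0)) (\<Union>F \<union> (e \<union> S))
        = psum ?k (\<Union>F \<union> (e \<union> S)) - ?k e * psum ?k (\<Union>F \<union> (e \<union> S) - e)"
      using e insert.prems(4) by (intro psum_fun_upd_0) auto
    ultimately show ?thesis using insert.hyps(2) by simp
  qed
  also have "\<dots> = psum (\<lambda>B. if B \<in> insert e F then 0 else cum m B) (\<Union>(insert e F) \<union> S)"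
  proof -
    have "\<Union>F \<union> (e \<union> S) = \<Union>(insert e F) \<union> S" by auto
    moreover have "?k(e := 0) = (\<lambda>B. if B \<in> insert e F then 0 else cum m B)" by (auto simp: fun_eq_iff)
    ultimately show ?thesis by simp
  qed
  finally show ?case .
qed

text \<open>By \<open>psum_no_mixing\<close> the product on the left is the sum over the partitions
  without a mixed block, so these cancel; on a partition with a mixed block the cut-off product is
  0.\<close>

lemma psum_nonmixing_diff_le:
  fixes \<kappa> :: "'h set \<Rightarrow> real"
  assumes "finite H1" "finite H2" "H1 \<inter> H2 = {}"
  shows "\<bar>psum \<kappa> (H1 \<union> H2) - psum \<kappa> H1 * psum \<kappa> H2\<bar>
    \<le> (\<Sum>P\<in>{P. partition_on (H1 \<union> H2) P \<and> (\<exists>B\<in>P. B \<inter> H1 \<noteq> {} \<and> B \<inter> H2 \<noteq> {})}. \<Prod>B\<in>P. \<bar>\<kappa> B\<bar>)"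
proof -
  let ?H = "H1 \<union> H2" let ?k = "\<lambda>B. if B \<subseteq> H1 \<or> B \<subseteq> H2 then \<kappa> B else 0"
  let ?C = "{P. partition_on ?H P \<and> (\<exists>B\<in>P. B \<inter> H1 \<noteq> {} \<and> B \<inter> H2 \<noteq> {})}"
  have fin: "finite (partitions ?H)" using assms by (intro finitely_many_partition_on) auto
  have "psum \<kappa> ?H - psum \<kappa> H1 * psum \<kappa> H2 = (\<Sum>P\<in>partitions ?H. (\<Prod>B\<in>P. \<kappa> B) - (\<Prod>B\<in>P. ?k B))"
    unfolding psum_no_mixing[OF assms, symmetric] by (simp add: psum_def sum_subtractf)
  also have "\<dots> = (\<Sum>P\<in>?C. (\<Prod>B\<in>P. \<kappa> B) - (\<Prod>B\<in>P. ?k B))"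
  proof (rule sum.mono_neutral_right[OF fin])
    show "?C \<subseteq> partitions ?H" by (rule Collect_mono) (rule impI, erule conjunct1)
    show "\<forall>P\<in>partitions ?H - ?C. (\<Prod>B\<in>P. \<kappa> B) - (\<Prod>B\<in>P. ?k B) = 0"
    proof
      fix P assume P: "P \<in> partitions ?H - ?C"
      have "(\<Prod>B\<in>P. \<kappa> B) = (\<Prod>B\<in>P. ?k B)"
      proof (intro prod.cong refl)
        fix B assume B: "B \<in> P"
        then have "B \<subseteq> H1 \<union> H2" using P partition_on_memD(1)[of ?H P B] by auto
        moreover have "B \<inter> H1 = {} \<or> B \<inter> H2 = {}" using P B by auto
        ultimately have "B \<subseteq> H1 \<or> B \<subseteq> H2" by blast
        then show "\<kappa> B = ?k B" by simp
      qed
      then show "(\<Prod>B\<in>P. \<kappa> B) - (\<Prod>B\<in>P. ?k B) = 0" by (simp only: diff_self)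
    qed
  qed
  finally have eq: "psum \<kappa> ?H - psum \<kappa> H1 * psum \<kappa> H2 = (\<Sum>P\<in>?C. (\<Prod>B\<in>P. \<kappa> B) - (\<Prod>B\<in>P. ?k B))" .
  have "\<bar>psum \<kappa> ?H - psum \<kappa> H1 * psum \<kappa> H2\<bar> \<le> (\<Sum>P\<in>?C. \<bar>(\<Prod>B\<in>P. \<kappa> B) - (\<Prod>B\<in>P. ?k B)\<bar>)"
    unfolding eq by (rule sum_abs)
  also have "\<dots> = (\<Sum>P\<in>?C. \<Prod>B\<in>P. \<bar>\<kappa> B\<bar>)"
  proof (intro sum.cong refl)
    fix P assume P: "P \<in> ?C"
    then obtain B where B: "B \<in> P" "B \<inter> H1 \<noteq> {}" "B \<inter> H2 \<noteq> {}" by blast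
    have "partition_on ?H P" using P by blast
    then have "finite P" using finite_elements[of ?H P] assms(1,2) by simp
    moreover have "\<not> B \<subseteq> H1" "\<not> B \<subseteq> H2" using B assms(3) by blast+
    then have "?k B = 0" by simp
    ultimately have "(\<Prod>B\<in>P. ?k B) = 0" using B(1) by (intro prod_zero bexI[of _ B])
    then show "\<bar>(\<Prod>B\<in>P. \<kappa> B) - (\<Prod>B\<in>P. ?k B)\<bar> = (\<Prod>B\<in>P. \<bar>\<kappa> B\<bar>)" by (simp add: abs_prod)
  qed
  finally show ?thesis .
qed

section \<open>Moments and cumulants of independent stationary rows\<close>

locale copies = prob_space M for M :: "'a measure" +
  fixes Z :: "int \<Rightarrow> 'a \<Rightarrow> real" and Zc :: "nat \<Rightarrow> int \<Rightarrow> 'a \<Rightarrow> real"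
  assumes Z_meas: "\<And>j. Z j \<in> borel_measurable M"
    and Z_stat: "\<And>s. distr M (PiM UNIV (\<lambda>_::int. borel)) (\<lambda>\<omega> j. Z (j + s) \<omega>)
                     = distr M (PiM UNIV (\<lambda>_::int. borel)) (\<lambda>\<omega> j. Z j \<omega>)"
    and Z_moments: "\<And>k::nat. k \<ge> 1 \<Longrightarrow> integrable M (\<lambda>\<omega>. \<bar>Z 0 \<omega>\<bar> ^ k)"
    and Z_mean: "expectation (Z 0) = 0"
    and Z_cum: "\<And>r::nat. r \<ge> 1 \<Longrightarrow>
        (\<lambda>js. \<bar>joint_cumulant M (Z 0 # map Z js)\<bar>) summable_on {js :: int list. length js = r}"
    and Zc_meas: "\<And>i j. Zc i j \<in> borel_measurable M"
    and Zc_law: "\<And>i. i \<ge> 1 \<Longrightarrow> distr M (PiM UNIV (\<lambda>_::int. borel)) (\<lambda>\<omega> j. Zc i j \<omega>)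
                     = distr M (PiM UNIV (\<lambda>_::int. borel)) (\<lambda>\<omega> j. Z j \<omega>)"
    and Zc_indep: "indep_vars (\<lambda>_. PiM UNIV (\<lambda>_::int. borel)) (\<lambda>i \<omega> j. Zc i j \<omega>) {1..}"
begin

abbreviation "seqM \<equiv> PiM UNIV (\<lambda>_::int. borel :: real measure)"

lemma measurable_seq:
  assumes "\<And>j. V j \<in> borel_measurable M"
  shows "(\<lambda>\<omega> j. V j \<omega>) \<in> M \<rightarrow>\<^sub>M seqM"
  using assms by (intro measurable_PiM_single') auto

lemma expectation_shift:
  fixes F :: "(int \<Rightarrow> real) \<Rightarrow> real"
  assumes "F \<in> borel_measurable seqM"
  shows "expectation (\<lambda>\<omega>. F (\<lambda>j. Z (j + s) \<omega>)) = expectation (\<lambda>\<omega>. F (\<lambda>j. Z j \<omega>))"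
  using integral_distr[OF measurable_seq[of "\<lambda>j. Z (j + s)"] assms]
    integral_distr[OF measurable_seq[of Z] assms] Z_meas Z_stat by simp

lemma expectation_copy:
  fixes F :: "(int \<Rightarrow> real) \<Rightarrow> real"
  assumes "F \<in> borel_measurable seqM" "1 \<le> r"
  shows "expectation (\<lambda>\<omega>. F (\<lambda>j. Zc r j \<omega>)) = expectation (\<lambda>\<omega>. F (\<lambda>j. Z j \<omega>))"
  using integral_distr[OF measurable_seq[of "Zc r"] assms(1)]
    integral_distr[OF measurable_seq[of Z] assms(1)] Z_meas Zc_meas Zc_law[OF assms(2)] by simp

lemma all_moments_Z: "all_moments M (Z j)"
proof -
  have "integrable M (\<lambda>\<omega>. \<bar>Z j \<omega>\<bar> ^ k)" for k
  proof (cases "k = 0")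
    case False
    have m: "(\<lambda>x. \<bar>x 0\<bar> ^ k) \<in> borel_measurable seqM" by measurable
    have "integrable M (\<lambda>\<omega>. \<bar>Z 0 \<omega>\<bar> ^ k)" using Z_moments False by simp
    then have "integrable (distr M seqM (\<lambda>\<omega> j. Z j \<omega>)) (\<lambda>x. \<bar>x 0\<bar> ^ k)"
      using integrable_distr_eq[OF measurable_seq[of Z] m] Z_meas by simp
    then have "integrable (distr M seqM (\<lambda>\<omega> i. Z (i + j) \<omega>)) (\<lambda>x. \<bar>x 0\<bar> ^ k)"
      by (simp add: Z_stat)
    then show ?thesis
      using integrable_distr_eq[OF measurable_seq[of "\<lambda>i. Z (i + j)"] m] Z_meas by simp
  qed simp
  then show ?thesis using Z_meas by (simp add: all_moments_def)
qed

lemma all_moments_Zc: "1 \<le> r \<Longrightarrow> all_moments M (Zc r j)"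
proof -
  assume r: "1 \<le> r"
  have "integrable M (\<lambda>\<omega>. \<bar>Zc r j \<omega>\<bar> ^ k)" for k
  proof -
    have m: "(\<lambda>x. \<bar>x j\<bar> ^ k) \<in> borel_measurable seqM" by measurable
    have "integrable (distr M seqM (\<lambda>\<omega> j. Z j \<omega>)) (\<lambda>x. \<bar>x j\<bar> ^ k)"
      using integrable_distr_eq[OF measurable_seq[of Z] m] Z_meas all_moments_Z[of j]
      by (simp add: all_moments_def)
    then have "integrable (distr M seqM (\<lambda>\<omega> j. Zc r j \<omega>)) (\<lambda>x. \<bar>x j\<bar> ^ k)"
      by (simp add: Zc_law[OF r])
    then show ?thesis
      using integrable_distr_eq[OF measurable_seq[of "Zc r"] m] Zc_meas by simp
  qed
  then show ?thesis using Zc_meas by (simp add: all_moments_def)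
qed

definition momZ :: "('h \<Rightarrow> int) \<Rightarrow> 'h set \<Rightarrow> real" where
  "momZ f S = expectation (\<lambda>\<omega>. \<Prod>h\<in>S. Z (f h) \<omega>)"

lemma momZ_shift: "momZ (\<lambda>h. f h + s) S = momZ f S"
  unfolding momZ_def using expectation_shift[of "\<lambda>x. \<Prod>h\<in>S. x (f h)" s] by simp

text \<open>The entry of the data matrix at the state (column, row), without the factor
  \<open>1 / sqrt n\<close>.\<close>

definition X :: "nat \<times> nat \<Rightarrow> 'a \<Rightarrow> real" where
  "X s = Zc (snd s) (int (fst s))"

definition mom :: "('h \<Rightarrow> nat \<times> nat) \<Rightarrow> 'h set \<Rightarrow> real" where
  "mom \<sigma> S = expectation (\<lambda>\<omega>. \<Prod>h\<in>S. X (\<sigma> h) \<omega>)"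

lemma all_moments_X: "1 \<le> snd s \<Longrightarrow> all_moments M (X s)"
  by (simp add: X_def all_moments_Zc)

lemma mom_empty [simp]: "mom \<sigma> {} = 1"
  by (simp add: mom_def prob_space)

lemma mom_one_row:
  assumes "1 \<le> r" "\<And>h. h \<in> S \<Longrightarrow> snd (\<sigma> h) = r"
  shows "mom \<sigma> S = momZ (\<lambda>h. int (fst (\<sigma> h))) S"
proof -
  have "mom \<sigma> S = expectation (\<lambda>\<omega>. \<Prod>h\<in>S. Zc r (int (fst (\<sigma> h))) \<omega>)"
    unfolding mom_def X_def using assms by (intro Bochner_Integration.integral_cong refl prod.cong) auto
  also have "\<dots> = momZ (\<lambda>h. int (fst (\<sigma> h))) S"
    unfolding momZ_def using expectation_copy[of "\<lambda>x. \<Prod>h\<in>S. x (int (fst (\<sigma> h)))" r] assms by simp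
  finally show ?thesis .
qed

lemma mom_prod_rows:
  assumes "finite S" "finite T" "(\<lambda>h. snd (\<sigma> h)) ` S \<subseteq> T" "T \<subseteq> {1..}"
  shows "mom \<sigma> S = (\<Prod>r\<in>T. mom \<sigma> {h\<in>S. snd (\<sigma> h) = r})"
proof -
  let ?Y = "\<lambda>r \<omega>. \<Prod>h\<in>{h\<in>S. snd (\<sigma> h) = r}. Zc r (int (fst (\<sigma> h))) \<omega>"
  have "indep_vars (\<lambda>_. seqM) (\<lambda>i \<omega> j. Zc i j \<omega>) T"
    using Zc_indep assms(4) by (rule indep_vars_subset)
  then have ind: "indep_vars (\<lambda>_. borel) ?Y T"
    by (rule indep_vars_compose2[where Y = "\<lambda>r x. \<Prod>h\<in>{h\<in>S. snd (\<sigma> h) = r}. x (int (fst (\<sigma> h)))"]) measurable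
  have intY: "integrable M (?Y r)" if "r \<in> T" for r
    using that assms(4) by (intro all_moments_integrable all_moments_prod all_moments_Zc) auto
  have Y: "(\<Prod>h\<in>{h\<in>S. snd (\<sigma> h) = r}. X (\<sigma> h) \<omega>) = ?Y r \<omega>" for r \<omega>
    by (intro prod.cong refl) (auto simp: X_def)
  have "mom \<sigma> S = expectation (\<lambda>\<omega>. \<Prod>r\<in>T. ?Y r \<omega>)"
    unfolding mom_def using prod.group[OF assms(1-3), of "\<lambda>h. X (\<sigma> h) _"] by (simp add: Y)
  also have "\<dots> = (\<Prod>r\<in>T. expectation (?Y r))"
    using assms(2) ind intY by (rule indep_vars_lebesgue_integral)
  also have "\<dots> = (\<Prod>r\<in>T. mom \<sigma> {h\<in>S. snd (\<sigma> h) = r})" by (simp add: mom_def Y)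
  finally show ?thesis .
qed

lemma mom_split_row:
  assumes "finite S" "\<And>h. h \<in> S \<Longrightarrow> 1 \<le> snd (\<sigma> h)"
  shows "mom \<sigma> S = mom \<sigma> {h\<in>S. snd (\<sigma> h) = r} * mom \<sigma> {h\<in>S. snd (\<sigma> h) \<noteq> r}"
proof (cases "r \<in> (\<lambda>h. snd (\<sigma> h)) ` S")
  case True
  let ?T = "(\<lambda>h. snd (\<sigma> h)) ` S" and ?S = "{h\<in>S. snd (\<sigma> h) \<noteq> r}"
  have T: "finite ?T" "?T \<subseteq> {1..}" using assms by auto
  have "mom \<sigma> S = mom \<sigma> {h\<in>S. snd (\<sigma> h) = r} * (\<Prod>r'\<in>?T - {r}. mom \<sigma> {h\<in>S. snd (\<sigma> h) = r'})"
    using mom_prod_rows[OF assms(1) T(1) _ T(2)] True T by (simp add: prod.remove)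
  moreover have "mom \<sigma> ?S = (\<Prod>r'\<in>?T. mom \<sigma> {h\<in>?S. snd (\<sigma> h) = r'})"
    using assms(1) T by (intro mom_prod_rows) auto
  moreover have "(\<Prod>r'\<in>?T. mom \<sigma> {h\<in>?S. snd (\<sigma> h) = r'})
      = mom \<sigma> {h\<in>?S. snd (\<sigma> h) = r} * (\<Prod>r'\<in>?T - {r}. mom \<sigma> {h\<in>?S. snd (\<sigma> h) = r'})"
    using True T by (intro prod.remove) auto
  moreover have "{h\<in>?S. snd (\<sigma> h) = r} = {}" by auto
  moreover have "(\<Prod>r'\<in>?T - {r}. mom \<sigma> {h\<in>?S. snd (\<sigma> h) = r'}) = (\<Prod>r'\<in>?T - {r}. mom \<sigma> {h\<in>S. snd (\<sigma> h) = r'})"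
    by (intro prod.cong refl arg_cong[where f = "mom \<sigma>"]) auto
  ultimately show ?thesis by simp
next
  case False
  then have "{h\<in>S. snd (\<sigma> h) = r} = {}" "{h\<in>S. snd (\<sigma> h) \<noteq> r} = S" by auto
  then have "mom \<sigma> {h\<in>S. snd (\<sigma> h) = r} = 1" "mom \<sigma> {h\<in>S. snd (\<sigma> h) \<noteq> r} = mom \<sigma> S"
    by (simp_all only: mom_empty)
  then show ?thesis by simp
qed

text \<open>Different rows are independent, so the moments factorise over rows and a block touching
  two rows has cumulant 0. In effect a block lives in a single row, and one of its states fixes the
  row of all its points.\<close>

lemma cum_mom_eq_0:
  assumes "finite B" "\<And>h. h \<in> B \<Longrightarrow> 1 \<le> snd (\<sigma> h)" "g \<in> B" "h \<in> B" "snd (\<sigma> g) \<noteq> snd (\<sigma> h)"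
  shows "cum (mom \<sigma>) B = 0"
proof -
  let ?H1 = "{x\<in>B. snd (\<sigma> x) = snd (\<sigma> g)}" and ?H2 = "{x\<in>B. snd (\<sigma> x) \<noteq> snd (\<sigma> g)}"
  show ?thesis
  proof (rule cum_mixing_eq_0[of ?H1 ?H2])
    fix S assume S: "S \<subseteq> ?H1 \<union> ?H2"
    have "S \<inter> ?H1 = {h\<in>S. snd (\<sigma> h) = snd (\<sigma> g)}" "S \<inter> ?H2 = {h\<in>S. snd (\<sigma> h) \<noteq> snd (\<sigma> g)}" using S by auto
    moreover have "finite S" using S assms(1) finite_subset[of S B] by auto
    ultimately show "mom \<sigma> S = mom \<sigma> (S \<inter> ?H1) * mom \<sigma> (S \<inter> ?H2)"
      using mom_split_row[of S \<sigma> "snd (\<sigma> g)"] S assms(2) by auto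
  qed (use assms in auto)
qed

lemma cum_mom_singleton: "1 \<le> snd (\<sigma> h) \<Longrightarrow> cum (mom \<sigma>) {h} = 0"
proof -
  assume h: "1 \<le> snd (\<sigma> h)"
  have "cum (mom \<sigma>) {h} = momZ (\<lambda>h. int (fst (\<sigma> h))) {h}"
    unfolding cum_singleton using h by (intro mom_one_row) auto
  also have "\<dots> = expectation (Z (0 + int (fst (\<sigma> h))))" by (simp add: momZ_def)
  also have "\<dots> = momZ (\<lambda>_. 0 + int (fst (\<sigma> h))) {h}" by (simp add: momZ_def)
  also have "\<dots> = momZ (\<lambda>_. 0) {h}" by (rule momZ_shift)
  also have "\<dots> = 0" using Z_mean by (simp add: momZ_def)
  finally show ?thesis .
qed

text \<open>Stationarity moves the time of the first point to 0, which is the normal form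
  \<open>Z 0 # map Z js\<close> in which the cumulants are assumed summable.\<close>

lemma cum_momZ_list:
  assumes "distinct (h0 # hs)"
  shows "cum (momZ f) (set (h0 # hs)) = joint_cumulant M (Z 0 # map Z (map (\<lambda>h. f h - f h0) hs))"
proof -
  let ?hs = "h0 # hs" let ?k = "length ?hs"
  let ?Xs = "map (\<lambda>h. Z (f h - f h0)) ?hs"
  have eq: "Z 0 # map Z (map (\<lambda>h. f h - f h0) hs) = ?Xs" by simp
  have inj: "inj_on ((!) ?hs) {..<?k}" using assms by (auto simp: inj_on_def nth_eq_iff_index_eq)
  have img: "set ?hs = (!) ?hs ` {..<?k}" unfolding set_conv_nth by auto
  have "cum (momZ f) (set ?hs) = cum (\<lambda>B. momZ f ((!) ?hs ` B)) {..<?k}"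
    unfolding img using inj by (intro cum_image) auto
  also have "\<dots> = cum (\<lambda>B. expectation (\<lambda>\<omega>. \<Prod>j\<in>B. (?Xs ! j) \<omega>)) {..<?k}"
  proof (rule cum_cong)
    fix B assume B: "B \<subseteq> {..<?k}"
    have "momZ f ((!) ?hs ` B) = momZ (\<lambda>h. f h + (- f h0)) ((!) ?hs ` B)" by (rule momZ_shift[symmetric])
    also have "\<dots> = expectation (\<lambda>\<omega>. \<Prod>j\<in>B. Z (f (?hs ! j) - f h0) \<omega>)"
      unfolding momZ_def using inj_on_subset[OF inj B] by (subst prod.reindex) (auto simp: comp_def)
    also have "\<dots> = expectation (\<lambda>\<omega>. \<Prod>j\<in>B. (?Xs ! j) \<omega>)"
    proof (intro Bochner_Integration.integral_cong refl prod.cong)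
      fix j \<omega> assume "j \<in> B"
      then have "j < length ?hs" using B by auto
      then have "?Xs ! j = Z (f (?hs ! j) - f h0)" by (rule nth_map)
      then show "Z (f (?hs ! j) - f h0) \<omega> = (?Xs ! j) \<omega>" by simp
    qed
    finally show "momZ f ((!) ?hs ` B) = expectation (\<lambda>\<omega>. \<Prod>j\<in>B. (?Xs ! j) \<omega>)" .
  qed auto
  also have "\<dots> = joint_cumulant M ?Xs"
    using prob_space_axioms all_moments_Z by (subst joint_cumulant_eq_cum) auto
  finally show ?thesis unfolding eq .
qed

lemma cum_mom_list:
  assumes "distinct (h0 # hs)" "1 \<le> r" "\<And>h. h \<in> set (h0 # hs) \<Longrightarrow> snd (\<sigma> h) = r"
  shows "cum (mom \<sigma>) (set (h0 # hs))
    = joint_cumulant M (Z 0 # map Z (map (\<lambda>h. int (fst (\<sigma> h)) - int (fst (\<sigma> h0))) hs))"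
proof -
  have "cum (mom \<sigma>) (set (h0 # hs)) = cum (momZ (\<lambda>h. int (fst (\<sigma> h)))) (set (h0 # hs))"
  proof (rule cum_cong)
    fix B assume "B \<subseteq> set (h0 # hs)"
    then show "mom \<sigma> B = momZ (\<lambda>h. int (fst (\<sigma> h))) B" using assms by (intro mom_one_row[of r]) auto
  qed auto
  then show ?thesis using cum_momZ_list[OF assms(1)] by simp
qed

definition cum_norm :: "nat \<Rightarrow> real" where
  "cum_norm r = (\<Sum>\<^sub>\<infinity>js\<in>{js :: int list. length js = r}. \<bar>joint_cumulant M (Z 0 # map Z js)\<bar>)"

lemma cum_norm_nonneg: "0 \<le> cum_norm r"
  unfolding cum_norm_def by (intro infsum_nonneg) auto

lemma sum_joint_cumulant_le:
  assumes "finite J" "J \<subseteq> {js :: int list. length js = r}" "1 \<le> r"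
  shows "(\<Sum>js\<in>J. \<bar>joint_cumulant M (Z 0 # map Z js)\<bar>) \<le> cum_norm r"
  unfolding cum_norm_def using assms Z_cum by (intro finite_sum_le_infsum) auto

text \<open>With the state at \<open>h0\<close> fixed, only assignments within its row count, and
  these are determined by the list of their column differences to \<open>h0\<close>. So the sum is
  part of the summable series of cumulants of order \<open>card B\<close>. This provides the block
  constant \<open>K\<close> of the network.\<close>

lemma sum_cum_mom_le:
  assumes B: "finite B" "2 \<le> card B" "h0 \<in> B" and s: "s \<in> {1..p} \<times> {1..n}"
  shows "(\<Sum>\<sigma>\<in>{\<sigma>\<in>PiE B (\<lambda>_. {1..p} \<times> {1..n}). \<sigma> h0 = s}. \<bar>cum (mom \<sigma>) B\<bar>) \<le> cum_norm (card B - 1)"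
proof -
  let ?D = "{\<sigma>\<in>PiE B (\<lambda>_. {1..p} \<times> {1..n}). \<sigma> h0 = s}"
  let ?E = "{\<sigma>\<in>?D. \<forall>h\<in>B. snd (\<sigma> h) = snd s}"
  obtain hs where hs: "set hs = B - {h0}" "distinct hs" using finite_distinct_list[of "B - {h0}"] B by auto
  have Bhs: "B = set (h0 # hs)" "distinct (h0 # hs)" using hs B by auto
  have len: "length hs = card B - 1" using hs B by (metis card_Diff_singleton distinct_card)
  let ?j = "\<lambda>\<sigma>. map (\<lambda>h. int (fst (\<sigma> h)) - int (fst (\<sigma> h0))) hs"
  have "finite (PiE B (\<lambda>_. {1..p} \<times> {1..n}))" using B by (intro finite_PiE) auto
  then have finD: "finite ?D" by simp
  have "(\<Sum>\<sigma>\<in>?D. \<bar>cum (mom \<sigma>) B\<bar>) = (\<Sum>\<sigma>\<in>?E. \<bar>cum (mom \<sigma>) B\<bar>)"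
  proof (rule sum.mono_neutral_right[OF finD])
    show "\<forall>\<sigma>\<in>?D - ?E. \<bar>cum (mom \<sigma>) B\<bar> = 0"
    proof
      fix \<sigma> assume "\<sigma> \<in> ?D - ?E"
      then obtain h where \<sigma>: "\<sigma> \<in> PiE B (\<lambda>_. {1..p} \<times> {1..n})" "\<sigma> h0 = s" "h \<in> B" "snd (\<sigma> h) \<noteq> snd s" by auto
      have "1 \<le> snd (\<sigma> g)" if "g \<in> B" for g
      proof -
        have "\<sigma> g \<in> {1..p} \<times> {1..n}" using \<sigma>(1) that by auto
        then show ?thesis by auto
      qed
      then have "cum (mom \<sigma>) B = 0" using \<sigma> B by (intro cum_mom_eq_0[of B \<sigma> h h0]) auto
      then show "\<bar>cum (mom \<sigma>) B\<bar> = 0" by simp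
    qed
  qed auto
  also have "\<dots> = (\<Sum>\<sigma>\<in>?E. \<bar>joint_cumulant M (Z 0 # map Z (?j \<sigma>))\<bar>)"
  proof (intro sum.cong refl)
    fix \<sigma> assume "\<sigma> \<in> ?E"
    then have "cum (mom \<sigma>) (set (h0 # hs)) = joint_cumulant M (Z 0 # map Z (?j \<sigma>))"
      using s Bhs by (intro cum_mom_list[where r = "snd s"]) auto
    then show "\<bar>cum (mom \<sigma>) B\<bar> = \<bar>joint_cumulant M (Z 0 # map Z (?j \<sigma>))\<bar>" using Bhs by simp
  qed
  also have "\<dots> = (\<Sum>js\<in>?j ` ?E. \<bar>joint_cumulant M (Z 0 # map Z js)\<bar>)"
  proof (subst sum.reindex)
    show "inj_on ?j ?E"
    proof (rule inj_onI)
      fix \<sigma> \<tau> assume \<sigma>: "\<sigma> \<in> ?E" and \<tau>: "\<tau> \<in> ?E" and e: "?j \<sigma> = ?j \<tau>"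
      show "\<sigma> = \<tau>"
      proof (rule PiE_ext[of \<sigma> B "\<lambda>_. {1..p} \<times> {1..n}"])
        fix h assume h: "h \<in> B"
        have "fst (\<sigma> h) = fst (\<tau> h)"
        proof (cases "h = h0")
          case False
          then have "int (fst (\<sigma> h)) - int (fst (\<sigma> h0)) = int (fst (\<tau> h)) - int (fst (\<tau> h0))"
            using e h hs by (auto simp: map_eq_conv)
          then show ?thesis using \<sigma> \<tau> by auto
        qed (use \<sigma> \<tau> in auto)
        then show "\<sigma> h = \<tau> h" using \<sigma> \<tau> h by (auto simp: prod_eq_iff)
      qed (use \<sigma> \<tau> in auto)
    qed
  qed (simp add: comp_def)
  also have "\<dots> \<le> cum_norm (card B - 1)"
  proof (rule sum_joint_cumulant_le)
    show "finite (?j ` ?E)" by (rule finite_imageI, rule finite_subset[OF _ finD]) auto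
  qed (use B len in auto)
  finally show ?thesis .
qed

lemma cum_mom_pair_le:
  assumes "x \<noteq> y" "1 \<le> snd (\<sigma> x)" "1 \<le> snd (\<sigma> y)"
  shows "\<bar>cum (mom \<sigma>) {x, y}\<bar> \<le> \<bar>joint_cumulant M [Z 0, Z (int (fst (\<sigma> x)) - int (fst (\<sigma> y)))]\<bar>"
proof (cases "snd (\<sigma> x) = snd (\<sigma> y)")
  case True
  have "cum (mom \<sigma>) (set [y, x]) = joint_cumulant M (Z 0 # map Z (map (\<lambda>h. int (fst (\<sigma> h)) - int (fst (\<sigma> y))) [x]))"
    using assms True by (intro cum_mom_list[where r = "snd (\<sigma> x)"]) auto
  then show ?thesis by (simp add: insert_commute)
next
  case False
  then have "cum (mom \<sigma>) {x, y} = 0" using assms by (intro cum_mom_eq_0[of _ _ x y]) auto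
  then show ?thesis by simp
qed

lemma sum_joint_cumulant_pair_le:
  assumes "finite F"
  shows "(\<Sum>d\<in>F. \<bar>joint_cumulant M [Z 0, Z d]\<bar>) \<le> cum_norm 1"
proof -
  have "(\<Sum>d\<in>F. \<bar>joint_cumulant M [Z 0, Z d]\<bar>) = (\<Sum>js\<in>(\<lambda>d. [d]) ` F. \<bar>joint_cumulant M (Z 0 # map Z js)\<bar>)"
    by (subst sum.reindex) (auto simp: inj_on_def)
  also have "\<dots> \<le> cum_norm 1" using assms by (intro sum_joint_cumulant_le) auto
  finally show ?thesis .
qed

text \<open>One constant for all relevant block sizes; the summand 1 makes its powers
  increasing.\<close>

definition cum_bound :: "nat \<Rightarrow> real" where
  "cum_bound k = 1 + (\<Sum>r\<le>k. cum_norm r)"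

lemma cum_bound_ge: "1 \<le> cum_bound k" "r \<le> k \<Longrightarrow> cum_norm r \<le> cum_bound k"
proof -
  show "1 \<le> cum_bound k" unfolding cum_bound_def using cum_norm_nonneg by (simp add: sum_nonneg)
  assume "r \<le> k"
  then have "cum_norm r \<le> (\<Sum>r\<le>k. cum_norm r)"
    using cum_norm_nonneg by (intro member_le_sum) auto
  then show "cum_norm r \<le> cum_bound k" by (simp add: cum_bound_def)
qed

text \<open>Cut off outside the index box because the bounds in \<open>crossing\<close> are required
  for arbitrary states, whereas the rows of \<open>Zc\<close> are controlled only from 1 on.\<close>

definition abs_cum :: "nat \<Rightarrow> nat \<Rightarrow> 'h set \<Rightarrow> ('h \<Rightarrow> nat \<times> nat) \<Rightarrow> real" where
  "abs_cum p n B \<sigma> = (if \<forall>h\<in>B. \<sigma> h \<in> {1..p} \<times> {1..n} then \<bar>cum (mom \<sigma>) B\<bar> else 0)"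

lemma abs_cum_nonneg: "0 \<le> abs_cum p n B \<sigma>"
  by (simp add: abs_cum_def)

lemma abs_cum_eq: "\<sigma> \<in> PiE H (\<lambda>_. {1..p} \<times> {1..n}) \<Longrightarrow> B \<subseteq> H \<Longrightarrow> abs_cum p n B \<sigma> = \<bar>cum (mom \<sigma>) B\<bar>"
proof -
  assume "\<sigma> \<in> PiE H (\<lambda>_. {1..p} \<times> {1..n})" "B \<subseteq> H"
  then have "\<forall>h\<in>B. \<sigma> h \<in> {1..p} \<times> {1..n}" by auto
  then show ?thesis unfolding abs_cum_def by (rule if_P)
qed

lemma abs_cum_cong:
  assumes "finite B" "B \<noteq> {}" "\<And>h. h \<in> B \<Longrightarrow> \<sigma> h = \<sigma>' h"
  shows "abs_cum p n B \<sigma> = abs_cum p n B \<sigma>'"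
proof -
  have "mom \<sigma> C = mom \<sigma>' C" if "C \<subseteq> B" for C
    unfolding mom_def using that assms(3) by (intro Bochner_Integration.integral_cong refl prod.cong) auto
  then have "cum (mom \<sigma>) B = cum (mom \<sigma>') B" using assms by (intro cum_cong) auto
  then show ?thesis using assms(3) by (simp add: abs_cum_def)
qed

lemma sum_abs_cum_le:
  assumes "finite B" "2 \<le> card B" "h \<in> B" "s \<in> {1..p} \<times> {1..n}" "card B \<le> k"
  shows "(\<Sum>\<sigma>\<in>{\<sigma>\<in>PiE B (\<lambda>_. {1..p} \<times> {1..n}). \<sigma> h = s}. abs_cum p n B \<sigma>) \<le> cum_bound k"
proof -
  have "(\<Sum>\<sigma>\<in>{\<sigma>\<in>PiE B (\<lambda>_. {1..p} \<times> {1..n}). \<sigma> h = s}. abs_cum p n B \<sigma>)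
      = (\<Sum>\<sigma>\<in>{\<sigma>\<in>PiE B (\<lambda>_. {1..p} \<times> {1..n}). \<sigma> h = s}. \<bar>cum (mom \<sigma>) B\<bar>)"
    by (intro sum.cong refl abs_cum_eq[of _ B]) auto
  also have "\<dots> \<le> cum_norm (card B - 1)" by (rule sum_cum_mom_le[OF assms(1-4)])
  also have "\<dots> \<le> cum_bound k" using assms(5) by (intro cum_bound_ge) auto
  finally show ?thesis .
qed

lemma abs_cum_pair_le:
  assumes "x \<noteq> y"
  shows "abs_cum p n {x, y} \<sigma> \<le> \<bar>joint_cumulant M [Z 0, Z (int (fst (\<sigma> x)) - int (fst (\<sigma> y)))]\<bar>"
proof (cases "\<forall>h\<in>{x,y}. \<sigma> h \<in> {1..p} \<times> {1..n}")
  case True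
  then have "1 \<le> snd (\<sigma> x)" "1 \<le> snd (\<sigma> y)" by (auto simp: mem_Times_iff)
  then have "\<bar>cum (mom \<sigma>) {x, y}\<bar> \<le> \<bar>joint_cumulant M [Z 0, Z (int (fst (\<sigma> x)) - int (fst (\<sigma> y)))]\<bar>"
    by (rule cum_mom_pair_le[OF assms])
  then show ?thesis using True unfolding abs_cum_def by (subst if_P)
next
  case False
  then show ?thesis unfolding abs_cum_def by (subst if_not_P) auto
qed

text \<open>A block of one point has cumulant 0 because the variables are centred, and a block in
  \<open>F\<close> has been set to 0; every other partition keeps its product.\<close>

lemma prod_cum_le_abs_cum:
  assumes \<sigma>: "\<sigma> \<in> PiE H (\<lambda>_. {1..p} \<times> {1..n})" and H: "finite H" and P: "partition_on H P"
  shows "(\<Prod>B\<in>P. \<bar>if B \<in> F then 0 else cum (mom \<sigma>) B\<bar>)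
    \<le> (if (\<forall>B\<in>P. 2 \<le> card B) \<and> P \<inter> F = {} then \<Prod>B\<in>P. abs_cum p n B \<sigma> else 0)"
proof (cases "(\<forall>B\<in>P. 2 \<le> card B) \<and> P \<inter> F = {}")
  case True
  have "(\<Prod>B\<in>P. \<bar>if B \<in> F then 0 else cum (mom \<sigma>) B\<bar>) = (\<Prod>B\<in>P. abs_cum p n B \<sigma>)"
  proof (intro prod.cong refl)
    fix B assume B: "B \<in> P"
    have "abs_cum p n B \<sigma> = \<bar>cum (mom \<sigma>) B\<bar>" by (rule abs_cum_eq[OF \<sigma> partition_on_memD(1)[OF P B]])
    moreover have "B \<notin> F" using True B by auto
    ultimately show "\<bar>if B \<in> F then 0 else cum (mom \<sigma>) B\<bar> = abs_cum p n B \<sigma>" by simp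
  qed
  then show ?thesis using True by simp
next
  case False
  have finP: "finite P" by (rule finite_elements[OF H P])
  have "\<exists>B\<in>P. \<bar>if B \<in> F then 0 else cum (mom \<sigma>) B\<bar> = 0"
  proof (cases "P \<inter> F = {}")
    case True
    then obtain B where B: "B \<in> P" "\<not> 2 \<le> card B" using False by auto
    have BH: "B \<subseteq> H" "B \<noteq> {}" using partition_on_memD[OF P B(1)] by auto
    then have "finite B" using H finite_subset by auto
    then have "card B = 1" using B(2) BH(2) by (metis One_nat_def card_gt_0_iff less_2_cases_iff not_le not_gr_zero)
    then obtain h where h: "B = {h}" by (auto simp: card_1_singleton_iff)
    have "\<sigma> h \<in> {1..p} \<times> {1..n}" using \<sigma> BH h by auto
    then have "1 \<le> snd (\<sigma> h)" by (auto simp: mem_Times_iff)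
    then show ?thesis using B(1) h cum_mom_singleton by (intro bexI[of _ B]) auto
  qed auto
  then have "(\<Prod>B\<in>P. \<bar>if B \<in> F then 0 else cum (mom \<sigma>) B\<bar>) = 0" using finP by (intro prod_zero)
  then show ?thesis using False by (simp add: prod_nonneg abs_cum_nonneg)
qed

definition centred_edge :: "('h \<Rightarrow> nat \<times> nat) \<Rightarrow> 'h set \<Rightarrow> 'a \<Rightarrow> real" where
  "centred_edge \<sigma> e \<omega> = (\<Prod>h\<in>e. X (\<sigma> h) \<omega>) - cum (mom \<sigma>) e"

lemma expectation_centred_edges:
  assumes "finite F" "finite (\<Union>F)" "pairwise disjnt F" "{} \<notin> F" "\<And>h. h \<in> \<Union>F \<Longrightarrow> 1 \<le> snd (\<sigma> h)"
  shows "expectation (\<lambda>\<omega>. \<Prod>e\<in>F. centred_edge \<sigma> e \<omega>) = psum (\<lambda>B. if B \<in> F then 0 else cum (mom \<sigma>) B) (\<Union>F)"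
proof -
  have mom_eq: "(\<lambda>S. expectation (\<lambda>\<omega>. \<Prod>h\<in>S. X (\<sigma> h) \<omega>)) = mom \<sigma>" by (auto simp: mom_def)
  show ?thesis
    using expectation_prod_centred[OF assms(1-4), of "{}" "\<lambda>h. X (\<sigma> h)"] assms(5) all_moments_X
    unfolding mom_eq by (simp add: centred_edge_def)
qed

text \<open>All three expectations are partition sums with the edges removed as blocks, so the
  covariance runs over partitions with a block meeting both sides. Singletons drop out since the
  means vanish.\<close>

lemma covariance_edges_le:
  assumes F1: "finite (\<Union>F1)" "pairwise disjnt F1" "{} \<notin> F1"
    and F2: "finite (\<Union>F2)" "pairwise disjnt F2" "{} \<notin> F2" and disj: "\<Union>F1 \<inter> \<Union>F2 = {}"
    and \<sigma>: "\<sigma> \<in> PiE (\<Union>F1 \<union> \<Union>F2) (\<lambda>_. {1..p} \<times> {1..n})"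
  shows "\<bar>expectation (\<lambda>\<omega>. (\<Prod>e\<in>F1. centred_edge \<sigma> e \<omega>) * (\<Prod>e\<in>F2. centred_edge \<sigma> e \<omega>))
      - expectation (\<lambda>\<omega>. \<Prod>e\<in>F1. centred_edge \<sigma> e \<omega>) * expectation (\<lambda>\<omega>. \<Prod>e\<in>F2. centred_edge \<sigma> e \<omega>)\<bar>
   \<le> (\<Sum>P\<in>{P. partition_on (\<Union>F1 \<union> \<Union>F2) P \<and> (\<forall>B\<in>P. 2 \<le> card B) \<and> P \<inter> (F1 \<union> F2) = {}
        \<and> (\<exists>B\<in>P. B \<inter> \<Union>F1 \<noteq> {} \<and> B \<inter> \<Union>F2 \<noteq> {})}. \<Prod>B\<in>P. abs_cum p n B \<sigma>)"
proof -
  let ?H1 = "\<Union>F1" and ?H2 = "\<Union>F2" and ?F = "F1 \<union> F2"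
  let ?k = "\<lambda>B. if B \<in> ?F then 0 else cum (mom \<sigma>) B"
  have fin: "finite F1" "finite F2" using F1 F2 by (auto intro: finite_UnionD)
  have F12: "F1 \<inter> F2 = {}"
  proof (rule ccontr)
    assume "F1 \<inter> F2 \<noteq> {}"
    then obtain e where e: "e \<in> F1" "e \<in> F2" by auto
    then have "e \<noteq> {}" using F1(3) by auto
    then show False using e disj by blast
  qed
  have snd: "1 \<le> snd (\<sigma> h)" if "h \<in> ?H1 \<union> ?H2" for h
  proof -
    have "\<sigma> h \<in> {1..p} \<times> {1..n}" using \<sigma> that by (rule PiE_mem)
    then show ?thesis by (auto simp: mem_Times_iff)
  qed
  have pd: "pairwise disjnt ?F"
  proof (rule pairwiseI)
    fix e f assume ef: "e \<in> ?F" "f \<in> ?F" "e \<noteq> f"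
    then consider "e \<in> F1" "f \<in> F1" | "e \<in> F2" "f \<in> F2" | "e \<in> F1" "f \<in> F2" | "e \<in> F2" "f \<in> F1" by auto
    then show "disjnt e f"
    proof cases
      case 1 then show ?thesis using F1(2) ef(3) by (auto simp: pairwise_def)
    next
      case 2 then show ?thesis using F2(2) ef(3) by (auto simp: pairwise_def)
    next
      case 3 then show ?thesis using disj unfolding disjnt_def by blast
    next
      case 4 then show ?thesis using disj unfolding disjnt_def by blast
    qed
  qed
  have Un: "\<Union>?F = ?H1 \<union> ?H2" by auto
  have "expectation (\<lambda>\<omega>. (\<Prod>e\<in>F1. centred_edge \<sigma> e \<omega>) * (\<Prod>e\<in>F2. centred_edge \<sigma> e \<omega>))
     = expectation (\<lambda>\<omega>. \<Prod>e\<in>?F. centred_edge \<sigma> e \<omega>)"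
    using fin F12 by (simp add: prod.union_disjoint)
  also have "\<dots> = psum ?k (?H1 \<union> ?H2)"
    unfolding Un[symmetric] using fin F1 F2 pd snd by (intro expectation_centred_edges) auto
  finally have 12: "expectation (\<lambda>\<omega>. (\<Prod>e\<in>F1. centred_edge \<sigma> e \<omega>) * (\<Prod>e\<in>F2. centred_edge \<sigma> e \<omega>)) = psum ?k (?H1 \<union> ?H2)" .
  have "expectation (\<lambda>\<omega>. \<Prod>e\<in>F1. centred_edge \<sigma> e \<omega>) = psum (\<lambda>B. if B \<in> F1 then 0 else cum (mom \<sigma>) B) ?H1"
    using fin F1 snd by (intro expectation_centred_edges) auto
  also have "\<dots> = psum ?k ?H1"
  proof (rule psum_cong)
    fix B assume "B \<subseteq> ?H1" "B \<noteq> {}"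
    then have "B \<notin> F2" using disj by blast
    then show "(if B \<in> F1 then 0 else cum (mom \<sigma>) B) = ?k B" by simp
  qed
  finally have 1: "expectation (\<lambda>\<omega>. \<Prod>e\<in>F1. centred_edge \<sigma> e \<omega>) = psum ?k ?H1" .
  have "expectation (\<lambda>\<omega>. \<Prod>e\<in>F2. centred_edge \<sigma> e \<omega>) = psum (\<lambda>B. if B \<in> F2 then 0 else cum (mom \<sigma>) B) ?H2"
    using fin F2 snd by (intro expectation_centred_edges) auto
  also have "\<dots> = psum ?k ?H2"
  proof (rule psum_cong)
    fix B assume "B \<subseteq> ?H2" "B \<noteq> {}"
    then have "B \<notin> F1" using disj by blast
    then show "(if B \<in> F2 then 0 else cum (mom \<sigma>) B) = ?k B" by simp
  qed
  finally have 2: "expectation (\<lambda>\<omega>. \<Prod>e\<in>F2. centred_edge \<sigma> e \<omega>) = psum ?k ?H2" .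
  let ?C = "{P. partition_on (?H1 \<union> ?H2) P \<and> (\<exists>B\<in>P. B \<inter> ?H1 \<noteq> {} \<and> B \<inter> ?H2 \<noteq> {})}"
  let ?G = "\<lambda>P. (\<forall>B\<in>P. 2 \<le> card B) \<and> P \<inter> ?F = {}"
  have finC: "finite ?C"
    by (rule finite_subset[OF _ finitely_many_partition_on[of "?H1 \<union> ?H2"]]) (use F1 F2 in blast)+
  have "\<bar>psum ?k (?H1 \<union> ?H2) - psum ?k ?H1 * psum ?k ?H2\<bar> \<le> (\<Sum>P\<in>?C. \<Prod>B\<in>P. \<bar>?k B\<bar>)"
    using F1(1) F2(1) disj by (rule psum_nonmixing_diff_le)
  also have "\<dots> \<le> (\<Sum>P\<in>?C. if ?G P then \<Prod>B\<in>P. abs_cum p n B \<sigma> else 0)"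
    using F1(1) F2(1) by (intro sum_mono prod_cum_le_abs_cum[OF \<sigma>]) auto
  also have "\<dots> = (\<Sum>P\<in>{P\<in>?C. ?G P}. \<Prod>B\<in>P. abs_cum p n B \<sigma>)"
    by (rule sum.inter_filter[OF finC, symmetric])
  also have "{P\<in>?C. ?G P} = {P. partition_on (?H1 \<union> ?H2) P \<and> (\<forall>B\<in>P. 2 \<le> card B) \<and> P \<inter> ?F = {}
        \<and> (\<exists>B\<in>P. B \<inter> ?H1 \<noteq> {} \<and> B \<inter> ?H2 \<noteq> {})}" by blast
  finally show ?thesis unfolding 12 1 2 .
qed

end

section \<open>Words in a matrix and its perturbation\<close>

lemma infsum_sum_swap:
  fixes f :: "'i \<Rightarrow> 'b \<Rightarrow> real"
  assumes "finite I" "\<And>i. i \<in> I \<Longrightarrow> f i summable_on A"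
  shows "(\<lambda>x. \<Sum>i\<in>I. f i x) summable_on A" "(\<Sum>\<^sub>\<infinity>x\<in>A. \<Sum>i\<in>I. f i x) = (\<Sum>i\<in>I. \<Sum>\<^sub>\<infinity>x\<in>A. f i x)"
proof -
  have "((\<lambda>x. \<Sum>i\<in>I. f i x) has_sum (\<Sum>i\<in>I. \<Sum>\<^sub>\<infinity>x\<in>A. f i x)) A"
    using assms
  proof (induction I rule: finite_induct)
    case (insert i I)
    then have "(f i has_sum (\<Sum>\<^sub>\<infinity>x\<in>A. f i x)) A" by simp
    then show ?case using insert by (simp add: has_sum_add)
  qed simp
  then show "(\<lambda>x. \<Sum>i\<in>I. f i x) summable_on A" "(\<Sum>\<^sub>\<infinity>x\<in>A. \<Sum>i\<in>I. f i x) = (\<Sum>i\<in>I. \<Sum>\<^sub>\<infinity>x\<in>A. f i x)"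
    by (auto simp: summable_on_def infsumI)
qed

section \<open>Matrix powers dominated by convolution powers of a summable kernel\<close>

locale summable_kernel =
  fixes r :: "int \<Rightarrow> real"
  assumes r_nonneg: "r d \<ge> 0" and r_even: "r (- d) = r d" and r_summable: "r summable_on UNIV"
begin

lemma sum_r_le: "finite F \<Longrightarrow> sum r F \<le> infsum r UNIV"
  using r_nonneg r_summable by (intro finite_sum_le_infsum) auto

lemma r_le: "r d \<le> infsum r UNIV"
  using sum_r_le[of "{d}"] by simp

text \<open>The three properties support each other in the induction step, so they are proved
  together. For summability, any partial sum of \<open>conv_pow r (Suc a)\<close> is at most the
  mass of \<open>r\<close> times that of \<open>conv_pow r a\<close>.\<close>

lemma conv_pow_props:
  "(\<forall>d. 0 \<le> conv_pow r a d) \<and> (\<forall>d. conv_pow r a (- d) = conv_pow r a d) \<and> conv_pow r a summable_on UNIV"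
proof (induction a)
  case 0
  have "(\<lambda>i::int. if i = 0 then 1 else 0 :: real) summable_on UNIV"
    by (rule finite_nonzero_values_imp_summable_on) auto
  then show ?case by auto
next
  case (Suc a)
  let ?h = "conv_pow r a"
  have inner: "(\<lambda>k. r (d - k) * ?h k) summable_on UNIV" for d
  proof (rule summable_on_comparison_test)
    show "(\<lambda>k. infsum r UNIV * ?h k) summable_on UNIV" using Suc by (intro summable_on_cmult_right) auto
  qed (use Suc r_nonneg r_le in \<open>auto intro: mult_right_mono\<close>)
  have nonneg: "0 \<le> conv_pow r (Suc a) d" for d
    unfolding conv_pow.simps conv_int_def using Suc r_nonneg by (intro infsum_nonneg mult_nonneg_nonneg) auto
  have "conv_pow r (Suc a) (- d) = conv_pow r (Suc a) d" for d
  proof -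
    have "conv_pow r (Suc a) (- d) = (\<Sum>\<^sub>\<infinity>k. r (- d - k) * ?h k)" by (simp add: conv_int_def)
    also have "\<dots> = (\<Sum>\<^sub>\<infinity>k. r (- d - (- k)) * ?h (- k))"
      by (rule infsum_reindex_bij_witness[of _ uminus uminus]) auto
    also have "\<dots> = (\<Sum>\<^sub>\<infinity>k. r (d - k) * ?h k)"
    proof (rule infsum_cong)
      fix k
      have "r (- d - (- k)) = r (d - k)" using r_even[of "d - k"] by simp
      then show "r (- d - (- k)) * ?h (- k) = r (d - k) * ?h k" using Suc by simp
    qed
    finally show ?thesis by (simp add: conv_int_def)
  qed
  moreover have "conv_pow r (Suc a) summable_on UNIV"
  proof (rule nonneg_bdd_above_summable_on)
    show "bdd_above (sum (conv_pow r (Suc a)) ` {F. F \<subseteq> UNIV \<and> finite F})"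
    proof (rule bdd_aboveI2)
      fix F assume "F \<in> {F :: int set. F \<subseteq> UNIV \<and> finite F}"
      then have F: "finite F" by simp
      have "sum (conv_pow r (Suc a)) F = (\<Sum>\<^sub>\<infinity>k. \<Sum>d\<in>F. r (d - k) * ?h k)"
        unfolding conv_pow.simps conv_int_def using F inner by (intro infsum_sum_swap(2)[symmetric]) auto
      also have "\<dots> \<le> (\<Sum>\<^sub>\<infinity>k. infsum r UNIV * ?h k)"
      proof (rule infsum_mono)
        show "(\<lambda>k. \<Sum>d\<in>F. r (d - k) * ?h k) summable_on UNIV" using F inner by (intro infsum_sum_swap(1)) auto
        show "(\<lambda>k. infsum r UNIV * ?h k) summable_on UNIV" using Suc by (intro summable_on_cmult_right) auto
        fix k
        have "(\<Sum>d\<in>F. r (d - k)) = sum r ((\<lambda>d. d - k) ` F)" by (subst sum.reindex) (auto simp: inj_on_def)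
        also have "\<dots> \<le> infsum r UNIV" using F by (intro sum_r_le) auto
        finally show "(\<Sum>d\<in>F. r (d - k) * ?h k) \<le> infsum r UNIV * ?h k"
          using Suc by (simp add: sum_distrib_right[symmetric] mult_right_mono)
      qed
      finally show "sum (conv_pow r (Suc a)) F \<le> (\<Sum>\<^sub>\<infinity>k. infsum r UNIV * ?h k)" .
    qed
  qed (use nonneg in auto)
  ultimately show ?case using nonneg by blast
qed

lemma conv_pow_nonneg: "0 \<le> conv_pow r a d"
  and conv_pow_even: "conv_pow r a (- d) = conv_pow r a d"
  and conv_pow_summable: "conv_pow r a summable_on UNIV"
  using conv_pow_props[of a] by auto

lemma conv_pow_inner_summable: "(\<lambda>k. r (d - k) * conv_pow r a k) summable_on UNIV"
proof (rule summable_on_comparison_test)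
  show "(\<lambda>k. infsum r UNIV * conv_pow r a k) summable_on UNIV" by (intro summable_on_cmult_right conv_pow_summable)
qed (use conv_pow_nonneg r_nonneg r_le in \<open>auto intro: mult_right_mono\<close>)

text \<open>The entries of the first \<open>k\<close> powers of a matrix dominated by \<open>r\<close> are dominated by
  \<open>path_const k\<close> times the probability-like kernel \<open>path_kernel k\<close>.\<close>
definition path_const :: "nat \<Rightarrow> real" where
  "path_const k = 1 + (\<Sum>a\<le>k. infsum (conv_pow r a) UNIV)"

definition path_kernel :: "nat \<Rightarrow> int \<Rightarrow> real" where
  "path_kernel k d = (\<Sum>a\<le>k. conv_pow r a d) / path_const k"

lemma path_const_ge_1: "1 \<le> path_const k"
  unfolding path_const_def using conv_pow_nonneg by (simp add: sum_nonneg infsum_nonneg)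

lemma path_kernel_nonneg: "0 \<le> path_kernel k d"
  unfolding path_kernel_def using path_const_ge_1[of k] conv_pow_nonneg by (simp add: sum_nonneg)

lemma path_kernel_even: "path_kernel k (- d) = path_kernel k d"
  by (simp add: path_kernel_def conv_pow_even)

lemma sum_path_kernel_le: "finite F \<Longrightarrow> sum (path_kernel k) F \<le> 1"
proof -
  assume F: "finite F"
  have "(\<Sum>d\<in>F. \<Sum>a\<le>k. conv_pow r a d) = (\<Sum>a\<le>k. \<Sum>d\<in>F. conv_pow r a d)" by (rule sum.swap)
  also have "\<dots> \<le> (\<Sum>a\<le>k. infsum (conv_pow r a) UNIV)"
    using F conv_pow_nonneg conv_pow_summable by (intro sum_mono finite_sum_le_infsum) auto
  also have "\<dots> \<le> path_const k" by (simp add: path_const_def)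
  finally show ?thesis
    using path_const_ge_1[of k] by (simp add: path_kernel_def sum_divide_distrib[symmetric])
qed

lemma conv_pow_le_path_kernel: "a \<le> k \<Longrightarrow> conv_pow r a d \<le> path_const k * path_kernel k d"
  using path_const_ge_1[of k] member_le_sum[of a "{..k}" "\<lambda>a. conv_pow r a d"] conv_pow_nonneg
  by (simp add: path_kernel_def)

text \<open>The sum over \<open>{1..p}\<close> in the matrix product is part of the convolution
  series, whose terms are non-negative. The bound is therefore uniform in \<open>p\<close>.\<close>

lemma abs_mat_pow_le:
  assumes "\<And>i j. \<bar>A i j\<bar> \<le> r (int i - int j)"
  shows "\<bar>mat_pow p A a i j\<bar> \<le> conv_pow r a (int i - int j)"
proof (induction a arbitrary: j)
  case (Suc a)
  have "\<bar>mat_pow p A (Suc a) i j\<bar> \<le> (\<Sum>l\<in>{1..p}. \<bar>mat_pow p A a i l * A l j\<bar>)"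
    unfolding mat_pow.simps mat_mult_def by (rule sum_abs)
  also have "\<dots> \<le> (\<Sum>l\<in>{1..p}. r (int l - int j) * conv_pow r a (int i - int l))"
    unfolding abs_mult mult.commute[of "r _"] using assms Suc conv_pow_nonneg by (intro sum_mono mult_mono) auto
  also have "\<dots> = (\<Sum>k\<in>(\<lambda>l. int i - int l) ` {1..p}. r ((int i - int j) - k) * conv_pow r a k)"
    by (subst sum.reindex) (auto simp: inj_on_def)
  also have "\<dots> \<le> (\<Sum>\<^sub>\<infinity>k. r ((int i - int j) - k) * conv_pow r a k)"
    using conv_pow_inner_summable conv_pow_nonneg r_nonneg by (intro finite_sum_le_infsum) auto
  finally show ?case by (simp add: conv_int_def)
qed (auto simp: sum_nonneg)

end

section \<open>Expansion of powers of a sum of two matrices\<close>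

lemma mat_mult_assoc: "mat_mult p (mat_mult p A B) C = mat_mult p A (mat_mult p B C)"
proof (intro ext)
  fix i j
  have "mat_mult p (mat_mult p A B) C i j = (\<Sum>l\<in>{1..p}. \<Sum>k\<in>{1..p}. A i k * B k l * C l j)"
    by (simp add: mat_mult_def sum_distrib_right)
  also have "\<dots> = (\<Sum>k\<in>{1..p}. \<Sum>l\<in>{1..p}. A i k * B k l * C l j)" by (rule sum.swap)
  also have "\<dots> = mat_mult p A (mat_mult p B C) i j"
    by (simp add: mat_mult_def sum_distrib_left mult.assoc)
  finally show "mat_mult p (mat_mult p A B) C i j = mat_mult p A (mat_mult p B C) i j" .
qed

lemma mat_mult_one_right: "j \<in> {1..p} \<Longrightarrow> mat_mult p A (mat_pow p B 0) i j = A i j"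
proof -
  assume j: "j \<in> {1..p}"
  have "mat_mult p A (mat_pow p B 0) i j = (\<Sum>l\<in>{1..p}. if l = j then A i l else 0)"
    unfolding mat_mult_def by (intro sum.cong) auto
  also have "\<dots> = A i j" using j by (subst sum.delta) auto
  finally show ?thesis .
qed

lemma mat_pow_add:
  assumes "j \<in> {1..p}"
  shows "mat_mult p (mat_pow p A k) (mat_pow p A l) i j = mat_pow p A (k + l) i j"
  using assms
proof (induction l arbitrary: j)
  case 0
  then show ?case using mat_mult_one_right by simp
next
  case (Suc l)
  have "mat_mult p (mat_pow p A k) (mat_pow p A (Suc l)) i j = mat_mult p (mat_mult p (mat_pow p A k) (mat_pow p A l)) A i j"
    by (simp add: mat_mult_assoc)
  also have "\<dots> = mat_mult p (mat_pow p A (k + l)) A i j"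
    unfolding mat_mult_def[of p _ A] by (intro sum.cong refl) (simp add: Suc.IH)
  finally show ?case by simp
qed

lemma mat_trace_commute: "mat_trace p (mat_mult p A B) = mat_trace p (mat_mult p B A)"
  unfolding mat_trace_def mat_mult_def by (subst sum.swap) (simp add: mult.commute)

text \<open>The word \<open>A ^ a 0 * D * A ^ a 1 * D * \<dots> * D * A ^ a m\<close>.\<close>
fun word :: "nat \<Rightarrow> (nat \<Rightarrow> nat \<Rightarrow> real) \<Rightarrow> (nat \<Rightarrow> nat \<Rightarrow> real) \<Rightarrow> (nat \<Rightarrow> nat) \<Rightarrow> nat \<Rightarrow> nat \<Rightarrow> nat \<Rightarrow> real" where
  "word p A D a 0 = mat_pow p A (a 0)"
| "word p A D a (Suc m) = mat_mult p (mat_mult p (word p A D a m) D) (mat_pow p A (a (Suc m)))"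

lemma word_cong: "(\<And>i. i \<le> m \<Longrightarrow> a i = a' i) \<Longrightarrow> word p A D a m = word p A D a' m"
  by (induction m) auto

text \<open>A word of length \<open>k\<close> in the letters \<open>A\<close> and \<open>D\<close>
  is coded by the number \<open>m\<close> of letters \<open>D\<close> and the exponents
  \<open>a 0\<close>, ..., \<open>a m\<close> of \<open>A\<close> around them. Appending
  \<open>A\<close> raises the last exponent, appending \<open>D\<close> opens a new exponent
  0.\<close>

fun words :: "nat \<Rightarrow> (nat \<times> (nat \<Rightarrow> nat)) list" where
  "words 0 = [(0, \<lambda>_. 0)]"
| "words (Suc k) = map (\<lambda>(m, a). (m, a(m := Suc (a m)))) (words k)
     @ map (\<lambda>(m, a). (Suc m, a(Suc m := 0))) (words k)"

lemma words_degree: "(m, a) \<in> set (words k) \<Longrightarrow> m + (\<Sum>i\<le>m. a i) = k"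
proof (induction k arbitrary: m a)
  case (Suc k)
  from Suc.prems consider m' a' where "(m', a') \<in> set (words k)" "m = m'" "a = a'(m' := Suc (a' m'))"
    | m' a' where "(m', a') \<in> set (words k)" "m = Suc m'" "a = a'(Suc m' := 0)"
    by auto
  then show ?case
  proof cases
    case 1
    have "(\<Sum>i\<le>m'. a i) = Suc (\<Sum>i\<le>m'. a' i)"
    proof -
      have "(\<Sum>i\<in>{..m'} - {m'}. a i) = (\<Sum>i\<in>{..m'} - {m'}. a' i)" using 1 by (intro sum.cong) auto
      then show ?thesis using 1 by (simp add: sum.remove[of "{..m'}" m'])
    qed
    then show ?thesis using Suc.IH[OF 1(1)] 1 by simp
  next
    case 2
    then show ?thesis using Suc.IH[OF 2(1)] by simp
  qed
qed auto

lemma words_degree_0: "filter (\<lambda>x. fst x = 0) (words k) = [(0, (\<lambda>_. 0)(0 := k))]"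
proof (induction k)
  case (Suc k)
  have "filter (\<lambda>x. fst x = 0) (map (\<lambda>(m, a). (Suc m, a(Suc m := 0))) (words k)) = []"
    by (auto simp: filter_empty_conv)
  moreover have "filter (\<lambda>x. fst x = 0) (map (\<lambda>(m, a). (m, a(m := Suc (a m)))) (words k))
      = map (\<lambda>(m, a). (m, a(m := Suc (a m)))) (filter (\<lambda>x. fst x = 0) (words k))"
    by (simp add: filter_map comp_def case_prod_beta)
  ultimately show ?case using Suc by (simp add: fun_eq_iff)
qed auto

lemma words_degree_1: "length (filter (\<lambda>x. fst x = 1) (words k)) = k"
proof (induction k)
  case (Suc k)
  have "filter (\<lambda>x. fst x = 1) (map (\<lambda>(m, a). (Suc m, a(Suc m := 0))) (words k))
      = map (\<lambda>(m, a). (Suc m, a(Suc m := 0))) (filter (\<lambda>x. fst x = 0) (words k))"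
    by (simp add: filter_map comp_def case_prod_beta)
  moreover have "filter (\<lambda>x. fst x = 1) (map (\<lambda>(m, a). (m, a(m := Suc (a m)))) (words k))
      = map (\<lambda>(m, a). (m, a(m := Suc (a m)))) (filter (\<lambda>x. fst x = 1) (words k))"
    by (simp add: filter_map comp_def case_prod_beta)
  ultimately show ?case using Suc by (simp add: words_degree_0)
qed auto

lemma mat_pow_sum_words:
  assumes "\<And>i j. i \<in> {1..p} \<Longrightarrow> j \<in> {1..p} \<Longrightarrow> Y i j = A i j + D i j" "i \<in> {1..p}" "j \<in> {1..p}"
  shows "mat_pow p Y k i j = (\<Sum>(m,a)\<leftarrow>words k. word p A D a m i j)"
  using assms(3)
proof (induction k arbitrary: j)
  case (Suc k)
  have swap: "(\<Sum>l\<in>I. (\<Sum>x\<leftarrow>xs. f x l)) = (\<Sum>x\<leftarrow>xs. \<Sum>l\<in>I. f x l)" for xs I and f :: "'z \<Rightarrow> nat \<Rightarrow> real"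
    by (induction xs) (auto simp: sum.distrib)
  have distr: "(\<Sum>x\<leftarrow>xs. f x) * c = (\<Sum>x\<leftarrow>xs. f x * c)" for xs and f :: "'z \<Rightarrow> real" and c
    by (induction xs) (auto simp: algebra_simps)
  have wA: "mat_mult p (word p A D a m) A i j = word p A D (a(m := Suc (a m))) m i j" for m a
  proof (cases m)
    case (Suc m')
    have "word p A D (a(Suc m' := Suc (a (Suc m')))) m' = word p A D a m'" by (rule word_cong) auto
    then show ?thesis using Suc by (simp add: mat_mult_assoc)
  qed simp
  have wD: "mat_mult p (word p A D a m) D i j = word p A D (a(Suc m := 0)) (Suc m) i j" for m a
  proof -
    have "word p A D (a(Suc m := 0)) m = word p A D a m" by (rule word_cong) auto
    then show ?thesis using mat_mult_one_right[OF Suc.prems] by simp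
  qed
  have "mat_pow p Y (Suc k) i j = (\<Sum>l\<in>{1..p}. (\<Sum>(m,a)\<leftarrow>words k. word p A D a m i l) * (A l j + D l j))"
    unfolding mat_pow.simps mat_mult_def using assms Suc.prems Suc.IH by (intro sum.cong refl) auto
  also have "\<dots> = (\<Sum>x\<leftarrow>words k. \<Sum>l\<in>{1..p}. word p A D (snd x) (fst x) i l * (A l j + D l j))"
    by (simp add: distr swap case_prod_beta)
  also have "\<dots> = (\<Sum>x\<leftarrow>words k. mat_mult p (word p A D (snd x) (fst x)) A i j + mat_mult p (word p A D (snd x) (fst x)) D i j)"
    by (simp add: mat_mult_def distrib_left sum.distrib)
  also have "\<dots> = (\<Sum>(m,a)\<leftarrow>words (Suc k). word p A D a m i j)"
    by (simp only: wA wD sum_list_addf words.simps map_append sum_list_append map_map comp_def case_prod_beta fst_conv snd_conv)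
  finally show ?case .
qed auto

text \<open>By cyclicity of the trace the position of the single \<open>D\<close> is
  irrelevant.\<close>

lemma trace_word_1:
  "mat_trace p (word p A D a 1) = mat_trace p (mat_mult p (mat_pow p A (a 0 + a 1)) D)"
proof -
  have "mat_trace p (word p A D a 1) = mat_trace p (mat_mult p (mat_pow p A (a 1)) (mat_mult p (mat_pow p A (a 0)) D))"
    by (simp add: mat_trace_commute)
  also have "\<dots> = mat_trace p (mat_mult p (mat_mult p (mat_pow p A (a 1)) (mat_pow p A (a 0))) D)"
    by (simp add: mat_mult_assoc)
  also have "\<dots> = mat_trace p (mat_mult p D (mat_mult p (mat_pow p A (a 1)) (mat_pow p A (a 0))))"
    by (rule mat_trace_commute)
  also have "\<dots> = mat_trace p (mat_mult p D (mat_pow p A (a 0 + a 1)))"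
    unfolding mat_trace_def mat_mult_def[of p D] using mat_pow_add[of _ p A "a 1" "a 0"]
    by (intro sum.cong refl) (auto simp: add.commute)
  finally show ?thesis by (simp add: mat_trace_commute)
qed

text \<open>One word contains no \<open>D\<close>, and \<open>k\<close> words contain exactly one,
  all with the same trace. For \<open>k = 0\<close> the truncated exponent \<open>k - 1\<close> is
  harmless because of the factor \<open>real k\<close>.\<close>

lemma trace_pow_expansion:
  assumes Y: "\<And>i j. i \<in> {1..p} \<Longrightarrow> j \<in> {1..p} \<Longrightarrow> Y i j = A i j + D i j"
  shows "mat_trace p (mat_pow p Y k) = mat_trace p (mat_pow p A k)
    + real k * mat_trace p (mat_mult p (mat_pow p A (k - 1)) D)
    + (\<Sum>(m,a)\<leftarrow>filter (\<lambda>x. 2 \<le> fst x) (words k). mat_trace p (word p A D a m))"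
proof -
  have swap: "(\<Sum>l\<in>I. (\<Sum>x\<leftarrow>xs. f x l)) = (\<Sum>x\<leftarrow>xs. \<Sum>l\<in>I. f x l)" for xs I and f :: "'z \<Rightarrow> nat \<Rightarrow> real"
    by (induction xs) (auto simp: sum.distrib)
  let ?t = "\<lambda>(m,a). mat_trace p (word p A D a m)"
  have split: "(\<Sum>x\<leftarrow>xs. ?t x) = (\<Sum>x\<leftarrow>filter (\<lambda>x. fst x = 0) xs. ?t x) + (\<Sum>x\<leftarrow>filter (\<lambda>x. fst x = 1) xs. ?t x)
      + (\<Sum>x\<leftarrow>filter (\<lambda>x. 2 \<le> fst x) xs. ?t x)" for xs
    by (induction xs) auto
  have one: "?t x = mat_trace p (mat_mult p (mat_pow p A (k - 1)) D)" if "x \<in> set (filter (\<lambda>x. fst x = 1) (words k))" for x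
  proof -
    define a where "a = snd x"
    have "fst x = 1" "x \<in> set (words k)" using that by auto
    moreover from this(1) have "x = (1, a)" by (simp add: a_def prod_eq_iff)
    ultimately have x: "x = (1, a)" "(1, a) \<in> set (words k)" by simp_all
    then have "a 0 + a 1 = k - 1" using words_degree[of 1 a k] by simp
    then show ?thesis using trace_word_1[of p A D a] x by simp
  qed
  have "mat_trace p (mat_pow p Y k) = (\<Sum>i\<in>{1..p}. \<Sum>(m,a)\<leftarrow>words k. word p A D a m i i)"
    unfolding mat_trace_def by (intro sum.cong refl mat_pow_sum_words Y) auto
  also have "\<dots> = (\<Sum>x\<leftarrow>words k. ?t x)"
    by (simp add: swap mat_trace_def case_prod_beta)
  also have "\<dots> = (\<Sum>x\<leftarrow>filter (\<lambda>x. fst x = 0) (words k). ?t x) + (\<Sum>x\<leftarrow>filter (\<lambda>x. fst x = 1) (words k). ?t x)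
      + (\<Sum>x\<leftarrow>filter (\<lambda>x. 2 \<le> fst x) (words k). ?t x)" by (rule split)
  also have "(\<Sum>x\<leftarrow>filter (\<lambda>x. fst x = 0) (words k). ?t x) = mat_trace p (mat_pow p A k)"
    unfolding words_degree_0 by simp
  also have "(\<Sum>x\<leftarrow>filter (\<lambda>x. fst x = 1) (words k). ?t x)
     = (\<Sum>x\<leftarrow>filter (\<lambda>x. fst x = 1) (words k). mat_trace p (mat_mult p (mat_pow p A (k - 1)) D))"
    using one by (intro arg_cong[where f = sum_list] map_cong refl) auto
  also have "\<dots> = real k * mat_trace p (mat_mult p (mat_pow p A (k - 1)) D)"
    using words_degree_1[of k] by (simp add: sum_list_triv)
  finally show ?thesis .
qed

text \<open>One term of an entry of \<open>word\<close> after all products are expanded: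
  \<open>\<sigma> (2 * s)\<close> and \<open>\<sigma> (2 * s + 1)\<close> are the states at the two
  ends of noise factor number \<open>s\<close>, counted from 0.\<close>

fun path_prod :: "nat \<Rightarrow> (nat \<Rightarrow> nat \<Rightarrow> real) \<Rightarrow> (nat \<times> nat \<Rightarrow> nat \<times> nat \<Rightarrow> real) \<Rightarrow> (nat \<Rightarrow> nat) \<Rightarrow> nat \<Rightarrow>
    (nat \<Rightarrow> nat \<times> nat) \<Rightarrow> nat \<Rightarrow> nat \<Rightarrow> real" where
  "path_prod p A e a \<alpha> \<sigma> 0 \<beta> = mat_pow p A (a 0) \<alpha> \<beta>"
| "path_prod p A e a \<alpha> \<sigma> (Suc m) \<beta> = path_prod p A e a \<alpha> \<sigma> m (fst (\<sigma> (2 * m)))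
     * e (\<sigma> (2 * m)) (\<sigma> (2 * m + 1)) * mat_pow p A (a (Suc m)) (fst (\<sigma> (2 * m + 1))) \<beta>"

lemma path_prod_cong: "(\<And>h. h < 2 * m \<Longrightarrow> \<sigma> h = \<sigma>' h) \<Longrightarrow> path_prod p A e a \<alpha> \<sigma> m \<beta> = path_prod p A e a \<alpha> \<sigma>' m \<beta>"
  by (induction m arbitrary: \<beta>) auto

lemma sum_states: "(\<Sum>s\<in>{1..p} \<times> {1..n}. f (fst s) (snd s)) = (\<Sum>i\<in>{1..p}. \<Sum>r\<in>{1..n}. f i r)"
  for f :: "nat \<Rightarrow> nat \<Rightarrow> real"
  by (subst sum.cartesian_product) (simp add: case_prod_beta)

lemma word_expansion:
  assumes D: "\<And>i j. i \<in> {1..p} \<Longrightarrow> j \<in> {1..p} \<Longrightarrow> D i j = c * (\<Sum>r\<in>{1..n}. \<Sum>r'\<in>{1..n}. e (i,r) (j,r'))"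
  shows "word p A D a m \<alpha> \<beta> = c ^ m * (\<Sum>\<sigma>\<in>PiE {..<2*m} (\<lambda>_. {1..p} \<times> {1..n}). path_prod p A e a \<alpha> \<sigma> m \<beta>)"
proof (induction m arbitrary: \<beta>)
  case 0
  then show ?case by simp
next
  case (Suc m)
  let ?S = "{1..p} \<times> {1..n}" let ?E = "PiE {..<2*m} (\<lambda>_. ?S)"
  let ?A = "mat_pow p A (a (Suc m))"
  let ?V = "\<lambda>\<sigma> \<beta>. path_prod p A e a \<alpha> \<sigma> m \<beta>"
  have "word p A D a (Suc m) \<alpha> \<beta> = (\<Sum>l\<in>{1..p}. (\<Sum>k\<in>{1..p}. word p A D a m \<alpha> k * D k l) * ?A l \<beta>)"
    by (simp add: mat_mult_def)
  also have "\<dots> = (\<Sum>l\<in>{1..p}. (\<Sum>k\<in>{1..p}. (c ^ m * (\<Sum>\<sigma>\<in>?E. ?V \<sigma> k)) * (c * (\<Sum>r\<in>{1..n}. \<Sum>r'\<in>{1..n}. e (k,r) (l,r')))) * ?A l \<beta>)"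
    using D Suc.IH by (intro sum.cong refl arg_cong2[where f = "(*)"]) auto
  also have "\<dots> = (\<Sum>l\<in>{1..p}. \<Sum>k\<in>{1..p}. \<Sum>\<sigma>\<in>?E. \<Sum>r\<in>{1..n}. \<Sum>r'\<in>{1..n}. c ^ Suc m * (?V \<sigma> k * e (k,r) (l,r') * ?A l \<beta>))"
    unfolding sum_distrib_right[of _ _ "?A _ \<beta>"]
  proof (intro sum.cong refl)
    fix l k
    define E where "E = (\<Sum>r\<in>{1..n}. \<Sum>r'\<in>{1..n}. e (k,r) (l,r'))"
    have "(c ^ m * (\<Sum>\<sigma>\<in>?E. ?V \<sigma> k)) * (c * E) * ?A l \<beta> = (\<Sum>\<sigma>\<in>?E. (c ^ Suc m * ?V \<sigma> k * ?A l \<beta>) * E)"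
      by (simp add: sum_distrib_left sum_distrib_right mult_ac)
    also have "\<dots> = (\<Sum>\<sigma>\<in>?E. \<Sum>r\<in>{1..n}. \<Sum>r'\<in>{1..n}. c ^ Suc m * (?V \<sigma> k * e (k,r) (l,r') * ?A l \<beta>))"
      unfolding E_def sum_distrib_left by (intro sum.cong refl) (simp add: mult_ac)
    finally show "(c ^ m * (\<Sum>\<sigma>\<in>?E. ?V \<sigma> k)) * (c * (\<Sum>r\<in>{1..n}. \<Sum>r'\<in>{1..n}. e (k,r) (l,r'))) * ?A l \<beta>
      = (\<Sum>\<sigma>\<in>?E. \<Sum>r\<in>{1..n}. \<Sum>r'\<in>{1..n}. c ^ Suc m * (?V \<sigma> k * e (k,r) (l,r') * ?A l \<beta>))"
      unfolding E_def .
  qed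
  also have "\<dots> = (\<Sum>l\<in>{1..p}. \<Sum>\<sigma>\<in>?E. \<Sum>k\<in>{1..p}. \<Sum>r\<in>{1..n}. \<Sum>r'\<in>{1..n}. c ^ Suc m * (?V \<sigma> k * e (k,r) (l,r') * ?A l \<beta>))"
    by (intro sum.cong refl sum.swap)
  also have "\<dots> = (\<Sum>\<sigma>\<in>?E. \<Sum>l\<in>{1..p}. \<Sum>k\<in>{1..p}. \<Sum>r\<in>{1..n}. \<Sum>r'\<in>{1..n}. c ^ Suc m * (?V \<sigma> k * e (k,r) (l,r') * ?A l \<beta>))"
    by (rule sum.swap)
  also have "\<dots> = (\<Sum>\<sigma>\<in>?E. \<Sum>s\<in>?S. \<Sum>t\<in>?S. c ^ Suc m * (?V \<sigma> (fst s) * e s t * ?A (fst t) \<beta>))"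
  proof (intro sum.cong refl)
    fix \<sigma>
    let ?g = "\<lambda>k r l r'. c ^ Suc m * (?V \<sigma> k * e (k,r) (l,r') * ?A l \<beta>)"
    have "(\<Sum>l\<in>{1..p}. \<Sum>k\<in>{1..p}. \<Sum>r\<in>{1..n}. \<Sum>r'\<in>{1..n}. ?g k r l r')
        = (\<Sum>k\<in>{1..p}. \<Sum>l\<in>{1..p}. \<Sum>r\<in>{1..n}. \<Sum>r'\<in>{1..n}. ?g k r l r')" by (rule sum.swap)
    also have "\<dots> = (\<Sum>k\<in>{1..p}. \<Sum>r\<in>{1..n}. \<Sum>l\<in>{1..p}. \<Sum>r'\<in>{1..n}. ?g k r l r')"
      by (intro sum.cong refl sum.swap)
    also have "\<dots> = (\<Sum>s\<in>?S. \<Sum>l\<in>{1..p}. \<Sum>r'\<in>{1..n}. ?g (fst s) (snd s) l r')"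
      by (rule sum_states[symmetric])
    also have "\<dots> = (\<Sum>s\<in>?S. \<Sum>t\<in>?S. ?g (fst s) (snd s) (fst t) (snd t))"
      by (intro sum.cong refl sum_states[symmetric])
    finally show "(\<Sum>l\<in>{1..p}. \<Sum>k\<in>{1..p}. \<Sum>r\<in>{1..n}. \<Sum>r'\<in>{1..n}. ?g k r l r')
        = (\<Sum>s\<in>?S. \<Sum>t\<in>?S. c ^ Suc m * (?V \<sigma> (fst s) * e s t * ?A (fst t) \<beta>))" by simp
  qed
  also have "\<dots> = (\<Sum>\<sigma>\<in>?E. \<Sum>s\<in>?S. \<Sum>t\<in>?S. c ^ Suc m * path_prod p A e a \<alpha> (\<sigma>(2*m := s, 2*m+1 := t)) (Suc m) \<beta>)"
  proof (intro sum.cong refl)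
    fix \<sigma> s t
    have "?V (\<sigma>(2*m := s, 2*m+1 := t)) (fst s) = ?V \<sigma> (fst s)" by (rule path_prod_cong) auto
    then show "c ^ Suc m * (?V \<sigma> (fst s) * e s t * ?A (fst t) \<beta>)
       = c ^ Suc m * path_prod p A e a \<alpha> (\<sigma>(2*m := s, 2*m+1 := t)) (Suc m) \<beta>" by simp
  qed
  also have "\<dots> = c ^ Suc m * (\<Sum>\<sigma>\<in>?E. \<Sum>s\<in>?S. \<Sum>t\<in>?S. path_prod p A e a \<alpha> (\<sigma>(2*m := s, 2*m+1 := t)) (Suc m) \<beta>)"
    by (simp only: sum_distrib_left)
  also have "(\<Sum>\<sigma>\<in>?E. \<Sum>s\<in>?S. \<Sum>t\<in>?S. path_prod p A e a \<alpha> (\<sigma>(2*m := s, 2*m+1 := t)) (Suc m) \<beta>)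
     = (\<Sum>\<sigma>\<in>PiE (insert (2*m+1) (insert (2*m) {..<2*m})) (\<lambda>_. ?S). path_prod p A e a \<alpha> \<sigma> (Suc m) \<beta>)"
    by (subst sum_PiE_insert, simp, simp, simp, subst sum_PiE_insert) auto
  also have "insert (2*m+1) (insert (2*m) {..<2*m}) = {..<2 * Suc m}" by auto
  finally show ?case .
qed

lemma path_prod_closed:
  "path_prod p A e a \<alpha> \<sigma> (Suc m) \<beta> = mat_pow p A (a 0) \<alpha> (fst (\<sigma> 0)) * (\<Prod>s\<le>m. e (\<sigma> (2 * s)) (\<sigma> (2 * s+1)))
    * (\<Prod>s<m. mat_pow p A (a (Suc s)) (fst (\<sigma> (2 * s+1))) (fst (\<sigma> (2 * s+2)))) * mat_pow p A (a (Suc m)) (fst (\<sigma> (2*m+1))) \<beta>"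
proof (induction m arbitrary: \<beta>)
  case (Suc m)
  show ?case
    unfolding path_prod.simps(2)[of p A e a \<alpha> \<sigma> "Suc m"] Suc.IH by (simp add: mult_ac)
qed simp

text \<open>In the trace the outer powers \<open>a (Suc m)\<close> and \<open>a 0\<close> merge and
  close the path to a cycle. There are \<open>Suc m\<close> noise factors, so \<open>m\<close> is
  one less than their number.\<close>

definition cycle_coeff :: "nat \<Rightarrow> (nat \<Rightarrow> nat \<Rightarrow> real) \<Rightarrow> (nat \<Rightarrow> nat) \<Rightarrow> nat \<Rightarrow> (nat \<Rightarrow> nat \<times> nat) \<Rightarrow> real" where
  "cycle_coeff p A a m \<sigma> = (\<Prod>s<m. mat_pow p A (a (Suc s)) (fst (\<sigma> (2 * s+1))) (fst (\<sigma> (2 * s+2))))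
     * mat_pow p A (a (Suc m) + a 0) (fst (\<sigma> (2*m+1))) (fst (\<sigma> 0))"

lemma trace_word_expansion:
  assumes D: "\<And>i j. i \<in> {1..p} \<Longrightarrow> j \<in> {1..p} \<Longrightarrow> D i j = c * (\<Sum>r\<in>{1..n}. \<Sum>r'\<in>{1..n}. e (i,r) (j,r'))"
  shows "mat_trace p (word p A D a (Suc m)) = c ^ Suc m *
    (\<Sum>\<sigma>\<in>PiE {..<2 * Suc m} (\<lambda>_. {1..p} \<times> {1..n}). cycle_coeff p A a m \<sigma> * (\<Prod>s<Suc m. e (\<sigma> (2 * s)) (\<sigma> (2 * s+1))))"
proof -
  let ?E = "PiE {..<2 * Suc m} (\<lambda>_. {1..p} \<times> {1..n})"
  have "mat_trace p (word p A D a (Suc m)) = (\<Sum>\<alpha>\<in>{1..p}. c ^ Suc m * (\<Sum>\<sigma>\<in>?E. path_prod p A e a \<alpha> \<sigma> (Suc m) \<alpha>))"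
    unfolding mat_trace_def using D by (intro sum.cong refl word_expansion) auto
  also have "\<dots> = c ^ Suc m * (\<Sum>\<sigma>\<in>?E. \<Sum>\<alpha>\<in>{1..p}. path_prod p A e a \<alpha> \<sigma> (Suc m) \<alpha>)"
    unfolding sum_distrib_left[symmetric] by (rule arg_cong[where f = "(*) _"], rule sum.swap)
  also have "(\<Sum>\<sigma>\<in>?E. \<Sum>\<alpha>\<in>{1..p}. path_prod p A e a \<alpha> \<sigma> (Suc m) \<alpha>)
    = (\<Sum>\<sigma>\<in>?E. cycle_coeff p A a m \<sigma> * (\<Prod>s<Suc m. e (\<sigma> (2 * s)) (\<sigma> (2 * s+1))))"
  proof (intro sum.cong refl)
    fix \<sigma> assume \<sigma>: "\<sigma> \<in> ?E"
    have "\<sigma> 0 \<in> {1..p} \<times> {1..n}" using \<sigma> by auto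
    then have 0: "fst (\<sigma> 0) \<in> {1..p}" by (auto simp: mem_Times_iff)
    let ?P = "\<Prod>s\<le>m. e (\<sigma> (2 * s)) (\<sigma> (2 * s+1))" and ?Q = "\<Prod>s<m. mat_pow p A (a (Suc s)) (fst (\<sigma> (2 * s+1))) (fst (\<sigma> (2 * s+2)))"
    have "(\<Sum>\<alpha>\<in>{1..p}. path_prod p A e a \<alpha> \<sigma> (Suc m) \<alpha>)
       = ?P * ?Q * mat_mult p (mat_pow p A (a (Suc m))) (mat_pow p A (a 0)) (fst (\<sigma> (2*m+1))) (fst (\<sigma> 0))"
      unfolding path_prod_closed mat_mult_def sum_distrib_left by (simp add: mult_ac)
    also have "\<dots> = cycle_coeff p A a m \<sigma> * ?P"
      unfolding mat_pow_add[OF 0] cycle_coeff_def by (simp add: mult_ac)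
    finally show "(\<Sum>\<alpha>\<in>{1..p}. path_prod p A e a \<alpha> \<sigma> (Suc m) \<alpha>)
      = cycle_coeff p A a m \<sigma> * (\<Prod>s<Suc m. e (\<sigma> (2 * s)) (\<sigma> (2 * s+1)))" by (simp add: lessThan_Suc_atMost)
  qed
  finally show ?thesis .
qed

definition edge_mate :: "nat \<Rightarrow> nat" where
  "edge_mate h = (if even h then h + 1 else h - 1)"

text \<open>The power of the mean matrix behind noise factor \<open>s\<close> joins end
  \<open>2 * s + 1\<close> to end \<open>2 * s + 2\<close>, cyclically modulo
  \<open>2 * M\<close>.\<close>

definition path_mate :: "nat \<Rightarrow> nat \<Rightarrow> nat" where
  "path_mate M h = (if odd h then (if h + 1 = 2 * M then 0 else h + 1) else (if h = 0 then 2 * M - 1 else h - 1))"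

lemma prod_lessThan_double: "(\<Prod>h<2*M. f h) = (\<Prod>s<M. f (2 * s) * f (2 * s+1))" for f :: "nat \<Rightarrow> real"
  by (induction M) (auto simp: mult_ac)

lemma prod_band_edges:
  "(\<Prod>h<2*M. band_weight b (\<sigma> h) (\<sigma> (edge_mate h))) = (\<Prod>s<M. band_weight b (\<sigma> (2 * s)) (\<sigma> (2 * s+1)))"
  unfolding prod_lessThan_double by (intro prod.cong refl) (auto simp: edge_mate_def band_weight_def)

text \<open>Each path link is met from both of its ends, and the two square roots multiply to one
  \<open>q\<close> per power of the mean matrix.\<close>

lemma prod_half_weights:
  assumes "\<And>d. q d \<ge> 0" "\<And>d. q (- d) = q d"
  shows "(\<Prod>h<2*Suc m. half_weight q (\<sigma> h) (\<sigma> (path_mate (Suc m) h)))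
    = (\<Prod>s<m. q (int (fst (\<sigma> (2 * s+1))) - int (fst (\<sigma> (2 * s+2))))) * q (int (fst (\<sigma> (2*m+1))) - int (fst (\<sigma> 0)))"
proof -
  let ?w = "half_weight q"
  have "(\<Prod>h<2*Suc m. ?w (\<sigma> h) (\<sigma> (path_mate (Suc m) h)))
     = (\<Prod>s<Suc m. ?w (\<sigma> (2 * s)) (\<sigma> (path_mate (Suc m) (2 * s)))) * (\<Prod>s<Suc m. ?w (\<sigma> (2 * s+1)) (\<sigma> (path_mate (Suc m) (2 * s+1))))"
    unfolding prod_lessThan_double prod.distrib ..
  also have "(\<Prod>s<Suc m. ?w (\<sigma> (2 * s)) (\<sigma> (path_mate (Suc m) (2 * s))))
     = ?w (\<sigma> 0) (\<sigma> (2*m+1)) * (\<Prod>s<m. ?w (\<sigma> (2 * s+2)) (\<sigma> (2 * s+1)))"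
    by (subst prod.lessThan_Suc_shift) (auto simp: path_mate_def)
  also have "(\<Prod>s<Suc m. ?w (\<sigma> (2 * s+1)) (\<sigma> (path_mate (Suc m) (2 * s+1))))
     = (\<Prod>s<m. ?w (\<sigma> (2 * s+1)) (\<sigma> (2 * s+2))) * ?w (\<sigma> (2*m+1)) (\<sigma> 0)"
    by (subst prod.lessThan_Suc, intro arg_cong2[where f = "(*)"] prod.cong refl) (auto simp: path_mate_def)
  also have "?w (\<sigma> 0) (\<sigma> (2*m+1)) * (\<Prod>s<m. ?w (\<sigma> (2 * s+2)) (\<sigma> (2 * s+1))) *
      ((\<Prod>s<m. ?w (\<sigma> (2 * s+1)) (\<sigma> (2 * s+2))) * ?w (\<sigma> (2*m+1)) (\<sigma> 0))
     = (\<Prod>s<m. ?w (\<sigma> (2 * s+1)) (\<sigma> (2 * s+2)) * ?w (\<sigma> (2 * s+2)) (\<sigma> (2 * s+1))) * (?w (\<sigma> (2*m+1)) (\<sigma> 0) * ?w (\<sigma> 0) (\<sigma> (2*m+1)))"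
    by (simp add: prod.distrib mult_ac)
  finally show ?thesis by (simp only: half_weight_mult[of q, OF assms])
qed

lemma edge_mate_props:
  assumes "h < 2 * M"
  shows "edge_mate h < 2 * M" "edge_mate (edge_mate h) = h" "edge_mate h \<noteq> h"
  using assms by (auto simp: edge_mate_def elim!: evenE oddE)

lemma path_mate_props:
  assumes "h < 2 * M"
  shows "path_mate M h < 2 * M" "path_mate M (path_mate M h) = h" "path_mate M h \<noteq> h"
  using assms by (auto simp: path_mate_def elim!: evenE oddE) presburger+

lemma edge_mate_neq_path_mate: "h < 2 * M \<Longrightarrow> 2 \<le> M \<Longrightarrow> edge_mate h \<noteq> path_mate M h"
  by (auto simp: edge_mate_def path_mate_def)

text \<open>One mate of an end is its successor and the other its predecessor, cyclically, so a set
  closed under both mates can be walked through from any of its elements.\<close>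

lemma mates_connected:
  assumes V: "V \<subseteq> {..<2*M}" "V \<noteq> {}" and cl: "\<And>h. h \<in> V \<Longrightarrow> edge_mate h \<in> V \<and> path_mate M h \<in> V"
  shows "V = {..<2*M}"
proof -
  have down: "h - 1 \<in> V" if "h \<in> V" "0 < h" for h
    using cl[OF that(1)] that(2) by (cases "even h") (auto simp: edge_mate_def path_mate_def)
  have up: "Suc h \<in> V" if "h \<in> V" "Suc h < 2 * M" for h
    using cl[OF that(1)] that(2) by (cases "even h") (auto simp: edge_mate_def path_mate_def)
  obtain h where h: "h \<in> V" using V by auto
  have "h - k \<in> V" for k
  proof (induction k)
    case (Suc k)
    then show ?case using down[of "h - k"] by (cases "h - k = 0") auto
  qed (use h in simp)
  from this[of h] have "0 \<in> V" by simp
  have "k < 2 * M \<Longrightarrow> k \<in> V" for k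
    by (induction k) (use \<open>0 \<in> V\<close> up in auto)
  then show ?thesis using V by auto
qed

text \<open>The tag distinguishes the two copies of the word. For \<open>M = 1\<close> the two mates
  of an end coincide, hence the assumption of at least two noise factors.\<close>

lemma two_cycles_bool:
  assumes "2 \<le> M"
  shows "two_cycles ({False} \<times> {..<2*M}) ({True} \<times> {..<2*M})
    (\<lambda>(c, h). (c, edge_mate h)) (\<lambda>(c, h). (c, path_mate M h))"
proof
  fix V :: "(bool \<times> nat) set" and c
  let ?m = "\<lambda>(c, h). (c, edge_mate h)" and ?p = "\<lambda>(c, h). (c :: bool, path_mate M h)"
  have conn: "V = {c} \<times> {..<2*M}" if V: "V \<subseteq> {c} \<times> {..<2*M}" "V \<noteq> {}"
    "\<And>h. h \<in> V \<Longrightarrow> ?m h \<in> V \<and> ?p h \<in> V" for c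
  proof -
    have Vs: "V = {c} \<times> (snd ` V)" using V(1) by force
    have "snd ` V = {..<2*M}"
    proof (rule mates_connected)
      fix h assume "h \<in> snd ` V"
      then have "(c, h) \<in> V" using V(1) by force
      then have "(c, edge_mate h) \<in> V" "(c, path_mate M h) \<in> V" using V(3) by fastforce+
      then show "edge_mate h \<in> snd ` V \<and> path_mate M h \<in> snd ` V" by force
    qed (use V in auto)
    then show ?thesis using Vs by simp
  qed
  show "V \<subseteq> {False} \<times> {..<2*M} \<Longrightarrow> V \<noteq> {} \<Longrightarrow> (\<And>h. h \<in> V \<Longrightarrow> ?m h \<in> V \<and> ?p h \<in> V) \<Longrightarrow> V = {False} \<times> {..<2*M}"
    by (rule conn)
  show "V \<subseteq> {True} \<times> {..<2*M} \<Longrightarrow> V \<noteq> {} \<Longrightarrow> (\<And>h. h \<in> V \<Longrightarrow> ?m h \<in> V \<and> ?p h \<in> V) \<Longrightarrow> V = {True} \<times> {..<2*M}"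
    by (rule conn)
qed (use edge_mate_props path_mate_props edge_mate_neq_path_mate[OF _ assms] in auto)

section \<open>Variance of the nonlinear words\<close>

lemma sum_PiE_bool:
  fixes f :: "(nat \<Rightarrow> 's) \<Rightarrow> (nat \<Rightarrow> 's) \<Rightarrow> real"
  shows "(\<Sum>\<sigma>\<in>PiE A (\<lambda>_. S). \<Sum>\<sigma>'\<in>PiE A (\<lambda>_. S). f \<sigma> \<sigma>')
    = (\<Sum>\<tau>\<in>PiE ({False} \<times> A \<union> {True} \<times> A) (\<lambda>_. S). f (\<lambda>h\<in>A. \<tau> (False, h)) (\<lambda>h\<in>A. \<tau> (True, h)))"
proof -
  let ?H = "{False} \<times> A \<union> {True} \<times> A" let ?E = "PiE A (\<lambda>_. S)"
  let ?j = "\<lambda>(\<sigma>, \<sigma>'). \<lambda>(c, h). if c then \<sigma>' h else \<sigma> h"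
  have "(\<Sum>\<sigma>\<in>?E. \<Sum>\<sigma>'\<in>?E. f \<sigma> \<sigma>') = (\<Sum>z\<in>?E \<times> ?E. f (fst z) (snd z))"
    by (simp add: sum.cartesian_product case_prod_beta)
  also have "\<dots> = (\<Sum>\<tau>\<in>PiE ?H (\<lambda>_. S). f (\<lambda>h\<in>A. \<tau> (False, h)) (\<lambda>h\<in>A. \<tau> (True, h)))"
  proof (rule sum.reindex_bij_witness[of _ "\<lambda>\<tau>. (\<lambda>h\<in>A. \<tau> (False, h), \<lambda>h\<in>A. \<tau> (True, h))" ?j])
    fix z assume z: "z \<in> ?E \<times> ?E"
    have e: "x \<notin> A \<Longrightarrow> fst z x = undefined" "x \<notin> A \<Longrightarrow> snd z x = undefined" for x
      using z by (auto simp: PiE_def extensional_def)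
    have r: "(\<lambda>h\<in>A. ?j z (False, h)) = fst z" "(\<lambda>h\<in>A. ?j z (True, h)) = snd z"
      using e by (auto simp: fun_eq_iff restrict_def case_prod_beta)
    show "(\<lambda>h\<in>A. ?j z (False, h), \<lambda>h\<in>A. ?j z (True, h)) = z" unfolding r by simp
    show "f (\<lambda>h\<in>A. ?j z (False, h)) (\<lambda>h\<in>A. ?j z (True, h)) = f (fst z) (snd z)" unfolding r ..
    show "?j z \<in> PiE ?H (\<lambda>_. S)"
      using z e by (auto simp: PiE_def extensional_def Pi_def case_prod_beta)
  next
    fix \<tau> assume \<tau>: "\<tau> \<in> PiE ?H (\<lambda>_. S)"
    have u: "\<tau> (c, h) = undefined" if "h \<notin> A" for c h using \<tau> that by (auto simp: PiE_def extensional_def)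
    show "?j (\<lambda>h\<in>A. \<tau> (False, h), \<lambda>h\<in>A. \<tau> (True, h)) = \<tau>"
    proof
      fix z show "?j (\<lambda>h\<in>A. \<tau> (False, h), \<lambda>h\<in>A. \<tau> (True, h)) z = \<tau> z"
        using u by (cases z; cases "fst z") (auto simp: restrict_def)
    qed
    have "\<tau> (c, h) \<in> S" if "h \<in> A" for c h using \<tau> that by (cases c) auto
    then show "(\<lambda>h\<in>A. \<tau> (False, h), \<lambda>h\<in>A. \<tau> (True, h)) \<in> ?E \<times> ?E" by auto
  qed
  finally show ?thesis .
qed

context copies
begin

definition R :: "int \<Rightarrow> real" where
  "R d = expectation (\<lambda>\<omega>. Z 0 \<omega> * Z d \<omega>)"

lemma expectation_Z_shift: "expectation (\<lambda>\<omega>. Z i \<omega> * Z j \<omega>) = R (j - i)"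
  using expectation_shift[of "\<lambda>x. x 0 * x (j - i)" i] by (simp add: R_def)

lemma R_even: "R (- d) = R d"
  using expectation_Z_shift[of d 0] by (simp add: R_def mult.commute)

lemma expectation_Z: "expectation (Z j) = 0"
  using expectation_shift[of "\<lambda>x. x 0" j] Z_mean by simp

text \<open>The means vanish, so the cumulant of a pair is its covariance; through this the cumulant
  assumption makes \<open>R\<close> summable.\<close>

lemma R_eq_joint_cumulant: "R d = joint_cumulant M [Z 0, Z d]"
proof -
  have "cum (momZ (\<lambda>h. if h then d else 0)) (set [False, True]) = joint_cumulant M [Z 0, Z d]"
    by (subst cum_momZ_list) auto
  moreover have "momZ (\<lambda>h. if h then d else 0) {False, True} = R d" by (simp add: momZ_def R_def)
  moreover have "momZ (\<lambda>h. if h then d else 0) {h} = 0" for h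
    using expectation_Z by (cases h) (simp_all add: momZ_def)
  ultimately show ?thesis by (simp add: cum_pair)
qed

lemma R_summable: "(\<lambda>d. \<bar>R d\<bar>) summable_on UNIV"
proof -
  have "{js :: int list. length js = 1} = range (\<lambda>d. [d])" by (auto simp: length_Suc_conv)
  then have "((\<lambda>js. \<bar>joint_cumulant M (Z 0 # map Z js)\<bar>) \<circ> (\<lambda>d. [d])) summable_on UNIV"
    using Z_cum[of 1] by (subst summable_on_reindex[symmetric]) (auto simp: inj_on_def)
  then show ?thesis by (simp add: comp_def R_eq_joint_cumulant)
qed

sublocale K: summable_kernel "\<lambda>d. \<bar>R d\<bar>"
  using R_summable by unfold_locales (auto simp: R_even)

lemma expectation_X_mult:
  assumes "1 \<le> snd s" "snd s = snd t"
  shows "expectation (\<lambda>\<omega>. X s \<omega> * X t \<omega>) = R (int (fst s) - int (fst t))"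
  using expectation_copy[of "\<lambda>x. x (int (fst s)) * x (int (fst t))" "snd s"] assms
    expectation_Z_shift[of "int (fst s)" "int (fst t)"] R_even[of "int (fst s) - int (fst t)"]
  by (simp add: X_def)

definition mean_mat :: "real \<Rightarrow> nat \<Rightarrow> nat \<Rightarrow> real" where
  "mean_mat b i j = (if \<bar>real i - real j\<bar> \<le> b then 1 else 0) * R (int i - int j)"

text \<open>For states in different rows the subtracted term is not the mean of the product; such
  pairs appear only together with a vanishing \<open>band_weight\<close>.\<close>

definition xi :: "'a \<Rightarrow> nat \<times> nat \<Rightarrow> nat \<times> nat \<Rightarrow> real" where
  "xi \<omega> s t = X s \<omega> * X t \<omega> - R (int (fst s) - int (fst t))"

text \<open>Each end of a noise factor gets a state of its own, so the row is written twice and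
  \<open>band_weight\<close> forces the two copies to agree.\<close>

definition noise_mat :: "real \<Rightarrow> nat \<Rightarrow> 'a \<Rightarrow> nat \<Rightarrow> nat \<Rightarrow> real" where
  "noise_mat b n \<omega> i j = (1 / real n) * (\<Sum>r\<in>{1..n}. \<Sum>r'\<in>{1..n}. band_weight b (i,r) (j,r') * xi \<omega> (i,r) (j,r'))"

lemma noise_mat_eq: "noise_mat b n \<omega> i j = (if \<bar>real i - real j\<bar> \<le> b then 1 else 0) *
    ((1 / real n) * (\<Sum>r\<in>{1..n}. xi \<omega> (i,r) (j,r)))"
proof -
  have "(\<Sum>r'\<in>{1..n}. band_weight b (i,r) (j,r') * xi \<omega> (i,r) (j,r'))
      = (if \<bar>real i - real j\<bar> \<le> b then 1 else 0) * xi \<omega> (i,r) (j,r)" if "r \<in> {1..n}" for r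
  proof -
    have "(\<Sum>r'\<in>{1..n}. band_weight b (i,r) (j,r') * xi \<omega> (i,r) (j,r'))
       = (\<Sum>r'\<in>{1..n}. if r' = r then (if \<bar>real i - real j\<bar> \<le> b then 1 else 0) * xi \<omega> (i,r) (j,r) else 0)"
      by (intro sum.cong refl) (auto simp: band_weight_def)
    then show ?thesis using that by simp
  qed
  then have "(\<Sum>r\<in>{1..n}. \<Sum>r'\<in>{1..n}. band_weight b (i,r) (j,r') * xi \<omega> (i,r) (j,r'))
      = (\<Sum>r\<in>{1..n}. (if \<bar>real i - real j\<bar> \<le> b then 1 else 0) * xi \<omega> (i,r) (j,r))" by (intro sum.cong refl)
  then show ?thesis unfolding noise_mat_def by (simp add: sum_distrib_left)
qed

lemma banded_Y_eq:
  assumes "0 < n"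
  shows "banded_Y b n p Zc \<omega> i j = mean_mat b i j + noise_mat b n \<omega> i j"
proof -
  have "(\<Sum>r\<in>{1..n}. Zc r (int i) \<omega> / sqrt (real n) * (Zc r (int j) \<omega> / sqrt (real n)))
     = (1 / real n) * (\<Sum>r\<in>{1..n}. xi \<omega> (i,r) (j,r)) + R (int i - int j)"
    using assms by (simp add: xi_def X_def sum_subtractf sum_divide_distrib diff_divide_distrib)
  then show ?thesis unfolding banded_Y_def mean_mat_def noise_mat_eq by (simp add: algebra_simps)
qed

lemma abs_mean_mat_le: "\<bar>mean_mat b i j\<bar> \<le> \<bar>R (int i - int j)\<bar>"
  by (simp add: mean_mat_def)

lemma abs_mat_pow_mean_le:
  "a \<le> k \<Longrightarrow> \<bar>mat_pow p (mean_mat b) a i j\<bar> \<le> K.path_const k * K.path_kernel k (int i - int j)"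
  by (rule order_trans[OF K.abs_mat_pow_le[OF abs_mean_mat_le] K.conv_pow_le_path_kernel])

lemma all_moments_xi: "1 \<le> snd s \<Longrightarrow> 1 \<le> snd t \<Longrightarrow> all_moments M (\<lambda>\<omega>. xi \<omega> s t)"
  unfolding xi_def by (intro all_moments_diff all_moments_mult all_moments_const all_moments_X)

lemma xi_eq_centred_edge:
  assumes "1 \<le> snd (\<tau> g)" "snd (\<tau> g) = snd (\<tau> h)" "g \<noteq> h"
  shows "xi \<omega> (\<tau> g) (\<tau> h) = centred_edge \<tau> {g, h} \<omega>"
proof -
  have "mom \<tau> {g} = 0" "mom \<tau> {h} = 0" using cum_mom_singleton[of \<tau>] assms by (auto simp: cum_singleton)
  then have "cum (mom \<tau>) {g, h} = expectation (\<lambda>\<omega>. X (\<tau> g) \<omega> * X (\<tau> h) \<omega>)"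
    using assms(3) by (simp add: cum_pair mom_def)
  then show ?thesis using assms expectation_X_mult[of "\<tau> g" "\<tau> h"] by (simp add: xi_def centred_edge_def)
qed

text \<open>One \<open>path_const k\<close> is paid for each of the \<open>Suc m\<close> powers in
  the closed cycle; \<open>a (Suc m) + a 0\<close> is the exponent of the merged one.\<close>

lemma abs_cycle_coeff_le:
  assumes "\<And>s. s \<le> Suc m \<Longrightarrow> a s \<le> k" "a (Suc m) + a 0 \<le> k"
  shows "\<bar>cycle_coeff p (mean_mat b) a m \<sigma>\<bar>
    \<le> K.path_const k ^ Suc m * (\<Prod>h<2 * Suc m. half_weight (K.path_kernel k) (\<sigma> h) (\<sigma> (path_mate (Suc m) h)))"
proof -
  let ?c = "K.path_const k" and ?q = "K.path_kernel k"
  have "\<bar>cycle_coeff p (mean_mat b) a m \<sigma>\<bar>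
      = (\<Prod>s<m. \<bar>mat_pow p (mean_mat b) (a (Suc s)) (fst (\<sigma> (2 * s+1))) (fst (\<sigma> (2 * s+2)))\<bar>)
     * \<bar>mat_pow p (mean_mat b) (a (Suc m) + a 0) (fst (\<sigma> (2*m+1))) (fst (\<sigma> 0))\<bar>"
    by (simp add: cycle_coeff_def abs_mult abs_prod)
  also have "\<dots> \<le> (\<Prod>s<m. ?c * ?q (int (fst (\<sigma> (2 * s+1))) - int (fst (\<sigma> (2 * s+2)))))
     * (?c * ?q (int (fst (\<sigma> (2*m+1))) - int (fst (\<sigma> 0))))"
    using assms K.path_const_ge_1[of k] K.path_kernel_nonneg
    by (intro mult_mono prod_mono abs_mat_pow_mean_le conjI prod_nonneg mult_nonneg_nonneg) auto
  also have "\<dots> = ?c ^ Suc m * ((\<Prod>s<m. ?q (int (fst (\<sigma> (2 * s+1))) - int (fst (\<sigma> (2 * s+2)))))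
     * ?q (int (fst (\<sigma> (2*m+1))) - int (fst (\<sigma> 0))))"
    by (simp add: prod.distrib mult_ac)
  also have "((\<Prod>s<m. ?q (int (fst (\<sigma> (2 * s+1))) - int (fst (\<sigma> (2 * s+2)))))
     * ?q (int (fst (\<sigma> (2*m+1))) - int (fst (\<sigma> 0))))
     = (\<Prod>h<2 * Suc m. half_weight ?q (\<sigma> h) (\<sigma> (path_mate (Suc m) h)))"
    using K.path_kernel_nonneg K.path_kernel_even by (intro prod_half_weights[symmetric]) auto
  finally show ?thesis .
qed

text \<open>The factors are the domination constants for the \<open>2 * N\<close> matrix powers in
  two copies of the word, the number of partitions of all ends, and the power \<open>K^Q\<close> of
  the network bound with \<open>Q = 2 * N\<close>.\<close>

definition var_const :: "nat \<Rightarrow> nat \<Rightarrow> real" where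
  "var_const k N = K.path_const k ^ (2 * N) *
    (real (card (partitions ({False} \<times> {..<2*N} \<union> {True} \<times> {..<2*N}))) * cum_bound (4 * N) ^ (2 * N))"

text \<open>This is \<open>crossing\<close> for two copies of a cycle with \<open>N\<close> edges:
  there are \<open>4 * N\<close> ends, so \<open>Q = 2 * N\<close>, and no block exceeds
  \<open>4 * N\<close> points.\<close>

lemma crossing_partition_sum_le:
  assumes N: "2 \<le> N" and b: "0 \<le> b" "2 * b + 1 \<le> real n"
    and P: "partition_on ({False} \<times> {..<2*N} \<union> {True} \<times> {..<2*N}) P" "\<forall>B\<in>P. 2 \<le> card B"
      "\<And>c s. s < N \<Longrightarrow> {(c, 2 * s), (c, 2 * s + 1)} \<notin> P"
      "\<exists>B\<in>P. B \<inter> {False} \<times> {..<2*N} \<noteq> {} \<and> B \<inter> {True} \<times> {..<2*N} \<noteq> {}"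
  shows "(\<Sum>\<tau>\<in>PiE ({False} \<times> {..<2*N} \<union> {True} \<times> {..<2*N}) (\<lambda>_. {1..p} \<times> {1..n}).
      (\<Prod>B\<in>P. abs_cum p n B \<tau>) *
      ((\<Prod>(c,h)\<in>{False} \<times> {..<2*N} \<union> {True} \<times> {..<2*N}. band_weight b (\<tau> (c,h)) (\<tau> (c, edge_mate h))) *
       (\<Prod>(c,h)\<in>{False} \<times> {..<2*N} \<union> {True} \<times> {..<2*N}. half_weight (K.path_kernel k) (\<tau> (c,h)) (\<tau> (c, path_mate N h)))))
    \<le> cum_bound (4 * N) ^ (2 * N) * real p * (2 * b + 1) * real n ^ (2 * N - 2)"
proof -
  let ?H1 = "{False} \<times> {..<2*N}" and ?H2 = "{True} \<times> {..<2*N}"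
  let ?mt = "\<lambda>(c :: bool, h). (c, edge_mate h)" and ?pl = "\<lambda>(c :: bool, h). (c, path_mate N h)"
  interpret tc: two_cycles ?H1 ?H2 ?mt ?pl by (rule two_cycles_bool[OF N])
  have cardH: "card (?H1 \<union> ?H2) = 4 * N"
    by (subst card_Un_disjoint) (auto simp: card_cartesian_product)
  obtain B0 where B0: "B0 \<in> P" "B0 \<inter> ?H1 \<noteq> {}" "B0 \<inter> ?H2 \<noteq> {}" using P(4) by blast
  have BH: "B \<subseteq> ?H1 \<union> ?H2" "B \<noteq> {}" "finite B" "card B \<le> 4 * N" if "B \<in> P" for B
  proof -
    show 1: "B \<subseteq> ?H1 \<union> ?H2" "B \<noteq> {}" using partition_on_memD[OF P(1) that] by auto
    show "finite B" by (rule finite_subset[OF 1(1)]) auto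
    show "card B \<le> 4 * N" unfolding cardH[symmetric] by (rule card_mono[OF _ 1(1)]) auto
  qed
  interpret cr: crossing ?H1 ?H2 ?mt ?pl P "abs_cum p n" p n b "cum_bound (4 * N)" "K.path_kernel k"
    "\<lambda>d. \<bar>joint_cumulant M [Z 0, Z d]\<bar>" "2 * N" B0
  proof
    show "partition_on tc.H P" using P(1) by (simp add: tc.H_def)
    show "2 \<le> card B" if "B \<in> P" for B using P(2) that by blast
    show "{h, ?mt h} \<notin> P" if "h \<in> tc.H" for h
    proof -
      obtain c j where h: "h = (c, j)" by (cases h)
      then have j: "j < 2 * N" using that by (auto simp: tc.H_def)
      \<comment> \<open>The edge through end \<open>j\<close> has number \<open>j div 2\<close>,
        whichever of its two ends \<open>j\<close> is.\<close>
      have "{h, ?mt h} = {(c, 2 * (j div 2)), (c, 2 * (j div 2) + 1)}"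
        unfolding h by (cases "even j") (auto simp: edge_mate_def elim!: evenE oddE)
      moreover have "j div 2 < N" using j by auto
      ultimately show ?thesis using P(3) by metis
    qed
    show "card tc.H = 2 * (2 * N)" using cardH by (simp add: tc.H_def)
    show "sum (\<lambda>d. \<bar>joint_cumulant M [Z 0, Z d]\<bar>) F \<le> cum_bound (4 * N)" if "finite F" for F
      using sum_joint_cumulant_pair_le[OF that] cum_bound_ge(2)[of 1 "4 * N"] N by linarith
    show "abs_cum p n B \<sigma> = abs_cum p n B \<sigma>'" if "B \<in> P" "\<And>h. h \<in> B \<Longrightarrow> \<sigma> h = \<sigma>' h" for B \<sigma> \<sigma>'
      using BH[OF that(1)] that(2) by (intro abs_cum_cong) auto
    show "(\<Sum>\<sigma>\<in>{\<sigma>\<in>PiE B (\<lambda>_. {1..p} \<times> {1..n}). \<sigma> h = s}. abs_cum p n B \<sigma>) \<le> cum_bound (4 * N)"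
      if "B \<in> P" "h \<in> B" "s \<in> {1..p} \<times> {1..n}" for B h s
      using BH[OF that(1)] that P(2) by (intro sum_abs_cum_le) auto
    show "0 \<le> abs_cum p n B \<sigma>" for B \<sigma> by (rule abs_cum_nonneg)
    show "abs_cum p n {x, y} \<sigma> \<le> \<bar>joint_cumulant M [Z 0, Z (int (fst (\<sigma> x)) - int (fst (\<sigma> y)))]\<bar>"
      if "x \<noteq> y" for x y \<sigma> by (rule abs_cum_pair_le[OF that])
  qed (use N b B0 K.path_kernel_nonneg K.path_kernel_even K.sum_path_kernel_le cum_bound_ge(1) in auto)
  show ?thesis
    using cr.total_bound unfolding tc.H_def by (simp add: case_prod_beta)
qed

lemma all_moments_word_term:
  fixes N :: nat
  assumes "\<sigma> \<in> PiE {..<2*N} (\<lambda>_. {1..p} \<times> {1..n})"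
  shows "all_moments M (\<lambda>\<omega>. \<Prod>s<N. band_weight b (\<sigma> (2 * s)) (\<sigma> (2 * s + 1)) * xi \<omega> (\<sigma> (2 * s)) (\<sigma> (2 * s + 1)))"
proof (intro all_moments_prod all_moments_cmult all_moments_xi)
  fix s assume "s \<in> {..<N}"
  then have "2 * s \<in> {..<2*N}" "2 * s + 1 \<in> {..<2*N}" by auto
  then have "\<sigma> (2 * s) \<in> {1..p} \<times> {1..n}" "\<sigma> (2 * s + 1) \<in> {1..p} \<times> {1..n}"
    using PiE_mem[OF assms] by blast+
  then show "1 \<le> snd (\<sigma> (2 * s))" "1 \<le> snd (\<sigma> (2 * s + 1))" by (auto simp: mem_Times_iff)
qed

lemma trace_noise_word:
  "mat_trace p (word p (mean_mat b) (noise_mat b n \<omega>) a (Suc m)) = (1 / real n) ^ Suc m *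
    (\<Sum>\<sigma>\<in>PiE {..<2 * Suc m} (\<lambda>_. {1..p} \<times> {1..n}). cycle_coeff p (mean_mat b) a m \<sigma> *
      (\<Prod>s<Suc m. band_weight b (\<sigma> (2 * s)) (\<sigma> (2 * s+1)) * xi \<omega> (\<sigma> (2 * s)) (\<sigma> (2 * s+1))))"
  by (rule trace_word_expansion) (simp add: noise_mat_def)

lemma all_moments_trace_noise_word:
  "all_moments M (\<lambda>\<omega>. mat_trace p (word p (mean_mat b) (noise_mat b n \<omega>) a (Suc m)))"
  unfolding trace_noise_word by (intro all_moments_cmult all_moments_sum all_moments_word_term)

text \<open>Band weights are 0 or 1. If one of them vanishes, both sides do; otherwise the rows
  agree along every edge, each \<open>xi\<close> is a centred edge, and
  \<open>covariance_edges_le\<close> applies.\<close>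

lemma word_covariance_le:
  fixes b :: real
  assumes \<tau>: "\<tau> \<in> PiE ({False} \<times> {..<2*N} \<union> {True} \<times> {..<2*N}) (\<lambda>_. {1..p} \<times> {1..n})"
  defines "T \<equiv> \<lambda>c \<omega>. \<Prod>s<N. band_weight b (\<tau> (c, 2 * s)) (\<tau> (c, 2 * s + 1)) * xi \<omega> (\<tau> (c, 2 * s)) (\<tau> (c, 2 * s + 1))"
  shows "\<bar>expectation (\<lambda>\<omega>. T False \<omega> * T True \<omega>) - expectation (T False) * expectation (T True)\<bar>
    \<le> (\<Prod>(c,h)\<in>{False} \<times> {..<2*N} \<union> {True} \<times> {..<2*N}. band_weight b (\<tau> (c,h)) (\<tau> (c, edge_mate h))) *
     (\<Sum>P\<in>{P. partition_on ({False} \<times> {..<2*N} \<union> {True} \<times> {..<2*N}) P \<and> (\<forall>B\<in>P. 2 \<le> card B) \<and>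
        (\<forall>c s. s < N \<longrightarrow> {(c, 2 * s), (c, 2 * s + 1)} \<notin> P) \<and>
        (\<exists>B\<in>P. B \<inter> {False} \<times> {..<2*N} \<noteq> {} \<and> B \<inter> {True} \<times> {..<2*N} \<noteq> {})}. \<Prod>B\<in>P. abs_cum p n B \<tau>)"
    (is "?lhs \<le> ?band * (\<Sum>P\<in>?G. _)")
proof -
  let ?b = "\<lambda>c. \<Prod>s<N. band_weight b (\<tau> (c, 2 * s)) (\<tau> (c, 2 * s + 1))"
  let ?x = "\<lambda>c \<omega>. \<Prod>s<N. xi \<omega> (\<tau> (c, 2 * s)) (\<tau> (c, 2 * s + 1))"
  let ?e = "\<lambda>c s. {(c :: bool, 2 * s), (c, 2 * s + 1)}"
  let ?F = "\<lambda>c. ?e c ` {..<N}"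
  have T: "T c \<omega> = ?b c * ?x c \<omega>" for c \<omega> by (simp add: T_def prod.distrib)
  have band: "?band = ?b False * ?b True"
  proof -
    have each: "(\<Prod>(c,h)\<in>{c} \<times> {..<2*N}. band_weight b (\<tau> (c,h)) (\<tau> (c, edge_mate h))) = ?b c" for c
    proof -
      have "{c} \<times> {..<2*N} = Pair c ` {..<2*N}" by auto
      then have "(\<Prod>(c,h)\<in>{c} \<times> {..<2*N}. band_weight b (\<tau> (c,h)) (\<tau> (c, edge_mate h)))
          = (\<Prod>h<2*N. band_weight b (\<tau> (c,h)) (\<tau> (c, edge_mate h)))"
        by (simp add: prod.reindex inj_on_def)
      then show ?thesis using prod_band_edges[of b "\<lambda>h. \<tau> (c, h)" N] by simp
    qed
    have "?band = (\<Prod>(c,h)\<in>{False} \<times> {..<2*N}. band_weight b (\<tau> (c,h)) (\<tau> (c, edge_mate h)))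
        * (\<Prod>(c,h)\<in>{True} \<times> {..<2*N}. band_weight b (\<tau> (c,h)) (\<tau> (c, edge_mate h)))"
      by (intro prod.union_disjoint) auto
    then show ?thesis unfolding each .
  qed
  have b01: "?b c = 1 \<or> ?b c = 0" for c
    by (induction N) (auto simp: band_weight_def)
  have nonneg: "0 \<le> (\<Sum>P\<in>?G. \<Prod>B\<in>P. abs_cum p n B \<tau>)"
    using abs_cum_nonneg by (intro sum_nonneg prod_nonneg) auto
  show ?thesis
  proof (cases "?b False = 1 \<and> ?b True = 1")
    case False
    then consider "?b False = 0" | "?b True = 0" using b01 by blast
    then have "(T False = (\<lambda>_. 0) \<or> T True = (\<lambda>_. 0)) \<and> ?band = 0"
    proof cases
      case 1
      then have "T False = (\<lambda>_. 0)" by (intro ext) (simp only: T mult_zero_left)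
      then show ?thesis using 1 by (simp only: band mult_zero_left simp_thms)
    next
      case 2
      then have "T True = (\<lambda>_. 0)" by (intro ext) (simp only: T mult_zero_left)
      then show ?thesis using 2 by (simp only: band mult_zero_right simp_thms)
    qed
    then have "?lhs = 0" "?band = 0" by auto
    then show ?thesis by (simp only: mult_zero_left order_refl)
  next
    case True
    have ne: "band_weight b (\<tau> (c, 2 * s)) (\<tau> (c, 2 * s + 1)) \<noteq> 0" if "s < N" for c s
    proof
      assume "band_weight b (\<tau> (c, 2 * s)) (\<tau> (c, 2 * s + 1)) = 0"
      then have b0: "?b c = 0" using that by (intro prod_zero) auto
      have "\<forall>c. ?b c = 1" unfolding all_bool_eq using True by blast
      then have b1: "?b c = 1" by (rule spec)
      show False using b0 unfolding b1 by simp
    qed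
    have Un: "\<Union>(?F c) = {c} \<times> {..<2*N}" for c
    proof -
      have "j \<in> {2 * (j div 2), 2 * (j div 2) + 1}" "j < 2 * N \<Longrightarrow> j div 2 < N" for j :: nat by auto
      then show ?thesis by (fastforce simp: image_iff)
    qed
    have prod: "?x c \<omega> = (\<Prod>e\<in>?F c. centred_edge \<tau> e \<omega>)" for c \<omega>
    proof -
      have inj: "inj_on (?e c) {..<N}" by (auto simp: inj_on_def doubleton_eq_iff; presburger)
      have "?x c \<omega> = (\<Prod>s<N. centred_edge \<tau> (?e c s) \<omega>)"
      proof (intro prod.cong refl)
        fix s assume s: "s \<in> {..<N}"
        have "snd (\<tau> (c, 2 * s)) = snd (\<tau> (c, 2 * s + 1))" using ne[of s c] s by (auto simp: band_weight_def split: if_splits)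
        moreover have "\<tau> (c, 2 * s) \<in> {1..p} \<times> {1..n}" using s by (intro PiE_mem[OF \<tau>]) (cases c, auto)
        then have "1 \<le> snd (\<tau> (c, 2 * s))" by (auto simp: mem_Times_iff)
        ultimately show "xi \<omega> (\<tau> (c, 2 * s)) (\<tau> (c, 2 * s + 1)) = centred_edge \<tau> (?e c s) \<omega>"
          by (intro xi_eq_centred_edge) auto
      qed
      then show ?thesis by (simp only: prod.reindex[OF inj] comp_def)
    qed
    have pd: "pairwise disjnt (?F c)" for c
    proof (rule pairwiseI)
      fix e f assume "e \<in> ?F c" "f \<in> ?F c" "e \<noteq> f"
      then obtain s t where "e = ?e c s" "f = ?e c t" "s \<noteq> t" by blast
      then show "disjnt e f" unfolding disjnt_def by (auto; presburger)
    qed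
    have \<tau>': "\<tau> \<in> PiE (\<Union>(?F False) \<union> \<Union>(?F True)) (\<lambda>_. {1..p} \<times> {1..n})" unfolding Un by (rule \<tau>)
    have "?lhs \<le> (\<Sum>P\<in>{P. partition_on (\<Union>(?F False) \<union> \<Union>(?F True)) P \<and> (\<forall>B\<in>P. 2 \<le> card B) \<and> P \<inter> (?F False \<union> ?F True) = {}
        \<and> (\<exists>B\<in>P. B \<inter> \<Union>(?F False) \<noteq> {} \<and> B \<inter> \<Union>(?F True) \<noteq> {})}. \<Prod>B\<in>P. abs_cum p n B \<tau>)"
    proof -
      have "T c = (\<lambda>\<omega>. \<Prod>e\<in>?F c. centred_edge \<tau> e \<omega>)" for c
        using True prod by (cases c) (auto simp: T fun_eq_iff)
      moreover have "finite (\<Union>(?F c))" for c unfolding Un by simp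
      moreover have "\<Union>(?F False) \<inter> \<Union>(?F True) = {}" unfolding Un by auto
      moreover have "{} \<notin> ?F c" for c by auto
      ultimately show ?thesis using covariance_edges_le[OF _ pd _ _ pd _ _ \<tau>'] by simp
    qed
    also have "\<dots> = (\<Sum>P\<in>?G. \<Prod>B\<in>P. abs_cum p n B \<tau>)"
    proof (intro sum.cong refl Collect_cong)
      fix P
      have "P \<inter> (?F False \<union> ?F True) = {} \<longleftrightarrow> (\<forall>c s. s < N \<longrightarrow> {(c, 2 * s), (c, 2 * s + 1)} \<notin> P)"
      proof
        assume l: "P \<inter> (?F False \<union> ?F True) = {}"
        show "\<forall>c s. s < N \<longrightarrow> {(c, 2 * s), (c, 2 * s + 1)} \<notin> P"
        proof (intro allI impI)
          fix c s assume "s < N"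
          then have "?e c s \<in> ?F False \<union> ?F True" by (cases c) blast+
          then show "?e c s \<notin> P" using l by blast
        qed
      qed blast
      then show "(partition_on (\<Union>(?F False) \<union> \<Union>(?F True)) P \<and> (\<forall>B\<in>P. 2 \<le> card B) \<and> P \<inter> (?F False \<union> ?F True) = {}
        \<and> (\<exists>B\<in>P. B \<inter> \<Union>(?F False) \<noteq> {} \<and> B \<inter> \<Union>(?F True) \<noteq> {})) =
        (partition_on ({False} \<times> {..<2*N} \<union> {True} \<times> {..<2*N}) P \<and> (\<forall>B\<in>P. 2 \<le> card B) \<and>
        (\<forall>c s. s < N \<longrightarrow> {(c, 2 * s), (c, 2 * s + 1)} \<notin> P) \<and>
        (\<exists>B\<in>P. B \<inter> {False} \<times> {..<2*N} \<noteq> {} \<and> B \<inter> {True} \<times> {..<2*N} \<noteq> {}))"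
        unfolding Un by (simp only:)
    qed
    finally show ?thesis using True unfolding band by simp
  qed
qed

text \<open>The variance is a double sum of covariances over state assignments, read as a single sum
  over two tagged copies of the cycle. With \<open>N = Suc m\<close>, the factor
  \<open>n^(-2 N)\<close> of the two words meets \<open>n^(2 N - 2)\<close> from the crossing
  partitions.\<close>

theorem variance_word_le:
  fixes p :: nat
  assumes m: "1 \<le> m" and b: "0 \<le> b" "2 * b + 1 \<le> real n"
    and a: "\<And>s. s \<le> Suc m \<Longrightarrow> a s \<le> k" "a (Suc m) + a 0 \<le> k"
  defines "F \<equiv> \<lambda>\<omega>. mat_trace p (word p (mean_mat b) (noise_mat b n \<omega>) a (Suc m))"
  shows "variance F \<le> var_const k (Suc m) * real p * (2 * b + 1) / (real n)\<^sup>2"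
proof -
  let ?N = "Suc m" let ?S = "{1..p} \<times> {1..n}" let ?E = "PiE {..<2 * ?N} (\<lambda>_. ?S)"
  let ?H = "{False} \<times> {..<2 * ?N} \<union> {True} \<times> {..<2 * ?N}" let ?HE = "PiE ?H (\<lambda>_. ?S)"
  let ?c = "cycle_coeff p (mean_mat b) a m"
  let ?T = "\<lambda>\<sigma> \<omega>. \<Prod>s<?N. band_weight b (\<sigma> (2 * s)) (\<sigma> (2 * s + 1)) * xi \<omega> (\<sigma> (2 * s)) (\<sigma> (2 * s + 1))"
  let ?z = "(1 / real n) ^ ?N"
  let ?q = "K.path_kernel k" and ?\<rho> = "K.path_const k"
  let ?hw = "\<lambda>\<tau>. \<Prod>(c,h)\<in>?H. half_weight ?q (\<tau> (c,h)) (\<tau> (c, path_mate ?N h))"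
  let ?bw = "\<lambda>\<tau>. \<Prod>(c,h)\<in>?H. band_weight b (\<tau> (c,h)) (\<tau> (c, edge_mate h))"
  let ?G = "{P. partition_on ?H P \<and> (\<forall>B\<in>P. 2 \<le> card B) \<and>
        (\<forall>c s. s < ?N \<longrightarrow> {(c, 2 * s), (c, 2 * s + 1)} \<notin> P) \<and>
        (\<exists>B\<in>P. B \<inter> {False} \<times> {..<2 * ?N} \<noteq> {} \<and> B \<inter> {True} \<times> {..<2 * ?N} \<noteq> {})}"
  have n0: "0 < real n" using b by linarith
  have F: "F \<omega> = ?z * (\<Sum>\<sigma>\<in>?E. ?c \<sigma> * ?T \<sigma> \<omega>)" for \<omega> unfolding F_def by (rule trace_noise_word)
  have mF: "all_moments M F" unfolding F_def by (rule all_moments_trace_noise_word)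
  have mT: "all_moments M (?T \<sigma>)" if "\<sigma> \<in> ?E" for \<sigma> using that by (rule all_moments_word_term)
  have EF: "expectation F = ?z * (\<Sum>\<sigma>\<in>?E. ?c \<sigma> * expectation (?T \<sigma>))"
    unfolding F using mT all_moments_integrable by (subst Bochner_Integration.integral_mult_right_zero, subst Bochner_Integration.integral_sum) auto
  have EF2: "expectation (\<lambda>\<omega>. (F \<omega>)\<^sup>2) = ?z\<^sup>2 * (\<Sum>\<sigma>\<in>?E. \<Sum>\<sigma>'\<in>?E. ?c \<sigma> * ?c \<sigma>' * expectation (\<lambda>\<omega>. ?T \<sigma> \<omega> * ?T \<sigma>' \<omega>))"
  proof -
    have "expectation (\<lambda>\<omega>. (F \<omega>)\<^sup>2) = expectation (\<lambda>\<omega>. ?z\<^sup>2 * (\<Sum>\<sigma>\<in>?E. \<Sum>\<sigma>'\<in>?E. ?c \<sigma> * ?c \<sigma>' * (?T \<sigma> \<omega> * ?T \<sigma>' \<omega>)))"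
      unfolding F by (intro Bochner_Integration.integral_cong refl) (simp only: power_mult_distrib power2_eq_square[of "sum _ _"] sum_product mult_ac)
    also have "\<dots> = ?z\<^sup>2 * (\<Sum>\<sigma>\<in>?E. \<Sum>\<sigma>'\<in>?E. ?c \<sigma> * ?c \<sigma>' * expectation (\<lambda>\<omega>. ?T \<sigma> \<omega> * ?T \<sigma>' \<omega>))"
    proof -
      have int: "integrable M (\<lambda>\<omega>. ?T \<sigma> \<omega> * ?T \<sigma>' \<omega>)" if "\<sigma> \<in> ?E" "\<sigma>' \<in> ?E" for \<sigma> \<sigma>'
        using mT that by (intro all_moments_integrable all_moments_mult)
      have "expectation (\<lambda>\<omega>. \<Sum>\<sigma>\<in>?E. \<Sum>\<sigma>'\<in>?E. ?c \<sigma> * ?c \<sigma>' * (?T \<sigma> \<omega> * ?T \<sigma>' \<omega>))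
         = (\<Sum>\<sigma>\<in>?E. expectation (\<lambda>\<omega>. \<Sum>\<sigma>'\<in>?E. ?c \<sigma> * ?c \<sigma>' * (?T \<sigma> \<omega> * ?T \<sigma>' \<omega>)))"
        using int by (intro Bochner_Integration.integral_sum Bochner_Integration.integrable_sum integrable_mult_right) auto
      also have "\<dots> = (\<Sum>\<sigma>\<in>?E. \<Sum>\<sigma>'\<in>?E. expectation (\<lambda>\<omega>. ?c \<sigma> * ?c \<sigma>' * (?T \<sigma> \<omega> * ?T \<sigma>' \<omega>)))"
        using int by (intro sum.cong refl Bochner_Integration.integral_sum integrable_mult_right) auto
      finally show ?thesis by (simp only: Bochner_Integration.integral_mult_right_zero)
    qed
    finally show ?thesis .
  qed
  let ?C = "\<lambda>\<sigma> \<sigma>'. expectation (\<lambda>\<omega>. ?T \<sigma> \<omega> * ?T \<sigma>' \<omega>) - expectation (?T \<sigma>) * expectation (?T \<sigma>')"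
  have "variance F = expectation (\<lambda>\<omega>. (F \<omega>)\<^sup>2) - (expectation F)\<^sup>2"
    by (rule variance_eq[OF all_moments_integrable[OF mF] all_moments_integrable_power[OF mF]])
  also have "\<dots> = ?z\<^sup>2 * (\<Sum>\<sigma>\<in>?E. \<Sum>\<sigma>'\<in>?E. ?c \<sigma> * ?c \<sigma>' * ?C \<sigma> \<sigma>')"
    unfolding EF EF2 power_mult_distrib power2_eq_square[of "sum _ _"] sum_product
    by (simp add: right_diff_distrib sum_subtractf mult_ac)
  also have "\<dots> = ?z\<^sup>2 * (\<Sum>\<tau>\<in>?HE. (\<lambda>\<sigma> \<sigma>'. ?c \<sigma> * ?c \<sigma>' * ?C \<sigma> \<sigma>') (\<lambda>h\<in>{..<2 * ?N}. \<tau> (False, h)) (\<lambda>h\<in>{..<2 * ?N}. \<tau> (True, h)))"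
    by (subst sum_PiE_bool) (rule refl)
  also have "\<dots> \<le> ?z\<^sup>2 * (\<Sum>\<tau>\<in>?HE. \<Sum>P\<in>?G. ?\<rho> ^ (2 * ?N) * ((\<Prod>B\<in>P. abs_cum p n B \<tau>) * (?bw \<tau> * ?hw \<tau>)))"
  proof (intro mult_left_mono sum_mono)
    fix \<tau> assume \<tau>: "\<tau> \<in> ?HE"
    let ?\<sigma> = "\<lambda>c. \<lambda>h\<in>{..<2 * ?N}. \<tau> (c, h)"
    let ?w = "\<lambda>c. \<Prod>h<2 * ?N. half_weight ?q (\<tau> (c,h)) (\<tau> (c, path_mate ?N h))"
    have w0: "0 \<le> ?w c" for c using K.path_kernel_nonneg by (intro prod_nonneg) (auto simp: half_weight_def)
    have hw: "?hw \<tau> = ?w False * ?w True"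
    proof -
    have each: "(\<Prod>(c,h)\<in>{c} \<times> {..<2 * ?N}. half_weight ?q (\<tau> (c,h)) (\<tau> (c, path_mate ?N h))) = ?w c" for c
      proof -
        have "{c} \<times> {..<2 * ?N} = Pair c ` {..<2 * ?N}" by auto
        then show ?thesis by (simp add: prod.reindex inj_on_def)
      qed
      have "?hw \<tau> = (\<Prod>(c,h)\<in>{False} \<times> {..<2 * ?N}. half_weight ?q (\<tau> (c,h)) (\<tau> (c, path_mate ?N h)))
        * (\<Prod>(c,h)\<in>{True} \<times> {..<2 * ?N}. half_weight ?q (\<tau> (c,h)) (\<tau> (c, path_mate ?N h)))"
        by (intro prod.union_disjoint) auto
        then show ?thesis unfolding each .
    qed
    have c: "\<bar>?c (?\<sigma> c)\<bar> \<le> ?\<rho> ^ ?N * ?w c" for c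
    proof -
      have "\<bar>?c (?\<sigma> c)\<bar> \<le> ?\<rho> ^ ?N * (\<Prod>h<2 * ?N. half_weight ?q (?\<sigma> c h) (?\<sigma> c (path_mate ?N h)))"
        by (rule abs_cycle_coeff_le[OF a])
      also have "(\<Prod>h<2 * ?N. half_weight ?q (?\<sigma> c h) (?\<sigma> c (path_mate ?N h))) = ?w c"
      proof (intro prod.cong refl)
        fix h assume "h \<in> {..<2 * ?N}"
        then have "h < 2 * ?N" "path_mate ?N h < 2 * ?N" using path_mate_props(1)[of h ?N] by auto
        then show "half_weight ?q (?\<sigma> c h) (?\<sigma> c (path_mate ?N h)) = half_weight ?q (\<tau> (c,h)) (\<tau> (c, path_mate ?N h))" by simp
      qed
      finally show ?thesis .
    qed
    have T: "?T (?\<sigma> c) \<omega> = (\<Prod>s<?N. band_weight b (\<tau> (c, 2 * s)) (\<tau> (c, 2 * s + 1)) * xi \<omega> (\<tau> (c, 2 * s)) (\<tau> (c, 2 * s + 1)))" for c \<omega>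
      by (intro prod.cong refl) auto
    have C: "\<bar>?C (?\<sigma> False) (?\<sigma> True)\<bar> \<le> ?bw \<tau> * (\<Sum>P\<in>?G. \<Prod>B\<in>P. abs_cum p n B \<tau>)"
      unfolding T by (rule word_covariance_le[OF \<tau>])
    have "?c (?\<sigma> False) * ?c (?\<sigma> True) * ?C (?\<sigma> False) (?\<sigma> True)
        \<le> \<bar>?c (?\<sigma> False)\<bar> * \<bar>?c (?\<sigma> True)\<bar> * \<bar>?C (?\<sigma> False) (?\<sigma> True)\<bar>"
      unfolding abs_mult[symmetric] by (rule abs_ge_self)
    also have "\<dots> \<le> (?\<rho> ^ ?N * ?w False) * (?\<rho> ^ ?N * ?w True) * (?bw \<tau> * (\<Sum>P\<in>?G. \<Prod>B\<in>P. abs_cum p n B \<tau>))"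
      using K.path_const_ge_1[of k] w0 by (intro mult_mono[OF mult_mono[OF c c] C] mult_nonneg_nonneg) auto
    also have "\<dots> = (\<Sum>P\<in>?G. ?\<rho> ^ (2 * ?N) * ((\<Prod>B\<in>P. abs_cum p n B \<tau>) * (?bw \<tau> * ?hw \<tau>)))"
    proof -
      have "?\<rho> ^ (2 * ?N) = ?\<rho> ^ ?N * ?\<rho> ^ ?N" by (simp only: mult_2 power_add)
      then show ?thesis unfolding hw by (simp only: sum_distrib_left mult_ac)
    qed
    finally show "?c (?\<sigma> False) * ?c (?\<sigma> True) * ?C (?\<sigma> False) (?\<sigma> True)
      \<le> (\<Sum>P\<in>?G. ?\<rho> ^ (2 * ?N) * ((\<Prod>B\<in>P. abs_cum p n B \<tau>) * (?bw \<tau> * ?hw \<tau>)))" .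
  qed simp
  also have "\<dots> = ?z\<^sup>2 * (?\<rho> ^ (2 * ?N) * (\<Sum>P\<in>?G. \<Sum>\<tau>\<in>?HE. (\<Prod>B\<in>P. abs_cum p n B \<tau>) * (?bw \<tau> * ?hw \<tau>)))"
    by (subst sum.swap) (simp only: sum_distrib_left)
  also have "\<dots> \<le> ?z\<^sup>2 * (?\<rho> ^ (2 * ?N) * (real (card (partitions ?H)) *
      (cum_bound (4 * ?N) ^ (2 * ?N) * real p * (2 * b + 1) * real n ^ (2 * ?N - 2))))"
  proof (intro mult_left_mono)
    let ?X = "cum_bound (4 * ?N) ^ (2 * ?N) * real p * (2 * b + 1) * real n ^ (2 * ?N - 2)"
    have fin: "finite (partitions ?H)" by (intro finitely_many_partition_on) auto
    have X0: "0 \<le> ?X" using cum_bound_ge(1)[of "4 * ?N"] b by (intro mult_nonneg_nonneg) auto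
    have "(\<Sum>P\<in>?G. \<Sum>\<tau>\<in>?HE. (\<Prod>B\<in>P. abs_cum p n B \<tau>) * (?bw \<tau> * ?hw \<tau>)) \<le> (\<Sum>P\<in>?G. ?X)"
    proof (rule sum_mono)
      fix P assume "P \<in> ?G"
      then show "(\<Sum>\<tau>\<in>?HE. (\<Prod>B\<in>P. abs_cum p n B \<tau>) * (?bw \<tau> * ?hw \<tau>)) \<le> ?X"
        using m b by (intro crossing_partition_sum_le) auto
    qed
    also have "\<dots> = real (card ?G) * ?X" by simp
    also have "\<dots> \<le> real (card (partitions ?H)) * ?X"
    proof (intro mult_right_mono X0)
      have "card ?G \<le> card (partitions ?H)" using fin by (rule card_mono) blast
      then show "real (card ?G) \<le> real (card (partitions ?H))" by simp
    qed
    finally show "(\<Sum>P\<in>?G. \<Sum>\<tau>\<in>?HE. (\<Prod>B\<in>P. abs_cum p n B \<tau>) * (?bw \<tau> * ?hw \<tau>)) \<le> real (card (partitions ?H)) * ?X" .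
  qed (use K.path_const_ge_1[of k] in auto)
  also have "\<dots> = var_const k ?N * real p * (2 * b + 1) * (?z\<^sup>2 * real n ^ (2 * ?N - 2))"
    unfolding var_const_def by (simp only: mult_ac)
  also have "?z\<^sup>2 * real n ^ (2 * ?N - 2) = 1 / (real n)\<^sup>2"
  proof -
    have "real n ^ (2 * ?N) = real n ^ (2 * ?N - 2) * (real n)\<^sup>2" by (simp flip: power_add)
    moreover have "?z\<^sup>2 = 1 / real n ^ (2 * ?N)" by (simp add: power_divide power_mult[symmetric] mult.commute del: power_Suc mult_Suc_right)
    ultimately show ?thesis using n0 by (simp add: field_simps)
  qed
  finally show ?thesis by simp
qed

end

section \<open>Fourth moments of quadratic forms\<close>

context network
begin

text \<open>Links are symmetric, so a link from the difference into \<open>U\<close> would lead back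
  out of the closed family \<open>U\<close>.\<close>

lemma closed_Diff:
  assumes "U \<subseteq> U'" "U' \<subseteq> P" "closed U" "closed U'"
  shows "closed (U' - U)"
  unfolding closed_def
proof (clarify)
  fix g h C assume gh: "(g,h) \<in> L" and C: "g \<in> C" "C \<in> U'" "C \<notin> U"
  have "h \<in> \<Union>U'" using assms(4) gh C unfolding closed_def by blast
  moreover have "h \<notin> \<Union>U"
  proof
    assume "h \<in> \<Union>U"
    then have "g \<in> \<Union>U" using assms(3) L_sym[OF gh] unfolding closed_def by blast
    moreover have "\<Union>U \<inter> C = {}" using block_disjoint[of U C] assms C by blast
    ultimately show False using C by blast
  qed
  ultimately show "h \<in> \<Union>(U' - U)" by blast
qed

text \<open>Each component covers at least four of at most eight points, so there are at most two.
  Only the first block of a component pays for a free state in \<open>S\<close>, whence the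
  square.\<close>

lemma total_le_two_components:
  assumes big: "\<And>U. U \<subseteq> P \<Longrightarrow> U \<noteq> {} \<Longrightarrow> closed U \<Longrightarrow> 4 \<le> card (\<Union>U)"
    and H8: "card H \<le> 8" and ne: "P \<noteq> {}" and K1: "1 \<le> K" and N1: "1 \<le> N" and S: "S \<noteq> {}"
  shows "total P \<le> (K * card S)\<^sup>2 * (K * N) ^ (2 * card P)"
proof -
  have S1: "1 \<le> K * card S"
  proof -
    have "1 \<le> real (card S)" using S finite_S by (simp add: Suc_le_eq card_gt_0_iff)
    then show ?thesis using mult_mono[OF K1, of 1 "real (card S)"] K1 by simp
  qed
  have KN: "1 \<le> K * N" using mult_mono[OF K1 N1] K1 by simp
  have PH: "\<Union>P = H" using partition by (auto simp: partition_on_def)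
  have closedP: "closed P" unfolding closed_def PH using L_H by auto
  have pow: "(K * N) ^ (card U' - k) \<le> (K * N) ^ card P" if "U' \<subseteq> P" for U' k
    using KN card_mono[OF finite_P that] by (intro power_increasing) auto
  obtain B1 where B1: "B1 \<in> P" using ne by auto
  obtain U1 where U1: "{B1} \<subseteq> U1" "U1 \<subseteq> P" "closed U1" "total U1 \<le> total {B1} * (K * N) ^ (card U1 - card {B1})"
    using grow_closed[of "{B1}"] B1 by auto
  have "total {B1} \<le> K * card S" using total_insert_start[of "{}" B1] B1 by (simp add: total_empty)
  then have t1: "total U1 \<le> (K * card S) * (K * N) ^ card P"
  proof -
    have "total {B1} * (K * N) ^ (card U1 - card {B1}) \<le> (K * card S) * (K * N) ^ card P"
      using \<open>total {B1} \<le> K * card S\<close> pow[OF U1(2), of "card {B1}"] S1 KN by (intro mult_mono) auto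
    then show ?thesis using U1(4) by linarith
  qed
  show ?thesis
  proof (cases "U1 = P")
    case True
    have "total P \<le> (K * card S) * (K * N) ^ card P" using t1 True by simp
    also have "\<dots> \<le> (K * card S)\<^sup>2 * (K * N) ^ (2 * card P)"
      using S1 KN self_le_power[of "K * card S" 2] by (intro mult_mono power_increasing) auto
    finally show ?thesis .
  next
    case False
    then obtain B2 where B2: "B2 \<in> P" "B2 \<notin> U1" using U1 by auto
    have "total (insert B2 U1) \<le> total U1 * (K * card S)" by (rule total_insert_start[OF U1(2) B2])
    also have "\<dots> \<le> ((K * card S) * (K * N) ^ card P) * (K * card S)" using t1 S1 by (intro mult_right_mono) auto
    finally have t2: "total (insert B2 U1) \<le> (K * card S)\<^sup>2 * (K * N) ^ card P" by (simp add: power2_eq_square mult_ac)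
    have "insert B2 U1 \<subseteq> P" using B2 U1 by auto
    then obtain U2 where U2: "insert B2 U1 \<subseteq> U2" "U2 \<subseteq> P" "closed U2"
        "total U2 \<le> total (insert B2 U1) * (K * N) ^ (card U2 - card (insert B2 U1))"
      using grow_closed[OF \<open>insert B2 U1 \<subseteq> P\<close>] by (elim exE conjE)
    \<comment> \<open>A third closed part would bring the number of points to twelve.\<close>
    have "U2 = P"
    proof (rule ccontr)
      assume "U2 \<noteq> P"
      have sub: "U1 \<subseteq> U2" using U2 by auto
      have c1: "4 \<le> card (\<Union>U1)" using U1 by (intro big) auto
      have c2: "4 \<le> card (\<Union>(U2 - U1))" using U2 B2 closed_Diff[OF sub U2(2) U1(3) U2(3)] by (intro big) auto
      have c3: "4 \<le> card (\<Union>(P - U2))"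
        using U2 \<open>U2 \<noteq> P\<close> closed_Diff[OF U2(2) order_refl U2(3) closedP] by (intro big) auto
      have d: "\<Union>A \<inter> \<Union>B = {}" if "A \<subseteq> P" "B \<subseteq> P" "A \<inter> B = {}" for A B
      proof -
        have "\<Union>A \<inter> C = {}" if "C \<in> B" for C using block_disjoint[of A C] that \<open>A \<subseteq> P\<close> \<open>B \<subseteq> P\<close> \<open>A \<inter> B = {}\<close> by blast
        then show ?thesis by blast
      qed
      have f: "finite (\<Union>A)" if "A \<subseteq> P" for A using that by (rule finite_Union)
      have "card (\<Union>U1 \<union> \<Union>(U2 - U1) \<union> \<Union>(P - U2)) = card (\<Union>U1 \<union> \<Union>(U2 - U1)) + card (\<Union>(P - U2))"
      proof (rule card_Un_disjoint)
        have e: "\<Union>U1 \<union> \<Union>(U2 - U1) = \<Union>U2" using sub by blast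
        show "(\<Union>U1 \<union> \<Union>(U2 - U1)) \<inter> \<Union>(P - U2) = {}" unfolding e using U2 by (intro d) auto
      qed (use f[of U1] f[of "U2 - U1"] f[of "P - U2"] U1 U2 in auto)
      also have "card (\<Union>U1 \<union> \<Union>(U2 - U1)) = card (\<Union>U1) + card (\<Union>(U2 - U1))"
        using f[of U1] f[of "U2 - U1"] d[of U1 "U2 - U1"] U1 U2 by (intro card_Un_disjoint) auto
      also have "\<Union>U1 \<union> \<Union>(U2 - U1) \<union> \<Union>(P - U2) = H" using sub U2 PH by blast
      finally show False using c1 c2 c3 H8 by linarith
    qed
    then have "total P \<le> total (insert B2 U1) * (K * N) ^ (card P - card (insert B2 U1))" using U2(4) by simp
    also have "\<dots> \<le> ((K * card S)\<^sup>2 * (K * N) ^ card P) * (K * N) ^ card P"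
      using pow[of P "card (insert B2 U1)"] t2 S1 KN by (intro mult_mono) auto
    also have "\<dots> = (K * card S)\<^sup>2 * (K * N) ^ (2 * card P)" by (simp only: mult_2 power_add mult.assoc)
    finally show ?thesis .
  qed
qed

end

lemma power_double_sum:
  fixes g :: "'s \<Rightarrow> 's \<Rightarrow> real"
  assumes "finite S"
  shows "(\<Sum>s\<in>S. \<Sum>t\<in>S. g s t) ^ m
    = (\<Sum>\<sigma>\<in>PiE ({..<m} \<times> (UNIV :: bool set)) (\<lambda>_. S). \<Prod>e<m. g (\<sigma> (e, False)) (\<sigma> (e, True)))"
proof (induction m)
  case (Suc m)
  let ?H = "{..<m} \<times> (UNIV :: bool set)" let ?E = "PiE ?H (\<lambda>_. S)"
  have H: "{..<Suc m} \<times> (UNIV :: bool set) = insert (m, True) (insert (m, False) ?H)"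
    by (auto simp: UNIV_bool less_Suc_eq)
  have "(\<Sum>\<sigma>\<in>PiE ({..<Suc m} \<times> UNIV) (\<lambda>_. S). \<Prod>e<Suc m. g (\<sigma> (e, False)) (\<sigma> (e, True)))
     = (\<Sum>\<sigma>\<in>?E. \<Sum>s\<in>S. \<Sum>t\<in>S. \<Prod>e<Suc m. g ((\<sigma>((m, False) := s, (m, True) := t)) (e, False)) ((\<sigma>((m, False) := s, (m, True) := t)) (e, True)))"
    unfolding H using assms by (subst sum_PiE_insert, simp, simp, simp, subst sum_PiE_insert) auto
  also have "\<dots> = (\<Sum>\<sigma>\<in>?E. \<Sum>s\<in>S. \<Sum>t\<in>S. (\<Prod>e<m. g (\<sigma> (e, False)) (\<sigma> (e, True))) * g s t)"
  proof (intro sum.cong refl)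
    fix \<sigma> :: "nat \<times> bool \<Rightarrow> 's" and s t
    let ?\<tau> = "\<sigma>((m, False) := s, (m, True) := t)"
    have "(\<Prod>e<m. g (?\<tau> (e, False)) (?\<tau> (e, True))) = (\<Prod>e<m. g (\<sigma> (e, False)) (\<sigma> (e, True)))"
      by (intro prod.cong refl) auto
    then show "(\<Prod>e<Suc m. g (?\<tau> (e, False)) (?\<tau> (e, True))) = (\<Prod>e<m. g (\<sigma> (e, False)) (\<sigma> (e, True))) * g s t"
      by simp
  qed
  also have "\<dots> = (\<Sum>\<sigma>\<in>?E. \<Prod>e<m. g (\<sigma> (e, False)) (\<sigma> (e, True))) * (\<Sum>s\<in>S. \<Sum>t\<in>S. g s t)"
    by (simp only: sum_distrib_left[symmetric] sum_distrib_right[symmetric])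
  finally show ?case using Suc by (simp add: mult.commute)
qed (simp add: assms)

context copies
begin

text \<open>All ends lie in one row, so the row range is \<open>{1..1}\<close> and a link costs 1.
  As no edge is a block, each component has at least two edges, so four edges make at most two
  components and \<open>p^2\<close> results. The exponent 18 is 2 for the two starting blocks plus
  twice the bound 8 on the number of blocks.\<close>

lemma edge_partition_sum_le:
  fixes q :: "int \<Rightarrow> real"
  defines "H \<equiv> {..<4::nat} \<times> (UNIV :: bool set)"
  assumes q: "\<And>d. 0 \<le> q d" "\<And>d. q (- d) = q d" "\<And>F. finite F \<Longrightarrow> sum q F \<le> 1" and p: "1 \<le> p"
    and P: "partition_on H P" "\<forall>B\<in>P. 2 \<le> card B" "\<And>e. e < 4 \<Longrightarrow> {(e, False), (e, True)} \<notin> P"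
  shows "(\<Sum>\<sigma>\<in>PiE H (\<lambda>_. {1..p} \<times> {1..1}). (\<Prod>B\<in>P. abs_cum p 1 B \<sigma>) *
      (\<Prod>(e,c)\<in>H. half_weight q (\<sigma> (e, c)) (\<sigma> (e, \<not> c)))) \<le> cum_bound 8 ^ 18 * (real p)\<^sup>2"
proof -
  let ?K = "cum_bound 8" and ?S = "{1..p} \<times> {1..1::nat}"
  let ?L = "(\<lambda>(e,c). ((e,c),(e,\<not> c))) ` H" and ?w = "\<lambda>(g :: nat \<times> bool) (h :: nat \<times> bool). half_weight q"
  have finH: "finite H" and cardH: "card H = 8" by (auto simp: H_def card_cartesian_product)
  have K1: "1 \<le> ?K" by (rule cum_bound_ge)
  have BH: "B \<subseteq> H" "B \<noteq> {}" "finite B" "card B \<le> 8" if "B \<in> P" for B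
  proof -
    show 1: "B \<subseteq> H" "B \<noteq> {}" using partition_on_memD[OF P(1) that] by auto
    show "finite B" by (rule finite_subset[OF 1(1) finH])
    show "card B \<le> 8" unfolding cardH[symmetric] by (rule card_mono[OF finH 1(1)])
  qed
  interpret net: network H P ?S "abs_cum p 1" ?w ?L ?K 1
  proof
    show "?L \<subseteq> H \<times> H" by (auto simp: H_def)
    show "(h, g) \<in> ?L" if gh: "(g, h) \<in> ?L" for g h
    proof -
      obtain z where z: "z \<in> H" "(g, h) = (\<lambda>(e,c). ((e,c),(e,\<not> c))) z" using gh by (elim imageE)
      obtain e c where "z = (e, c)" by (cases z)
      then have "g = (e,c)" "h = (e,\<not> c)" "(e,c) \<in> H" using z by auto
      then have "(h, g) = (\<lambda>(e,c). ((e,c),(e,\<not> c))) (e, \<not> c)" "(e, \<not> c) \<in> H" by (auto simp: H_def)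
      then show ?thesis by blast
    qed
    show "0 \<le> half_weight q s t \<and> half_weight q s t \<le> 1" for s t
      using q(1) q(3)[of "{int (fst s) - int (fst t)}"] by (auto simp: half_weight_def)
    show "(\<Sum>t\<in>?S. half_weight q s t * half_weight q t s) \<le> 1" for s
      using half_weight_row[of q s p 1] q by simp
    show "0 \<le> abs_cum p 1 B \<sigma>" for B and \<sigma> :: "nat \<times> bool \<Rightarrow> nat \<times> nat" by (rule abs_cum_nonneg)
    show "abs_cum p 1 B \<sigma> = abs_cum p 1 B \<sigma>'" if "B \<in> P" "\<And>h. h \<in> B \<Longrightarrow> \<sigma> h = \<sigma>' h" for B \<sigma> \<sigma>'
      using BH[OF that(1)] that(2) by (intro abs_cum_cong) auto
    show "(\<Sum>\<sigma>\<in>{\<sigma>\<in>PiE B (\<lambda>_. ?S). \<sigma> h = s}. abs_cum p 1 B \<sigma>) \<le> ?K"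
      if "B \<in> P" "h \<in> B" "s \<in> ?S" for B h s
      using BH[OF that(1)] that P(2) by (intro sum_abs_cum_le) auto
    show "finite ?S" by simp
  qed (use finH P K1 in auto)
  have UP: "\<Union>P = H" using P(1) by (auto simp: partition_on_def)
  have "net.total P \<le> (?K * card ?S)\<^sup>2 * (?K * 1) ^ (2 * card P)"
  proof (rule net.total_le_two_components)
    fix U assume U: "U \<subseteq> P" "U \<noteq> {}" "net.closed U"
    define V where "V = \<Union>U"
    have VH: "V \<subseteq> H" using U net.Union_subset V_def by blast
    then have finV: "finite V" using finH finite_subset by blast
    have flip: "(e, \<not> c) \<in> V" if "(e, c) \<in> V" for e c
    proof -
      have "((e,c),(e,\<not> c)) \<in> ?L" using that VH by (auto intro!: image_eqI[of _ _ "(e,c)"])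
      then show ?thesis using U(3) that unfolding net.closed_def V_def by blast
    qed
    have "even (card V)"
      using flip by (intro even_card_involution[OF finV, of "\<lambda>(e,c). (e, \<not> c)"]) auto
    moreover obtain B where B: "B \<in> U" using U by auto
    have BP: "B \<in> P" using B U by auto
    have BV: "B \<subseteq> V" using B by (auto simp: V_def)
    have c2: "2 \<le> card B" using P(2) BP by blast
    moreover have "card V \<noteq> 2"
    proof
      assume cV: "card V = 2"
      have "B = V" using card_mono[OF finV BV] c2 cV by (intro card_subset_eq[OF finV BV]) auto
      obtain e c where ec: "(e,c) \<in> V" using BH(2)[OF BP] BV by auto
      have "{(e,c),(e,\<not> c)} \<subseteq> V" "card {(e,c),(e,\<not> c)} = 2" using ec flip by auto
      then have "{(e,c),(e,\<not> c)} = V" using cV finV by (intro card_subset_eq) auto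
      moreover have "{(e,c),(e,\<not> c)} = {(e,False),(e,True)}" by (cases c) auto
      moreover have "e < 4" using ec VH by (auto simp: H_def)
      ultimately show False using P(3)[of e] BP \<open>B = V\<close> by simp
    qed
    moreover have "2 \<le> card V" using c2 card_mono[OF finV BV] by linarith
    ultimately show "4 \<le> card (\<Union>U)" unfolding V_def[symmetric] by (auto elim!: evenE)
  next
    show "P \<noteq> {}" using UP cardH by auto
    show "{1..p} \<times> {1..1::nat} \<noteq> {}" using p by auto
  qed (use cardH K1 in auto)
  also have "\<dots> = ?K\<^sup>2 * ?K ^ (2 * card P) * (real p)\<^sup>2" by (simp add: power_mult_distrib)
  also have "\<dots> \<le> ?K\<^sup>2 * ?K ^ 16 * (real p)\<^sup>2"
  proof -
    have "card P \<le> (\<Sum>B\<in>P. card B)"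
      using sum_mono[of P "\<lambda>_. 1" card] P(2) by force
    also have "\<dots> = 8" using product_partition[OF P(1)] BH(3) cardH by metis
    finally have "?K ^ (2 * card P) \<le> ?K ^ 16" using K1 by (intro power_increasing) auto
    then show ?thesis using K1 by (intro mult_right_mono mult_left_mono) auto
  qed
  also have "net.total P = (\<Sum>\<sigma>\<in>PiE H (\<lambda>_. ?S). (\<Prod>B\<in>P. abs_cum p 1 B \<sigma>) *
      (\<Prod>(e,c)\<in>H. half_weight q (\<sigma> (e, c)) (\<sigma> (e, \<not> c))))"
    unfolding net.total_def net.weight_def UP
  proof (intro sum.cong refl arg_cong2[where f = "(*)"])
    fix \<sigma> :: "nat \<times> bool \<Rightarrow> nat \<times> nat"
    have "?L \<inter> (H \<times> H) = ?L" by (auto simp: H_def)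
    moreover have "inj_on (\<lambda>z. (z, fst z, \<not> snd z)) H" by (auto simp: inj_on_def)
    ultimately show "(\<Prod>(g,h)\<in>?L \<inter> (H \<times> H). half_weight q (\<sigma> g) (\<sigma> h)) = (\<Prod>(e,c)\<in>H. half_weight q (\<sigma> (e, c)) (\<sigma> (e, \<not> c)))"
      by (simp add: prod.reindex case_prod_beta)
  qed
  also have "?K\<^sup>2 * ?K ^ 16 = ?K ^ 18" by (simp flip: power_add)
  finally show ?thesis .
qed

definition row_form :: "nat \<Rightarrow> (nat \<Rightarrow> nat \<Rightarrow> real) \<Rightarrow> nat \<Rightarrow> 'a \<Rightarrow> real" where
  "row_form p W r \<omega> = (\<Sum>i\<in>{1..p}. \<Sum>j\<in>{1..p}. W i j * xi \<omega> (i,r) (j,r))"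

definition fourth_const :: real where
  "fourth_const = real (card (partitions ({..<4::nat} \<times> (UNIV :: bool set)))) * cum_bound 8 ^ 18"

text \<open>The fourth power is expanded over four edges. The expectation of the product of centred
  edges is a sum over partitions without singletons and without edges as blocks, and
  \<open>edge_partition_sum_le\<close> bounds each of these. The order \<open>p^2\<close> becomes a
  constant when the form is divided by \<open>sqrt p\<close>.\<close>

lemma fourth_moment_le:
  fixes q :: "int \<Rightarrow> real"
  assumes q: "\<And>d. 0 \<le> q d" "\<And>d. q (- d) = q d" "\<And>F. finite F \<Longrightarrow> sum q F \<le> 1" and p: "1 \<le> p"
    and W: "\<And>i j. \<bar>W i j\<bar> \<le> \<rho> * q (int i - int j)" and \<rho>: "0 \<le> \<rho>"
  shows "expectation (\<lambda>\<omega>. row_form p W 1 \<omega> ^ 4) \<le> fourth_const * \<rho> ^ 4 * (real p)\<^sup>2"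
proof -
  let ?S = "{1..p} \<times> {1..1::nat}" let ?H = "{..<4::nat} \<times> (UNIV :: bool set)" let ?E = "PiE ?H (\<lambda>_. ?S)"
  let ?e = "\<lambda>e. {(e, False), (e :: nat, True)}" let ?F = "?e ` {..<4}"
  let ?W = "\<lambda>\<sigma>. \<Prod>e<4. W (fst (\<sigma> (e, False))) (fst (\<sigma> (e, True)))"
  let ?X = "\<lambda>\<sigma> \<omega>. \<Prod>e<4. xi \<omega> (\<sigma> (e, False)) (\<sigma> (e, True))"
  let ?hw = "\<lambda>\<sigma>. \<Prod>(e,c)\<in>?H. half_weight q (\<sigma> (e, c)) (\<sigma> (e, \<not> c))"
  let ?G = "\<lambda>P. (\<forall>B\<in>P. 2 \<le> card B) \<and> P \<inter> ?F = {}"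
  have row: "row_form p W 1 \<omega> = (\<Sum>s\<in>?S. \<Sum>t\<in>?S. W (fst s) (fst t) * xi \<omega> s t)" for \<omega>
  proof -
    have "?S = (\<lambda>i. (i, 1)) ` {1..p}" by auto
    then show ?thesis unfolding row_form_def by (simp add: sum.reindex inj_on_def)
  qed
  have snd1: "snd (\<sigma> h) = 1" if "\<sigma> \<in> ?E" "h \<in> ?H" for \<sigma> h
    using PiE_mem[OF that] by (auto simp: mem_Times_iff)
  have mX: "all_moments M (?X \<sigma>)" if "\<sigma> \<in> ?E" for \<sigma>
    using snd1[OF that] by (intro all_moments_prod all_moments_xi) auto
  have EX: "\<bar>expectation (?X \<sigma>)\<bar> \<le> (\<Sum>P\<in>partitions ?H. if ?G P then \<Prod>B\<in>P. abs_cum p 1 B \<sigma> else 0)" if \<sigma>: "\<sigma> \<in> ?E" for \<sigma>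
  proof -
    have inj: "inj_on ?e {..<4}" by (auto simp: inj_on_def doubleton_eq_iff)
    have Un: "\<Union>?F = ?H" by (auto simp: UNIV_bool)
    have "expectation (?X \<sigma>) = expectation (\<lambda>\<omega>. \<Prod>e<4. centred_edge \<sigma> (?e e) \<omega>)"
      using snd1[OF \<sigma>] by (intro Bochner_Integration.integral_cong refl prod.cong xi_eq_centred_edge) auto
    also have "\<dots> = expectation (\<lambda>\<omega>. \<Prod>e\<in>?F. centred_edge \<sigma> e \<omega>)" by (simp add: prod.reindex[OF inj])
    also have "\<dots> = psum (\<lambda>B. if B \<in> ?F then 0 else cum (mom \<sigma>) B) (\<Union>?F)"
      using snd1[OF \<sigma>] unfolding Un
    proof (subst expectation_centred_edges)
      show "pairwise disjnt ?F" by (auto simp: pairwise_def disjnt_def)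
    qed (auto simp: Un)
    finally have "\<bar>expectation (?X \<sigma>)\<bar> = \<bar>psum (\<lambda>B. if B \<in> ?F then 0 else cum (mom \<sigma>) B) ?H\<bar>" unfolding Un by simp
    also have "\<dots> \<le> (\<Sum>P\<in>partitions ?H. \<Prod>B\<in>P. \<bar>if B \<in> ?F then 0 else cum (mom \<sigma>) B\<bar>)"
      unfolding psum_def abs_prod[symmetric] by (rule sum_abs)
    also have "\<dots> \<le> (\<Sum>P\<in>partitions ?H. if ?G P then \<Prod>B\<in>P. abs_cum p 1 B \<sigma> else 0)"
      by (intro sum_mono prod_cum_le_abs_cum[OF \<sigma>]) auto
    finally show ?thesis .
  qed
  have Wb: "\<bar>?W \<sigma>\<bar> \<le> \<rho> ^ 4 * ?hw \<sigma>" for \<sigma>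
  proof -
    have "?hw \<sigma> = (\<Prod>e<4. \<Prod>c\<in>UNIV. half_weight q (\<sigma> (e, c)) (\<sigma> (e, \<not> c)))"
      by (subst prod.cartesian_product) (simp add: case_prod_beta)
    also have "\<dots> = (\<Prod>e<4. q (int (fst (\<sigma> (e, False))) - int (fst (\<sigma> (e, True)))))"
      using half_weight_mult[of q, OF q(1,2)] by (intro prod.cong refl) (simp add: UNIV_bool mult.commute)
    finally have "\<rho> ^ 4 * ?hw \<sigma> = (\<Prod>e<4. \<rho> * q (int (fst (\<sigma> (e, False))) - int (fst (\<sigma> (e, True)))))"
      by (simp add: prod.distrib)
    moreover have "\<bar>?W \<sigma>\<bar> \<le> (\<Prod>e<4. \<rho> * q (int (fst (\<sigma> (e, False))) - int (fst (\<sigma> (e, True)))))"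
      unfolding abs_prod using W by (intro prod_mono) auto
    ultimately show ?thesis by simp
  qed
  have hw0: "0 \<le> ?hw \<sigma>" for \<sigma> using q by (intro prod_nonneg) (auto simp: half_weight_def)
  have "expectation (\<lambda>\<omega>. row_form p W 1 \<omega> ^ 4) = expectation (\<lambda>\<omega>. \<Sum>\<sigma>\<in>?E. ?W \<sigma> * ?X \<sigma> \<omega>)"
    unfolding row by (subst power_double_sum) (simp_all add: prod.distrib)
  also have "\<dots> = (\<Sum>\<sigma>\<in>?E. expectation (\<lambda>\<omega>. ?W \<sigma> * ?X \<sigma> \<omega>))"
    using mX all_moments_integrable by (intro Bochner_Integration.integral_sum integrable_mult_right) blast
  also have "\<dots> = (\<Sum>\<sigma>\<in>?E. ?W \<sigma> * expectation (?X \<sigma>))" by simp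
  also have "\<dots> \<le> (\<Sum>\<sigma>\<in>?E. (\<rho> ^ 4 * ?hw \<sigma>) * (\<Sum>P\<in>partitions ?H. if ?G P then \<Prod>B\<in>P. abs_cum p 1 B \<sigma> else 0))"
  proof (rule sum_mono)
    fix \<sigma> assume \<sigma>: "\<sigma> \<in> ?E"
    have "?W \<sigma> * expectation (?X \<sigma>) \<le> \<bar>?W \<sigma>\<bar> * \<bar>expectation (?X \<sigma>)\<bar>" 
      using abs_ge_self[of "?W \<sigma> * expectation (?X \<sigma>)"] by (simp only: abs_mult)
    also have "\<dots> \<le> (\<rho> ^ 4 * ?hw \<sigma>) * (\<Sum>P\<in>partitions ?H. if ?G P then \<Prod>B\<in>P. abs_cum p 1 B \<sigma> else 0)"
      using \<rho> hw0[of \<sigma>] by (intro mult_mono[OF Wb EX[OF \<sigma>]]) auto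
    finally show "?W \<sigma> * expectation (?X \<sigma>) \<le> (\<rho> ^ 4 * ?hw \<sigma>) * (\<Sum>P\<in>partitions ?H. if ?G P then \<Prod>B\<in>P. abs_cum p 1 B \<sigma> else 0)" .
  qed
  also have "\<dots> = \<rho> ^ 4 * (\<Sum>P\<in>partitions ?H. \<Sum>\<sigma>\<in>?E. (if ?G P then \<Prod>B\<in>P. abs_cum p 1 B \<sigma> else 0) * ?hw \<sigma>)"
    by (subst sum.swap) (simp only: sum_distrib_left mult_ac)
  also have "\<dots> \<le> \<rho> ^ 4 * (\<Sum>P\<in>partitions ?H. cum_bound 8 ^ 18 * (real p)\<^sup>2)"
  proof (intro mult_left_mono sum_mono)
    fix P assume P: "P \<in> partitions ?H"
    show "(\<Sum>\<sigma>\<in>?E. (if ?G P then \<Prod>B\<in>P. abs_cum p 1 B \<sigma> else 0) * ?hw \<sigma>) \<le> cum_bound 8 ^ 18 * (real p)\<^sup>2"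
    proof (cases "?G P")
      case True
      have "{(e, False), (e, True)} \<notin> P" if "e < 4" for e using True that by blast
      then have "(\<Sum>\<sigma>\<in>?E. (\<Prod>B\<in>P. abs_cum p 1 B \<sigma>) * ?hw \<sigma>) \<le> cum_bound 8 ^ 18 * (real p)\<^sup>2"
        using True P by (intro edge_partition_sum_le q p) auto
      then show ?thesis using True by simp
    next
      case False
      have "(\<Sum>\<sigma>\<in>?E. (if ?G P then \<Prod>B\<in>P. abs_cum p 1 B \<sigma> else 0) * ?hw \<sigma>) = 0"
        unfolding if_not_P[OF False] by simp
      then show ?thesis using cum_bound_ge(1)[of 8] by simp
    qed
  qed (use \<rho> in simp)
  also have "\<dots> = fourth_const * \<rho> ^ 4 * (real p)\<^sup>2" by (simp add: fourth_const_def)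
  finally show ?thesis .
qed

end

section \<open>Convolution powers and limits of sums\<close>

lemma summable_on_abs_iff: "f summable_on A \<longleftrightarrow> (\<lambda>x. \<bar>f x\<bar>) summable_on A" for f :: "'i \<Rightarrow> real"
  using summable_on_iff_abs_summable_on_real[of f A] by simp

lemma summable_on_dominated:
  fixes f g :: "'i \<Rightarrow> real"
  assumes "g summable_on A" "\<And>x. x \<in> A \<Longrightarrow> \<bar>f x\<bar> \<le> g x"
  shows "f summable_on A"
  unfolding summable_on_abs_iff[of f]
  by (rule summable_on_comparison_test[OF assms(1)]) (use assms(2) in auto)

text \<open>Dominated convergence for unordered sums along any filter: a finite index set carries
  the majorant up to \<open>e / 4\<close>, which controls the tails of both sums, and only finitely
  many terms have to converge.\<close>

lemma tannery_infsum:
  fixes f :: "'x \<Rightarrow> 'i \<Rightarrow> real"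
  assumes lim: "\<And>i. i \<in> I \<Longrightarrow> ((\<lambda>x. f x i) \<longlongrightarrow> g i) F" and bound: "\<And>x i. i \<in> I \<Longrightarrow> \<bar>f x i\<bar> \<le> G i"
    and G: "G summable_on I"
  shows "((\<lambda>x. infsum (f x) I) \<longlongrightarrow> infsum g I) F"
proof (cases "F = bot")
  case False
  have bg: "\<bar>g i\<bar> \<le> G i" if "i \<in> I" for i
    using tendsto_upperbound[OF tendsto_rabs[OF lim[OF that]] _ False, of "G i"] bound that by simp
  have tail: "\<bar>infsum h I - sum h D\<bar> \<le> infsum G I - sum G D"
    if D: "finite D" "D \<subseteq> I" and h: "\<And>i. i \<in> I \<Longrightarrow> \<bar>h i\<bar> \<le> G i" for h D
  proof -
    have sh: "h summable_on I"
      by (rule summable_on_dominated[OF G]) (use h in auto)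
    have hd: "(h has_sum (infsum h I - sum h D)) (I - D)"
      using sh D by (intro has_sum_Diff) (auto intro: has_sum_finite)
    have Gd: "(G has_sum (infsum G I - sum G D)) (I - D)"
      using G D by (intro has_sum_Diff) (auto intro: has_sum_finite)
    show ?thesis using norm_infsum_le[OF hd Gd] h by simp
  qed
  show ?thesis
  proof (rule tendstoI)
    fix e :: real assume e: "0 < e"
    obtain D where D: "finite D" "D \<subseteq> I" "dist (sum G D) (infsum G I) \<le> e / 4"
      using infsum_finite_approximation[OF G, of "e / 4"] e by auto
    have "((\<lambda>x. sum (f x) D) \<longlongrightarrow> sum g D) F" using D lim by (intro tendsto_sum) auto
    then have "\<forall>\<^sub>F x in F. dist (sum (f x) D) (sum g D) < e / 4" using e by (intro tendstoD) auto
    then show "\<forall>\<^sub>F x in F. dist (infsum (f x) I) (infsum g I) < e"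
    proof eventually_elim
      case (elim x)
      have "\<bar>infsum (f x) I - sum (f x) D\<bar> \<le> e / 4"
        using tail[OF D(1,2), of "f x"] bound D(3) by (auto simp: dist_real_def)
      moreover have "\<bar>infsum g I - sum g D\<bar> \<le> e / 4"
        using tail[OF D(1,2), of g] bg D(3) by (auto simp: dist_real_def)
      ultimately show ?case using elim e unfolding dist_real_def by linarith
    qed
  qed
qed simp

text \<open>Positions \<open>a\<close> that move away from both ends of \<open>{1..p}\<close>, which
  forces \<open>p\<close> to infinity as well. There the truncation of the matrices ceases to be
  felt at fixed offsets.\<close>

definition bulk :: "(nat \<times> nat) filter" where
  "bulk = (INF N. principal {(p, a). N \<le> a \<and> a + N \<le> p})"

lemma eventually_bulk: "eventually Q bulk \<longleftrightarrow> (\<exists>N. \<forall>p a. N \<le> a \<longrightarrow> a + N \<le> p \<longrightarrow> Q (p, a))"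
proof -
  have "eventually Q bulk \<longleftrightarrow> (\<exists>N\<in>UNIV. eventually Q (principal {(p, a). N \<le> a \<and> a + N \<le> p}))"
    unfolding bulk_def
  proof (rule eventually_INF_base)
    fix N N' :: nat
    show "\<exists>x\<in>UNIV. principal {(p, a). x \<le> a \<and> a + x \<le> p}
       \<le> inf (principal {(p, a). N \<le> a \<and> a + N \<le> p}) (principal {(p, a). N' \<le> a \<and> a + N' \<le> p})"
      by (intro bexI[of _ "max N N'"]) auto
  qed simp
  then show ?thesis by (auto simp: eventually_principal)
qed

text \<open>At most \<open>2 * N\<close> positions are close to an end, and their bounded
  contribution disappears after division by \<open>p\<close>.\<close>

lemma bulk_average:
  fixes f :: "nat \<times> nat \<Rightarrow> real"
  assumes lim: "(f \<longlongrightarrow> L) bulk" and bound: "\<And>p a. a \<in> {1..p} \<Longrightarrow> \<bar>f (p, a)\<bar> \<le> C"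
  shows "(\<lambda>p. (\<Sum>a\<in>{1..p}. f (p, a)) / real p) \<longlonglongrightarrow> L"
proof (rule LIMSEQ_I)
  fix e :: real assume e: "0 < e"
  have "0 \<le> C" using bound[of 1 1] by simp
  define c where "c = C + \<bar>L\<bar>"
  have C0: "0 \<le> c" using \<open>0 \<le> C\<close> by (simp add: c_def)
  have "\<forall>\<^sub>F z in bulk. dist (f z) L < e / 2" using lim e by (intro tendstoD) auto
  then obtain N where N: "\<And>p a. N \<le> a \<Longrightarrow> a + N \<le> p \<Longrightarrow> \<bar>f (p, a) - L\<bar> < e / 2"
    unfolding eventually_bulk by (auto simp: dist_real_def)
  obtain p0 :: nat where p0: "2 * real N * c * 2 / e < real p0" using reals_Archimedean2 by blast
  show "\<exists>no. \<forall>p\<ge>no. norm ((\<Sum>a\<in>{1..p}. f (p, a)) / real p - L) < e"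
  proof (intro exI[of _ "max p0 1"] allI impI)
    fix p assume p: "max p0 1 \<le> p"
    then have p1: "0 < real p" by simp
    have "2 * real N * c * 2 / e < real p" using p0 p by linarith
    then have small: "2 * real N * c < real p * (e / 2)"
      using e by (simp add: field_simps)
    have "(\<Sum>a\<in>{1..p}. f (p, a)) - real p * L = (\<Sum>a\<in>{1..p}. f (p, a) - L)"
      by (simp add: sum_subtractf)
    also have "\<bar>(\<Sum>a\<in>{1..p}. f (p, a) - L)\<bar> \<le> (\<Sum>a\<in>{1..p}. \<bar>f (p, a) - L\<bar>)" by (rule sum_abs)
    also have "\<dots> \<le> (\<Sum>a\<in>{1..p}. e / 2 + (if a \<in> {..<N} \<union> {p - N<..p} then c else 0))"
    proof (rule sum_mono)
      fix a assume a: "a \<in> {1..p}"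
      have "\<bar>f (p, a) - L\<bar> \<le> c" using bound[OF a] unfolding c_def by linarith
      moreover have "\<bar>f (p, a) - L\<bar> < e / 2" if "a \<notin> {..<N} \<union> {p - N<..p}"
        using that a by (intro N) auto
      ultimately show "\<bar>f (p, a) - L\<bar> \<le> e / 2 + (if a \<in> {..<N} \<union> {p - N<..p} then c else 0)"
        using e by (cases "a \<in> {..<N} \<union> {p - N<..p}") (auto simp del: Un_iff intro: less_imp_le)
    qed
    also have "\<dots> = real p * (e / 2) + (\<Sum>a\<in>{1..p} \<inter> ({..<N} \<union> {p - N<..p}). c)"
      unfolding sum.distrib sum.inter_restrict[OF finite_atLeastAtMost] by simp
    also have "\<dots> \<le> real p * (e / 2) + 2 * real N * c"
    proof -
      have "card ({1..p} \<inter> ({..<N} \<union> {p - N<..p})) \<le> card ({..<N} \<union> {p - N<..p})" by (intro card_mono) auto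
      also have "\<dots> \<le> card {..<N} + card {p - N<..p}" by (rule card_Un_le)
      also have "\<dots> \<le> 2 * N" by simp
      finally have "real (card ({1..p} \<inter> ({..<N} \<union> {p - N<..p}))) \<le> 2 * real N" by linarith
      then show ?thesis using C0 by (simp add: mult_right_mono)
    qed
    also have "\<dots> < real p * e" using small by (simp add: field_simps)
    finally have "\<bar>(\<Sum>a\<in>{1..p}. f (p, a)) - real p * L\<bar> < real p * e" .
    moreover have "(\<Sum>a\<in>{1..p}. f (p, a)) / real p - L = ((\<Sum>a\<in>{1..p}. f (p, a)) - real p * L) / real p"
      using p1 by (simp add: field_simps)
    ultimately show "norm ((\<Sum>a\<in>{1..p}. f (p, a)) / real p - L) < e"
      using p1 by (simp add: field_simps)
  qed
qed

section \<open>Summable families and convolutions on the integers\<close>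

lemma abs_summable_Times:
  fixes f :: "'i \<Rightarrow> real" and g :: "'j \<Rightarrow> real"
  assumes "f summable_on A" "g summable_on B"
  shows "(\<lambda>(x, y). f x * g y) summable_on A \<times> B"
proof -
  have f: "(\<lambda>x. \<bar>f x\<bar>) summable_on A" and g: "(\<lambda>x. \<bar>g x\<bar>) summable_on B"
    using assms unfolding summable_on_abs_iff[of f] summable_on_abs_iff[of g] by auto
  have "(\<lambda>z. norm (f (fst z) * g (snd z))) summable_on A \<times> B"
  proof (rule nonneg_bdd_above_summable_on)
    show "bdd_above (sum (\<lambda>z. norm (f (fst z) * g (snd z))) ` {F. F \<subseteq> A \<times> B \<and> finite F})"
    proof (rule bdd_aboveI2)
      fix F assume "F \<in> {F. F \<subseteq> A \<times> B \<and> finite F}"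
      then have F: "F \<subseteq> A \<times> B" "finite F" by auto
      have "sum (\<lambda>z. norm (f (fst z) * g (snd z))) F \<le> sum (\<lambda>z. norm (f (fst z) * g (snd z))) (fst ` F \<times> snd ` F)"
        using F by (intro sum_mono2 subset_fst_snd) auto
      also have "\<dots> = (\<Sum>x\<in>fst ` F. \<bar>f x\<bar>) * (\<Sum>y\<in>snd ` F. \<bar>g y\<bar>)"
        unfolding sum_product by (subst sum.cartesian_product) (simp add: abs_mult case_prod_beta)
      also have "\<dots> \<le> infsum (\<lambda>x. \<bar>f x\<bar>) A * infsum (\<lambda>y. \<bar>g y\<bar>) B"
        using F f g by (intro mult_mono finite_sum_le_infsum infsum_nonneg sum_nonneg) auto
      finally show "sum (\<lambda>z. norm (f (fst z) * g (snd z))) F \<le> infsum (\<lambda>x. \<bar>f x\<bar>) A * infsum (\<lambda>y. \<bar>g y\<bar>) B" .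
    qed
  qed auto
  then have "(\<lambda>z. f (fst z) * g (snd z)) summable_on A \<times> B"
    unfolding summable_on_abs_iff[of "\<lambda>z. f (fst z) * g (snd z)"] by simp
  then show ?thesis by (simp add: case_prod_unfold)
qed

lemma summable_on_bounded_mult:
  fixes f g :: "'i \<Rightarrow> real"
  assumes "f summable_on A" "\<And>x. x \<in> A \<Longrightarrow> \<bar>g x\<bar> \<le> C"
  shows "(\<lambda>x. g x * f x) summable_on A"
proof -
  have "(\<lambda>x. \<bar>f x\<bar>) summable_on A" using assms(1) unfolding summable_on_abs_iff[of f] .
  then have "(\<lambda>x. C * \<bar>f x\<bar>) summable_on A" by (rule summable_on_cmult_right)
  then show ?thesis
    by (rule summable_on_dominated) (use assms in \<open>auto simp: abs_mult intro: mult_right_mono\<close>)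
qed

lemma summable_bounded:
  fixes f :: "'i \<Rightarrow> real"
  assumes "f summable_on A"
  obtains C where "\<And>x. x \<in> A \<Longrightarrow> \<bar>f x\<bar> \<le> C" "0 \<le> C"
proof -
  have s: "(\<lambda>x. \<bar>f x\<bar>) summable_on A" using assms unfolding summable_on_abs_iff[of f] by simp
  have "\<bar>f x\<bar> \<le> infsum (\<lambda>x. \<bar>f x\<bar>) A" if "x \<in> A" for x
    using finite_sum_le_infsum[OF s, of "{x}"] that by simp
  then show ?thesis using infsum_nonneg[of A "\<lambda>x. \<bar>f x\<bar>"] by (intro that) auto
qed

lemma summable_shift_iff: "(\<lambda>z::int. f (z + c)) summable_on UNIV \<longleftrightarrow> f summable_on UNIV" for f :: "int \<Rightarrow> real"
  by (rule summable_on_reindex_bij_witness[of _ "\<lambda>z. z - c" "\<lambda>z. z + c"]) auto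

lemma conv_int_commute: "conv_int F G = conv_int G F"
proof
  fix j show "conv_int F G j = conv_int G F j"
    unfolding conv_int_def by (rule infsum_reindex_bij_witness[of _ "\<lambda>k. j - k" "\<lambda>k. j - k"]) auto
qed

lemma conv_int_even:
  assumes "\<And>d. F (- d) = F d" "\<And>d. G (- d) = G d"
  shows "conv_int F G (- d) = conv_int F G d"
proof -
  have "conv_int F G (- d) = (\<Sum>\<^sub>\<infinity>k. F (- d - (- k)) * G (- k))"
    unfolding conv_int_def by (rule infsum_reindex_bij_witness[of _ uminus uminus]) auto
  also have "\<dots> = (\<Sum>\<^sub>\<infinity>k. F (d - k) * G k)"
  proof (rule infsum_cong)
    fix k show "F (- d - (- k)) * G (- k) = F (d - k) * G k" using assms(1)[of "d - k"] assms(2)[of k] by simp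
  qed
  finally show ?thesis by (simp add: conv_int_def)
qed

lemma conv_summable_pair:
  fixes F G :: "int \<Rightarrow> real"
  assumes "F summable_on UNIV" "G summable_on UNIV"
  shows "(\<lambda>(j, k). F (j - k) * G k) summable_on UNIV \<times> UNIV"
proof -
  have "(\<lambda>(x, y). F x * G y) summable_on UNIV \<times> UNIV" by (rule abs_summable_Times[OF assms])
  also have "?this \<longleftrightarrow> ?thesis"
    by (rule summable_on_reindex_bij_witness[of _ "\<lambda>(j,k). (j - k, k)" "\<lambda>(x,y). (x + y, y)"]) auto
  finally show ?thesis .
qed

lemma conv_int_summable:
  fixes F G :: "int \<Rightarrow> real"
  assumes "F summable_on UNIV" "G summable_on UNIV"
  shows "conv_int F G summable_on UNIV"
  using summable_on_Sigma_banach[of "\<lambda>j k. F (j - k) * G k" UNIV "\<lambda>_. UNIV"] conv_summable_pair[OF assms]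
  unfolding conv_int_def by simp

text \<open>Fubini for sums; the double family is summable because \<open>G (m - k) * K k\<close> is
  and \<open>F\<close> is bounded.\<close>

lemma conv_int_assoc:
  fixes F G K :: "int \<Rightarrow> real"
  assumes F: "F summable_on UNIV" and G: "G summable_on UNIV" and K: "K summable_on UNIV"
  shows "conv_int (conv_int F G) K = conv_int F (conv_int G K)"
proof
  fix j
  obtain C where C: "\<And>x. \<bar>F x\<bar> \<le> C" using summable_bounded[OF F] by auto
  have s: "(\<lambda>(k, m). F (j - m) * (G (m - k) * K k)) summable_on UNIV \<times> UNIV"
  proof -
    have "(\<lambda>(m, k). G (m - k) * K k) summable_on UNIV \<times> UNIV" by (rule conv_summable_pair[OF G K])
    then have "(\<lambda>z. F (j - fst z) * (case z of (m, k) \<Rightarrow> G (m - k) * K k)) summable_on UNIV \<times> UNIV"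
      by (rule summable_on_bounded_mult) (rule C)
    also have "?this \<longleftrightarrow> ?thesis"
      by (rule summable_on_reindex_bij_witness[of _ "\<lambda>(k,m). (m,k)" "\<lambda>(m,k). (k,m)"]) auto
    finally show ?thesis .
  qed
  have "conv_int (conv_int F G) K j = (\<Sum>\<^sub>\<infinity>k. \<Sum>\<^sub>\<infinity>m. F (j - k - m) * G m * K k)"
    unfolding conv_int_def
    by (intro infsum_cong infsum_cmult_left'[symmetric])
  also have "\<dots> = (\<Sum>\<^sub>\<infinity>k. \<Sum>\<^sub>\<infinity>m. F (j - m) * (G (m - k) * K k))"
  proof (rule infsum_cong)
    fix k show "(\<Sum>\<^sub>\<infinity>m. F (j - k - m) * G m * K k) = (\<Sum>\<^sub>\<infinity>m. F (j - m) * (G (m - k) * K k))"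
      by (rule infsum_reindex_bij_witness[of _ "\<lambda>m. m - k" "\<lambda>m. m + k"]) (auto simp: algebra_simps)
  qed
  also have "\<dots> = (\<Sum>\<^sub>\<infinity>m. \<Sum>\<^sub>\<infinity>k. F (j - m) * (G (m - k) * K k))"
    by (rule infsum_swap_banach[OF s])
  also have "\<dots> = conv_int F (conv_int G K) j"
    unfolding conv_int_def by (intro infsum_cong infsum_cmult_right')
  finally show "conv_int (conv_int F G) K j = conv_int F (conv_int G K) j" .
qed

lemma conv_pow_summable_even:
  assumes "F summable_on UNIV" "\<And>d. F (- d) = F d"
  shows "conv_pow F a summable_on UNIV" "conv_pow F a (- d) = conv_pow F a d"
proof (induction a arbitrary: d)
  case 0
  { case 1
    have "(\<lambda>i::int. if i = 0 then 1 else 0 :: real) summable_on UNIV"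
      by (rule finite_nonzero_values_imp_summable_on) auto
    then show ?case by simp }
  { case 2 then show ?case by simp }
next
  case (Suc a)
  { case 1 then show ?case using Suc assms by (simp add: conv_int_summable) }
  { case 2 then show ?case using Suc assms by (simp add: conv_int_even) }
qed

lemma conv_int_unit_left: "conv_int (conv_pow F 0) G = G"
proof
  fix j
  have "conv_int (conv_pow F 0) G j = (\<Sum>\<^sub>\<infinity>k\<in>{j}. G k)"
    unfolding conv_int_def by (rule infsum_cong_neutral) auto
  then show "conv_int (conv_pow F 0) G j = G j" by simp
qed

lemma conv_pow_add:
  assumes "F summable_on UNIV" "\<And>d. F (- d) = F d"
  shows "conv_int (conv_pow F a) (conv_pow F b) = conv_pow F (a + b)"
proof (induction a)
  case 0
  show ?case by (simp only: conv_int_unit_left add_0)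
next
  case (Suc a)
  have "conv_int (conv_pow F (Suc a)) (conv_pow F b) = conv_int F (conv_int (conv_pow F a) (conv_pow F b))"
    unfolding conv_pow.simps using conv_pow_summable_even[OF assms] assms(1) by (intro conv_int_assoc) auto
  then show ?case using Suc by simp
qed

lemma conv_pow_one: "conv_pow F (Suc 0) = F"
  unfolding conv_pow.simps(2) by (subst conv_int_commute) (rule conv_int_unit_left)

lemma sum_Pow_insert:
  assumes "finite A" "b \<notin> A"
  shows "(\<Sum>B\<in>Pow (insert b A). f B) = (\<Sum>B\<in>Pow A. f B) + (\<Sum>B\<in>Pow A. f (insert b B))"
proof -
  have "(\<Sum>B\<in>Pow (insert b A). f B) = (\<Sum>B\<in>Pow A. f B) + (\<Sum>B\<in>insert b ` Pow A. f B)"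
    unfolding Pow_insert using assms by (intro sum.union_disjoint) auto
  moreover have "inj_on (insert b) (Pow A)" using assms(2) by (intro inj_onI) (metis PowD insert_ident subsetD)
  ultimately show ?thesis by (simp add: sum.reindex)
qed

text \<open>With vanishing means only the three pairings and the full block survive: Wick's formula,
  corrected by the fourth cumulant.\<close>

lemma moment_four_expansion:
  fixes m :: "'h set \<Rightarrow> real"
  assumes "distinct [a, b, c, d]" "\<And>x. m {x} = 0" "m {} = 1"
  shows "m {a, b, c, d} = m {a, b} * m {c, d} + m {a, c} * m {b, d} + m {a, d} * m {b, c} + cum m {a, b, c, d}"
proof -
  have pc: "psum (cum m) T = m T" if "finite T" for T
    using that psum_cum[of T m] assms(3) by (cases "T = {}") auto
  have c2: "cum m {x, y} = m {x, y}" if "x \<noteq> y" for x y using that assms(2) by (simp add: cum_pair)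
  have c1: "cum m {x} = 0" for x using assms(2) by (simp add: cum_singleton)
  have ne: "a \<noteq> b" "a \<noteq> c" "a \<noteq> d" "b \<noteq> c" "b \<noteq> d" "c \<noteq> d" using assms(1) by auto
  have "m {a, b, c, d} = psum (cum m) (insert a {b, c, d})" by (simp add: pc)
  also have "\<dots> = (\<Sum>B\<in>Pow {b, c, d}. cum m (insert a B) * psum (cum m) ({b, c, d} - B))"
    using ne by (intro psum_insert) auto
  also have "\<dots> = (\<Sum>B\<in>Pow {b, c, d}. cum m (insert a B) * m ({b, c, d} - B))"
    by (intro sum.cong refl) (simp add: pc)
  also have "\<dots> = (let f = \<lambda>B. cum m (insert a B) * m ({b, c, d} - B) in
      f {} + f {d} + (f {c} + f {c, d}) + (f {b} + f {b, d} + (f {b, c} + f {b, c, d})))"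
    unfolding Let_def using ne by (simp add: sum_Pow_insert)
  also have "\<dots> = cum m {a, d} * m {b, c} + cum m {a, c} * m {b, d} + cum m {a, b} * m {c, d} + cum m {a, b, c, d}"
  proof -
    have "{b, c, d} - {b} = {c, d}" "{b, c, d} - {c} = {b, d}" "{b, c, d} - {d} = {b, c}"
      "{b, c, d} - {b, c} = {d}" "{b, c, d} - {b, d} = {c}" "{b, c, d} - {c, d} = {b}" "{b, c, d} - {b, c, d} = {}"
      using ne by auto
    then show ?thesis by (simp add: Let_def c1 assms(2,3))
  qed
  finally show ?thesis using ne by (simp add: c1 c2 assms)
qed

text \<open>The matrix extended by zero to the integers, so that sums over \<open>{1..p}\<close>
  become sums over a fixed index set, as \<open>tannery_infsum\<close> requires.\<close>

definition ent :: "(nat \<Rightarrow> nat \<Rightarrow> real) \<Rightarrow> nat \<Rightarrow> int \<Rightarrow> int \<Rightarrow> real" where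
  "ent W p x y = (if x \<in> {1..int p} \<and> y \<in> {1..int p} then W (nat x) (nat y) else 0)"

lemma ent_bound:
  assumes "\<And>i j. \<bar>W i j\<bar> \<le> h (int i - int j)" "\<And>d. 0 \<le> h d"
  shows "\<bar>ent W p x y\<bar> \<le> h (x - y)"
  using assms(1)[of "nat x" "nat y"] assms(2)[of "x - y"] by (auto simp: ent_def)

lemma sum_int_Icc: "(\<Sum>l\<in>{1..p}. f (int l)) = (\<Sum>z\<in>{1..int p}. f z)" for f :: "int \<Rightarrow> real"
  by (rule sum.reindex_bij_witness[of _ nat int]) auto

lemma eventually_bulk_range: "eventually (\<lambda>(p, a). int a + x \<in> {1..int p}) bulk"
  unfolding eventually_bulk by (intro exI[of _ "nat \<bar>x\<bar> + 1"]) auto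

lemma eventually_bulk_at_top:
  fixes b :: "nat \<Rightarrow> real"
  assumes "filterlim b at_top sequentially"
  shows "eventually (\<lambda>(p, a). c \<le> b p) bulk"
proof -
  have "eventually (\<lambda>p. c \<le> b p) sequentially" using assms by (auto simp: filterlim_at_top)
  then obtain N where "\<And>p. N \<le> p \<Longrightarrow> c \<le> b p" by (auto simp: eventually_sequentially)
  then show ?thesis unfolding eventually_bulk by (intro exI[of _ N]) auto
qed

section \<open>Covariance of the quadratic forms and its limit\<close>

context copies
begin

text \<open>The noise lives on the band, so the trace of a power times the noise sees only the
  banded part of that power; powers of the banded \<open>mean_mat\<close> reach beyond the
  band.\<close>

definition band_pow :: "real \<Rightarrow> nat \<Rightarrow> nat \<Rightarrow> nat \<Rightarrow> nat \<Rightarrow> real" where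
  "band_pow b p k i j = (if \<bar>real i - real j\<bar> \<le> b then 1 else 0) * mat_pow p (mean_mat b) k i j"

lemma xi_commute: "xi \<omega> s t = xi \<omega> t s"
  using R_even[of "int (fst s) - int (fst t)"] by (simp add: xi_def mult.commute)

lemma trace_linear_term:
  "mat_trace p (mat_mult p (mat_pow p (mean_mat b) k) (noise_mat b n \<omega>))
    = (1 / real n) * (\<Sum>r\<in>{1..n}. row_form p (band_pow b p k) r \<omega>)"
proof -
  have "mat_trace p (mat_mult p (mat_pow p (mean_mat b) k) (noise_mat b n \<omega>))
      = (\<Sum>i\<in>{1..p}. \<Sum>j\<in>{1..p}. \<Sum>r\<in>{1..n}. (1 / real n) * (band_pow b p k i j * xi \<omega> (i,r) (j,r)))"
    unfolding mat_trace_def mat_mult_def noise_mat_eq sum_distrib_left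
  proof (intro sum.cong refl)
    fix i j r
    have "xi \<omega> (j, r) (i, r) = xi \<omega> (i, r) (j, r)" by (rule xi_commute)
    then show "mat_pow p (mean_mat b) k i j * ((if \<bar>real j - real i\<bar> \<le> b then 1 else 0) * (1 / real n * xi \<omega> (j, r) (i, r)))
        = 1 / real n * (band_pow b p k i j * xi \<omega> (i, r) (j, r))"
      by (simp add: band_pow_def abs_minus_commute)
  qed
  also have "\<dots> = (\<Sum>i\<in>{1..p}. \<Sum>r\<in>{1..n}. \<Sum>j\<in>{1..p}. (1 / real n) * (band_pow b p k i j * xi \<omega> (i,r) (j,r)))"
    by (intro sum.cong refl sum.swap)
  also have "\<dots> = (\<Sum>r\<in>{1..n}. \<Sum>i\<in>{1..p}. \<Sum>j\<in>{1..p}. (1 / real n) * (band_pow b p k i j * xi \<omega> (i,r) (j,r)))"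
    by (rule sum.swap)
  finally show ?thesis by (simp only: row_form_def sum_distrib_left)
qed

abbreviation "h_pow \<equiv> conv_pow (\<lambda>d. \<bar>R d\<bar>)"

lemma abs_band_pow_le: "\<bar>band_pow b p k i j\<bar> \<le> h_pow k (int i - int j)"
  using K.abs_mat_pow_le[of "mean_mat b" p k i j, OF abs_mean_mat_le] K.conv_pow_nonneg[of k "int i - int j"]
  by (simp add: band_pow_def)

lemma R_summable': "R summable_on UNIV"
  using R_summable unfolding summable_on_abs_iff[of R] .

lemma joint_cumulant_shift: "joint_cumulant M (map (\<lambda>i. Z (i + s)) is) = joint_cumulant M (map Z is)"
proof (cases "is = []")
  case False
  have "joint_cumulant M (map (\<lambda>i. Z (i + s)) is)
      = cum (\<lambda>B. expectation (\<lambda>\<omega>. \<Prod>j\<in>B. (map (\<lambda>i. Z (i + s)) is ! j) \<omega>)) {..<length is}"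
    using False prob_space_axioms all_moments_Z by (subst joint_cumulant_eq_cum) auto
  also have "\<dots> = cum (\<lambda>B. expectation (\<lambda>\<omega>. \<Prod>j\<in>B. (map Z is ! j) \<omega>)) {..<length is}"
  proof (rule cum_cong)
    fix B assume B: "B \<subseteq> {..<length is}"
    have "expectation (\<lambda>\<omega>. \<Prod>j\<in>B. (map (\<lambda>i. Z (i + s)) is ! j) \<omega>) = momZ (\<lambda>j. is ! j + s) B"
      unfolding momZ_def using B by (intro Bochner_Integration.integral_cong refl prod.cong) auto
    also have "\<dots> = momZ (\<lambda>j. is ! j) B" by (rule momZ_shift)
    also have "\<dots> = expectation (\<lambda>\<omega>. \<Prod>j\<in>B. (map Z is ! j) \<omega>)"
      unfolding momZ_def using B by (intro Bochner_Integration.integral_cong refl prod.cong) auto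
    finally show "expectation (\<lambda>\<omega>. \<Prod>j\<in>B. (map (\<lambda>i. Z (i + s)) is ! j) \<omega>)
      = expectation (\<lambda>\<omega>. \<Prod>j\<in>B. (map Z is ! j) \<omega>)" .
  qed (use False in auto)
  also have "\<dots> = joint_cumulant M (map Z is)"
    using False prob_space_axioms all_moments_Z by (subst joint_cumulant_eq_cum) auto
  finally show ?thesis .
qed simp

lemma momZ_pair: "x \<noteq> y \<Longrightarrow> momZ f {x, y} = R (f x - f y)"
  using expectation_Z_shift[of "f y" "f x"] by (simp add: momZ_def mult.commute)

lemma momZ_four:
  "expectation (\<lambda>\<omega>. Z i \<omega> * Z j \<omega> * (Z k \<omega> * Z l \<omega>))
    = R (i - j) * R (k - l) + R (i - k) * R (j - l) + R (i - l) * R (j - k) + joint_cumulant M [Z i, Z j, Z k, Z l]"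
proof -
  let ?f = "\<lambda>h. [i, j, k, l] ! h" let ?m = "momZ ?f"
  have "joint_cumulant M [Z i, Z j, Z k, Z l] = cum (\<lambda>B. expectation (\<lambda>\<omega>. \<Prod>h\<in>B. ([Z i, Z j, Z k, Z l] ! h) \<omega>)) {..<4}"
  proof -
    have "{..<length [Z i, Z j, Z k, Z l]} = {..<4}" by (simp add: eval_nat_numeral)
    then show ?thesis
      using prob_space_axioms all_moments_Z joint_cumulant_eq_cum[of M "[Z i, Z j, Z k, Z l]"] by (auto simp only: set_simps)
  qed
  also have "\<dots> = cum ?m {..<4}"
  proof (rule cum_cong)
    fix B :: "nat set" assume B: "B \<subseteq> {..<4}"
    have "([Z i, Z j, Z k, Z l] ! h) \<omega> = Z (?f h) \<omega>" if "h \<in> B" for h \<omega>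
    proof -
      have "h = 0 \<or> h = 1 \<or> h = 2 \<or> h = 3" using that B by auto
      then show ?thesis by auto
    qed
    then show "expectation (\<lambda>\<omega>. \<Prod>h\<in>B. ([Z i, Z j, Z k, Z l] ! h) \<omega>) = ?m B"
      unfolding momZ_def by (intro Bochner_Integration.integral_cong refl prod.cong)
  qed (simp_all add: lessThan_empty_iff)
  also have "{..<4} = {0, 1, 2, 3::nat}" by auto
  finally have jc: "joint_cumulant M [Z i, Z j, Z k, Z l] = cum ?m {0, 1, 2, 3}" .
  have m1: "?m {x} = 0" for x using expectation_Z by (simp add: momZ_def)
  have "?m {0, 1, 2, 3} = ?m {0, 1} * ?m {2, 3} + ?m {0, 2} * ?m {1, 3} + ?m {0, 3} * ?m {1, 2} + cum ?m {0, 1, 2, 3}"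
    by (rule moment_four_expansion) (simp_all add: m1, simp add: momZ_def prob_space)
  moreover have "?m {0, 1, 2, 3} = expectation (\<lambda>\<omega>. Z i \<omega> * Z j \<omega> * (Z k \<omega> * Z l \<omega>))"
    by (simp add: momZ_def mult.assoc)
  ultimately show ?thesis using jc by (simp add: momZ_pair)
qed

text \<open>The covariance of \<open>Z x * Z 0\<close> with \<open>Z (y + l) * Z l\<close>: of the
  three pairings the one that reproduces the product of the means cancels.\<close>

definition cov_kernel :: "int \<Rightarrow> int \<Rightarrow> int \<Rightarrow> real" where
  "cov_kernel x y l = R (x - y - l) * R l + R (x - l) * R (y + l) + joint_cumulant M [Z x, Z 0, Z (y + l), Z l]"

lemma expectation_xi_mult:
  assumes "1 \<le> r"
  shows "expectation (\<lambda>\<omega>. xi \<omega> (i,r) (j,r) * xi \<omega> (k,r) (l,r))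
    = cov_kernel (int i - int j) (int k - int l) (int l - int j)"
proof -
  let ?i = "int i" and ?j = "int j" and ?k = "int k" and ?l = "int l"
  have mX: "all_moments M (X (i', r))" for i' using assms by (intro all_moments_X) simp
  have int2: "integrable M (\<lambda>\<omega>. X (i',r) \<omega> * X (j',r) \<omega>)" for i' j'
    using mX by (intro all_moments_integrable all_moments_mult)
  have int4: "integrable M (\<lambda>\<omega>. X (i,r) \<omega> * X (j,r) \<omega> * (X (k,r) \<omega> * X (l,r) \<omega>))"
    using mX by (intro all_moments_integrable all_moments_mult)
  have E2: "expectation (\<lambda>\<omega>. X (i',r) \<omega> * X (j',r) \<omega>) = R (int i' - int j')" for i' j'
    using expectation_X_mult[of "(i',r)" "(j',r)"] assms by simp
  have "expectation (\<lambda>\<omega>. xi \<omega> (i,r) (j,r) * xi \<omega> (k,r) (l,r))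
     = expectation (\<lambda>\<omega>. X (i,r) \<omega> * X (j,r) \<omega> * (X (k,r) \<omega> * X (l,r) \<omega>)
        - R (?k - ?l) * (X (i,r) \<omega> * X (j,r) \<omega>) - R (?i - ?j) * (X (k,r) \<omega> * X (l,r) \<omega>) + R (?i - ?j) * R (?k - ?l))"
    by (intro Bochner_Integration.integral_cong refl) (simp add: xi_def algebra_simps)
  also have "\<dots> = expectation (\<lambda>\<omega>. X (i,r) \<omega> * X (j,r) \<omega> * (X (k,r) \<omega> * X (l,r) \<omega>)) - R (?i - ?j) * R (?k - ?l)"
    using int2 int4 E2 by (simp add: prob_space)
  also have "expectation (\<lambda>\<omega>. X (i,r) \<omega> * X (j,r) \<omega> * (X (k,r) \<omega> * X (l,r) \<omega>))
      = expectation (\<lambda>\<omega>. Z ?i \<omega> * Z ?j \<omega> * (Z ?k \<omega> * Z ?l \<omega>))"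
    using expectation_copy[of "\<lambda>x. x ?i * x ?j * (x ?k * x ?l)" r] assms by (simp add: X_def)
  also have "\<dots> - R (?i - ?j) * R (?k - ?l) = R (?i - ?k) * R (?j - ?l) + R (?i - ?l) * R (?j - ?k) + joint_cumulant M [Z ?i, Z ?j, Z ?k, Z ?l]"
    unfolding momZ_four by simp
  also have "joint_cumulant M [Z ?i, Z ?j, Z ?k, Z ?l] = joint_cumulant M [Z (?i - ?j), Z 0, Z (?k - ?j), Z (?l - ?j)]"
    using joint_cumulant_shift[of "- ?j" "[?i, ?j, ?k, ?l]"] by simp
  also have "R (?i - ?k) * R (?j - ?l) + R (?i - ?l) * R (?j - ?k) + joint_cumulant M [Z (?i - ?j), Z 0, Z (?k - ?j), Z (?l - ?j)]
      = cov_kernel (int i - int j) (int k - int l) (int l - int j)"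
    using R_even[of "?l - ?j"] R_even[of "?k - ?j"] by (simp add: cov_kernel_def)
  finally show ?thesis .
qed

lemma all_moments_row_form: "1 \<le> r \<Longrightarrow> all_moments M (row_form p W r)"
  unfolding row_form_def[abs_def] by (intro all_moments_sum all_moments_cmult all_moments_xi) auto

lemma expectation_row_form: "1 \<le> r \<Longrightarrow> expectation (row_form p W r) = 0"
proof -
  assume r: "1 \<le> r"
  have mX: "all_moments M (X (i', r))" for i' using r by (intro all_moments_X) simp
  have "expectation (\<lambda>\<omega>. xi \<omega> (i,r) (j,r)) = 0" for i j
    unfolding xi_def using expectation_X_mult[of "(i,r)" "(j,r)"] r mX
    by (subst Bochner_Integration.integral_diff) (auto intro: all_moments_integrable all_moments_mult simp: prob_space)
  moreover have "integrable M (\<lambda>\<omega>. xi \<omega> (i,r) (j,r))" for i j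
    using r by (intro all_moments_integrable all_moments_xi) auto
  ultimately show ?thesis
    unfolding row_form_def[abs_def] by (simp add: Bochner_Integration.integral_sum)
qed

text \<open>The four column indices become an anchor \<open>a\<close>, the offsets \<open>x\<close>
  and \<open>y\<close> within the two pairs, and the offset \<open>l\<close> between them. As
  \<open>ent\<close> vanishes outside the matrix, the offsets may run over all integers.\<close>

lemma expectation_row_form_mult:
  assumes "1 \<le> r"
  shows "expectation (\<lambda>\<omega>. row_form p W r \<omega> * row_form p V r \<omega>)
    = (\<Sum>a\<in>{1..p}. \<Sum>\<^sub>\<infinity>((x, y), l)\<in>UNIV. ent W p (int a + x) (int a) * ent V p (int a + l + y) (int a + l) * cov_kernel x y l)"
proof -
  let ?I = "{1..p}"
  let ?c = "\<lambda>i j k l. cov_kernel (int i - int j) (int k - int l) (int l - int j)"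
  have int: "integrable M (\<lambda>\<omega>. xi \<omega> (i,r) (j,r) * xi \<omega> (k,r) (l,r))" for i j k l
    using assms by (intro all_moments_integrable all_moments_mult all_moments_xi) auto
  have "expectation (\<lambda>\<omega>. row_form p W r \<omega> * row_form p V r \<omega>)
     = expectation (\<lambda>\<omega>. \<Sum>i\<in>?I. \<Sum>j\<in>?I. \<Sum>k\<in>?I. \<Sum>l\<in>?I. W i j * V k l * (xi \<omega> (i,r) (j,r) * xi \<omega> (k,r) (l,r)))"
  proof (intro Bochner_Integration.integral_cong refl)
    fix \<omega>
    let ?a = "\<lambda>i j. W i j * xi \<omega> (i,r) (j,r)" and ?c = "\<lambda>k l. V k l * xi \<omega> (k,r) (l,r)"
    have "row_form p W r \<omega> * row_form p V r \<omega> = (\<Sum>i\<in>?I. \<Sum>k\<in>?I. \<Sum>j\<in>?I. \<Sum>l\<in>?I. ?a i j * ?c k l)"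
      unfolding row_form_def sum_product[of _ ?I _ ?I] ..
    also have "\<dots> = (\<Sum>i\<in>?I. \<Sum>j\<in>?I. \<Sum>k\<in>?I. \<Sum>l\<in>?I. ?a i j * ?c k l)"
      by (intro sum.cong refl sum.swap)
    finally show "row_form p W r \<omega> * row_form p V r \<omega>
        = (\<Sum>i\<in>?I. \<Sum>j\<in>?I. \<Sum>k\<in>?I. \<Sum>l\<in>?I. W i j * V k l * (xi \<omega> (i,r) (j,r) * xi \<omega> (k,r) (l,r)))"
      by (simp add: mult_ac)
  qed
  also have "\<dots> = (\<Sum>i\<in>?I. \<Sum>j\<in>?I. \<Sum>k\<in>?I. \<Sum>l\<in>?I. W i j * V k l * ?c i j k l)"
    using int by (simp add: Bochner_Integration.integral_sum expectation_xi_mult[OF assms])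
  also have "\<dots> = (\<Sum>a\<in>?I. \<Sum>i\<in>?I. \<Sum>k\<in>?I. \<Sum>l\<in>?I. W i a * V k l * ?c i a k l)" by (rule sum.swap)
  also have "\<dots> = (\<Sum>a\<in>?I. \<Sum>\<^sub>\<infinity>((x, y), l)\<in>UNIV. ent W p (int a + x) (int a) * ent V p (int a + l + y) (int a + l) * cov_kernel x y l)"
  proof (intro sum.cong refl)
    fix a assume a: "a \<in> ?I"
    let ?g = "\<lambda>((x, y), l). ent W p (int a + x) (int a) * ent V p (int a + l + y) (int a + l) * cov_kernel x y l"
    let ?j = "\<lambda>(i, k, l). ((int i - int a, int k - int l), int l - int a)"
    have inj: "inj_on ?j (?I \<times> ?I \<times> ?I)" by (auto simp: inj_on_def)
    have "infsum ?g UNIV = infsum ?g (?j ` (?I \<times> ?I \<times> ?I))"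
    proof (rule infsum_cong_neutral)
      fix z assume z: "z \<in> UNIV - ?j ` (?I \<times> ?I \<times> ?I)"
      obtain x y l where xyl: "z = ((x, y), l)" by (metis surj_pair)
      show "?g z = 0"
      proof (rule ccontr)
        assume "?g z \<noteq> 0"
        then have r: "int a + x \<in> {1..int p}" "int a + l + y \<in> {1..int p}" "int a + l \<in> {1..int p}"
          unfolding xyl by (auto simp: ent_def split: if_splits)
        have "z = ?j (nat (int a + x), nat (int a + l + y), nat (int a + l))"
          using r by (simp add: xyl)
        moreover have "(nat (int a + x), nat (int a + l + y), nat (int a + l)) \<in> ?I \<times> ?I \<times> ?I"
          using r by auto
        ultimately show False using z by blast
      qed
    qed auto
    also have "\<dots> = (\<Sum>z\<in>?I \<times> ?I \<times> ?I. ?g (?j z))"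
      by (simp only: infsum_finite finite_imageI finite_cartesian_product finite_atLeastAtMost sum.reindex[OF inj] comp_def)
    also have "\<dots> = (\<Sum>(i,k,l)\<in>?I \<times> ?I \<times> ?I. W i a * V k l * ?c i a k l)"
      using a by (intro sum.cong refl) (auto simp: ent_def)
    also have "\<dots> = (\<Sum>i\<in>?I. \<Sum>k\<in>?I. \<Sum>l\<in>?I. W i a * V k l * ?c i a k l)"
      by (simp add: sum.cartesian_product)
    finally show "(\<Sum>i\<in>?I. \<Sum>k\<in>?I. \<Sum>l\<in>?I. W i a * V k l * ?c i a k l) = infsum ?g UNIV" by simp
  qed
  finally show ?thesis .
qed

lemma ent_mean_tendsto:
  assumes "filterlim b at_top sequentially"
  shows "((\<lambda>(p, a). ent (mean_mat (b p)) p (int a + x) (int a + y)) \<longlongrightarrow> R (x - y)) bulk"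
proof (rule tendsto_eventually)
  show "\<forall>\<^sub>F z in bulk. (case z of (p, a) \<Rightarrow> ent (mean_mat (b p)) p (int a + x) (int a + y)) = R (x - y)"
    using eventually_bulk_range[of x] eventually_bulk_range[of y]
      eventually_bulk_at_top[OF assms, of "\<bar>real_of_int (x - y)\<bar>"]
  proof eventually_elim
    case (elim z)
    obtain p a where z: "z = (p, a)" by (cases z)
    have "real (nat (int a + x)) - real (nat (int a + y)) = real_of_int (x - y)" using elim z by auto
    then show ?case using elim z by (auto simp: ent_def mean_mat_def)
  qed
qed

text \<open>Read at offsets from \<open>a\<close>, one more matrix factor is a sum over all integers
  dominated by \<open>h_pow k (x - z) * \<bar>R (z - y)\<bar>\<close>. Its terms converge in the
  bulk, so the sum tends to the convolution.\<close>

lemma ent_pow_tendsto: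
  assumes b: "filterlim b at_top sequentially"
  shows "((\<lambda>(p, a). ent (mat_pow p (mean_mat (b p)) k) p (int a + x) (int a + y)) \<longlongrightarrow> conv_pow R k (x - y)) bulk"
proof (induction k arbitrary: y)
  case 0
  show ?case
  proof (rule tendsto_eventually)
    show "\<forall>\<^sub>F z in bulk. (case z of (p, a) \<Rightarrow> ent (mat_pow p (mean_mat (b p)) 0) p (int a + x) (int a + y)) = conv_pow R 0 (x - y)"
      using eventually_bulk_range[of x] eventually_bulk_range[of y]
      by eventually_elim (auto simp: ent_def)
  qed
next
  case (Suc k)
  let ?A = "\<lambda>p. mean_mat (b p)"
  let ?t = "\<lambda>w z. case w of (p, a) \<Rightarrow> ent (mat_pow p (?A p) k) p (int a + x) (int a + z) * ent (?A p) p (int a + z) (int a + y)"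
  have "((\<lambda>w. infsum (?t w) UNIV) \<longlongrightarrow> infsum (\<lambda>z. conv_pow R k (x - z) * R (z - y)) UNIV) bulk"
  proof (rule tannery_infsum)
    fix z
    have "((\<lambda>w. (case w of (p, a) \<Rightarrow> ent (mat_pow p (?A p) k) p (int a + x) (int a + z)) *
       (case w of (p, a) \<Rightarrow> ent (?A p) p (int a + z) (int a + y))) \<longlongrightarrow> conv_pow R k (x - z) * R (z - y)) bulk"
      by (intro tendsto_mult Suc ent_mean_tendsto b)
    then show "((\<lambda>w. ?t w z) \<longlongrightarrow> conv_pow R k (x - z) * R (z - y)) bulk" by (simp add: case_prod_unfold)
    fix w :: "nat \<times> nat"
    obtain p a where w: "w = (p, a)" by (cases w)
    have "\<bar>ent (mat_pow p (?A p) k) p (int a + x) (int a + z)\<bar> \<le> h_pow k (x - z)"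
      using ent_bound[of "mat_pow p (?A p) k" "h_pow k" p "int a + x" "int a + z"] K.abs_mat_pow_le[OF abs_mean_mat_le] K.conv_pow_nonneg by simp
    moreover have "\<bar>ent (?A p) p (int a + z) (int a + y)\<bar> \<le> \<bar>R (z - y)\<bar>"
      using ent_bound[of "?A p" "\<lambda>d. \<bar>R d\<bar>" p "int a + z" "int a + y"] abs_mean_mat_le by simp
    ultimately show "\<bar>?t w z\<bar> \<le> h_pow k (x - z) * \<bar>R (z - y)\<bar>"
      using w K.conv_pow_nonneg by (simp add: abs_mult mult_mono)
  next
    have "(\<lambda>z. \<bar>R (z + (- y))\<bar>) summable_on UNIV"
      using R_summable summable_shift_iff[of "\<lambda>z. \<bar>R z\<bar>" "- y"] by simp
    moreover obtain C where "\<And>d. \<bar>h_pow k d\<bar> \<le> C" using summable_bounded[OF K.conv_pow_summable[of k]] by auto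
    ultimately show "(\<lambda>z. h_pow k (x - z) * \<bar>R (z - y)\<bar>) summable_on UNIV"
      using summable_on_bounded_mult[of "\<lambda>z. \<bar>R (z + (- y))\<bar>" UNIV "\<lambda>z. h_pow k (x - z)" C] by simp
  qed
  also have "infsum (\<lambda>z. conv_pow R k (x - z) * R (z - y)) UNIV = conv_pow R (Suc k) (x - y)"
    unfolding conv_pow.simps conv_int_def
    by (rule infsum_reindex_bij_witness[of _ "\<lambda>m. x - m" "\<lambda>z. x - z"]) (auto simp: algebra_simps)
  finally have lim: "((\<lambda>w. infsum (?t w) UNIV) \<longlongrightarrow> conv_pow R (Suc k) (x - y)) bulk" .
  have ev: "\<forall>\<^sub>F w in bulk. infsum (?t w) UNIV = (case w of (p, a) \<Rightarrow> ent (mat_pow p (?A p) (Suc k)) p (int a + x) (int a + y))"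
    using eventually_bulk_range[of x] eventually_bulk_range[of y]
  proof eventually_elim
    case (elim w)
    obtain p a where w: "w = (p, a)" by (cases w)
    let ?J = "(\<lambda>u. u - int a) ` {1..int p}"
    have "infsum (?t w) UNIV = infsum (?t w) ?J"
    proof (rule infsum_cong_neutral)
      fix z assume z: "z \<in> UNIV - ?J"
      have "int a + z \<notin> {1..int p}"
      proof
        assume "int a + z \<in> {1..int p}"
        then have "(int a + z) - int a \<in> ?J" by (rule imageI)
        then show False using z by simp
      qed
      then show "?t w z = 0" using w by (auto simp: ent_def)
    qed auto
    also have "\<dots> = (\<Sum>u\<in>{1..int p}. ?t w (u - int a))"
    proof -
      have "inj_on (\<lambda>u. u - int a) {1..int p}" by (auto simp: inj_on_def)
      then show ?thesis by (simp only: infsum_finite finite_imageI finite_atLeastAtMost_int sum.reindex comp_def)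
    qed
    also have "\<dots> = (\<Sum>u\<in>{1..int p}. mat_pow p (?A p) k (nat (int a + x)) (nat u) * ?A p (nat u) (nat (int a + y)))"
      using elim w by (intro sum.cong refl) (simp add: ent_def)
    also have "\<dots> = (\<Sum>l\<in>{1..p}. mat_pow p (?A p) k (nat (int a + x)) l * ?A p l (nat (int a + y)))"
      using sum_int_Icc[of "\<lambda>u. mat_pow p (?A p) k (nat (int a + x)) (nat u) * ?A p (nat u) (nat (int a + y))" p] by simp
    also have "\<dots> = (case w of (p, a) \<Rightarrow> ent (mat_pow p (?A p) (Suc k)) p (int a + x) (int a + y))"
      using elim w by (simp add: ent_def mat_mult_def)
    finally show ?case .
  qed
  show ?case by (rule Lim_transform_eventually[OF lim ev])
qed

text \<open>Since \<open>b\<close> tends to infinity, a fixed offset eventually lies inside the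
  band, and the banding changes nothing there.\<close>

lemma ent_band_pow_tendsto:
  assumes b: "filterlim b at_top sequentially"
  shows "((\<lambda>(p, a). ent (band_pow (b p) p k) p (int a + x) (int a + y)) \<longlongrightarrow> conv_pow R k (x - y)) bulk"
proof (rule Lim_transform_eventually[OF ent_pow_tendsto[OF b]])
  show "\<forall>\<^sub>F z in bulk. (case z of (p, a) \<Rightarrow> ent (mat_pow p (mean_mat (b p)) k) p (int a + x) (int a + y))
     = (case z of (p, a) \<Rightarrow> ent (band_pow (b p) p k) p (int a + x) (int a + y))"
    using eventually_bulk_range[of x] eventually_bulk_range[of y]
      eventually_bulk_at_top[OF b, of "\<bar>real_of_int (x - y)\<bar>"]
  proof eventually_elim
    case (elim z)
    obtain p a where z: "z = (p, a)" by (cases z)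
    have "real (nat (int a + x)) - real (nat (int a + y)) = real_of_int (x - y)" using elim z by auto
    then show ?case using elim z by (auto simp: ent_def band_pow_def)
  qed
qed

lemma joint_cumulant_triple_summable:
  "(\<lambda>((x, y), l). joint_cumulant M [Z x, Z 0, Z (y + l), Z l]) summable_on (UNIV :: ((int \<times> int) \<times> int) set)"
proof -
  have "(\<lambda>js. joint_cumulant M (Z 0 # map Z js)) summable_on {js :: int list. length js = 3}"
    unfolding summable_on_abs_iff[of "\<lambda>js. joint_cumulant M (Z 0 # map Z js)"] using Z_cum[of 3] by simp
  \<comment> \<open>\<open>I\<close> lists the other three times relative to \<open>x\<close>, the
    time of the first variable, and \<open>J\<close> recovers the offsets.\<close>
  moreover define I :: "(int \<times> int) \<times> int \<Rightarrow> int list" where "I = (\<lambda>((x, y), l). [- x, y + l - x, l - x])"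
  moreover define J :: "int list \<Rightarrow> (int \<times> int) \<times> int" where "J = (\<lambda>js. ((- (js ! 0), js ! 1 - js ! 2), js ! 2 - js ! 0))"
  have IJ: "I (J js) = js" and h: "(case J js of ((x, y), l) \<Rightarrow> joint_cumulant M [Z x, Z 0, Z (y + l), Z l])
        = joint_cumulant M (Z 0 # map Z js)" if len: "length js = 3" for js
  proof -
    obtain u v w where js: "js = [u, v, w]" using len by (auto simp: numeral_3_eq_3 length_Suc_conv)
    show "I (J js) = js" by (simp add: js I_def J_def)
    show "(case J js of ((x, y), l) \<Rightarrow> joint_cumulant M [Z x, Z 0, Z (y + l), Z l]) = joint_cumulant M (Z 0 # map Z js)"
      using joint_cumulant_shift[of "- u" "[0, u, v, w]"] by (simp add: js J_def)
  qed
  have "J (I z) = z" "length (I z) = 3" for z by (auto simp: I_def J_def split: prod.splits)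
  ultimately show ?thesis
    by (subst summable_on_reindex_bij_witness[of UNIV J I "{js. length js = 3}" "\<lambda>js. joint_cumulant M (Z 0 # map Z js)"])
      (use IJ h in \<open>auto simp flip: h\<close>)
qed

text \<open>In the first two terms \<open>f\<close>, \<open>g\<close> and one factor
  \<open>R\<close> form a summable product after a change of variables, and the other
  \<open>R\<close> is bounded. In the third the cumulant itself is summable and \<open>f\<close>,
  \<open>g\<close> are bounded.\<close>

lemma cov_kernel_summable:
  fixes f g :: "int \<Rightarrow> real"
  assumes f: "f summable_on UNIV" and g: "g summable_on UNIV"
  shows "(\<lambda>((x, y), l). f x * g y * (R (x - y - l) * R l)) summable_on UNIV"
    "(\<lambda>((x, y), l). f x * g y * (R (x - l) * R (y + l))) summable_on UNIV"
    "(\<lambda>((x, y), l). f x * g y * joint_cumulant M [Z x, Z 0, Z (y + l), Z l]) summable_on UNIV"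
proof -
  obtain C where C: "\<And>d. \<bar>R d\<bar> \<le> C" using summable_bounded[OF R_summable'] by auto
  obtain Cf where Cf: "\<And>d. \<bar>f d\<bar> \<le> Cf" "0 \<le> Cf" using summable_bounded[OF f] by auto
  obtain Cg where Cg: "\<And>d. \<bar>g d\<bar> \<le> Cg" using summable_bounded[OF g] by auto
  have "(\<lambda>(x, y). f x * g y) summable_on UNIV \<times> UNIV" by (rule abs_summable_Times[OF f g])
  then have fg: "(\<lambda>u. f (fst u) * g (snd u)) summable_on UNIV" by (simp add: case_prod_unfold)
  have s1: "(\<lambda>z. f (fst (fst z)) * g (snd (fst z)) * R (snd z)) summable_on UNIV"
    using abs_summable_Times[OF fg R_summable'] by (simp add: case_prod_unfold)
  have s2: "(\<lambda>z. f (fst (fst z)) * g (snd (fst z)) * R (fst (fst z) - snd z)) summable_on UNIV"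
    using s1 by (subst summable_on_reindex_bij_witness[of UNIV "\<lambda>z. (fst z, fst (fst z) - snd z)" "\<lambda>z. (fst z, fst (fst z) - snd z)" UNIV
      "\<lambda>z. f (fst (fst z)) * g (snd (fst z)) * R (snd z)"]) auto
  have "(\<lambda>z. R (fst (fst z) - snd (fst z) - snd z) * (f (fst (fst z)) * g (snd (fst z)) * R (snd z))) summable_on UNIV"
    by (rule summable_on_bounded_mult[OF s1]) (rule C)
  then show "(\<lambda>((x, y), l). f x * g y * (R (x - y - l) * R l)) summable_on UNIV" by (simp add: case_prod_unfold mult_ac)
  have "(\<lambda>z. R (snd (fst z) + snd z) * (f (fst (fst z)) * g (snd (fst z)) * R (fst (fst z) - snd z))) summable_on UNIV"
    by (rule summable_on_bounded_mult[OF s2]) (rule C)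
  then show "(\<lambda>((x, y), l). f x * g y * (R (x - l) * R (y + l))) summable_on UNIV" by (simp add: case_prod_unfold mult_ac)
  have "(\<lambda>z. (f (fst (fst z)) * g (snd (fst z))) * (\<lambda>((x, y), l). joint_cumulant M [Z x, Z 0, Z (y + l), Z l]) z) summable_on UNIV"
    by (rule summable_on_bounded_mult[OF joint_cumulant_triple_summable, where g = "\<lambda>z. f (fst (fst z)) * g (snd (fst z))" and C = "Cf * Cg"])
      (auto simp: abs_mult intro!: mult_mono Cf Cg)
  then show "(\<lambda>((x, y), l). f x * g y * joint_cumulant M [Z x, Z 0, Z (y + l), Z l]) summable_on UNIV"
    by (simp add: case_prod_unfold)
qed

text \<open>Summed over \<open>l\<close>, the two pairings give \<open>conv_pow R 2\<close> at
  \<open>x - y\<close> and at \<open>x + y\<close>. Since \<open>g\<close> is even both contribute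
  the same, hence the factor 2.\<close>

lemma infsum_cov_kernel:
  assumes f: "f summable_on UNIV" and g: "g summable_on UNIV" and ev: "\<And>d. f (- d) = f d" "\<And>d. g (- d) = g d"
  shows "(\<Sum>\<^sub>\<infinity>((x, y), l)\<in>UNIV. f x * g y * cov_kernel x y l)
    = 2 * conv_int f (conv_int (conv_pow R 2) g) 0
      + (\<Sum>\<^sub>\<infinity>(x, y)\<in>UNIV. f x * (\<Sum>\<^sub>\<infinity>l\<in>UNIV. joint_cumulant M [Z x, Z 0, Z (y + l), Z l]) * g y)"
proof -
  note s = cov_kernel_summable[OF f g]
  have R2: "conv_pow R 2 = conv_int R R" 
    using conv_pow_one[of R] by (simp only: numeral_2_eq_2 conv_pow.simps(2))
  have it: "(\<Sum>\<^sub>\<infinity>((x, y), l)\<in>UNIV. f x * g y * c x y l) = (\<Sum>\<^sub>\<infinity>(x, y)\<in>UNIV. f x * g y * (\<Sum>\<^sub>\<infinity>l\<in>UNIV. c x y l))"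
    and it_summable: "(\<lambda>(x, y). f x * g y * (\<Sum>\<^sub>\<infinity>l\<in>UNIV. c x y l)) summable_on UNIV"
    if "(\<lambda>((x, y), l). f x * g y * c x y l) summable_on UNIV" for c
  proof -
    have s': "(\<lambda>(u, l). f (fst u) * g (snd u) * c (fst u) (snd u) l) summable_on Sigma UNIV (\<lambda>_. UNIV)"
      using that by (simp add: case_prod_unfold)
    show "(\<Sum>\<^sub>\<infinity>((x, y), l)\<in>UNIV. f x * g y * c x y l) = (\<Sum>\<^sub>\<infinity>(x, y)\<in>UNIV. f x * g y * (\<Sum>\<^sub>\<infinity>l\<in>UNIV. c x y l))"
      using infsum_Sigma'_banach[OF s'] by (simp add: case_prod_unfold infsum_cmult_right')
    show "(\<lambda>(x, y). f x * g y * (\<Sum>\<^sub>\<infinity>l\<in>UNIV. c x y l)) summable_on UNIV"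
      using summable_on_Sigma_banach[OF s'] by (simp add: case_prod_unfold infsum_cmult_right')
  qed
  have conv: "(\<Sum>\<^sub>\<infinity>(x, y)\<in>UNIV. f x * g y * r x y) = conv_int f (conv_int (conv_pow R 2) g) 0"
    if "(\<lambda>(x, y). f x * g y * r x y) summable_on UNIV" "\<And>x. (\<Sum>\<^sub>\<infinity>y\<in>UNIV. r x y * g y) = conv_int (conv_pow R 2) g x" for r
  proof -
    have s': "(\<lambda>(x, y). f x * g y * r x y) summable_on Sigma UNIV (\<lambda>_. UNIV)" using that(1) by simp
    have "(\<Sum>\<^sub>\<infinity>(x, y)\<in>UNIV. f x * g y * r x y) = (\<Sum>\<^sub>\<infinity>x\<in>UNIV. \<Sum>\<^sub>\<infinity>y\<in>UNIV. f x * g y * r x y)"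
      using infsum_Sigma'_banach[OF s'] by simp
    also have "\<dots> = (\<Sum>\<^sub>\<infinity>x\<in>UNIV. f x * conv_int (conv_pow R 2) g x)"
    proof (rule infsum_cong)
      fix x show "(\<Sum>\<^sub>\<infinity>y\<in>UNIV. f x * g y * r x y) = f x * conv_int (conv_pow R 2) g x"
        unfolding that(2)[symmetric] infsum_cmult_right'[symmetric] by (rule infsum_cong) simp
    qed
    finally show ?thesis by (simp add: conv_int_def[of f] ev)
  qed
  have e1: "(\<Sum>\<^sub>\<infinity>l\<in>UNIV. R (x - y - l) * R l) = conv_pow R 2 (x - y)" for x y
    by (simp add: R2 conv_int_def)
  have e2: "(\<Sum>\<^sub>\<infinity>l\<in>UNIV. R (x - l) * R (y + l)) = conv_pow R 2 (x + y)" for x y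
    unfolding R2 conv_int_def by (rule infsum_reindex_bij_witness[of _ "\<lambda>u. u - y" "\<lambda>l. l + y"]) (auto simp: algebra_simps)
  have i1: "(\<Sum>\<^sub>\<infinity>((x, y), l)\<in>UNIV. f x * g y * (R (x - y - l) * R l)) = conv_int f (conv_int (conv_pow R 2) g) 0"
    using it[OF s(1)] conv[OF it_summable[OF s(1)]] unfolding e1 by (simp add: conv_int_def)
  have c2: "(\<Sum>\<^sub>\<infinity>y\<in>UNIV. conv_pow R 2 (x + y) * g y) = conv_int (conv_pow R 2) g x" for x
    unfolding conv_int_def by (rule infsum_reindex_bij_witness[of _ uminus uminus]) (auto simp: ev)
  have i2: "(\<Sum>\<^sub>\<infinity>((x, y), l)\<in>UNIV. f x * g y * (R (x - l) * R (y + l))) = conv_int f (conv_int (conv_pow R 2) g) 0"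
    using it[OF s(2)] conv[OF it_summable[OF s(2)]] c2 unfolding e2 by simp
  have "(\<Sum>\<^sub>\<infinity>z\<in>UNIV. (\<lambda>((x, y), l). f x * g y * cov_kernel x y l) z)
     = (\<Sum>\<^sub>\<infinity>z\<in>UNIV. (\<lambda>((x, y), l). f x * g y * (R (x - y - l) * R l)) z
        + (\<lambda>((x, y), l). f x * g y * (R (x - l) * R (y + l))) z
        + (\<lambda>((x, y), l). f x * g y * joint_cumulant M [Z x, Z 0, Z (y + l), Z l]) z)"
    by (rule infsum_cong) (auto simp: cov_kernel_def algebra_simps split: prod.splits)
  also have "\<dots> = (\<Sum>\<^sub>\<infinity>((x, y), l)\<in>UNIV. f x * g y * (R (x - y - l) * R l))
        + (\<Sum>\<^sub>\<infinity>((x, y), l)\<in>UNIV. f x * g y * (R (x - l) * R (y + l)))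
        + (\<Sum>\<^sub>\<infinity>((x, y), l)\<in>UNIV. f x * g y * joint_cumulant M [Z x, Z 0, Z (y + l), Z l])"
    by (subst infsum_add[OF summable_on_add[OF s(1,2)] s(3)], subst infsum_add[OF s(1,2)]) (rule refl)
  also have "\<dots> = 2 * conv_int f (conv_int (conv_pow R 2) g) 0
      + (\<Sum>\<^sub>\<infinity>(x, y)\<in>UNIV. f x * (\<Sum>\<^sub>\<infinity>l\<in>UNIV. joint_cumulant M [Z x, Z 0, Z (y + l), Z l]) * g y)"
    unfolding i1 i2 it[OF s(3)] by (simp add: mult_ac)
  finally show ?thesis .
qed

text \<open>The arguments are exponents of the mean matrix in the linear terms, one less than the
  powers inside the traces. The two extra convolution factors in \<open>Suc k + Suc l\<close> come
  from the \<open>conv_pow R 2\<close> between the powers.\<close>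

definition limit_cov :: "nat \<Rightarrow> nat \<Rightarrow> real" where
  "limit_cov k l = 2 * conv_pow R (Suc k + Suc l) 0
     + (\<Sum>\<^sub>\<infinity>(i, j)\<in>UNIV. conv_pow R k i * (\<Sum>\<^sub>\<infinity>l\<in>UNIV. joint_cumulant M [Z i, Z 0, Z (j + l), Z l]) * conv_pow R l j)"

text \<open>For an anchor in the bulk, dominated convergence gives the limit of the sum over
  offsets; \<open>bulk_average\<close> then averages over the anchors.\<close>

lemma row_form_cov_limit:
  assumes b: "filterlim b at_top sequentially" and r: "1 \<le> r"
  shows "(\<lambda>p. expectation (\<lambda>\<omega>. row_form p (band_pow (b p) p k) r \<omega> * row_form p (band_pow (b p) p l) r \<omega>) / real p)
    \<longlonglongrightarrow> limit_cov k l"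
proof -
  let ?W = "\<lambda>k p. band_pow (b p) p k"
  let ?f = "\<lambda>w ((x, y), z). case w of (p, a) \<Rightarrow> ent (?W k p) p (int a + x) (int a) * ent (?W l p) p (int a + z + y) (int a + z) * cov_kernel x y z"
  let ?G = "\<lambda>((x, y), z). h_pow k x * h_pow l y * \<bar>cov_kernel x y z\<bar>"
  let ?g = "\<lambda>((x, y), z). conv_pow R k x * conv_pow R l y * cov_kernel x y z"
  have hs: "h_pow k summable_on UNIV" for k by (rule K.conv_pow_summable)
  have entb: "\<bar>ent (?W k p) p u v\<bar> \<le> h_pow k (u - v)" for k p u v
    using ent_bound[of "?W k p" "h_pow k" p u v] abs_band_pow_le K.conv_pow_nonneg by simp
  have G: "?G summable_on UNIV"
  proof -
    note s = cov_kernel_summable[OF hs[of k] hs[of l]]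
    have "(\<lambda>z. (\<lambda>((x, y), z). h_pow k x * h_pow l y * (R (x - y - z) * R z)) z
        + (\<lambda>((x, y), z). h_pow k x * h_pow l y * (R (x - z) * R (y + z))) z
        + (\<lambda>((x, y), z). h_pow k x * h_pow l y * joint_cumulant M [Z x, Z 0, Z (y + z), Z z]) z) summable_on UNIV" (is "?S summable_on _")
      by (rule summable_on_add[OF summable_on_add[OF s(1) s(2)] s(3)])
    then have "(\<lambda>z. \<bar>?S z\<bar>) summable_on UNIV" unfolding summable_on_abs_iff[of ?S] .
    moreover have "(\<lambda>z. \<bar>?S z\<bar>) = ?G"
    proof
      fix z :: "(int \<times> int) \<times> int"
      obtain x y w where z: "z = ((x, y), w)" by (metis surj_pair)
      have "?S z = h_pow k x * h_pow l y * cov_kernel x y w" by (simp add: z cov_kernel_def algebra_simps)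
      then show "\<bar>?S z\<bar> = ?G z" using K.conv_pow_nonneg by (simp add: z abs_mult)
    qed
    ultimately show ?thesis by simp
  qed
  have bound: "\<bar>?f w z\<bar> \<le> ?G z" for w z
  proof -
    obtain x y u where z: "z = ((x, y), u)" by (metis surj_pair)
    obtain p a where w: "w = (p, a)" by (cases w)
    have "\<bar>ent (?W k p) p (int a + x) (int a)\<bar> \<le> h_pow k x" using entb[of p k "int a + x" "int a"] by simp
    moreover have "\<bar>ent (?W l p) p (int a + u + y) (int a + u)\<bar> \<le> h_pow l y"
      using entb[of p l "int a + u + y" "int a + u"] by simp
    ultimately show ?thesis
      using K.conv_pow_nonneg by (simp add: z w abs_mult mult_mono)
  qed
  have lim: "((\<lambda>w. infsum (?f w) UNIV) \<longlongrightarrow> infsum ?g UNIV) bulk"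
  proof (rule tannery_infsum[OF _ bound G])
    fix z :: "(int \<times> int) \<times> int"
    obtain x y u where z: "z = ((x, y), u)" by (metis surj_pair)
    have "((\<lambda>w. (case w of (p, a) \<Rightarrow> ent (?W k p) p (int a + x) (int a + 0)) *
        (case w of (p, a) \<Rightarrow> ent (?W l p) p (int a + (u + y)) (int a + u)) * cov_kernel x y u)
       \<longlongrightarrow> conv_pow R k (x - 0) * conv_pow R l (u + y - u) * cov_kernel x y u) bulk"
      by (intro tendsto_mult tendsto_const ent_band_pow_tendsto b)
    then show "((\<lambda>w. ?f w z) \<longlongrightarrow> ?g z) bulk" by (simp add: z case_prod_unfold add.assoc)
  qed
  have "(\<lambda>p. (\<Sum>a\<in>{1..p}. infsum (?f (p, a)) UNIV) / real p) \<longlonglongrightarrow> infsum ?g UNIV"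
  proof (rule bulk_average[OF lim])
    fix p a
    have s: "?f (p, a) summable_on UNIV" by (rule summable_on_dominated[OF G]) (rule bound)
    have "\<bar>infsum (?f (p, a)) UNIV\<bar> \<le> infsum (\<lambda>z. \<bar>?f (p, a) z\<bar>) UNIV"
      using norm_infsum_bound[of "?f (p, a)" UNIV] s unfolding summable_on_abs_iff[of "?f (p, a)"] by (simp add: real_norm_def)
    also have "\<dots> \<le> infsum ?G UNIV"
      using s bound G unfolding summable_on_abs_iff[of "?f (p, a)"] by (intro infsum_mono) auto
    finally show "\<bar>infsum (?f (p, a)) UNIV\<bar> \<le> infsum ?G UNIV" .
  qed
  also have "(\<lambda>p. (\<Sum>a\<in>{1..p}. infsum (?f (p, a)) UNIV) / real p)
     = (\<lambda>p. expectation (\<lambda>\<omega>. row_form p (?W k p) r \<omega> * row_form p (?W l p) r \<omega>) / real p)"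
    unfolding expectation_row_form_mult[OF r] by simp
  also have "infsum ?g UNIV = limit_cov k l"
  proof -
    have ev: "R (- d) = R d" for d by (rule R_even)
    note c = conv_pow_summable_even[OF R_summable' ev]
    have "conv_int (conv_pow R k) (conv_int (conv_pow R 2) (conv_pow R l)) 0 = conv_pow R (Suc k + Suc l) 0"
      unfolding conv_pow_add[OF R_summable' ev] by (simp add: add.commute)
    then show ?thesis unfolding limit_cov_def infsum_cov_kernel[OF c(1) c(1) c(2) c(2)] by simp
  qed
  finally show ?thesis .
qed

end

section \<open>A central limit theorem for triangular arrays\<close>

lemma exp_minus_approx: "0 \<le> x \<Longrightarrow> \<bar>exp (- x) - (1 - x)\<bar> \<le> x\<^sup>2" for x :: real
proof -
  assume x: "0 \<le> x"
  have "1 - x \<le> exp (- x)" using exp_ge_add_one_self[of "- x"] by simp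
  moreover have "exp (- x) \<le> 1 / (1 + x)"
    using exp_ge_add_one_self[of x] x by (simp add: exp_minus field_simps)
  moreover have "1 / (1 + x) \<le> 1 - x + x\<^sup>2"
  proof -
    have "1 \<le> (1 - x + x\<^sup>2) * (1 + x)" using x by (simp add: algebra_simps power2_eq_square)
    then show ?thesis using x by (simp add: field_simps)
  qed
  ultimately show ?thesis by linarith
qed

text \<open>The third absolute moment is thereby expressed through the second and the fourth, which
  are the ones under control.\<close>

lemma power3_abs_le: "\<bar>x\<bar> ^ 3 \<le> x\<^sup>2 + x ^ 4" for x :: real
proof -
  have "0 \<le> x\<^sup>2 * ((1 - \<bar>x\<bar>)\<^sup>2 + \<bar>x\<bar>)" by (intro mult_nonneg_nonneg) auto
  also have "\<dots> = x\<^sup>2 + x\<^sup>2 * \<bar>x\<bar>\<^sup>2 - \<bar>x\<bar> * \<bar>x\<bar>\<^sup>2" by (simp add: power2_eq_square algebra_simps)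
  also have "\<dots> = x\<^sup>2 + x ^ 4 - \<bar>x\<bar> ^ 3" by (simp add: eval_nat_numeral)
  finally show ?thesis by simp
qed

context prob_space
begin

text \<open>A third-order expansion of the characteristic function is combined with the quadratic
  error of \<open>1 - x\<close> against \<open>exp (- x)\<close>. The comparison uses the variance
  \<open>v\<close> as it is, so the degenerate case \<open>v = 0\<close> is included.\<close>

lemma char_normal_approx:
  assumes X: "random_variable borel X" and X4: "integrable M (\<lambda>\<omega>. X \<omega> ^ 4)" and mean: "expectation X = 0"
    and second: "expectation (\<lambda>\<omega>. (X \<omega>)\<^sup>2) = v" and fourth: "expectation (\<lambda>\<omega>. X \<omega> ^ 4) \<le> C"
  shows "cmod (char (distr M borel X) t - exp (- (t\<^sup>2 * v / 2))) \<le> \<bar>t\<bar> ^ 3 * (v + C) + t ^ 4 * v\<^sup>2"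
proof -
  have dom: "integrable M (\<lambda>\<omega>. 1 + X \<omega> ^ 4)" using X4 by simp
  have le4: "\<bar>x\<bar> \<le> 1 + x ^ 4" "x\<^sup>2 \<le> 1 + x ^ 4" for x :: real
  proof -
    have "0 \<le> (x\<^sup>2 - 1)\<^sup>2" by simp
    then have a: "2 * x\<^sup>2 \<le> 1 + x ^ 4" by (simp add: power2_diff flip: power_mult)
    have "0 \<le> (\<bar>x\<bar> - 1)\<^sup>2" by simp
    then have b: "2 * \<bar>x\<bar> \<le> 1 + x\<^sup>2" by (simp add: power2_diff)
    have c: "0 \<le> x\<^sup>2" "0 \<le> x ^ 4" by simp_all
    show "x\<^sup>2 \<le> 1 + x ^ 4" "\<bar>x\<bar> \<le> 1 + x ^ 4" using a b c by linarith+
  qed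
  have X1: "integrable M X"
    by (rule Bochner_Integration.integrable_bound[OF dom X]) (use le4 in \<open>auto simp: abs_of_nonneg\<close>)
  have X2: "integrable M (\<lambda>\<omega>. (X \<omega>)\<^sup>2)"
    by (rule Bochner_Integration.integrable_bound[OF dom]) (use X le4 in \<open>auto simp: abs_of_nonneg\<close>)
  have v0: "0 \<le> v" unfolding second[symmetric] by simp
  have a: "cmod (char (distr M borel X) t - (1 - t\<^sup>2 * v / 2)) \<le> (t\<^sup>2 / 6) * expectation (\<lambda>x. min (6 * (X x)\<^sup>2) (\<bar>t\<bar> * \<bar>X x\<bar>^3))"
    by (rule char_approx3'[OF X X1 X2 mean _ refl]) (simp add: mean second)
  have "expectation (\<lambda>x. min (6 * (X x)\<^sup>2) (\<bar>t\<bar> * \<bar>X x\<bar>^3)) \<le> expectation (\<lambda>x. \<bar>t\<bar> * ((X x)\<^sup>2 + X x ^ 4))"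
  proof (rule integral_mono)
    show "integrable M (\<lambda>x. min (6 * (X x)\<^sup>2) (\<bar>t\<bar> * \<bar>X x\<bar>^3))"
      by (rule Bochner_Integration.integrable_bound[of _ "\<lambda>x. 6 * (X x)\<^sup>2"]) (use X X2 in auto)
    show "min (6 * (X x)\<^sup>2) (\<bar>t\<bar> * \<bar>X x\<bar>^3) \<le> \<bar>t\<bar> * ((X x)\<^sup>2 + X x ^ 4)" for x
      by (rule min.coboundedI2) (intro mult_left_mono power3_abs_le abs_ge_zero)
  qed (use X2 X4 in simp)
  also have "\<dots> \<le> \<bar>t\<bar> * (v + C)"
    using X2 X4 second fourth by (simp add: mult_left_mono)
  finally have b: "(t\<^sup>2 / 6) * expectation (\<lambda>x. min (6 * (X x)\<^sup>2) (\<bar>t\<bar> * \<bar>X x\<bar>^3)) \<le> (t\<^sup>2 / 6) * (\<bar>t\<bar> * (v + C))"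
    by (intro mult_left_mono) auto
  have "0 \<le> expectation (\<lambda>\<omega>. X \<omega> ^ 4)" by (rule Bochner_Integration.integral_nonneg) simp
  then have vC: "0 \<le> v + C" using v0 fourth by linarith
  have "(t\<^sup>2 / 6) * (\<bar>t\<bar> * (v + C)) = (1/6) * (\<bar>t\<bar> ^ 3 * (v + C))" by (simp add: eval_nat_numeral)
  also have "\<dots> \<le> 1 * (\<bar>t\<bar> ^ 3 * (v + C))" using vC by (intro mult_right_mono) auto
  finally have c: "cmod (char (distr M borel X) t - (1 - t\<^sup>2 * v / 2)) \<le> \<bar>t\<bar> ^ 3 * (v + C)" using a b by linarith
  have "cmod ((1 - t\<^sup>2 * v / 2) - exp (- (t\<^sup>2 * v / 2))) = \<bar>exp (- (t\<^sup>2 * v / 2)) - (1 - t\<^sup>2 * v / 2)\<bar>"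
  proof -
    have "(1 - t\<^sup>2 * v / 2) - exp (- (t\<^sup>2 * v / 2)) = complex_of_real ((1 - t\<^sup>2 * v / 2) - exp (- (t\<^sup>2 * v / 2)))"
      by simp
    then show ?thesis by (simp only: norm_of_real abs_minus_commute)
  qed
  also have "\<dots> \<le> (t\<^sup>2 * v / 2)\<^sup>2" by (rule exp_minus_approx) (use v0 in simp)
  also have "\<dots> \<le> t ^ 4 * v\<^sup>2" by (simp add: power_mult_distrib power_divide flip: power_mult)
  finally have d: "cmod ((1 - t\<^sup>2 * v / 2) - exp (- (t\<^sup>2 * v / 2))) \<le> t ^ 4 * v\<^sup>2" .
  show ?thesis
    using norm_triangle_ineq[of "char (distr M borel X) t - (1 - t\<^sup>2 * v / 2)" "(1 - t\<^sup>2 * v / 2) - exp (- (t\<^sup>2 * v / 2))"] c d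
    by simp
qed

text \<open>Two products of numbers of modulus at most 1 differ by at most the sum of the
  differences of the factors. At the argument \<open>t / sqrt n\<close> each of the \<open>n\<close>
  factors errs by order \<open>n^(-3/2)\<close>, so the total error is of order
  \<open>n^(-1/2)\<close>.\<close>

theorem triangular_array_clt:
  fixes W :: "nat \<Rightarrow> nat \<Rightarrow> 'a \<Rightarrow> real"
  assumes indep: "\<And>p. indep_vars (\<lambda>_. borel) (W p) {1..n p}" and n: "filterlim n at_top sequentially"
    and W4: "\<And>p r. 1 \<le> r \<Longrightarrow> integrable M (\<lambda>\<omega>. W p r \<omega> ^ 4)" and mean: "\<And>p r. 1 \<le> r \<Longrightarrow> expectation (W p r) = 0"
    and second: "\<And>p r. 1 \<le> r \<Longrightarrow> expectation (\<lambda>\<omega>. (W p r \<omega>)\<^sup>2) = v p" and v: "v \<longlonglongrightarrow> V"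
    and fourth: "\<And>p r. 1 \<le> r \<Longrightarrow> expectation (\<lambda>\<omega>. W p r \<omega> ^ 4) \<le> C"
  shows "(\<lambda>p. CLINT \<omega>|M. iexp (t * ((\<Sum>r\<in>{1..n p}. W p r \<omega>) / sqrt (real (n p))))) \<longlonglongrightarrow> exp (- (t\<^sup>2 * V / 2))"
proof -
  let ?s = "\<lambda>p. t / sqrt (real (n p))"
  have rv: "random_variable borel (W p r)" if "r \<in> {1..n p}" for p r using indep[of p] that by (simp add: indep_vars_def2)
  define err where "err p = real (n p) * (\<bar>?s p\<bar> ^ 3 * (v p + C) + ?s p ^ 4 * (v p)\<^sup>2)" for p
  have eq: "(CLINT \<omega>|M. iexp (t * ((\<Sum>r\<in>{1..n p}. W p r \<omega>) / sqrt (real (n p))))) = (\<Prod>r\<in>{1..n p}. char (distr M borel (W p r)) (?s p))" for p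
  proof -
    have "(CLINT \<omega>|M. iexp (t * ((\<Sum>r\<in>{1..n p}. W p r \<omega>) / sqrt (real (n p))))) = char (distr M borel (\<lambda>\<omega>. \<Sum>r\<in>{1..n p}. W p r \<omega>)) (?s p)"
      using rv by (simp add: char_def integral_distr)
    then show ?thesis using char_distr_sum[OF indep] by simp
  qed
  have bound: "cmod ((CLINT \<omega>|M. iexp (t * ((\<Sum>r\<in>{1..n p}. W p r \<omega>) / sqrt (real (n p))))) - exp (- (t\<^sup>2 * v p / 2))) \<le> err p"
    if n0: "0 < n p" for p
  proof -
    have v0: "0 \<le> v p" using second[of 1 p] Bochner_Integration.integral_nonneg[of M "\<lambda>\<omega>. (W p 1 \<omega>)\<^sup>2"] by simp
    let ?e = "complex_of_real (exp (- ((?s p)\<^sup>2 * v p / 2)))"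
    have "exp (- (t\<^sup>2 * v p / 2)) = exp (- ((?s p)\<^sup>2 * v p / 2)) ^ n p"
      using n0 by (simp add: power_divide flip: exp_of_nat_mult)
    then have "complex_of_real (exp (- (t\<^sup>2 * v p / 2))) = (\<Prod>r\<in>{1..n p}. ?e)" by simp
    then have "cmod ((CLINT \<omega>|M. iexp (t * ((\<Sum>r\<in>{1..n p}. W p r \<omega>) / sqrt (real (n p))))) - exp (- (t\<^sup>2 * v p / 2)))
       = cmod ((\<Prod>r\<in>{1..n p}. char (distr M borel (W p r)) (?s p)) - (\<Prod>r\<in>{1..n p}. ?e))"
      unfolding eq by simp
    also have "\<dots> \<le> (\<Sum>r\<in>{1..n p}. cmod (char (distr M borel (W p r)) (?s p) - ?e))"
    proof (rule norm_prod_diff)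
      fix r assume "r \<in> {1..n p}"
      then interpret D: real_distribution "distr M borel (W p r)" using rv by simp
      show "cmod (char (distr M borel (W p r)) (?s p)) \<le> 1" by (rule D.cmod_char_le_1)
      show "cmod ?e \<le> 1" using v0 by simp
    qed
    also have "\<dots> \<le> (\<Sum>r\<in>{1..n p}. \<bar>?s p\<bar> ^ 3 * (v p + C) + ?s p ^ 4 * (v p)\<^sup>2)"
      by (intro sum_mono char_normal_approx[OF rv W4 mean second fourth]) auto
    also have "\<dots> = err p" by (simp add: err_def)
    finally show ?thesis .
  qed
  have sn: "(\<lambda>p. 1 / sqrt (real (n p))) \<longlonglongrightarrow> 0"
    by (intro tendsto_divide_0[OF tendsto_const] filterlim_at_top_imp_at_infinity
        filterlim_compose[OF sqrt_at_top] filterlim_compose[OF filterlim_real_sequentially n])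
  have ev: "\<forall>\<^sub>F p in sequentially. 0 < n p" using filterlim_at_top[THEN iffD1, OF n, rule_format, of 1] by (simp add: Suc_le_eq)
  have "(\<lambda>p. (1 / sqrt (real (n p))) * (\<bar>t\<bar> ^ 3 * (v p + C)) + (1 / sqrt (real (n p)))\<^sup>2 * (t ^ 4 * (v p)\<^sup>2))
     \<longlonglongrightarrow> 0 * (\<bar>t\<bar> ^ 3 * (V + C)) + 0\<^sup>2 * (t ^ 4 * V\<^sup>2)"
    by (intro tendsto_intros sn v)
  then have "(\<lambda>p. (1 / sqrt (real (n p))) * (\<bar>t\<bar> ^ 3 * (v p + C)) + (1 / sqrt (real (n p)))\<^sup>2 * (t ^ 4 * (v p)\<^sup>2)) \<longlonglongrightarrow> 0" by simp
  then have err0: "err \<longlonglongrightarrow> 0"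
  proof (rule Lim_transform_eventually)
    show "\<forall>\<^sub>F p in sequentially. (1 / sqrt (real (n p))) * (\<bar>t\<bar> ^ 3 * (v p + C)) + (1 / sqrt (real (n p)))\<^sup>2 * (t ^ 4 * (v p)\<^sup>2) = err p"
      using ev
    proof eventually_elim
      case (elim p)
      define q where "q = sqrt (real (n p))"
      have q: "0 < q" "real (n p) = q\<^sup>2" using elim by (auto simp: q_def)
      show ?case unfolding err_def q_def[symmetric] q(2) using q(1)
        by (simp add: field_simps eval_nat_numeral)
    qed
  qed
  have d: "(\<lambda>p. (CLINT \<omega>|M. iexp (t * ((\<Sum>r\<in>{1..n p}. W p r \<omega>) / sqrt (real (n p))))) - exp (- (t\<^sup>2 * v p / 2))) \<longlonglongrightarrow> 0"
    by (rule Lim_null_comparison[OF _ err0]) (use ev bound in \<open>auto elim: eventually_mono\<close>)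
  have "(\<lambda>p. complex_of_real (exp (- (t\<^sup>2 * v p / 2)))) \<longlonglongrightarrow> complex_of_real (exp (- (t\<^sup>2 * V / 2)))"
    by (intro tendsto_intros v) simp
  from tendsto_add[OF d this] show ?thesis by simp
qed

text \<open>The Slutsky step for characteristic functions: a perturbation that is small in mean
  square does not affect the limit.\<close>

lemma char_diff_le:
  assumes U: "random_variable borel U" and D: "random_variable borel D" "integrable M (\<lambda>\<omega>. (D \<omega>)\<^sup>2)"
  shows "cmod ((CLINT \<omega>|M. iexp (t * (U \<omega> + D \<omega>))) - (CLINT \<omega>|M. iexp (t * U \<omega>))) \<le> \<bar>t\<bar> * sqrt (expectation (\<lambda>\<omega>. (D \<omega>)\<^sup>2))"
proof -
  have D1: "integrable M D" using D by (rule square_integrable_imp_integrable)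
  have i: "integrable M (\<lambda>\<omega>. iexp (t * V \<omega>))" if "random_variable borel V" for V
    by (rule integrable_const_bound[of _ 1]) (use that in auto)
  have UD: "random_variable borel (\<lambda>\<omega>. U \<omega> + D \<omega>)" using U D by simp
  have "cmod ((CLINT \<omega>|M. iexp (t * (U \<omega> + D \<omega>))) - (CLINT \<omega>|M. iexp (t * U \<omega>)))
     = cmod (CLINT \<omega>|M. iexp (t * (U \<omega> + D \<omega>)) - iexp (t * U \<omega>))"
    using i[OF U] i[OF UD] by simp
  also have "\<dots> \<le> expectation (\<lambda>\<omega>. cmod (iexp (t * (U \<omega> + D \<omega>)) - iexp (t * U \<omega>)))"
    by (rule integral_norm_bound)
  also have "\<dots> \<le> expectation (\<lambda>\<omega>. \<bar>t\<bar> * \<bar>D \<omega>\<bar>)"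
  proof (rule integral_mono)
    show "integrable M (\<lambda>\<omega>. cmod (iexp (t * (U \<omega> + D \<omega>)) - iexp (t * U \<omega>)))" using i[OF U] i[OF UD] by simp
    fix \<omega>
    have "iexp (t * (U \<omega> + D \<omega>)) - iexp (t * U \<omega>) = iexp (t * U \<omega>) * (iexp (t * D \<omega>) - 1)"
      by (simp add: algebra_simps flip: exp_add)
    then have "cmod (iexp (t * (U \<omega> + D \<omega>)) - iexp (t * U \<omega>)) = cmod (iexp (t * D \<omega>) - 1)"
      by (simp add: norm_mult)
    also have "\<dots> \<le> \<bar>t * D \<omega>\<bar>" using iexp_approx1[of "t * D \<omega>" 0] by simp
    finally show "cmod (iexp (t * (U \<omega> + D \<omega>)) - iexp (t * U \<omega>)) \<le> \<bar>t\<bar> * \<bar>D \<omega>\<bar>" by (simp add: abs_mult)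
  qed (use D1 in simp)
  also have "\<dots> = \<bar>t\<bar> * expectation (\<lambda>\<omega>. \<bar>D \<omega>\<bar>)" by simp
  also have "expectation (\<lambda>\<omega>. \<bar>D \<omega>\<bar>) \<le> sqrt (expectation (\<lambda>\<omega>. (D \<omega>)\<^sup>2))"
  proof (rule real_le_rsqrt)
    have "0 \<le> variance (\<lambda>\<omega>. \<bar>D \<omega>\<bar>)" by simp
    then show "(expectation (\<lambda>\<omega>. \<bar>D \<omega>\<bar>))\<^sup>2 \<le> expectation (\<lambda>\<omega>. (D \<omega>)\<^sup>2)"
      using D1 D by (subst (asm) variance_eq) auto
  qed
  finally show ?thesis by (simp add: mult_left_mono)
qed

end

section \<open>Convergence of finite-dimensional distributions\<close>

text \<open>Linear combinations of characters in the coordinates of \<open>K\<close>. They form an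
  algebra, and their expectations are linear combinations of values of the characteristic
  function.\<close>

inductive_set trig_poly :: "nat set \<Rightarrow> ((nat \<Rightarrow> real) \<Rightarrow> complex) set" for K where
  monom: "(\<lambda>x. a * cis (\<Sum>k\<in>K. c k * x k)) \<in> trig_poly K"
| add: "f \<in> trig_poly K \<Longrightarrow> g \<in> trig_poly K \<Longrightarrow> (\<lambda>x. f x + g x) \<in> trig_poly K"

lemma trig_poly_const: "(\<lambda>x. a) \<in> trig_poly K"
  using trig_poly.monom[where a = a and c = "\<lambda>_. 0" and K = K] by simp

lemma trig_poly_mult:
  assumes "f \<in> trig_poly K" "g \<in> trig_poly K"
  shows "(\<lambda>x. f x * g x) \<in> trig_poly K"
  using assms(1)
proof induction
  case (monom a c)
  show ?case using assms(2)
  proof induction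
    case (monom a' c')
    have "(\<lambda>x. a * a' * cis (\<Sum>k\<in>K. (c k + c' k) * x k)) \<in> trig_poly K" by (rule trig_poly.monom)
    also have "(\<lambda>x. a * a' * cis (\<Sum>k\<in>K. (c k + c' k) * x k))
        = (\<lambda>x. a * cis (\<Sum>k\<in>K. c k * x k) * (a' * cis (\<Sum>k\<in>K. c' k * x k)))"
      by (simp add: distrib_right sum.distrib cis_mult[symmetric] mult.assoc mult.left_commute)
    finally show ?case .
  next
    case (add f' g')
    from trig_poly.add[OF add.IH] show ?case by (simp add: distrib_left)
  qed
next
  case (add f' g')
  from trig_poly.add[OF add.IH] show ?case by (simp add: distrib_right)
qed

lemma trig_poly_sin:
  assumes "finite K" "k \<in> K"
  shows "(\<lambda>x. complex_of_real (sin (s * x k))) \<in> trig_poly K"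
proof -
  have e: "(\<Sum>j\<in>K. (if j = k then u else 0) * x j) = u * x k" for u :: real and x :: "nat \<Rightarrow> real"
    using assms by (simp add: if_distrib[of "\<lambda>y. y * _"] cong: if_cong)
  have "complex_of_real (sin (s * x k)) = - \<i> / 2 * cis (s * x k) + \<i> / 2 * cis (- s * x k)" for x
    by (simp add: complex_eq_iff)
  moreover have "(\<lambda>x. - \<i> / 2 * cis (\<Sum>j\<in>K. (if j = k then s else 0) * x j) + \<i> / 2 * cis (\<Sum>j\<in>K. (if j = k then - s else 0) * x j)) \<in> trig_poly K"
    by (intro trig_poly.intros)
  ultimately show ?thesis unfolding e by simp
qed

lemma compact_box_coords:
  fixes K :: "nat set"
  shows "compact {x :: nat \<Rightarrow> real. \<forall>k. x k \<in> (if k \<in> K then {- 1..1} else {0})}"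
proof -
  have "compact (PiE UNIV (\<lambda>k. if k \<in> K then {- 1..1} else {0 :: real}))"
  proof -
    have "compactin (product_topology (\<lambda>_::nat. euclidean) UNIV) (PiE UNIV (\<lambda>k. if k \<in> K then {- 1..1} else {0 :: real}))"
      unfolding compactin_PiE by (auto simp: compactin_euclidean_iff)
    then show ?thesis by (simp add: euclidean_product_topology)
  qed
  then show ?thesis by (simp add: PiE_def Pi_def extensional_def)
qed

text \<open>Stone-Weierstrass is applied on a compact box to \<open>f\<close> composed with the
  inverse of the sine map \<open>tr\<close>. As \<open>tr\<close> sends the whole space into the
  box, the approximant stays within \<open>B + \<epsilon>\<close> off the cube too, which makes the
  later tail estimate possible.\<close>

lemma trig_poly_dense:
  fixes f :: "(nat \<Rightarrow> real) \<Rightarrow> real"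
  assumes f: "continuous_on UNIV f" and K: "finite K" and A: "0 < A" and B: "\<And>x. \<bar>f x\<bar> \<le> B" and \<epsilon>: "0 < \<epsilon>"
  obtains g where "(\<lambda>x. complex_of_real (g x)) \<in> trig_poly K" "\<And>x. \<bar>g x\<bar> \<le> B + \<epsilon>"
    "\<And>x. (\<forall>k\<in>K. \<bar>x k\<bar> \<le> A) \<Longrightarrow> \<bar>f (\<lambda>k. if k \<in> K then x k else 0) - g x\<bar> \<le> \<epsilon>"
proof -
  \<comment> \<open>This scale maps \<open>[-A, A]\<close> onto \<open>[-pi/2, pi/2]\<close>, where
    the sine is inverted by \<open>arcsin\<close>.\<close>
  define s where "s = pi / (2 * A)"
  have s: "0 < s" using A by (simp add: s_def)
  \<comment> \<open>Coordinates outside \<open>K\<close> are pinned to 0, so that those in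
    \<open>K\<close> separate the points.\<close>
  define S where "S = {x :: nat \<Rightarrow> real. \<forall>k. x k \<in> (if k \<in> K then {- 1..1} else {0})}"
  define tr where "tr = (\<lambda>(x :: nat \<Rightarrow> real) k. if k \<in> K then sin (s * x k) else 0)"
  define P where "P = {g. continuous_on S g \<and> (\<lambda>x. complex_of_real (g (tr x))) \<in> trig_poly K}"
  have tr_S: "tr x \<in> S" for x by (auto simp: tr_def S_def)
  interpret function_ring_on P S
  proof
    show "compact S" unfolding S_def by (rule compact_box_coords)
    show "continuous_on S g" if "g \<in> P" for g using that by (simp add: P_def)
    show "(\<lambda>x. g x + h x) \<in> P" if "g \<in> P" "h \<in> P" for g h
      using that by (auto simp: P_def intro: continuous_on_add trig_poly.add)
    show "(\<lambda>x. g x * h x) \<in> P" if "g \<in> P" "h \<in> P" for g h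
      using that by (auto simp: P_def intro: continuous_on_mult trig_poly_mult)
    show "(\<lambda>_. c) \<in> P" for c by (auto simp: P_def intro: trig_poly_const)
    fix x y assume xy: "x \<in> S" "y \<in> S" "x \<noteq> y"
    then obtain k where k: "x k \<noteq> y k" by auto
    then have kK: "k \<in> K" using xy by (auto simp: S_def split: if_splits) (metis singletonD)
    have "(\<lambda>x. x k) \<in> P"
      using trig_poly_sin[OF K kK, of s] kK by (auto simp: P_def tr_def intro: continuous_on_product_coordinates continuous_on_subset)
    then show "\<exists>g\<in>P. g x \<noteq> g y" using k by (intro bexI[of _ "\<lambda>x. x k"])
  qed
  have "continuous_on S (\<lambda>x. f (\<lambda>k. arcsin (x k) / s))"
  proof (rule continuous_on_compose2[OF f])
    show "continuous_on S (\<lambda>x k. arcsin (x k) / s)"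
    proof (rule continuous_on_coordinatewise_then_product)
      fix k
      have "continuous_on S (\<lambda>x. arcsin (x k))"
      proof (rule continuous_on_compose2[OF continuous_on_arcsin'])
        show "continuous_on S (\<lambda>x. x k)" by (rule continuous_on_subset[OF continuous_on_product_coordinates]) simp
        show "(\<lambda>x. x k) ` S \<subseteq> {- 1..1}" by (auto simp: S_def split: if_splits dest!: spec[of _ k])
      qed
      then show "continuous_on S (\<lambda>x. arcsin (x k) / s)" using s by (intro continuous_on_divide continuous_on_const) auto
    qed
  qed simp
  from Stone_Weierstrass_basic[OF this \<epsilon>] obtain h where h: "h \<in> P"
    and h_close: "\<And>x. x \<in> S \<Longrightarrow> \<bar>f (\<lambda>k. arcsin (x k) / s) - h x\<bar> < \<epsilon>" by auto
  show thesis
  proof (rule that[of "\<lambda>x. h (tr x)"])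
    show "(\<lambda>x. complex_of_real (h (tr x))) \<in> trig_poly K" using h by (simp add: P_def)
    show "\<bar>h (tr x)\<bar> \<le> B + \<epsilon>" for x
      using h_close[OF tr_S, of x] B[of "\<lambda>k. arcsin (tr x k) / s"] by linarith
    fix x assume x: "\<forall>k\<in>K. \<bar>x k\<bar> \<le> A"
    have "(\<lambda>k. arcsin (tr x k) / s) = (\<lambda>k. if k \<in> K then x k else 0)"
    proof
      fix k
      have "arcsin (sin (s * x k)) = s * x k" if "k \<in> K"
      proof (rule arcsin_sin)
        have "- A \<le> x k" "x k \<le> A" using x that by (auto simp: abs_le_iff)
        then have "s * (- A) \<le> s * x k" "s * x k \<le> s * A" using s by (intro mult_left_mono, auto)+
        moreover have "s * A = pi / 2" using A by (simp add: s_def)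
        ultimately show "- (pi / 2) \<le> s * x k" "s * x k \<le> pi / 2" by auto
      qed
      then show "arcsin (tr x k) / s = (if k \<in> K then x k else 0)" using s by (simp add: tr_def)
    qed
    then show "\<bar>f (\<lambda>k. if k \<in> K then x k else 0) - h (tr x)\<bar> \<le> \<epsilon>" using h_close[OF tr_S, of x] by simp
  qed
qed

lemma trig_poly_integral_converges:
  fixes N :: "(nat \<Rightarrow> real) measure" and T :: "nat \<Rightarrow> nat \<Rightarrow> 'a \<Rightarrow> real"
  assumes M: "prob_space M" and N: "prob_space N" and T: "\<And>p k. T p k \<in> borel_measurable M"
    and pr: "\<And>k. (\<lambda>x. x k) \<in> borel_measurable N"
    and char: "\<And>c. (\<lambda>p. LINT \<omega>|M. cis (\<Sum>k\<in>K. c k * T p k \<omega>)) \<longlonglongrightarrow> (LINT x|N. cis (\<Sum>k\<in>K. c k * x k))"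
    and g: "g \<in> trig_poly K"
  shows "(\<lambda>p. LINT \<omega>|M. g (\<lambda>k. T p k \<omega>)) \<longlonglongrightarrow> (LINT x|N. g x)"
    "integrable N g" "integrable M (\<lambda>\<omega>. g (\<lambda>k. T p k \<omega>))"
proof -
  have cis_i: "integrable L (\<lambda>\<omega>. cis (X \<omega>))" if "prob_space L" "X \<in> borel_measurable L" for L :: "'b measure" and X
  proof -
    interpret L: prob_space L by fact
    have "cis \<in> borel_measurable borel" by (intro borel_measurable_continuous_onI continuous_intros)
    then show ?thesis by (intro L.integrable_const_bound[of _ 1]) (use that in auto)
  qed
  have i: "integrable N g \<and> (\<forall>p. integrable M (\<lambda>\<omega>. g (\<lambda>k. T p k \<omega>)))" using g
  proof induction
    case (monom a c)
    show ?case using cis_i[OF N, of "\<lambda>x. \<Sum>k\<in>K. c k * x k"] cis_i[OF M, of "\<lambda>\<omega>. \<Sum>k\<in>K. c k * T _ k \<omega>"] T pr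
      by auto
  qed auto
  then show "integrable N g" "integrable M (\<lambda>\<omega>. g (\<lambda>k. T p k \<omega>))" by auto
  have "integrable N g \<and> (\<forall>p. integrable M (\<lambda>\<omega>. g (\<lambda>k. T p k \<omega>))) \<and> (\<lambda>p. LINT \<omega>|M. g (\<lambda>k. T p k \<omega>)) \<longlonglongrightarrow> (LINT x|N. g x)" using g
  proof induction
    case (monom a c)
    show ?case using cis_i[OF N, of "\<lambda>x. \<Sum>k\<in>K. c k * x k"] cis_i[OF M, of "\<lambda>\<omega>. \<Sum>k\<in>K. c k * T _ k \<omega>"] T pr
      tendsto_mult_left[OF char[of c], of a] by auto
  next
    case (add f g)
    then show ?case by (auto intro: tendsto_add)
  qed
  then show "(\<lambda>p. LINT \<omega>|M. g (\<lambda>k. T p k \<omega>)) \<longlonglongrightarrow> (LINT x|N. g x)" by simp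
qed

text \<open>Second moments bounded in \<open>p\<close> give tightness: off the cube of half-width
  \<open>A\<close> the approximation error is at most \<open>2 * B + \<epsilon>\<close>, and by
  Chebyshev this contributes at most \<open>(2 * B + \<epsilon>) * D / A^2\<close> under every law
  involved, the limit included.\<close>

lemma fdd_converges_charI:
  fixes N :: "(nat \<Rightarrow> real) measure" and T :: "nat \<Rightarrow> nat \<Rightarrow> 'a \<Rightarrow> real"
  assumes M: "prob_space M" and N: "prob_space N" and T: "\<And>p k. T p k \<in> borel_measurable M"
    and pr: "\<And>k. (\<lambda>x. x k) \<in> borel_measurable N"
    and char: "\<And>K c. finite K \<Longrightarrow> K \<subseteq> {1..} \<Longrightarrow>
      (\<lambda>p. LINT \<omega>|M. cis (\<Sum>k\<in>K. c k * T p k \<omega>)) \<longlonglongrightarrow> (LINT x|N. cis (\<Sum>k\<in>K. c k * x k))"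
    and T2: "\<And>p k. 1 \<le> k \<Longrightarrow> integrable M (\<lambda>\<omega>. (T p k \<omega>)\<^sup>2)" and N2: "\<And>k. 1 \<le> k \<Longrightarrow> integrable N (\<lambda>x. (x k)\<^sup>2)"
    and bnd: "\<And>k p. 1 \<le> k \<Longrightarrow> (LINT \<omega>|M. (T p k \<omega>)\<^sup>2) \<le> C k"
  shows "fdd_converges M T N"
  unfolding fdd_converges_def
proof (intro allI impI)
  fix K :: "nat set" and f :: "(nat \<Rightarrow> real) \<Rightarrow> real"
  assume K: "finite K \<and> K \<subseteq> {1..}" and f: "continuous_on UNIV f \<and> bounded (range f)"
  interpret M: prob_space M by fact
  interpret N: prob_space N by fact
  let ?f = "\<lambda>x. f (\<lambda>k. if k \<in> K then x k else 0)"
  obtain B0 where "\<And>x. \<bar>f x\<bar> \<le> B0" using f by (auto simp: bounded_iff)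
  then obtain B where B: "\<And>x. \<bar>f x\<bar> \<le> B" "0 \<le> B" using abs_ge_zero order_trans by blast
  have f_meas: "f \<in> borel_measurable borel" using f by (intro borel_measurable_continuous_onI) simp
  have r_meas: "(\<lambda>y k. if k \<in> K then Y k y else 0) \<in> borel_measurable L"
    if "\<And>k. Y k \<in> borel_measurable L" for L :: "'b measure" and Y :: "nat \<Rightarrow> 'b \<Rightarrow> real"
    by (rule measurable_coordinatewise_then_product) (use that in auto)
  have fM: "integrable M (\<lambda>\<omega>. ?f (\<lambda>k. T p k \<omega>))" for p
    using measurable_compose[OF r_meas[OF T] f_meas] B by (intro M.integrable_const_bound[of _ B]) auto
  have fN: "integrable N ?f"
    using measurable_compose[OF r_meas[of "\<lambda>k x. x k", OF pr] f_meas] B by (intro N.integrable_const_bound[of _ B]) auto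
  define D where "D = (\<Sum>k\<in>K. C k) + (\<Sum>k\<in>K. LINT x|N. (x k)\<^sup>2)"
  have C0: "0 \<le> C k" if "1 \<le> k" for k
    
    by (rule order_trans[OF _ bnd[OF that, of 0]]) simp
  have D1: "(\<Sum>k\<in>K. LINT \<omega>|M. (T p k \<omega>)\<^sup>2) \<le> D" for p
  proof -
    have "(\<Sum>k\<in>K. LINT \<omega>|M. (T p k \<omega>)\<^sup>2) \<le> (\<Sum>k\<in>K. C k)" using K by (intro sum_mono bnd) auto
    moreover have "0 \<le> (\<Sum>k\<in>K. LINT x|N. (x k)\<^sup>2)" by (intro sum_nonneg Bochner_Integration.integral_nonneg) simp
    ultimately show ?thesis unfolding D_def by linarith
  qed
  have D2: "(\<Sum>k\<in>K. LINT x|N. (x k)\<^sup>2) \<le> D" using K C0 unfolding D_def by (auto intro!: sum_nonneg)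
  have D0: "0 \<le> D" using D2 sum_nonneg[of K "\<lambda>k. LINT x|N. (x k)\<^sup>2"] by simp
  show "(\<lambda>p. LINT \<omega>|M. ?f (\<lambda>k. T p k \<omega>)) \<longlonglongrightarrow> (LINT x|N. ?f x)"
  proof (rule LIMSEQ_I)
    fix e :: real assume e: "0 < e"
    \<comment> \<open>The final comparison spends \<open>2 * \<epsilon>\<close> under each of the
      two laws and \<epsilon> on the convergence of the trigonometric integrals.\<close>
    define \<epsilon> where "\<epsilon> = e / 8"
    have \<epsilon>: "0 < \<epsilon>" using e by (simp add: \<epsilon>_def)
    \<comment> \<open>Chosen so that the tail contribution is at most \<epsilon>; the summand 1
      keeps \<open>A\<close> positive.\<close>
    define A where "A = sqrt ((2 * B + \<epsilon>) * D / \<epsilon>) + 1"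
    have A: "0 < A" using B D0 \<epsilon> by (auto simp: A_def intro!: add_nonneg_pos)
    have A2: "(2 * B + \<epsilon>) * D / A\<^sup>2 \<le> \<epsilon>"
    proof -
      have "(2 * B + \<epsilon>) * D / \<epsilon> \<le> A\<^sup>2"
        by (rule sqrt_le_D) (simp add: A_def)
      then show ?thesis using \<epsilon> A by (simp add: field_simps)
    qed
    obtain g where g: "(\<lambda>x. complex_of_real (g x)) \<in> trig_poly K" and gB: "\<And>x. \<bar>g x\<bar> \<le> B + \<epsilon>"
      and gf: "\<And>x. (\<forall>k\<in>K. \<bar>x k\<bar> \<le> A) \<Longrightarrow> \<bar>?f x - g x\<bar> \<le> \<epsilon>"
      using trig_poly_dense[of f K A B \<epsilon>] f K A B \<epsilon> by blast
    note tp = trig_poly_integral_converges[OF M N T pr char g]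
    have Kc: "finite K" "K \<subseteq> {1..}" using K by auto
    have gN: "integrable N g" and gM: "integrable M (\<lambda>\<omega>. g (\<lambda>k. T p k \<omega>))" for p
      using integrable_Re[OF tp(2)] integrable_Re[OF tp(3)] Kc by simp_all
    have gc: "(\<lambda>p. LINT \<omega>|M. g (\<lambda>k. T p k \<omega>)) \<longlonglongrightarrow> (LINT x|N. g x)"
      using tp(1) Kc by (simp add: tendsto_of_real_iff)
    have pt: "\<bar>?f x - g x\<bar> \<le> \<epsilon> + (2 * B + \<epsilon>) / A\<^sup>2 * (\<Sum>k\<in>K. (x k)\<^sup>2)" for x
    proof (cases "\<forall>k\<in>K. \<bar>x k\<bar> \<le> A")
      case True
      have "0 \<le> (2 * B + \<epsilon>) / A\<^sup>2 * (\<Sum>k\<in>K. (x k)\<^sup>2)" using B \<epsilon> by (intro mult_nonneg_nonneg sum_nonneg) auto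
      then show ?thesis using gf[of x] True by linarith
    next
      case False
      then obtain k where k: "k \<in> K" "A < \<bar>x k\<bar>" by auto
      have "A\<^sup>2 \<le> \<bar>x k\<bar>\<^sup>2" using k A by (intro power_mono) auto
      also have "\<dots> \<le> (\<Sum>k\<in>K. (x k)\<^sup>2)" using member_le_sum[of k K "\<lambda>k. (x k)\<^sup>2"] k Kc by simp
      finally have "(2 * B + \<epsilon>) * A\<^sup>2 \<le> (2 * B + \<epsilon>) * (\<Sum>k\<in>K. (x k)\<^sup>2)" using B \<epsilon> by (intro mult_left_mono) auto
      then have "2 * B + \<epsilon> \<le> (2 * B + \<epsilon>) / A\<^sup>2 * (\<Sum>k\<in>K. (x k)\<^sup>2)" using A by (simp add: field_simps)
      moreover have "\<bar>?f x - g x\<bar> \<le> B + (B + \<epsilon>)" using B(1)[of "\<lambda>k. if k \<in> K then x k else 0"] gB[of x] by linarith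
      ultimately show ?thesis using \<epsilon> by linarith
    qed
    have close: "\<bar>(LINT y|L. ?f (\<lambda>k. Y k y)) - (LINT y|L. g (\<lambda>k. Y k y))\<bar> \<le> 2 * \<epsilon>"
      if L: "prob_space L" and i: "integrable L (\<lambda>y. ?f (\<lambda>k. Y k y))" "integrable L (\<lambda>y. g (\<lambda>k. Y k y))"
        "\<And>k. k \<in> K \<Longrightarrow> integrable L (\<lambda>y. (Y k y)\<^sup>2)" "(\<Sum>k\<in>K. LINT y|L. (Y k y)\<^sup>2) \<le> D"
      for L :: "'b measure" and Y :: "nat \<Rightarrow> 'b \<Rightarrow> real"
    proof -
      interpret L: prob_space L by fact
      have "\<bar>(LINT y|L. ?f (\<lambda>k. Y k y)) - (LINT y|L. g (\<lambda>k. Y k y))\<bar> = \<bar>LINT y|L. ?f (\<lambda>k. Y k y) - g (\<lambda>k. Y k y)\<bar>"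
        using i by simp
      also have "\<dots> \<le> (LINT y|L. \<bar>?f (\<lambda>k. Y k y) - g (\<lambda>k. Y k y)\<bar>)" by (rule integral_abs_bound)
      also have "\<dots> \<le> (LINT y|L. \<epsilon> + (2 * B + \<epsilon>) / A\<^sup>2 * (\<Sum>k\<in>K. (Y k y)\<^sup>2))"
        using i pt by (intro integral_mono) auto
      also have "\<dots> = \<epsilon> + (2 * B + \<epsilon>) / A\<^sup>2 * (\<Sum>k\<in>K. LINT y|L. (Y k y)\<^sup>2)"
        using i(3) by (simp add: L.prob_space)
      also have "\<dots> \<le> \<epsilon> + (2 * B + \<epsilon>) / A\<^sup>2 * D" using B \<epsilon> i(4) by (intro add_left_mono mult_left_mono) auto
      also have "\<dots> \<le> 2 * \<epsilon>" using A2 by simp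
      finally show ?thesis .
    qed
    have cM: "\<bar>(LINT \<omega>|M. ?f (\<lambda>k. T p k \<omega>)) - (LINT \<omega>|M. g (\<lambda>k. T p k \<omega>))\<bar> \<le> 2 * \<epsilon>" for p
      using Kc by (intro close[OF M fM gM T2 D1]) auto
    have cN: "\<bar>(LINT x|N. ?f x) - (LINT x|N. g x)\<bar> \<le> 2 * \<epsilon>"
      using close[OF N, of "\<lambda>k x. x k"] fN gN N2 D2 Kc by auto
    obtain p0 where p0: "\<And>p. p0 \<le> p \<Longrightarrow> \<bar>(LINT \<omega>|M. g (\<lambda>k. T p k \<omega>)) - (LINT x|N. g x)\<bar> < \<epsilon>"
      using LIMSEQ_D[OF gc \<epsilon>] by auto
    have "norm ((LINT \<omega>|M. ?f (\<lambda>k. T p k \<omega>)) - (LINT x|N. ?f x)) < e" if "p0 \<le> p" for p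
      using cM[of p] cN p0[OF that] e unfolding \<epsilon>_def real_norm_def by linarith
    then show "\<exists>p0. \<forall>p\<ge>p0. norm ((LINT \<omega>|M. ?f (\<lambda>k. T p k \<omega>)) - (LINT x|N. ?f x)) < e" by blast
  qed
qed

section \<open>Gaussian processes with a given covariance\<close>

definition psd :: "(nat \<Rightarrow> nat \<Rightarrow> real) \<Rightarrow> bool" where
  "psd D \<longleftrightarrow> (\<forall>i j. D i j = D j i) \<and> (\<forall>F c. finite F \<longrightarrow> 0 \<le> (\<Sum>i\<in>F. \<Sum>j\<in>F. c i * c j * D i j))"

lemma psdD: "psd D \<Longrightarrow> finite F \<Longrightarrow> 0 \<le> (\<Sum>i\<in>F. \<Sum>j\<in>F. c i * c j * D i j)"
  unfolding psd_def by blast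

text \<open>The quadratic form at the vector \<open>c\<close> on \<open>F\<close> plus
  \<open>a\<close> times the unit vector at \<open>m\<close>. As \<open>m\<close> may itself belong
  to \<open>F\<close>, the two coefficients are added.\<close>

lemma psd_quadratic:
  assumes D: "psd D" and F: "finite F"
  shows "0 \<le> (\<Sum>i\<in>F. \<Sum>j\<in>F. c i * c j * D i j) + 2 * a * (\<Sum>i\<in>F. c i * D i m) + a\<^sup>2 * D m m"
proof -
  let ?c = "\<lambda>i. (if i \<in> F then c i else 0) + (if i = m then a else 0)"
  have L: "(\<Sum>i\<in>insert m F. ?c i * h i) = (\<Sum>i\<in>F. c i * h i) + a * h m" for h
  proof -
    have "(\<Sum>i\<in>insert m F. ?c i * h i) = (\<Sum>i\<in>insert m F. (if i \<in> F then c i else 0) * h i) + (\<Sum>i\<in>insert m F. if i = m then a * h i else 0)"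
      by (simp only: distrib_right sum.distrib if_distrib[of "\<lambda>y. y * _"] mult_zero_left)
    also have "(\<Sum>i\<in>insert m F. (if i \<in> F then c i else 0) * h i) = (\<Sum>i\<in>F. c i * h i)"
      using F by (intro sum.mono_neutral_cong_right) auto
    also have "(\<Sum>i\<in>insert m F. if i = m then a * h i else 0) = a * h m" using F by simp
    finally show ?thesis .
  qed
  have sym: "D m j = D j m" for j using D by (simp add: psd_def)
  have "0 \<le> (\<Sum>i\<in>insert m F. \<Sum>j\<in>insert m F. ?c i * ?c j * D i j)" by (rule psdD[OF D]) (use F in simp)
  also have "\<dots> = (\<Sum>i\<in>insert m F. ?c i * (\<Sum>j\<in>insert m F. ?c j * D i j))" by (simp add: sum_distrib_left mult.assoc)
  also have "\<dots> = (\<Sum>i\<in>F. c i * ((\<Sum>j\<in>F. c j * D i j) + a * D i m)) + a * ((\<Sum>j\<in>F. c j * D m j) + a * D m m)"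
    unfolding L ..
  also have "\<dots> = (\<Sum>i\<in>F. \<Sum>j\<in>F. c i * c j * D i j) + 2 * a * (\<Sum>i\<in>F. c i * D i m) + a\<^sup>2 * D m m"
  proof -
    have "c i * ((\<Sum>j\<in>F. c j * D i j) + a * D i m) = (\<Sum>j\<in>F. c i * c j * D i j) + a * (c i * D i m)" for i
      by (simp add: distrib_left sum_distrib_left mult_ac)
    then have "(\<Sum>i\<in>F. c i * ((\<Sum>j\<in>F. c j * D i j) + a * D i m)) = (\<Sum>i\<in>F. \<Sum>j\<in>F. c i * c j * D i j) + a * (\<Sum>i\<in>F. c i * D i m)"
      by (simp add: sum.distrib sum_distrib_left)
    moreover have "(\<Sum>j\<in>F. c j * D m j) = (\<Sum>i\<in>F. c i * D i m)" by (intro sum.cong refl) (simp only: sym)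
    ultimately show ?thesis by (simp add: distrib_left power2_eq_square)
  qed
  finally show ?thesis .
qed

lemma psd_diag_nonneg: "psd D \<Longrightarrow> 0 \<le> D m m"
  using psd_quadratic[of D "{}" "\<lambda>_. 0" 1 m] by simp

text \<open>Otherwise the form in \<open>psd_quadratic\<close> would be a non-constant affine
  function of \<open>a\<close>, hence negative somewhere.\<close>

lemma psd_diag_zero:
  assumes D: "psd D" and m: "D m m = 0"
  shows "D k m = 0"
proof (rule ccontr)
  assume n: "D k m \<noteq> 0"
  have "0 \<le> D k k + 2 * a * D k m" for a using psd_quadratic[OF D, of "{k}" "\<lambda>_. 1" a m] m by simp
  from this[of "- (D k k + 1) / (2 * D k m)"] n show False by (simp add: field_simps)
qed

text \<open>The covariance left after linear regression on coordinate \<open>m\<close>. If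
  \<open>D m m = 0\<close>, division by zero makes the subtracted term 0.\<close>

definition schur :: "nat \<Rightarrow> (nat \<Rightarrow> nat \<Rightarrow> real) \<Rightarrow> nat \<Rightarrow> nat \<Rightarrow> real" where
  "schur m D k l = D k l - D k m * D m l / D m m"

text \<open>For a nonzero pivot this is \<open>psd_quadratic\<close> at its minimising
  \<open>a\<close>, namely \<open>- b / D m m\<close> with \<open>b\<close> the sum of
  \<open>c i * D i m\<close>.\<close>

lemma psd_schur:
  assumes D: "psd D"
  shows "psd (schur m D)"
  unfolding psd_def
proof (intro conjI allI impI)
  have sym: "D i j = D j i" for i j using D by (simp add: psd_def)
  show "schur m D i j = schur m D j i" for i j by (simp add: schur_def sym[of i j] sym[of i m] sym[of m j] mult.commute)
  fix F :: "nat set" and c assume F: "finite F"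
  let ?q = "\<Sum>i\<in>F. \<Sum>j\<in>F. c i * c j * D i j" let ?b = "\<Sum>i\<in>F. c i * D i m"
  have "(\<Sum>i\<in>F. \<Sum>j\<in>F. c i * c j * schur m D i j) = ?q - (\<Sum>i\<in>F. \<Sum>j\<in>F. (c i * D i m) * (c j * D j m) / D m m)"
  proof -
    have "c i * c j * schur m D i j = c i * c j * D i j - (c i * D i m) * (c j * D j m) / D m m" for i j
      unfolding schur_def sym[of m j] by (simp add: algebra_simps)
    then show ?thesis by (simp add: sum_subtractf)
  qed
  also have "(\<Sum>i\<in>F. \<Sum>j\<in>F. (c i * D i m) * (c j * D j m) / D m m) = ?b\<^sup>2 / D m m"
    by (simp add: power2_eq_square sum_product sum_divide_distrib)
  also have "0 \<le> ?q - ?b\<^sup>2 / D m m"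
  proof (cases "D m m = 0")
    case True
    then show ?thesis using psdD[OF D F, of c] by simp
  next
    case False
    have "(- ?b / D m m)\<^sup>2 * D m m = ?b\<^sup>2 / D m m" using False by (simp add: power2_eq_square)
    moreover have "2 * (- ?b / D m m) * ?b = - 2 * (?b\<^sup>2 / D m m)" by (simp add: power2_eq_square)
    ultimately show ?thesis using psd_quadratic[OF D F, of c "- ?b / D m m" m] by linarith
  qed
  finally show "0 \<le> (\<Sum>i\<in>F. \<Sum>j\<in>F. c i * c j * schur m D i j)" by simp
qed

fun residual :: "(nat \<Rightarrow> nat \<Rightarrow> real) \<Rightarrow> nat \<Rightarrow> nat \<Rightarrow> nat \<Rightarrow> real" where
  "residual C 0 = C"
| "residual C (Suc m) = schur m (residual C m)"

text \<open>The column \<open>m\<close> vanishes (\<open>x / 0 = 0\<close>) when its pivot does.\<close>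
definition cholesky :: "(nat \<Rightarrow> nat \<Rightarrow> real) \<Rightarrow> nat \<Rightarrow> nat \<Rightarrow> real" where
  "cholesky C m k = residual C m k m / sqrt (residual C m m m)"

lemma psd_residual: "psd C \<Longrightarrow> psd (residual C m)"
  by (induction m) (auto intro: psd_schur)

text \<open>Eliminating \<open>m\<close> makes row \<open>m\<close> vanish, by
  \<open>psd_diag_zero\<close> also for a zero pivot, and later eliminations keep vanishing
  rows.\<close>

lemma residual_zero:
  assumes C: "psd C" and "k < m"
  shows "residual C m k l = 0"
  using assms(2)
proof (induction m arbitrary: l)
  case (Suc m)
  let ?D = "residual C m"
  have D: "psd ?D" by (rule psd_residual[OF C])
  show ?case
  proof (cases "k < m")
    case True
    then show ?thesis using Suc.IH by (simp add: schur_def)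
  next
    case False
    then have k: "k = m" using Suc.prems by simp
    show ?thesis
    proof (cases "?D m m = 0")
      case True
      have "?D m l = ?D l m" using D by (simp add: psd_def)
      then show ?thesis using psd_diag_zero[OF D True, of l] k by (simp add: schur_def)
    next
      case False
      then show ?thesis using k by (simp add: schur_def)
    qed
  qed
qed simp

lemma cholesky_sum:
  assumes C: "psd C"
  shows "C k l = (\<Sum>m<L. cholesky C m k * cholesky C m l) + residual C L k l"
proof (induction L)
  case (Suc L)
  let ?D = "residual C L"
  have D: "psd ?D" by (rule psd_residual[OF C])
  have "?D L l = ?D l L" using D by (simp add: psd_def)
  then have "cholesky C L k * cholesky C L l = ?D k L * ?D L l / ?D L L"
    using psd_diag_nonneg[OF D, of L] by (simp add: cholesky_def)
  then show ?case using Suc by (simp add: schur_def)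
qed simp

lemma cholesky_zero: "psd C \<Longrightarrow> k < m \<Longrightarrow> cholesky C m k = 0"
  by (simp add: cholesky_def residual_zero)

lemma cholesky_factor: "psd C \<Longrightarrow> k < L \<Longrightarrow> C k l = (\<Sum>m<L. cholesky C m k * cholesky C m l)"
  using cholesky_sum[of C k l L] residual_zero[of C k L l] by simp

text \<open>\<open>centred_gaussian_rv\<close> with the standard deviation exposed, from which
  characteristic function and second moment are computed.\<close>

definition gaussian_rv :: "'a measure \<Rightarrow> ('a \<Rightarrow> real) \<Rightarrow> real \<Rightarrow> bool" where
  "gaussian_rv N X \<sigma> \<longleftrightarrow> X \<in> borel_measurable N \<and> \<sigma> \<ge> 0 \<and>
        (if \<sigma> = 0 then distr N borel X = return borel 0
         else distributed N lborel X (\<lambda>x. ennreal (normal_density 0 \<sigma> x)))"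

lemma gaussian_rv_centred: "gaussian_rv N X \<sigma> \<Longrightarrow> centred_gaussian_rv N X"
  unfolding gaussian_rv_def centred_gaussian_rv_def by blast

lemma gaussian_rv_distr:
  assumes G: "G \<in> measurable P B" and X: "X \<in> borel_measurable B" and g: "gaussian_rv P (\<lambda>\<xi>. X (G \<xi>)) \<sigma>"
  shows "gaussian_rv (distr P B G) X \<sigma>"
proof -
  have d: "distr (distr P B G) borel X = distr P borel (\<lambda>\<xi>. X (G \<xi>))"
    using distr_distr[OF X G] by (simp add: comp_def)
  have X': "X \<in> measurable B lborel" using X by simp
  have d': "distr (distr P B G) lborel X = distr P lborel (\<lambda>\<xi>. X (G \<xi>))"
    using distr_distr[OF X' G] by (simp add: comp_def)
  show ?thesis using g X unfolding gaussian_rv_def distributed_def d d' by (auto split: if_splits)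
qed

context prob_space
begin

lemma gaussian_rv_char_and_moment:
  assumes g: "gaussian_rv M X \<sigma>"
  shows "(LINT \<omega>|M. cis (X \<omega>)) = exp (- (\<sigma>\<^sup>2 / 2))"
    "integrable M (\<lambda>\<omega>. (X \<omega>)\<^sup>2)" "expectation (\<lambda>\<omega>. (X \<omega>)\<^sup>2) = \<sigma>\<^sup>2"
proof -
  have X: "X \<in> borel_measurable M" and \<sigma>: "0 \<le> \<sigma>" using g by (auto simp: gaussian_rv_def)
  have cis_meas: "cis \<in> borel_measurable borel" by (intro borel_measurable_continuous_onI continuous_intros)
  have "(LINT \<omega>|M. cis (X \<omega>)) = exp (- (\<sigma>\<^sup>2 / 2)) \<and> integrable M (\<lambda>\<omega>. (X \<omega>)\<^sup>2) \<and> expectation (\<lambda>\<omega>. (X \<omega>)\<^sup>2) = \<sigma>\<^sup>2"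
  proof (cases "\<sigma> = 0")
    case True
    then have d: "distr M borel X = return borel 0" using g by (simp add: gaussian_rv_def)
    have "(LINT \<omega>|M. cis (X \<omega>)) = (LINT x|distr M borel X. cis x)" using X cis_meas by (simp add: integral_distr)
    also have "\<dots> = 1" unfolding d by (subst integral_return) (auto simp: cis_meas)
    finally have 1: "(LINT \<omega>|M. cis (X \<omega>)) = 1" .
    have "expectation (\<lambda>\<omega>. (X \<omega>)\<^sup>2) = (LINT x|distr M borel X. x\<^sup>2)" using X by (simp add: integral_distr)
    also have "\<dots> = 0" unfolding d by (subst integral_return) auto
    finally have 2: "expectation (\<lambda>\<omega>. (X \<omega>)\<^sup>2) = 0" .
    have "AE x in distr M borel X. x = 0" unfolding d by (subst AE_return) auto
    then have "AE \<omega> in M. X \<omega> = 0" using X by (subst (asm) AE_distr_iff) auto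
    then have "integrable M (\<lambda>\<omega>. (X \<omega>)\<^sup>2) \<longleftrightarrow> integrable M (\<lambda>\<omega>. 0 :: real)" using X by (intro integrable_cong_AE) auto
    then show ?thesis using 1 2 True by simp
  next
    case False
    then have s: "0 < \<sigma>" using \<sigma> by simp
    have D: "distributed M lborel X (normal_density 0 \<sigma>)" using g False by (simp add: gaussian_rv_def)
    have D1: "distributed M lborel (\<lambda>x. X x / \<sigma>) std_normal_density"
      using D normal_standard_normal_convert[OF s, of X 0] by simp
    have e: "distr M borel (\<lambda>x. X x / \<sigma>) = std_normal_distribution"
      using distributed_distr_eq_density[OF D1] by (metis distr_cong sets_lborel)
    have "(LINT \<omega>|M. cis (X \<omega>)) = (LINT \<omega>|M. iexp (\<sigma> * (X \<omega> / \<sigma>)))" using s False by (simp add: cis_conv_exp)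
    also have "\<dots> = char (distr M borel (\<lambda>x. X x / \<sigma>)) \<sigma>" using X False by (simp add: char_def integral_distr)
    also have "\<dots> = exp (- (\<sigma>\<^sup>2 / 2))" unfolding e by (simp add: char_std_normal_distribution)
    finally have 1: "(LINT \<omega>|M. cis (X \<omega>)) = exp (- (\<sigma>\<^sup>2 / 2))" .
    have 2: "integrable M (\<lambda>\<omega>. (X \<omega>)\<^sup>2)"
      using distributed_integrable[OF D, of "\<lambda>x. x\<^sup>2"] integrable_normal_moment[OF s, of 0 2] by (simp add: mult.commute)
    have "expectation X = 0" "variance X = \<sigma>\<^sup>2"
      using normal_distributed_expectation[OF s D] normal_distributed_variance[OF s D] by auto
    then have 3: "expectation (\<lambda>\<omega>. (X \<omega>)\<^sup>2) = \<sigma>\<^sup>2" by simp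
    show ?thesis using 1 2 3 by simp
  qed
  then show "(LINT \<omega>|M. cis (X \<omega>)) = exp (- (\<sigma>\<^sup>2 / 2))"
    "integrable M (\<lambda>\<omega>. (X \<omega>)\<^sup>2)" "expectation (\<lambda>\<omega>. (X \<omega>)\<^sup>2) = \<sigma>\<^sup>2" by auto
qed

end

lemma gaussian_rv_std_normal_sum:
  fixes a :: "nat \<Rightarrow> real"
  assumes I: "finite I"
  shows "gaussian_rv (PiM UNIV (\<lambda>_. std_normal_distribution)) (\<lambda>\<xi>. \<Sum>m\<in>I. a m * \<xi> m) (sqrt (\<Sum>m\<in>I. (a m)\<^sup>2))"
proof -
  \<comment> \<open>Zero coefficients are dropped, since the sum rule for independent normals asks
    for positive variances. An empty \<open>J\<close> is the degenerate case.\<close>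
  define J where "J = {m \<in> I. a m \<noteq> 0}"
  have J: "finite J" using I by (simp add: J_def)
  let ?S = "std_normal_distribution" let ?P = "PiM (UNIV :: nat set) (\<lambda>_. ?S)"
  interpret S: prob_space ?S by (rule prob_space_normal_density) simp
  interpret P: product_prob_space "\<lambda>_::nat. ?S" UNIV ..
  have setsP: "sets ?P = sets (PiM UNIV (\<lambda>_. borel))" by (intro sets_PiM_cong) auto
  have coord: "(\<lambda>\<xi>. \<xi> m) \<in> borel_measurable ?P" for m
    using measurable_component_singleton[of m UNIV "\<lambda>_. ?S"] by simp
  have dist: "distributed ?P lborel (\<lambda>\<xi>. \<xi> m) (\<lambda>x. ennreal (std_normal_density x))" for m
  proof -
    have "distr ?P lborel (\<lambda>\<xi>. \<xi> m) = distr ?P ?S (\<lambda>\<xi>. \<xi> m)" by (intro distr_cong) auto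
    also have "\<dots> = ?S" by (rule P.PiM_component) simp
    finally show ?thesis using coord by (simp add: distributed_def)
  qed
  have eqY: "(\<Sum>m\<in>I. a m * \<xi> m) = (\<Sum>m\<in>J. a m * \<xi> m)" for \<xi>
    using I by (intro sum.mono_neutral_right) (auto simp: J_def)
  have eqs: "(\<Sum>m\<in>I. (a m)\<^sup>2) = (\<Sum>m\<in>J. (a m)\<^sup>2)"
    using I by (intro sum.mono_neutral_right) (auto simp: J_def)
  have meas: "(\<lambda>\<xi>. \<Sum>m\<in>J. a m * \<xi> m) \<in> borel_measurable ?P" using coord by measurable
  show ?thesis
  proof (cases "J = {}")
    case True
    have "distr ?P borel (\<lambda>\<xi>. 0 :: real) = return borel 0" by (rule P.distr_const) simp
    then show ?thesis using True by (simp add: gaussian_rv_def eqY eqs)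
  next
    case False
    have ind: "P.indep_vars (\<lambda>_. ?S) (\<lambda>m \<xi>. \<xi> m) J"
    proof (subst P.indep_vars_iff_distr_eq_PiM'[OF False])
      show "P.random_variable ?S (\<lambda>\<xi>. \<xi> m)" for m using coord by simp
      show "distr ?P (PiM J (\<lambda>_. ?S)) (\<lambda>x. \<lambda>i\<in>J. x i) = (\<Pi>\<^sub>M i\<in>J. distr ?P ?S (\<lambda>\<xi>. \<xi> i))"
        using P.distr_PiM_restrict_finite[OF J] P.PiM_component by (simp add: restrict_def)
    qed
    have ind': "P.indep_vars (\<lambda>_. borel) (\<lambda>m \<xi>. a m * \<xi> m) J"
      by (rule P.indep_vars_compose2[OF ind]) simp
    have "distributed ?P lborel (\<lambda>\<xi>. \<Sum>m\<in>J. a m * \<xi> m) (normal_density (\<Sum>m\<in>J. 0) (sqrt (\<Sum>m\<in>J. \<bar>a m\<bar>\<^sup>2)))"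
    proof (rule P.sum_indep_normal[OF J False ind'])
      fix m assume m: "m \<in> J"
      then show "0 < \<bar>a m\<bar>" by (simp add: J_def)
      show "distributed ?P lborel (\<lambda>\<xi>. a m * \<xi> m) (\<lambda>x. ennreal (normal_density 0 \<bar>a m\<bar> x))"
        using P.normal_density_affine[OF dist, of "a m" 0 m] m by (simp add: J_def)
    qed
    moreover have "0 < (\<Sum>m\<in>J. (a m)\<^sup>2)" using False J by (intro sum_pos) (auto simp: J_def)
    ultimately show ?thesis using meas by (simp add: gaussian_rv_def eqY eqs)
  qed
qed

text \<open>A triangular transform of an i.i.d. standard normal sequence: each coordinate is a
  finite combination of the sequence, with coefficients from the Cholesky factor of
  \<open>C\<close>.\<close>

lemma gaussian_process_exists:
  assumes C: "psd C"
  shows "\<exists>N :: (nat \<Rightarrow> real) measure. prob_space N \<and> sets N = sets (PiM UNIV (\<lambda>_::nat. borel)) \<and>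
    (\<forall>K c. finite K \<longrightarrow> gaussian_rv N (\<lambda>x. \<Sum>k\<in>K. c k * x k) (sqrt (\<Sum>k\<in>K. \<Sum>l\<in>K. c k * c l * C k l)))"
proof -
  let ?S = "std_normal_distribution" let ?P = "PiM (UNIV :: nat set) (\<lambda>_. ?S)" let ?B = "PiM UNIV (\<lambda>_::nat. borel :: real measure)"
  let ?u = "cholesky C"
  define G where "G = (\<lambda>(\<xi> :: nat \<Rightarrow> real) k. \<Sum>m<Suc k. ?u m k * \<xi> m)"
  have G: "G \<in> measurable ?P ?B"
  proof (rule measurable_PiM_single')
    fix k
    have "(\<lambda>\<xi>. \<xi> m) \<in> borel_measurable ?P" for m using measurable_component_singleton[of m UNIV "\<lambda>_. ?S"] by simp
    then show "(\<lambda>\<xi>. G \<xi> k) \<in> borel_measurable ?P" unfolding G_def by measurable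
  qed simp
  interpret P: prob_space ?P by (intro prob_space_PiM prob_space_normal_density) simp
  show ?thesis
  proof (intro exI[of _ "distr ?P ?B G"] conjI allI impI)
    show "prob_space (distr ?P ?B G)" using G by (rule P.prob_space_distr)
    fix K :: "nat set" and c :: "nat \<Rightarrow> real" assume K: "finite K"
    \<comment> \<open>A bound beyond all indices in \<open>K\<close>: as
      \<open>cholesky C m k\<close> vanishes for \<open>k < m\<close>, every coordinate in
      \<open>K\<close> can be written as a sum over the same range \<open>m < L\<close>.\<close>
    define L where "L = Suc (Max (insert 0 K))"
    have L: "k < L" if "k \<in> K" for k using that K by (simp add: L_def less_Suc_eq_le)
    have GL: "G \<xi> k = (\<Sum>m<L. ?u m k * \<xi> m)" if "k \<in> K" for k \<xi>
      unfolding G_def using L[OF that] cholesky_zero[OF C] by (intro sum.mono_neutral_left) auto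
    have "(\<Sum>k\<in>K. c k * G \<xi> k) = (\<Sum>k\<in>K. \<Sum>m<L. c k * (?u m k * \<xi> m))" for \<xi>
      by (intro sum.cong refl) (simp add: GL sum_distrib_left)
    then have comb: "(\<Sum>k\<in>K. c k * G \<xi> k) = (\<Sum>m<L. (\<Sum>k\<in>K. c k * ?u m k) * \<xi> m)" for \<xi>
      by (subst (asm) sum.swap) (simp add: sum_distrib_right mult.assoc)
    have "(\<Sum>m<L. (\<Sum>k\<in>K. c k * ?u m k)\<^sup>2) = (\<Sum>m<L. \<Sum>k\<in>K. \<Sum>l\<in>K. c k * c l * (?u m k * ?u m l))"
      by (simp add: power2_eq_square sum_product mult_ac)
    also have "\<dots> = (\<Sum>k\<in>K. \<Sum>l\<in>K. \<Sum>m<L. c k * c l * (?u m k * ?u m l))"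
      by (subst sum.swap) (intro sum.cong refl sum.swap)
    also have "\<dots> = (\<Sum>k\<in>K. \<Sum>l\<in>K. c k * c l * C k l)"
      by (intro sum.cong refl) (simp add: cholesky_factor[OF C L] sum_distrib_left)
    finally have var: "(\<Sum>m<L. (\<Sum>k\<in>K. c k * ?u m k)\<^sup>2) = (\<Sum>k\<in>K. \<Sum>l\<in>K. c k * c l * C k l)" .
    show "gaussian_rv (distr ?P ?B G) (\<lambda>x. \<Sum>k\<in>K. c k * x k) (sqrt (\<Sum>k\<in>K. \<Sum>l\<in>K. c k * c l * C k l))"
      using gaussian_rv_std_normal_sum[of "{..<L}" "\<lambda>m. \<Sum>k\<in>K. c k * ?u m k"]
      by (intro gaussian_rv_distr[OF G]) (auto simp: comb var)
  qed simp
qed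

section \<open>Fluctuations of the traces\<close>

lemma (in finite_measure) all_moments_sum_list:
  "(\<And>x. x \<in> set xs \<Longrightarrow> all_moments M (f x)) \<Longrightarrow> all_moments M (\<lambda>\<omega>. \<Sum>x\<leftarrow>xs. f x \<omega>)"
  by (induction xs) (auto intro: all_moments_const all_moments_add)

lemma all_moments_square: "all_moments M X \<Longrightarrow> integrable M (\<lambda>\<omega>. (X \<omega>)\<^sup>2)"
  by (rule all_moments_integrable_power)

context prob_space
begin

text \<open>Each further summand is split off by \<open>(x + y)^2 \<le> 2 x^2 + 2 y^2\<close>; the
  factor 4 per summand absorbs both terms.\<close>

lemma expectation_sum_list_square_le:
  assumes "\<And>x. x \<in> set xs \<Longrightarrow> all_moments M (f x)" "\<And>x. x \<in> set xs \<Longrightarrow> expectation (\<lambda>\<omega>. (f x \<omega>)\<^sup>2) \<le> c" "0 \<le> c"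
  shows "expectation (\<lambda>\<omega>. (\<Sum>x\<leftarrow>xs. f x \<omega>)\<^sup>2) \<le> 4 ^ length xs * c"
  using assms(1,2)
proof (induction xs)
  case (Cons y xs)
  let ?g = "\<lambda>\<omega>. \<Sum>x\<leftarrow>xs. f x \<omega>"
  have m: "all_moments M (f y)" "all_moments M ?g" using Cons.prems(1) by (auto intro: all_moments_sum_list)
  have "expectation (\<lambda>\<omega>. (f y \<omega> + ?g \<omega>)\<^sup>2) \<le> expectation (\<lambda>\<omega>. 2 * (f y \<omega>)\<^sup>2 + 2 * (?g \<omega>)\<^sup>2)"
  proof (rule integral_mono)
    show "integrable M (\<lambda>\<omega>. (f y \<omega> + ?g \<omega>)\<^sup>2)" by (intro all_moments_square all_moments_add m)
    show "integrable M (\<lambda>\<omega>. 2 * (f y \<omega>)\<^sup>2 + 2 * (?g \<omega>)\<^sup>2)" using m[THEN all_moments_square] by simp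
    show "(f y \<omega> + ?g \<omega>)\<^sup>2 \<le> 2 * (f y \<omega>)\<^sup>2 + 2 * (?g \<omega>)\<^sup>2" for \<omega>
      using zero_le_power2[of "f y \<omega> - ?g \<omega>"] unfolding power2_sum power2_diff by linarith
  qed
  also have "\<dots> = 2 * expectation (\<lambda>\<omega>. (f y \<omega>)\<^sup>2) + 2 * expectation (\<lambda>\<omega>. (?g \<omega>)\<^sup>2)"
    using m[THEN all_moments_square] by simp
  also have "\<dots> \<le> 2 * c + 2 * (4 ^ length xs * c)" using Cons by (intro add_mono mult_left_mono) auto
  also have "\<dots> \<le> 4 ^ length (y # xs) * c"
  proof -
    have "1 * c \<le> 4 ^ length xs * c" using assms(3) by (intro mult_right_mono) auto
    then show ?thesis by (simp add: mult.commute)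
  qed
  finally show ?case by simp
qed (use assms(3) in simp)

lemma expectation_indep_sum_square:
  assumes I: "finite I" and ind: "indep_vars (\<lambda>_. borel) W I" and W: "\<And>r. r \<in> I \<Longrightarrow> all_moments M (W r)"
    and mean: "\<And>r. r \<in> I \<Longrightarrow> expectation (W r) = 0"
  shows "expectation (\<lambda>\<omega>. (\<Sum>r\<in>I. W r \<omega>)\<^sup>2) = (\<Sum>r\<in>I. expectation (\<lambda>\<omega>. (W r \<omega>)\<^sup>2))"
proof -
  have E: "expectation (\<lambda>\<omega>. W r \<omega> * W s \<omega>) = (if r = s then expectation (\<lambda>\<omega>. (W r \<omega>)\<^sup>2) else 0)"
    if rs: "r \<in> I" "s \<in> I" for r s
  proof (cases "r = s")
    case False
    have "expectation (\<lambda>\<omega>. \<Prod>i\<in>{r, s}. W i \<omega>) = (\<Prod>i\<in>{r, s}. expectation (W i))"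
      using rs by (intro indep_vars_lebesgue_integral indep_vars_subset[OF ind]) (auto intro: all_moments_integrable W)
    then show ?thesis using False mean rs by simp
  qed (simp add: power2_eq_square)
  have "expectation (\<lambda>\<omega>. (\<Sum>r\<in>I. W r \<omega>)\<^sup>2) = (\<Sum>r\<in>I. \<Sum>s\<in>I. expectation (\<lambda>\<omega>. W r \<omega> * W s \<omega>))"
    using W unfolding power2_eq_square sum_product
    by (subst Bochner_Integration.integral_sum, intro Bochner_Integration.integrable_sum all_moments_integrable all_moments_mult, simp, simp,
      intro sum.cong refl Bochner_Integration.integral_sum all_moments_integrable all_moments_mult) auto
  also have "\<dots> = (\<Sum>r\<in>I. \<Sum>s\<in>I. if r = s then expectation (\<lambda>\<omega>. (W r \<omega>)\<^sup>2) else 0)"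
    by (intro sum.cong refl E)
  finally show ?thesis using I by simp
qed

end

section \<open>The traces: sum over independent rows, remainder, and limit law\<close>

locale banded_asymptotics = copies +
  fixes b :: "nat \<Rightarrow> real" and n :: "nat \<Rightarrow> nat"
  assumes b_pos: "\<And>p. p > 0 \<Longrightarrow> b p > 0" and n_pos: "\<And>p. n p > 0"
    and b_lim: "filterlim b at_top sequentially" and n_lim: "filterlim n at_top sequentially"
    and bn_lim: "(\<lambda>p. b p / real (n p)) \<longlonglongrightarrow> 0"
begin

definition rem :: "nat \<Rightarrow> nat \<Rightarrow> 'a \<Rightarrow> real" where
  "rem p k \<omega> = (\<Sum>(m,a)\<leftarrow>filter (\<lambda>x. 2 \<le> fst x) (words k). mat_trace p (word p (mean_mat (b p)) (noise_mat (b p) (n p) \<omega>) a m))"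

definition fluctuation :: "nat \<Rightarrow> nat \<Rightarrow> 'a \<Rightarrow> real" where
  "fluctuation p k \<omega> = sqrt (real (n p) / real p) *
     (mat_trace p (mat_pow p (banded_Y (b p) (n p) p Zc \<omega>) k)
       - expectation (\<lambda>\<omega>'. mat_trace p (mat_pow p (banded_Y (b p) (n p) p Zc \<omega>') k)))"

text \<open>The contribution of one row to a linear combination of the linear terms, scaled so that
  its variance converges.\<close>

definition row_comb :: "nat set \<Rightarrow> (nat \<Rightarrow> real) \<Rightarrow> nat \<Rightarrow> nat \<Rightarrow> 'a \<Rightarrow> real" where
  "row_comb K c p r \<omega> = (\<Sum>k\<in>K. c k * (real k * row_form p (band_pow (b p) p (k - 1)) r \<omega>)) / sqrt (real p)"

definition rem_comb :: "nat set \<Rightarrow> (nat \<Rightarrow> real) \<Rightarrow> nat \<Rightarrow> 'a \<Rightarrow> real" where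
  "rem_comb K c p \<omega> = sqrt (real (n p) / real p) * (\<Sum>k\<in>K. c k * (rem p k \<omega> - expectation (rem p k)))"

definition row_var :: "nat set \<Rightarrow> (nat \<Rightarrow> real) \<Rightarrow> nat \<Rightarrow> real" where
  "row_var K c p = expectation (\<lambda>\<omega>. (row_comb K c p 1 \<omega>)\<^sup>2)"

definition trace_cov :: "nat \<Rightarrow> nat \<Rightarrow> real" where
  "trace_cov k l = real k * real l * limit_cov (k - 1) (l - 1)"

lemma word_moments:
  assumes "x \<in> set (filter (\<lambda>x. 2 \<le> fst x) (words k))"
  shows "all_moments M (\<lambda>\<omega>. case x of (m, a) \<Rightarrow> mat_trace p (word p (mean_mat (b p)) (noise_mat (b p) (n p) \<omega>) a m))"
proof -
  have "2 \<le> fst x" using assms by simp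
  then obtain m a where x: "x = (Suc m, a)" by (cases x; cases "fst x") auto
  show ?thesis unfolding x using all_moments_trace_noise_word by simp
qed

lemma all_moments_rem: "all_moments M (rem p k)"
  unfolding rem_def[abs_def] by (rule all_moments_sum_list) (rule word_moments)

text \<open>Only finitely many words occur, of degrees 2 to \<open>k\<close>, and their exponents
  are at most \<open>k\<close>; so the constants \<open>var_const k j\<close> with
  \<open>j \<le> k\<close> can be summed into one.\<close>

lemma variance_rem_le:
  obtains C where "0 \<le> C" "\<And>p. 0 \<le> b p \<Longrightarrow> 2 * b p + 1 \<le> real (n p) \<Longrightarrow> variance (rem p k) \<le> C * (real p * (2 * b p + 1) / (real (n p))\<^sup>2)"
proof -
  let ?L = "filter (\<lambda>x. 2 \<le> fst x) (words k)"
  define V where "V = (\<Sum>j\<le>k. \<bar>var_const k j\<bar>)"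
  have V0: "0 \<le> V" by (simp add: V_def sum_nonneg)
  show thesis
  proof (rule that[of "4 ^ length ?L * V"])
    fix p assume bp: "0 \<le> b p" "2 * b p + 1 \<le> real (n p)"
    let ?w = "\<lambda>x \<omega>. case x of (m, a) \<Rightarrow> mat_trace p (word p (mean_mat (b p)) (noise_mat (b p) (n p) \<omega>) a m)"
    let ?f = "\<lambda>x \<omega>. ?w x \<omega> - expectation (?w x)"
    let ?z = "real p * (2 * b p + 1) / (real (n p))\<^sup>2"
    have z: "0 \<le> ?z" using bp by simp
    have E: "expectation (\<lambda>\<omega>. \<Sum>x\<leftarrow>xs. ?w x \<omega>) = (\<Sum>x\<leftarrow>xs. expectation (?w x))" if "set xs \<subseteq> set ?L" for xs
      using that
    proof (induction xs)
      case (Cons x xs)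
      have "integrable M (?w x)" "integrable M (\<lambda>\<omega>. \<Sum>x\<leftarrow>xs. ?w x \<omega>)"
        using Cons.prems by (intro all_moments_integrable all_moments_sum_list word_moments, auto)+
      then show ?case using Cons by simp
    qed simp
    have "variance (rem p k) = expectation (\<lambda>\<omega>. (\<Sum>x\<leftarrow>?L. ?f x \<omega>)\<^sup>2)"
      unfolding rem_def[abs_def] E[OF subset_refl] by (simp add: sum_list_subtractf)
    also have "\<dots> \<le> 4 ^ length ?L * (V * ?z)"
    proof (rule expectation_sum_list_square_le)
      fix x assume x: "x \<in> set ?L"
      show "all_moments M (?f x)" using word_moments[OF x] by (intro all_moments_diff all_moments_const)
      have "2 \<le> fst x" using x by simp
      then obtain m a where xm: "x = (Suc m, a)" "1 \<le> m" by (cases x; cases "fst x") auto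
      have deg: "Suc m + (\<Sum>i\<le>Suc m. a i) = k" using x xm words_degree[of "Suc m" a k] by simp
      have a: "a s \<le> k" if "s \<le> Suc m" for s using member_le_sum[of s "{..Suc m}" a] that deg by simp
      have a2: "a (Suc m) + a 0 \<le> k"
      proof -
        have "(\<Sum>i\<in>{0, Suc m}. a i) \<le> (\<Sum>i\<le>Suc m. a i)" by (rule sum_mono2) auto
        then show ?thesis using deg by simp
      qed
      have "expectation (\<lambda>\<omega>. (?f x \<omega>)\<^sup>2) \<le> var_const k (Suc m) * real p * (2 * b p + 1) / (real (n p))\<^sup>2"
        unfolding xm prod.case by (rule variance_word_le) (use xm bp a a2 in auto)
      also have "\<dots> = var_const k (Suc m) * ?z" by simp
      also have "\<dots> \<le> V * ?z"
      proof (rule mult_right_mono[OF _ z])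
        have "\<bar>var_const k (Suc m)\<bar> \<le> V" unfolding V_def using deg by (intro member_le_sum) auto
        then show "var_const k (Suc m) \<le> V" by simp
      qed
      finally show "expectation (\<lambda>\<omega>. (?f x \<omega>)\<^sup>2) \<le> V * ?z" .
    qed (rule mult_nonneg_nonneg[OF V0 z])
    finally show "variance (rem p k) \<le> 4 ^ length ?L * V * ?z" by (simp only: mult.assoc)
  qed (simp add: V_def sum_nonneg)
qed

lemma trace_banded:
  "mat_trace p (mat_pow p (banded_Y (b p) (n p) p Zc \<omega>) k) = mat_trace p (mat_pow p (mean_mat (b p)) k)
    + real k * ((1 / real (n p)) * (\<Sum>r\<in>{1..n p}. row_form p (band_pow (b p) p (k - 1)) r \<omega>)) + rem p k \<omega>"
  unfolding rem_def trace_linear_term[symmetric] by (rule trace_pow_expansion) (rule banded_Y_eq[OF n_pos])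

lemma fluctuation_eq:
  "fluctuation p k \<omega> = sqrt (real (n p) / real p) * (real k * ((1 / real (n p)) * (\<Sum>r\<in>{1..n p}. row_form p (band_pow (b p) p (k - 1)) r \<omega>))
     + (rem p k \<omega> - expectation (rem p k)))"
proof -
  have i: "integrable M (row_form p W r)" if "r \<in> {1..n p}" for W r
    using that by (intro all_moments_integrable all_moments_row_form) auto
  have ir: "integrable M (rem p k)" by (intro all_moments_integrable all_moments_rem)
  have 0: "expectation (\<lambda>\<omega>. \<Sum>r\<in>{1..n p}. row_form p (band_pow (b p) p (k - 1)) r \<omega>) = 0"
    using i by (subst Bochner_Integration.integral_sum) (auto intro!: sum.neutral expectation_row_form)
  have isum: "integrable M (\<lambda>\<omega>. \<Sum>r\<in>{1..n p}. row_form p (band_pow (b p) p (k - 1)) r \<omega>)" by (intro Bochner_Integration.integrable_sum i)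
  have "expectation (\<lambda>\<omega>. mat_trace p (mat_pow p (banded_Y (b p) (n p) p Zc \<omega>) k)) = mat_trace p (mat_pow p (mean_mat (b p)) k) + expectation (rem p k)"
    unfolding trace_banded using 0 isum ir by (simp add: prob_space)
  then show ?thesis unfolding fluctuation_def trace_banded by simp
qed

text \<open>The factor \<open>sqrt (n / p) / n\<close> splits into \<open>1 / sqrt p\<close>,
  absorbed by each row, and \<open>1 / sqrt n\<close> for the sum of the rows: the shape required by
  \<open>triangular_array_clt\<close>.\<close>

lemma fluctuation_comb:
  assumes "finite K"
  shows "(\<Sum>k\<in>K. c k * fluctuation p k \<omega>) = (\<Sum>r\<in>{1..n p}. row_comb K c p r \<omega>) / sqrt (real (n p)) + rem_comb K c p \<omega>"
proof -
  let ?S = "\<lambda>k. \<Sum>r\<in>{1..n p}. row_form p (band_pow (b p) p (k - 1)) r \<omega>"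
  have s: "sqrt (real (n p) / real p) * (1 / real (n p)) = 1 / sqrt (real p) / sqrt (real (n p))"
  proof -
    define q where "q = sqrt (real (n p))"
    have q: "0 < q" "real (n p) = q * q" using n_pos[of p] by (auto simp: q_def)
    have "sqrt (real (n p) / real p) * (1 / real (n p)) = q / sqrt (real p) * (1 / (q * q))"
      by (simp only: real_sqrt_divide q_def[symmetric] q(2)[symmetric])
    also have "\<dots> = 1 / sqrt (real p) / q" using q(1) by simp
    finally show ?thesis by (simp add: q_def)
  qed
  have "(\<Sum>r\<in>{1..n p}. row_comb K c p r \<omega>) = (\<Sum>k\<in>K. c k * (real k * ?S k)) / sqrt (real p)"
    unfolding row_comb_def sum_divide_distrib[symmetric] by (subst sum.swap) (simp add: sum_distrib_left)
  then have 1: "(\<Sum>r\<in>{1..n p}. row_comb K c p r \<omega>) / sqrt (real (n p)) = (\<Sum>k\<in>K. c k * (real k * ?S k)) * (1 / sqrt (real p) / sqrt (real (n p)))"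
    by simp
  have "(\<Sum>k\<in>K. c k * fluctuation p k \<omega>)
     = (\<Sum>k\<in>K. (sqrt (real (n p) / real p) * (1 / real (n p))) * (c k * (real k * ?S k)) + sqrt (real (n p) / real p) * (c k * (rem p k \<omega> - expectation (rem p k))))"
    unfolding fluctuation_eq by (intro sum.cong refl) (simp add: algebra_simps)
  also have "\<dots> = (sqrt (real (n p) / real p) * (1 / real (n p))) * (\<Sum>k\<in>K. c k * (real k * ?S k)) + rem_comb K c p \<omega>"
    unfolding rem_comb_def sum.distrib sum_distrib_left ..
  finally show ?thesis unfolding 1 s by (simp add: mult.commute)
qed

lemma all_moments_row_comb: "1 \<le> r \<Longrightarrow> all_moments M (row_comb K c p r)"
  unfolding row_comb_def[abs_def] divide_inverse
  by (subst mult.commute) (intro all_moments_cmult all_moments_sum all_moments_row_form, simp)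

lemma all_moments_rem_comb: "all_moments M (rem_comb K c p)"
  unfolding rem_comb_def[abs_def] by (intro all_moments_cmult all_moments_sum all_moments_diff all_moments_const all_moments_rem)

lemma expectation_row_comb: "1 \<le> r \<Longrightarrow> expectation (row_comb K c p r) = 0"
  unfolding row_comb_def[abs_def]
  by (simp add: Bochner_Integration.integral_sum all_moments_integrable all_moments_row_form expectation_row_form)

text \<open>\<open>row_comb\<close> as a measurable functional of one row that does not depend on
  the row number, so that equality in law and independence of the copies carry over.\<close>

definition seq_comb :: "nat set \<Rightarrow> (nat \<Rightarrow> real) \<Rightarrow> nat \<Rightarrow> (int \<Rightarrow> real) \<Rightarrow> real" where
  "seq_comb K c p x = (\<Sum>k\<in>K. c k * (real k * (\<Sum>i\<in>{1..p}. \<Sum>j\<in>{1..p}. band_pow (b p) p (k - 1) i j *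
     (x (int i) * x (int j) - R (int i - int j))))) / sqrt (real p)"

lemma row_comb_eq_seq: "row_comb K c p r \<omega> = seq_comb K c p (\<lambda>j. Zc r j \<omega>)"
  by (simp add: row_comb_def seq_comb_def row_form_def xi_def X_def)

lemma seq_comb_measurable: "seq_comb K c p \<in> borel_measurable seqM"
proof -
  have [measurable]: "(\<lambda>x. x i) \<in> borel_measurable seqM" for i
    using measurable_component_singleton[of i UNIV "\<lambda>_. borel"] by simp
  show ?thesis unfolding seq_comb_def[abs_def] by measurable
qed

lemma row_comb_copy:
  assumes "1 \<le> r"
  shows "expectation (\<lambda>\<omega>. row_comb K c p r \<omega> ^ a) = expectation (\<lambda>\<omega>. row_comb K c p 1 \<omega> ^ a)"
proof -
  have m: "(\<lambda>x. seq_comb K c p x ^ a) \<in> borel_measurable seqM" using seq_comb_measurable by simp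
  show ?thesis unfolding row_comb_eq_seq using expectation_copy[OF m assms] expectation_copy[OF m, of 1] by simp
qed

lemma row_comb_indep: "indep_vars (\<lambda>_. borel) (row_comb K c p) {1..n p}"
proof -
  have "indep_vars (\<lambda>_. borel) (\<lambda>r \<omega>. seq_comb K c p (\<lambda>j. Zc r j \<omega>)) {1..n p}"
    by (rule indep_vars_compose2[OF indep_vars_subset[OF Zc_indep]]) (auto intro: seq_comb_measurable)
  then show ?thesis unfolding row_comb_eq_seq[abs_def] .
qed

lemma row_var_tendsto: "finite K \<Longrightarrow> row_var K c \<longlonglongrightarrow> (\<Sum>k\<in>K. \<Sum>l\<in>K. c k * c l * trace_cov k l)"
proof -
  assume K: "finite K"
  let ?row = "\<lambda>p k \<omega>. row_form p (band_pow (b p) p (k - 1)) 1 \<omega>"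
  have eq: "row_var K c p = (\<Sum>k\<in>K. \<Sum>l\<in>K. c k * c l * (real k * real l * (expectation (\<lambda>\<omega>. ?row p k \<omega> * ?row p l \<omega>) / real p)))" for p
  proof -
    have i: "integrable M (\<lambda>\<omega>. ?row p k \<omega> * ?row p l \<omega>)" for k l
      by (intro all_moments_integrable all_moments_mult all_moments_row_form) auto
    have "(row_comb K c p 1 \<omega>)\<^sup>2 = (\<Sum>k\<in>K. \<Sum>l\<in>K. c k * c l * (real k * real l * (?row p k \<omega> * ?row p l \<omega>))) / real p" for \<omega>
      unfolding row_comb_def power_divide by (simp add: power2_eq_square sum_product mult_ac)
    then show ?thesis unfolding row_var_def using i
      by (simp add: Bochner_Integration.integral_sum sum_divide_distrib)
  qed
  show ?thesis unfolding eq[abs_def] trace_cov_def by (intro tendsto_intros row_form_cov_limit b_lim) simp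
qed

text \<open>A combination of the forms is again a single quadratic form. Its coefficient matrix
  \<open>W\<close> is dominated by a multiple of one path kernel, and dividing by
  \<open>sqrt p\<close> cancels the \<open>p^2\<close> of \<open>fourth_moment_le\<close>.\<close>

lemma row_comb_fourth_le:
  assumes K: "finite K"
  obtains C where "\<And>p. expectation (\<lambda>\<omega>. row_comb K c p 1 \<omega> ^ 4) \<le> C"
proof -
  define N where "N = Max (insert 0 K)"
  have N: "k - 1 \<le> N" if "k \<in> K" for k unfolding N_def using that K by (intro order_trans[OF diff_le_self] Max_ge) auto
  define \<rho> where "\<rho> = (\<Sum>k\<in>K. \<bar>c k\<bar> * real k * K.path_const N)"
  have \<rho>: "0 \<le> \<rho>" unfolding \<rho>_def using K.path_const_ge_1[of N] by (intro sum_nonneg) auto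
  define W where "W p i j = (\<Sum>k\<in>K. c k * (real k * band_pow (b p) p (k - 1) i j))" for p i j
  have W: "\<bar>W p i j\<bar> \<le> \<rho> * K.path_kernel N (int i - int j)" for p i j
  proof -
    have "\<bar>W p i j\<bar> \<le> (\<Sum>k\<in>K. \<bar>c k * (real k * band_pow (b p) p (k - 1) i j)\<bar>)" unfolding W_def by (rule sum_abs)
    also have "\<dots> \<le> (\<Sum>k\<in>K. \<bar>c k\<bar> * real k * (K.path_const N * K.path_kernel N (int i - int j)))"
    proof (rule sum_mono)
      fix k assume k: "k \<in> K"
      have "\<bar>band_pow (b p) p (k - 1) i j\<bar> \<le> K.path_const N * K.path_kernel N (int i - int j)"
        by (rule order_trans[OF abs_band_pow_le K.conv_pow_le_path_kernel[OF N[OF k]]])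
      then show "\<bar>c k * (real k * band_pow (b p) p (k - 1) i j)\<bar> \<le> \<bar>c k\<bar> * real k * (K.path_const N * K.path_kernel N (int i - int j))"
        unfolding abs_mult by (simp add: mult_left_mono mult.assoc)
    qed
    also have "\<dots> = \<rho> * K.path_kernel N (int i - int j)" unfolding \<rho>_def by (simp add: sum_distrib_right mult.assoc)
    finally show ?thesis .
  qed
  have row: "row_comb K c p 1 \<omega> = row_form p (W p) 1 \<omega> / sqrt (real p)" for p \<omega>
  proof -
    have "row_form p (W p) 1 \<omega> = (\<Sum>i\<in>{1..p}. \<Sum>j\<in>{1..p}. \<Sum>k\<in>K. c k * (real k * (band_pow (b p) p (k - 1) i j * xi \<omega> (i,1) (j,1))))"
      unfolding row_form_def W_def by (simp only: sum_distrib_right mult.assoc)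
    also have "\<dots> = (\<Sum>i\<in>{1..p}. \<Sum>k\<in>K. \<Sum>j\<in>{1..p}. c k * (real k * (band_pow (b p) p (k - 1) i j * xi \<omega> (i,1) (j,1))))"
      by (intro sum.cong refl sum.swap)
    also have "\<dots> = (\<Sum>k\<in>K. \<Sum>i\<in>{1..p}. \<Sum>j\<in>{1..p}. c k * (real k * (band_pow (b p) p (k - 1) i j * xi \<omega> (i,1) (j,1))))"
      by (rule sum.swap)
    also have "\<dots> = (\<Sum>k\<in>K. c k * (real k * row_form p (band_pow (b p) p (k - 1)) 1 \<omega>))"
      unfolding row_form_def by (simp only: sum_distrib_left)
    finally show ?thesis unfolding row_comb_def by simp
  qed
  have "expectation (\<lambda>\<omega>. row_comb K c p 1 \<omega> ^ 4) \<le> \<bar>fourth_const * \<rho> ^ 4\<bar>" for p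
  proof (cases "p = 0")
    \<comment> \<open>Here the division by \<open>sqrt 0\<close> yields 0.\<close>
    case True
    show ?thesis unfolding row by (simp add: True)
  next
    case False
    have "(sqrt (real p)) ^ 4 = (real p)\<^sup>2"
      using real_sqrt_pow2[of "real p"] power_mult[of "sqrt (real p)" 2 2] by simp
    then have "expectation (\<lambda>\<omega>. row_comb K c p 1 \<omega> ^ 4) = expectation (\<lambda>\<omega>. row_form p (W p) 1 \<omega> ^ 4) / (real p)\<^sup>2"
      unfolding row power_divide by simp
    also have "\<dots> \<le> (fourth_const * \<rho> ^ 4 * (real p)\<^sup>2) / (real p)\<^sup>2"
      using K.path_kernel_nonneg K.path_kernel_even K.sum_path_kernel_le W \<rho> False
      by (intro divide_right_mono fourth_moment_le[where q = "K.path_kernel N" and \<rho> = \<rho>]) auto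
    finally show ?thesis using False by simp
  qed
  then show thesis by (rule that)
qed

text \<open>The normalisation \<open>n / p\<close> times the variance bound
  \<open>p (2 b + 1) / n^2\<close> is \<open>(2 b + 1) / n\<close>, which tends to 0 because
  \<open>b / n\<close> does; the same limit secures \<open>2 * b + 1 \<le> real (n p)\<close>
  eventually. Cauchy-Schwarz separates the coefficients from the remainders.\<close>

lemma rem_comb_tendsto:
  assumes K: "finite K"
  shows "(\<lambda>p. expectation (\<lambda>\<omega>. (rem_comb K c p \<omega>)\<^sup>2)) \<longlonglongrightarrow> 0"
proof -
  have "\<exists>C. 0 \<le> C \<and> (\<forall>p. 0 \<le> b p \<longrightarrow> 2 * b p + 1 \<le> real (n p) \<longrightarrow> variance (rem p k) \<le> C * (real p * (2 * b p + 1) / (real (n p))\<^sup>2))" for k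
    using variance_rem_le[of k] by metis
  then obtain C where C: "\<And>k. 0 \<le> C k" "\<And>k p. 0 \<le> b p \<Longrightarrow> 2 * b p + 1 \<le> real (n p) \<Longrightarrow> variance (rem p k) \<le> C k * (real p * (2 * b p + 1) / (real (n p))\<^sup>2)"
    by metis
  define D where "D = (\<Sum>k\<in>K. (c k)\<^sup>2) * (\<Sum>k\<in>K. C k)"
  have D: "0 \<le> D" unfolding D_def using C(1) by (intro mult_nonneg_nonneg sum_nonneg) auto
  have bnd: "expectation (\<lambda>\<omega>. (rem_comb K c p \<omega>)\<^sup>2) \<le> D * ((2 * b p + 1) / real (n p))"
    if p: "0 < p" "2 * b p + 1 \<le> real (n p)" for p
  proof -
    let ?r = "\<lambda>k \<omega>. rem p k \<omega> - expectation (rem p k)"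
    have i: "integrable M (\<lambda>\<omega>. (?r k \<omega>)\<^sup>2)" for k
      by (intro all_moments_square all_moments_diff all_moments_rem all_moments_const)
    have "expectation (\<lambda>\<omega>. (rem_comb K c p \<omega>)\<^sup>2) \<le> expectation (\<lambda>\<omega>. (real (n p) / real p) * ((\<Sum>k\<in>K. (c k)\<^sup>2) * (\<Sum>k\<in>K. (?r k \<omega>)\<^sup>2)))"
    proof (rule integral_mono)
      show "integrable M (\<lambda>\<omega>. (rem_comb K c p \<omega>)\<^sup>2)" by (intro all_moments_square all_moments_rem_comb)
      show "integrable M (\<lambda>\<omega>. (real (n p) / real p) * ((\<Sum>k\<in>K. (c k)\<^sup>2) * (\<Sum>k\<in>K. (?r k \<omega>)\<^sup>2)))" using i by simp
      show "(rem_comb K c p \<omega>)\<^sup>2 \<le> (real (n p) / real p) * ((\<Sum>k\<in>K. (c k)\<^sup>2) * (\<Sum>k\<in>K. (?r k \<omega>)\<^sup>2))" for \<omega>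
        unfolding rem_comb_def power_mult_distrib using Cauchy_Schwarz_ineq_sum[of c "\<lambda>k. ?r k \<omega>" K]
        by (simp add: mult_left_mono divide_right_mono)
    qed
    also have "\<dots> = (real (n p) / real p) * ((\<Sum>k\<in>K. (c k)\<^sup>2) * (\<Sum>k\<in>K. variance (rem p k)))" using i by simp
    also have "\<dots> \<le> (real (n p) / real p) * ((\<Sum>k\<in>K. (c k)\<^sup>2) * (\<Sum>k\<in>K. C k * (real p * (2 * b p + 1) / (real (n p))\<^sup>2)))"
      using b_pos[OF p(1)] p(2) by (intro mult_left_mono sum_mono C(2)) (auto intro: sum_nonneg)
    also have "\<dots> = D * ((2 * b p + 1) / real (n p))"
    proof -
      have "(real (n p) / real p) * (A * (B * (real p * t / (real (n p))\<^sup>2))) = A * B * (t / real (n p))" for A B t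
        using p(1) n_pos[of p] by (simp add: field_simps power2_eq_square)
      then show ?thesis unfolding D_def sum_distrib_right[symmetric] .
    qed
    finally show ?thesis .
  qed
  have nr: "filterlim (\<lambda>p. real (n p)) at_top sequentially"
    by (rule filterlim_compose[OF filterlim_real_sequentially n_lim])
  have "(\<lambda>p. 2 * (b p / real (n p)) + 1 / real (n p)) \<longlonglongrightarrow> 2 * 0 + 0"
    by (intro tendsto_intros bn_lim tendsto_divide_0[OF tendsto_const] filterlim_at_top_imp_at_infinity nr)
  then have lim: "(\<lambda>p. (2 * b p + 1) / real (n p)) \<longlonglongrightarrow> 0" by (simp add: add_divide_distrib)
  have ev: "\<forall>\<^sub>F p in sequentially. 0 < p \<and> 2 * b p + 1 \<le> real (n p)"
  proof -
    have "\<forall>\<^sub>F p in sequentially. (2 * b p + 1) / real (n p) < 1" by (rule order_tendstoD(2)[OF lim]) simp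
    then show ?thesis using eventually_gt_at_top[of 0]
      by eventually_elim (use n_pos in \<open>simp add: divide_less_eq\<close>)
  qed
  have "(\<lambda>p. D * ((2 * b p + 1) / real (n p))) \<longlonglongrightarrow> 0" using tendsto_mult_right_zero[OF lim] .
  then show ?thesis
    by (rule Lim_null_comparison[rotated]) (use ev in eventually_elim, use bnd in auto)
qed

lemma fluctuation_char_tendsto:
  assumes K: "finite K"
  shows "(\<lambda>p. LINT \<omega>|M. cis (\<Sum>k\<in>K. c k * fluctuation p k \<omega>)) \<longlonglongrightarrow> exp (- ((\<Sum>k\<in>K. \<Sum>l\<in>K. c k * c l * trace_cov k l) / 2))"
proof -
  let ?V = "\<Sum>k\<in>K. \<Sum>l\<in>K. c k * c l * trace_cov k l"
  let ?U = "\<lambda>p \<omega>. (\<Sum>r\<in>{1..n p}. row_comb K c p r \<omega>) / sqrt (real (n p))"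
  obtain C where C: "\<And>p. expectation (\<lambda>\<omega>. row_comb K c p 1 \<omega> ^ 4) \<le> C" using row_comb_fourth_le[OF K] by metis
  have U: "random_variable borel (?U p)" for p
    using all_moments_row_comb[THEN all_moments_measurable] by (intro borel_measurable_divide borel_measurable_sum) auto
  have 1: "(\<lambda>p. CLINT \<omega>|M. iexp (1 * ?U p \<omega>)) \<longlonglongrightarrow> exp (- (1\<^sup>2 * ?V / 2))"
  proof (rule triangular_array_clt[OF row_comb_indep n_lim _ _ _ row_var_tendsto[OF K]])
    fix p r :: nat assume r: "1 \<le> r"
    show "integrable M (\<lambda>\<omega>. row_comb K c p r \<omega> ^ 4)" by (intro all_moments_integrable_power all_moments_row_comb r)
    show "expectation (row_comb K c p r) = 0" by (rule expectation_row_comb[OF r])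
    show "expectation (\<lambda>\<omega>. (row_comb K c p r \<omega>)\<^sup>2) = row_var K c p" unfolding row_var_def by (rule row_comb_copy[OF r])
    show "expectation (\<lambda>\<omega>. row_comb K c p r \<omega> ^ 4) \<le> C" unfolding row_comb_copy[OF r] by (rule C)
  qed
  have 2: "(\<lambda>p. (CLINT \<omega>|M. iexp (1 * (?U p \<omega> + rem_comb K c p \<omega>))) - (CLINT \<omega>|M. iexp (1 * ?U p \<omega>))) \<longlonglongrightarrow> 0"
  proof (rule Lim_null_comparison)
    show "\<forall>\<^sub>F p in sequentially. norm ((CLINT \<omega>|M. iexp (1 * (?U p \<omega> + rem_comb K c p \<omega>))) - (CLINT \<omega>|M. iexp (1 * ?U p \<omega>)))
       \<le> \<bar>1\<bar> * sqrt (expectation (\<lambda>\<omega>. (rem_comb K c p \<omega>)\<^sup>2))"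
      using U all_moments_rem_comb[THEN all_moments_measurable] all_moments_rem_comb[THEN all_moments_square]
      by (intro always_eventually allI char_diff_le) auto
    show "(\<lambda>p. \<bar>1\<bar> * sqrt (expectation (\<lambda>\<omega>. (rem_comb K c p \<omega>)\<^sup>2))) \<longlonglongrightarrow> 0"
      using tendsto_real_sqrt[OF rem_comb_tendsto[OF K]] by simp
  qed
  show ?thesis using tendsto_add[OF 2 1] by (simp add: cis_conv_exp fluctuation_comb[OF K])
qed

lemma fluctuation_single: "fluctuation p k \<omega> = (\<Sum>r\<in>{1..n p}. row_comb {k} (\<lambda>_. 1) p r \<omega>) / sqrt (real (n p)) + rem_comb {k} (\<lambda>_. 1) p \<omega>"
  using fluctuation_comb[of "{k}" "\<lambda>_. 1" p \<omega>] by simp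

lemma all_moments_fluctuation: "all_moments M (fluctuation p k)"
proof -
  have "all_moments M (\<lambda>\<omega>. inverse (sqrt (real (n p))) * (\<Sum>r\<in>{1..n p}. row_comb {k} (\<lambda>_. 1) p r \<omega>) + rem_comb {k} (\<lambda>_. 1) p \<omega>)"
    by (intro all_moments_add all_moments_cmult all_moments_sum all_moments_row_comb all_moments_rem_comb) simp
  then show ?thesis unfolding fluctuation_single[abs_def] by (simp add: divide_inverse mult.commute)
qed

text \<open>The bound is wanted for every \<open>p\<close>: the second moment has a convergent
  majorant, and a convergent sequence is bounded from its first term on.\<close>

lemma fluctuation_second_moment_bounded:
  obtains C where "\<And>p. expectation (\<lambda>\<omega>. (fluctuation p k \<omega>)\<^sup>2) \<le> C"
proof -
  let ?W = "row_comb {k} (\<lambda>_. 1)" and ?D = "rem_comb {k} (\<lambda>_. 1)"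
  let ?U = "\<lambda>p \<omega>. \<Sum>r\<in>{1..n p}. ?W p r \<omega>"
  have U: "expectation (\<lambda>\<omega>. (?U p \<omega> / sqrt (real (n p)))\<^sup>2) = row_var {k} (\<lambda>_. 1) p" for p
  proof -
    have "expectation (\<lambda>\<omega>. (?U p \<omega>)\<^sup>2) = (\<Sum>r\<in>{1..n p}. expectation (\<lambda>\<omega>. (?W p r \<omega>)\<^sup>2))"
      by (rule expectation_indep_sum_square[OF _ row_comb_indep]) (auto intro: all_moments_row_comb expectation_row_comb)
    also have "\<dots> = (\<Sum>r\<in>{1..n p}. row_var {k} (\<lambda>_. 1) p)"
      unfolding row_var_def by (intro sum.cong refl row_comb_copy) simp
    finally show ?thesis using n_pos[of p] by (simp add: power_divide)
  qed
  have mU: "all_moments M (?U p)" for p by (intro all_moments_sum all_moments_row_comb) simp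
  have bnd: "expectation (\<lambda>\<omega>. (fluctuation p k \<omega>)\<^sup>2) \<le> 2 * row_var {k} (\<lambda>_. 1) p + 2 * expectation (\<lambda>\<omega>. (?D p \<omega>)\<^sup>2)" for p
  proof -
    have i: "integrable M (\<lambda>\<omega>. (?U p \<omega> / sqrt (real (n p)))\<^sup>2)" "integrable M (\<lambda>\<omega>. (?D p \<omega>)\<^sup>2)"
      using all_moments_square[OF mU] all_moments_square[OF all_moments_rem_comb] by (simp_all add: power_divide)
    have "expectation (\<lambda>\<omega>. (fluctuation p k \<omega>)\<^sup>2) \<le> expectation (\<lambda>\<omega>. 2 * (?U p \<omega> / sqrt (real (n p)))\<^sup>2 + 2 * (?D p \<omega>)\<^sup>2)"
    proof (rule integral_mono)
      show "integrable M (\<lambda>\<omega>. (fluctuation p k \<omega>)\<^sup>2)" by (intro all_moments_square all_moments_fluctuation)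
      show "(fluctuation p k \<omega>)\<^sup>2 \<le> 2 * (?U p \<omega> / sqrt (real (n p)))\<^sup>2 + 2 * (?D p \<omega>)\<^sup>2" for \<omega>
        unfolding fluctuation_single using zero_le_power2[of "?U p \<omega> / sqrt (real (n p)) - ?D p \<omega>"]
        unfolding power2_sum power2_diff by linarith
    qed (use i in simp)
    also have "\<dots> = 2 * row_var {k} (\<lambda>_. 1) p + 2 * expectation (\<lambda>\<omega>. (?D p \<omega>)\<^sup>2)" using i U[of p] by simp
    finally show ?thesis .
  qed
  have "(\<lambda>p. 2 * row_var {k} (\<lambda>_. 1) p + 2 * expectation (\<lambda>\<omega>. (?D p \<omega>)\<^sup>2)) \<longlonglongrightarrow>
      2 * (\<Sum>i\<in>{k}. \<Sum>j\<in>{k}. 1 * 1 * trace_cov i j) + 2 * 0"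
    by (intro tendsto_add tendsto_mult tendsto_const row_var_tendsto rem_comb_tendsto) simp_all
  then have "convergent (\<lambda>p. 2 * row_var {k} (\<lambda>_. 1) p + 2 * expectation (\<lambda>\<omega>. (?D p \<omega>)\<^sup>2))" by (rule convergentI)
  then obtain C where C: "\<forall>p. norm (2 * row_var {k} (\<lambda>_. 1) p + 2 * expectation (\<lambda>\<omega>. (?D p \<omega>)\<^sup>2)) \<le> C"
    by (auto dest!: convergent_imp_Bseq simp: Bseq_def)
  show thesis
  proof (rule that)
    show "expectation (\<lambda>\<omega>. (fluctuation p k \<omega>)\<^sup>2) \<le> C" for p using bnd[of p] C[rule_format, of p] by (auto simp: abs_le_iff)
  qed
qed

text \<open>Each quadratic form of \<open>trace_cov\<close> is a limit of the variances
  \<open>row_var\<close>, hence non-negative; symmetry holds before the limit is taken.\<close>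

lemma psd_trace_cov: "psd trace_cov"
  unfolding psd_def
proof (intro conjI allI impI)
  fix F :: "nat set" and c assume "finite F"
  then show "0 \<le> (\<Sum>i\<in>F. \<Sum>j\<in>F. c i * c j * trace_cov i j)"
    by (rule LIMSEQ_le_const[OF row_var_tendsto]) (simp add: row_var_def)
next
  fix k l
  have "limit_cov k l = limit_cov l k" for k l
    by (rule LIMSEQ_unique[OF row_form_cov_limit[OF b_lim order_refl, of k l]])
      (use row_form_cov_limit[OF b_lim order_refl, of l k] in \<open>simp add: mult.commute\<close>)
  then show "trace_cov k l = trace_cov l k" by (simp add: trace_cov_def mult.commute)
qed

theorem fluctuation_limit:
  "\<exists>N. centred_gaussian_process_law N \<and> (\<forall>k l. (LINT x|N. x k * x l) = trace_cov k l) \<and> fdd_converges M fluctuation N"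
proof -
  from gaussian_process_exists[OF psd_trace_cov]
  obtain N :: "(nat \<Rightarrow> real) measure" where N: "prob_space N" "sets N = sets (PiM UNIV (\<lambda>_::nat. borel))"
    and "\<forall>K c. finite K \<longrightarrow> gaussian_rv N (\<lambda>x. \<Sum>k\<in>K. c k * x k) (sqrt (\<Sum>k\<in>K. \<Sum>l\<in>K. c k * c l * trace_cov k l))"
    by blast
  then have G: "gaussian_rv N (\<lambda>x. \<Sum>k\<in>K. c k * x k) (sqrt (\<Sum>k\<in>K. \<Sum>l\<in>K. c k * c l * trace_cov k l))" if "finite K" for K c
    using that by simp
  interpret N: prob_space N by fact
  have sq: "(sqrt (\<Sum>k\<in>K. \<Sum>l\<in>K. c k * c l * trace_cov k l))\<^sup>2 = (\<Sum>k\<in>K. \<Sum>l\<in>K. c k * c l * trace_cov k l)" if "finite K" for K c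
    using psdD[OF psd_trace_cov that] by (intro real_sqrt_pow2)
  have pr: "(\<lambda>x. x k) \<in> borel_measurable N" for k using G[of "{k}" "\<lambda>_. 1"] by (simp add: gaussian_rv_def)
  note gm = N.gaussian_rv_char_and_moment[OF G, unfolded sq]
  have sqi: "integrable N (\<lambda>x. (x k)\<^sup>2)" and sqE: "(LINT x|N. (x k)\<^sup>2) = trace_cov k k" for k
    using gm(2,3)[of "{k}" "\<lambda>_. 1"] sq[of "{k}" "\<lambda>_. 1"] by simp_all
  have cov: "(LINT x|N. x k * x l) = trace_cov k l" for k l
  proof (cases "k = l")
    case True
    then show ?thesis using sqE[of k] by (simp add: power2_eq_square)
  next
    case False
    have sym: "trace_cov l k = trace_cov k l" using psd_trace_cov by (simp add: psd_def)
    have s: "(LINT x|N. (x k + x l)\<^sup>2) = trace_cov k k + trace_cov l l + 2 * trace_cov k l"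
      and i: "integrable N (\<lambda>x. (x k + x l)\<^sup>2)"
      using gm(2,3)[of "{k, l}" "\<lambda>_. 1"] sq[of "{k, l}" "\<lambda>_. 1"] False sym by simp_all
    \<comment> \<open>Polarisation, since \<open>gaussian_rv\<close> provides only second moments of
      linear combinations.\<close>
    have "(LINT x|N. x k * x l) = (LINT x|N. ((x k + x l)\<^sup>2 - (x k)\<^sup>2 - (x l)\<^sup>2) / 2)"
      by (intro Bochner_Integration.integral_cong refl) (simp add: power2_sum)
    then show ?thesis using s i sqi sqE by simp
  qed
  have "\<exists>C. \<forall>p. expectation (\<lambda>\<omega>. (fluctuation p k \<omega>)\<^sup>2) \<le> C" for k
    using fluctuation_second_moment_bounded[of k] by metis
  then obtain C where C: "\<And>k p. expectation (\<lambda>\<omega>. (fluctuation p k \<omega>)\<^sup>2) \<le> C k" by metis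
  have "fdd_converges M fluctuation N"
  proof (rule fdd_converges_charI[OF prob_space_axioms N(1) _ pr _ _ sqi C])
    show "fluctuation p k \<in> borel_measurable M" for p k using all_moments_fluctuation by (rule all_moments_measurable)
    show "integrable M (\<lambda>\<omega>. (fluctuation p k \<omega>)\<^sup>2)" for p k using all_moments_fluctuation by (rule all_moments_square)
    show "(\<lambda>p. LINT \<omega>|M. cis (\<Sum>k\<in>K. c k * fluctuation p k \<omega>)) \<longlonglongrightarrow> (LINT x|N. cis (\<Sum>k\<in>K. c k * x k))"
      if "finite K" for K c
      using fluctuation_char_tendsto[OF that, of c] gm(1)[OF that, of c] sq[OF that, of c] by simp
  qed
  moreover have "centred_gaussian_process_law N"
    unfolding centred_gaussian_process_law_def using N G gaussian_rv_centred by blast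
  ultimately show ?thesis using cov by blast
qed

end

theorem theorem2p4:
  fixes M :: "'a measure"
    and Z :: "int \<Rightarrow> 'a \<Rightarrow> real"
    and Zc :: "nat \<Rightarrow> int \<Rightarrow> 'a \<Rightarrow> real"
    and b :: "nat \<Rightarrow> real"
    and n :: "nat \<Rightarrow> nat"
  assumes M: "prob_space M"
    \<comment> \<open>Assumption A\<close>
    and b_pos: "\<And>p. p > 0 \<Longrightarrow> b p > 0"
    and b_le_p: "\<And>p. p > 0 \<Longrightarrow> b p \<le> real p"
    and n_pos: "\<And>p. n p > 0"
    and b_lim: "filterlim b at_top sequentially"
    and n_lim: "filterlim n at_top sequentially"
    and bn_lim: "(\<lambda>p. b p / real (n p)) \<longlonglongrightarrow> 0"
    \<comment> \<open>Assumption Z: a stationary real sequence\<close>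
    and Z_meas: "\<And>j. Z j \<in> borel_measurable M"
    and Z_stat: "\<And>s. distr M (PiM UNIV (\<lambda>_::int. borel)) (\<lambda>\<omega> j. Z (j + s) \<omega>)
                     = distr M (PiM UNIV (\<lambda>_::int. borel)) (\<lambda>\<omega> j. Z j \<omega>)"
    and Z_moments: "\<And>k::nat. k \<ge> 1 \<Longrightarrow> integrable M (\<lambda>\<omega>. \<bar>Z 0 \<omega>\<bar> ^ k)"
    and Z_mean: "prob_space.expectation M (Z 0) = 0"
    and Z_cum: "\<And>r::nat. r \<ge> 1 \<Longrightarrow>
        (\<lambda>js. \<bar>joint_cumulant M (Z 0 # map Z js)\<bar>) summable_on {js :: int list. length js = r}"
    \<comment> \<open>i.i.d. copies Z^(i), i >= 1\<close>
    and Zc_meas: "\<And>i j. Zc i j \<in> borel_measurable M"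
    and Zc_law: "\<And>i. i \<ge> 1 \<Longrightarrow> distr M (PiM UNIV (\<lambda>_::int. borel)) (\<lambda>\<omega> j. Zc i j \<omega>)
                     = distr M (PiM UNIV (\<lambda>_::int. borel)) (\<lambda>\<omega> j. Z j \<omega>)"
    and Zc_indep: "prob_space.indep_vars M (\<lambda>_. PiM UNIV (\<lambda>_::int. borel))
                     (\<lambda>i \<omega> j. Zc i j \<omega>) {1..}"
  defines "R \<equiv> (\<lambda>j. prob_space.expectation M (\<lambda>\<omega>. (Z 0 \<omega> - prob_space.expectation M (Z 0)) * (Z j \<omega> - prob_space.expectation M (Z j))))"
    and "Q \<equiv> (\<lambda>i j. \<Sum>\<^sub>\<infinity>l\<in>(UNIV::int set). joint_cumulant M [Z i, Z 0, Z (j + l), Z l])"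
    and "T \<equiv> (\<lambda>p k \<omega>. sqrt (real (n p) / real p) *
              (mat_trace p (mat_pow p (banded_Y (b p) (n p) p Zc \<omega>) k)
               - prob_space.expectation M (\<lambda>\<omega>'. mat_trace p (mat_pow p (banded_Y (b p) (n p) p Zc \<omega>') k))))"
  shows "\<exists>N. centred_gaussian_process_law N \<and>
           (\<forall>k l. k \<ge> 1 \<and> l \<ge> 1 \<longrightarrow>
              (LINT x|N. x k * x l) / (real k * real l) =
                2 * conv_pow R (k + l) 0 +
                (\<Sum>\<^sub>\<infinity>(i, j)\<in>(UNIV :: (int \<times> int) set).
                    conv_pow R (k - 1) i * Q i j * conv_pow R (l - 1) j)) \<and>
           fdd_converges M T N"
proof -
  interpret A: banded_asymptotics M Z Zc b n
  proof -
    interpret prob_space M by fact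
    show "banded_asymptotics M Z Zc b n"
      using Z_meas Z_stat Z_moments Z_mean Z_cum Zc_meas Zc_law Zc_indep b_pos n_pos b_lim n_lim bn_lim
      by unfold_locales
  qed
  \<comment> \<open>All means vanish, so the centred covariance in the statement is the product
    moment \<open>A.R\<close>.\<close>
  have m0: "A.expectation (Z j) = 0" for j by (rule A.expectation_Z)
  have R: "A.R = R" by (simp add: A.R_def R_def m0 fun_eq_iff)
  have T: "T = A.fluctuation" by (simp add: T_def A.fluctuation_def fun_eq_iff)
  \<comment> \<open>For positive \<open>k\<close> and \<open>l\<close> the truncated exponents
    \<open>k - 1\<close> and \<open>l - 1\<close> are undone by the successors in
    \<open>limit_cov\<close>.\<close>
  have cov: "A.trace_cov k l / (real k * real l) = 2 * conv_pow R (k + l) 0 +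
      (\<Sum>\<^sub>\<infinity>(i, j)\<in>UNIV. conv_pow R (k - 1) i * Q i j * conv_pow R (l - 1) j)" if "1 \<le> k" "1 \<le> l" for k l
  proof -
    have "A.trace_cov k l / (real k * real l) = A.limit_cov (k - 1) (l - 1)"
      using that by (simp add: A.trace_cov_def)
    moreover have "Suc (k - 1) + Suc (l - 1) = k + l" using that by simp
    ultimately show ?thesis by (simp only: A.limit_cov_def R Q_def)
  qed
  from A.fluctuation_limit obtain N where N: "centred_gaussian_process_law N"
    "\<And>k l. (LINT x|N. x k * x l) = A.trace_cov k l" "fdd_converges M A.fluctuation N" by blast
  show ?thesis
    unfolding T by (intro exI[of _ N] conjI allI impI N) (simp add: N(2) cov)
qed

end
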